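(* There are isomorphisms of 2-categories over $\mathbf{CAT}^{\mathbf 2}$ (i.e. commuting strictly with the forgetful 2-functors to $\mathbf{CAT}^{\mathbf 2}$) $$\Gamma\colon\mathbf{SCoFib}\cong\mathbf{Alg}_{\mathrm s}(\mathbb C),\qquad \Gamma_{\mathrm n}\colon\mathbf{NClCoFib}\cong\mathbf{PsAlg}_{\mathrm n}(\mathbb C).$$ Restriction of scalars along the colax morphism of 2-monads $(\mathrm{Dom},\kappa)$ from $\mathbb C$ to $\mathbb S$ gives 2-functors $$\kappa^*\colon\mathbf{Alg}_{\mathrm s}(\mathbb C)\to\mathbf{Alg}_{\mathrm s}(\mathbb S),\qquad \kappa^*_{\mathrm{ps}}\colon\mathbf{PsAlg}_{\mathrm n}(\mathbb C)\to\mathbf{PsAlg}_{\mathrm n}(\mathbb S),$$ and the diagram with rows $\mathbf{SCoFib}\xrightarrow{\Gamma}\mathbf{Alg}_{\mathrm s}(\mathbb C)\xrightarrow{\kappa^*}\mathbf{Alg}_{\mathrm s}(\mathbb S)$ and $\mathbf{NClCoFib}\xrightarrow{\Gamma_{\mathrm n}}\mathbf{PsAlg}_{\mathrm n}(\mathbb C)\xrightarrow{\kappa^*_{\mathrm{ps}}}\mathbf{PsAlg}_{\mathrm n}(\mathbb S)$ and with vertical 2-functors the evident inclusions commutes. For every normally cloven cofibration $P\colon E\to B$, the resulting normal pseudo-$\mathbb S$-algebra selects, for every $f\colon x\to y$ in $E$, the factorization $f=\nu_f\,\delta^x_{Pf}$, and it determines the orthogonal factorization system $$\bigl(\mathrm{CoCart}(P),\,P^{-1}\mathrm{Iso}(B)\bigr)$$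 on $E$. If the cleavage is split, the $\mathbb S$-action is strict and its strict factorization system is $(\Delta_P,\mathrm{Vert}(P))$, where $\Delta_P$ is the class of designated cocartesian arrows $\delta^x_u$. Over a fixed base $B$, the same restriction applies to every cleavage (normal or not): the orthogonal classes remain $(\mathrm{CoCart}(P),P^{-1}\mathrm{Iso}(B))$, while the pseudo-$\mathbb S$-unit $\jmath_x=\delta^x_{1_{Px}}$ records the possibly non-normalized factorization of each identity: $1_x$ is factored as $\jmath_x$ followed by $\jmath_x^{-1}$.
   Context: **Arrow 2-category.** $\mathbf{CAT}$ is the strict 2-category of locally small categories, functors and natural transformations (relative to a fixed enlargement of universes). Composites are written right to left. $\mathbf{CAT}^{\mathbf 2}$ is the strict arrow 2-category: objects are functors $P\colon E\to B$; a 1-cell $(T,S)\colon P\to Q$, with $Q\colon F\to C$, is a pair of functors $T\colon E\to F$, $S\colon B\to C$ with $QT=SP$; a 2-cell $(\beta,\alpha)\colon(T,S)\Rightarrow(T',S')$ is a pair of natural transformations $\beta\colon T\Rightarrow T'$, $\alpha\colon S\Rightarrow S'$ with $Q\beta=\alpha P$; compositions are componentwise. $\mathrm{Dom}\colon\mathbf{CAT}^{\mathbf 2}\to\mathbf{CAT}$ sends $P\colon E\to B$ to $E$. $\mathbf{CAT}/B$ is the strict slice: functors into $B$, functors strictly over $B$, natural transformations over $1_B$. **Cofibrations.** For $P\colon E\to B$, an arrow $e\colon x\to y$ of $E$ is $P$-cocartesian if for all $g\colon x\to z$ in $E$ and $v\colon Py\to Pz$ in $B$ with $Pg=v\,Pe$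 there is a unique $h\colon y\to z$ with $he=g$ and $Ph=v$. $\mathrm{CoCart}(P)$ is the class of such arrows. An arrow $f$ is vertical if $Pf$ is an identity; $\mathrm{Vert}(P)$ is the wide subcategory of vertical arrows. $P^{-1}\mathrm{Iso}(B)$ is the class of arrows $f$ with $Pf$ invertible. $P$ is a cofibration (Grothendieck opfibration) if for all $x\in E$, $u\colon Px\to b$ there is a $P$-cocartesian arrow with domain $x$ over $u$. A cleavage chooses one, $\delta^x_u\colon x\to u_!x$, for each $(x,u)$; a cofibration with a cleavage is cloven. For $u\colon a\to b$ it induces a functor $u_!\colon E_a\to E_b$ between fibres by $(u_!f)\delta^x_u=\delta^y_uf$ with $u_!f$ vertical. The cleavage is normal if $\delta^x_{1_{Px}}=1_x$ for all $x$; it is split if it is normal and $(vu)_!=v_!u_!$, $\delta^x_{vu}=\delta^{u_!x}_v\delta^x_u$ whenever defined. In a cloven cofibration, for $f\colon x\to y$, $\nu_f\colon(Pf)_!x\to y$ is the unique vertical arrow with $f=\nu_f\delta^x_{Pf}$. $\mathbf{SCoFib}$: split cofibrations (with their split cleavage); 1-cells are the squares $(T,S)\colon P\to Q$ with $T\delta^x_u=\delta^{Tx}_{Su}$ for all $(x,u)$; all 2-cells of $\mathbf{CAT}^{\mathbf 2}$ between them. $\mathbf{NClCoFib}$: normally cloven cofibrations; 1-cells are the squares $(T,S)$ for which $T$ preserves cocartesian arrows; all 2-cells of $\mathbf{CAT}^{\mathbf 2}$ between them. **Algebras.** For a strict 2-monad $\mathbb T=(\mathbb T,\eta,\mu)$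 on a strict 2-category $\mathcal K$: a strict algebra is $a\colon\mathbb TX\to X$ with $a\eta_X=1$, $a\mu_X=a\,\mathbb Ta$; a strict morphism $f\colon(X,a)\to(Y,b)$ is a 1-cell with $fa=b\,\mathbb Tf$; an algebra 2-cell $\alpha\colon f\Rightarrow g$ satisfies $\alpha a=b\,\mathbb T\alpha$. These form $\mathbf{Alg}_{\mathrm s}(\mathbb T)$. A pseudoalgebra is $a\colon\mathbb TX\to X$ with invertible 2-cells $\iota\colon1_X\Rightarrow a\eta_X$, $\chi\colon a\,\mathbb Ta\Rightarrow a\mu_X$ satisfying (vertical composites of whiskered cells) $(\chi\,\mathbb T\eta_X)(a\,\mathbb T\iota)=1_a$, $(\chi\,\eta_{\mathbb TX})(\iota a)=1_a$, $(\chi\,\mathbb T\mu_X)(a\,\mathbb T\chi)=(\chi\,\mu_{\mathbb TX})(\chi\,\mathbb T^2a)$; it is normal if $\iota$ is an identity. A pseudomorphism $(X,a,\iota^a,\chi^a)\to(Y,b,\iota^b,\chi^b)$ is a 1-cell $f$ with an invertible $\overline f\colon b\,\mathbb Tf\Rightarrow fa$ satisfying $(\overline f\,\eta_X)(\iota^bf)=f\iota^a$ and $(\overline f\,\mu_X)(\chi^b\,\mathbb T^2f)=(f\chi^a)(\overline f\,\mathbb Ta)(b\,\mathbb T\overline f)$. An algebra transformation $\alpha\colon(f,\overline f)\Rightarrow(g,\overline g)$ is a 2-cell with $(\alpha a)\overline f=\overline g(b\,\mathbb T\alpha)$. These form $\mathbf{PsAlg}(\mathbb T)$; its normal pseudoalgebras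 give $\mathbf{PsAlg}_{\mathrm n}(\mathbb T)$. **Comma 2-monad $\mathbb C$ on $\mathbf{CAT}^{\mathbf 2}$.** $P\downarrow B$ has objects $(x,u)$, $u\colon Px\to b$; arrows $(f,v)\colon(x,u)\to(y,w)$ with $f\colon x\to y$, $v\colon b\to c$, $vu=w\,Pf$. $\mathbb CP=\mathrm{Cod}_P\colon P\downarrow B\to B$, $(x,u)\mapsto b$, $(f,v)\mapsto v$; $\mathbb C(T,S)=(\overline T,S)$ with $\overline T(x,u)=(Tx,Su)$, $\overline T(f,v)=(Tf,Sv)$; $\mathbb C(\beta,\alpha)=(\overline\beta,\alpha)$ with $\overline\beta_{(x,u)}=(\beta_x,\alpha_b)$. Unit $(H^P,1_B)$: $H^Px=(x,1_{Px})$, $H^Pf=(f,Pf)$. Multiplication $(M^P,1_B)$: $M^P((x,u),v)=(x,vu)$, $M^P((f,r),s)=(f,s)$. $\mathbb C_B$ is its restriction to $\mathbf{CAT}/B$. **Comparison $\Gamma,\Gamma_{\mathrm n}$.** For a cloven cofibration, $L^P\colon P\downarrow B\to E$ is the unique functor with $L^P(x,u)=u_!x$, $PL^P=\mathrm{Cod}_P$, $L^P(f,v)\delta^x_u=\delta^y_wf$. $\Gamma$ sends $P$ to the strict action $(L^P,1_B)$; $\Gamma_{\mathrm n}$ sends $P$ to $(L^P,1_B)$ with multiplication cell given by the unique vertical isomorphisms $\chi^x_{v,u}\colon v_!u_!x\to(vu)_!x$ with $\chi^x_{v,u}\delta^{u_!x}_v\delta^x_u=\delta^x_{vu}$. Over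 a fixed base, an arbitrary cleavage gives the pseudo-$\mathbb C_B$-algebra $L^P$ with this $\chi$ and unit $\iota_x=\delta^x_{1_{Px}}$. **Squaring 2-monad $\mathbb S$ on $\mathbf{CAT}$.** $\mathbb SE=E^{\mathbf 2}$ (objects: arrows of $E$; arrows $(r,s)\colon f\to g$: commutative squares $sf=gr$); unit $I_E\colon E\to E^{\mathbf 2}$, $x\mapsto1_x$; multiplication $m_E\colon(E^{\mathbf 2})^{\mathbf 2}\to E^{\mathbf 2}$ sends a square $(r,s)\colon f\to g$ to its diagonal $sf=gr$ (and a morphism of squares to its components at the initial and terminal corners). For a pseudo-$\mathbb S$-algebra $F\colon E^{\mathbf 2}\to E$ with unit $\jmath\colon1_E\Rightarrow FI_E$ (identity in the strict or normal case), the selected factorization of $f\colon x\to y$ is $f=m_fe_f$ with $e_f=F(1_x,f)\jmath_x$, $m_f=\jmath_y^{-1}F(f,1_y)$. The orthogonal factorization system it determines has left class $\{f\mid m_f\text{ invertible}\}$ and right class $\{f\mid e_f\text{ invertible}\}$. For a strict $\mathbb S$-algebra, its strict factorization system is $(\{f\mid m_f=1\},\{f\mid e_f=1\})$; in general, a strict factorization system on $E$ is a pair $(\mathcal E,\mathcal M)$ of wide subcategories such that every arrow is uniquely $me$ with $e\in\mathcal E$, $m\in\mathcal M$. An orthogonal factorization system is a pair of classes closed under composition with isomorphisms, such that every arrow factors as a left-class arrow followed by a right-class arrow and every commutative square from a left-class arrow to a right-class arrow has a unique diagonal. **Restriction of scalars along $\kappa$.** $\kappa\colon\mathbb S\,\mathrm{Dom}\Rightarrow\mathrm{Dom}\,\mathbb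 C$ has components $\kappa_P\colon E^{\mathbf 2}\to P\downarrow B$, $\kappa_P(f\colon x\to y)=(x,Pf)$, $\kappa_P(r,s)=(r,Ps)$. A colax morphism of 2-monads $\mathbb T\to\mathbb R$ is a strict 2-functor $V$ and a 2-natural $\lambda\colon\mathbb RV\Rightarrow V\mathbb T$ with $\lambda_X\eta^{\mathbb R}_{VX}=V\eta^{\mathbb T}_X$ and $\lambda_X\mu^{\mathbb R}_{VX}=V\mu^{\mathbb T}_X\,\lambda_{\mathbb TX}\,\mathbb R\lambda_X$. Restriction of scalars sends an action $a$ to $Va\,\lambda_X$, a pseudoalgebra's cells $\iota,\chi$ to $V\iota$ and $V\chi\,(\lambda_{\mathbb TX}\mathbb R\lambda_X)$, a pseudomorphism $(f,\overline f)$ to $(Vf,V\overline f\,\lambda_X)$, and 2-cells $\alpha$ to $V\alpha$. In particular the $\mathbb S$-action obtained from a cloven cofibration is $F^P=L^P\kappa_P$. Over a fixed base $B$ the same formulas for $\kappa$ are used with $\mathbb C_B$ and $\mathrm{Dom}\colon\mathbf{CAT}/B\to\mathbf{CAT}$. *)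

theory Defs
  imports Main "HOL-Library.FuncSet"
begin

section \<open>Cells, strict 2-categories, 2-functors\<close>

text \<open>All 1-cells and 2-cells below carry their source and target, so that two cells with the
  same underlying data but different ends are different.\<close>

datatype ('x, 'c) cell = Cell (src: 'x) (trg: 'x) (body: 'c)

record ('o, 'f, 't) two_cat =
  Ob :: "'o set"
  Cell1 :: "('o, 'f) cell set"
  Cell2 :: "(('o, 'f) cell, 't) cell set"
  id1 :: "'o \<Rightarrow> ('o, 'f) cell"
  comp1 :: "('o, 'f) cell \<Rightarrow> ('o, 'f) cell \<Rightarrow> ('o, 'f) cell" (infixl "\<odot>\<index>" 75)
  id2 :: "('o, 'f) cell \<Rightarrow> (('o, 'f) cell, 't) cell"
  vcomp :: "(('o, 'f) cell, 't) cell \<Rightarrow> (('o, 'f) cell, 't) cell \<Rightarrow> (('o, 'f) cell, 't) cell"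
    (infixl "\<bullet>\<index>" 70)
  hcomp :: "(('o, 'f) cell, 't) cell \<Rightarrow> (('o, 'f) cell, 't) cell \<Rightarrow> (('o, 'f) cell, 't) cell"
    (infixl "\<star>\<index>" 75)

abbreviation lwhisker (infixl "\<rhd>\<index>" 75) where "g \<rhd>\<^bsub>K\<^esub> \<alpha> \<equiv> id2 K g \<star>\<^bsub>K\<^esub> \<alpha>"
abbreviation rwhisker (infixl "\<lhd>\<index>" 75) where "\<alpha> \<lhd>\<^bsub>K\<^esub> f \<equiv> \<alpha> \<star>\<^bsub>K\<^esub> id2 K f"

definition hom1 :: "('o, 'f, 't) two_cat \<Rightarrow> 'o \<Rightarrow> 'o \<Rightarrow> ('o, 'f) cell set" where
  "hom1 K X Y = {f \<in> Cell1 K. src f = X \<and> trg f = Y}"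

definition hom2 ::
  "('o, 'f, 't) two_cat \<Rightarrow> ('o, 'f) cell \<Rightarrow> ('o, 'f) cell \<Rightarrow> (('o, 'f) cell, 't) cell set" where
  "hom2 K f g = {\<alpha> \<in> Cell2 K. src \<alpha> = f \<and> trg \<alpha> = g}"

definition parallel :: "('o, 'f) cell \<Rightarrow> ('o, 'f) cell \<Rightarrow> bool" where
  "parallel f g \<longleftrightarrow> src f = src g \<and> trg f = trg g"

locale strict_2category =
  fixes K :: "('o, 'f, 't) two_cat"
  assumes cell1_ends: "f \<in> Cell1 K \<Longrightarrow> src f \<in> Ob K \<and> trg f \<in> Ob K"
    and cell2_ends: "\<alpha> \<in> Cell2 K \<Longrightarrow> src \<alpha> \<in> Cell1 K \<and> trg \<alpha> \<in> Cell1 K \<and> parallel (src \<alpha>) (trg \<alpha>)"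
    and id1_in: "X \<in> Ob K \<Longrightarrow> id1 K X \<in> hom1 K X X"
    and comp1_in: "\<lbrakk>f \<in> hom1 K X Y; g \<in> hom1 K Y Z\<rbrakk> \<Longrightarrow> g \<odot>\<^bsub>K\<^esub> f \<in> hom1 K X Z"
    and comp1_id1: "f \<in> hom1 K X Y \<Longrightarrow> f \<odot>\<^bsub>K\<^esub> id1 K X = f"
    and id1_comp1: "f \<in> hom1 K X Y \<Longrightarrow> id1 K Y \<odot>\<^bsub>K\<^esub> f = f"
    and comp1_assoc: "\<lbrakk>f \<in> hom1 K X Y; g \<in> hom1 K Y Z; h \<in> hom1 K Z W\<rbrakk>
      \<Longrightarrow> h \<odot>\<^bsub>K\<^esub> (g \<odot>\<^bsub>K\<^esub> f) = h \<odot>\<^bsub>K\<^esub> g \<odot>\<^bsub>K\<^esub> f"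
    and id2_in: "f \<in> Cell1 K \<Longrightarrow> id2 K f \<in> hom2 K f f"
    and vcomp_in: "\<lbrakk>\<alpha> \<in> hom2 K f g; \<beta> \<in> hom2 K g h\<rbrakk> \<Longrightarrow> \<beta> \<bullet>\<^bsub>K\<^esub> \<alpha> \<in> hom2 K f h"
    and vcomp_id2: "\<alpha> \<in> hom2 K f g \<Longrightarrow> \<alpha> \<bullet>\<^bsub>K\<^esub> id2 K f = \<alpha>"
    and id2_vcomp: "\<alpha> \<in> hom2 K f g \<Longrightarrow> id2 K g \<bullet>\<^bsub>K\<^esub> \<alpha> = \<alpha>"
    and vcomp_assoc: "\<lbrakk>\<alpha> \<in> hom2 K f g; \<beta> \<in> hom2 K g h; \<gamma> \<in> hom2 K h k\<rbrakk>
      \<Longrightarrow> \<gamma> \<bullet>\<^bsub>K\<^esub> (\<beta> \<bullet>\<^bsub>K\<^esub> \<alpha>) = \<gamma> \<bullet>\<^bsub>K\<^esub> \<beta> \<bullet>\<^bsub>K\<^esub> \<alpha>"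
    and hcomp_in: "\<lbrakk>\<alpha> \<in> hom2 K f f'; \<beta> \<in> hom2 K g g'; trg f = src g\<rbrakk>
      \<Longrightarrow> \<beta> \<star>\<^bsub>K\<^esub> \<alpha> \<in> hom2 K (g \<odot>\<^bsub>K\<^esub> f) (g' \<odot>\<^bsub>K\<^esub> f')"
    and hcomp_id: "\<lbrakk>\<alpha> \<in> hom2 K f f'; src f = X; trg f = Y\<rbrakk>
      \<Longrightarrow> \<alpha> \<lhd>\<^bsub>K\<^esub> id1 K X = \<alpha> \<and> id1 K Y \<rhd>\<^bsub>K\<^esub> \<alpha> = \<alpha>"
    and hcomp_assoc: "\<lbrakk>\<alpha> \<in> hom2 K f f'; \<beta> \<in> hom2 K g g'; \<gamma> \<in> hom2 K h h'; trg f = src g; trg g = src h\<rbrakk>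
      \<Longrightarrow> \<gamma> \<star>\<^bsub>K\<^esub> (\<beta> \<star>\<^bsub>K\<^esub> \<alpha>) = \<gamma> \<star>\<^bsub>K\<^esub> \<beta> \<star>\<^bsub>K\<^esub> \<alpha>"
    and hcomp_id2: "\<lbrakk>f \<in> hom1 K X Y; g \<in> hom1 K Y Z\<rbrakk>
      \<Longrightarrow> id2 K g \<star>\<^bsub>K\<^esub> id2 K f = id2 K (g \<odot>\<^bsub>K\<^esub> f)"
    and interchange: "\<lbrakk>\<alpha> \<in> hom2 K f f'; \<alpha>' \<in> hom2 K f' f''; \<beta> \<in> hom2 K g g'; \<beta>' \<in> hom2 K g' g'';
        trg f = src g\<rbrakk>
      \<Longrightarrow> (\<beta>' \<bullet>\<^bsub>K\<^esub> \<beta>) \<star>\<^bsub>K\<^esub> (\<alpha>' \<bullet>\<^bsub>K\<^esub> \<alpha>) = (\<beta>' \<star>\<^bsub>K\<^esub> \<alpha>') \<bullet>\<^bsub>K\<^esub> (\<beta> \<star>\<^bsub>K\<^esub> \<alpha>)"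

definition invertible2 :: "('o, 'f, 't) two_cat \<Rightarrow> (('o, 'f) cell, 't) cell \<Rightarrow> bool" where
  "invertible2 K \<alpha> \<longleftrightarrow> \<alpha> \<in> Cell2 K \<and> (\<exists>\<beta> \<in> hom2 K (trg \<alpha>) (src \<alpha>).
     \<beta> \<bullet>\<^bsub>K\<^esub> \<alpha> = id2 K (src \<alpha>) \<and> \<alpha> \<bullet>\<^bsub>K\<^esub> \<beta> = id2 K (trg \<alpha>))"

record ('o, 'f, 't, 'p, 'g, 's) two_fun =
  F0 :: "'o \<Rightarrow> 'p"
  F1 :: "('o, 'f) cell \<Rightarrow> ('p, 'g) cell"
  F2 :: "(('o, 'f) cell, 't) cell \<Rightarrow> (('p, 'g) cell, 's) cell"

locale strict_2functor = dom: strict_2category K + cod: strict_2category L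
  for K :: "('o, 'f, 't) two_cat" and L :: "('p, 'g, 's) two_cat" +
  fixes F :: "('o, 'f, 't, 'p, 'g, 's) two_fun"
  assumes F0_in: "X \<in> Ob K \<Longrightarrow> F0 F X \<in> Ob L"
    and F1_in: "f \<in> hom1 K X Y \<Longrightarrow> F1 F f \<in> hom1 L (F0 F X) (F0 F Y)"
    and F2_in: "\<alpha> \<in> hom2 K f g \<Longrightarrow> F2 F \<alpha> \<in> hom2 L (F1 F f) (F1 F g)"
    and F1_id1: "X \<in> Ob K \<Longrightarrow> F1 F (id1 K X) = id1 L (F0 F X)"
    and F1_comp1: "\<lbrakk>f \<in> hom1 K X Y; g \<in> hom1 K Y Z\<rbrakk> \<Longrightarrow> F1 F (g \<odot>\<^bsub>K\<^esub> f) = F1 F g \<odot>\<^bsub>L\<^esub> F1 F f"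
    and F2_id2: "f \<in> Cell1 K \<Longrightarrow> F2 F (id2 K f) = id2 L (F1 F f)"
    and F2_vcomp: "\<lbrakk>\<alpha> \<in> hom2 K f g; \<beta> \<in> hom2 K g h\<rbrakk> \<Longrightarrow> F2 F (\<beta> \<bullet>\<^bsub>K\<^esub> \<alpha>) = F2 F \<beta> \<bullet>\<^bsub>L\<^esub> F2 F \<alpha>"
    and F2_hcomp: "\<lbrakk>\<alpha> \<in> hom2 K f f'; \<beta> \<in> hom2 K g g'; trg f = src g\<rbrakk>
      \<Longrightarrow> F2 F (\<beta> \<star>\<^bsub>K\<^esub> \<alpha>) = F2 F \<beta> \<star>\<^bsub>L\<^esub> F2 F \<alpha>"

definition id_2fun :: "('o, 'f, 't, 'o, 'f, 't) two_fun" where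
  "id_2fun = \<lparr>F0 = \<lambda>X. X, F1 = \<lambda>f. f, F2 = \<lambda>\<alpha>. \<alpha>\<rparr>"

definition comp_2fun ::
  "('p, 'g, 's, 'q, 'h, 'r) two_fun \<Rightarrow> ('o, 'f, 't, 'p, 'g, 's) two_fun \<Rightarrow> ('o, 'f, 't, 'q, 'h, 'r) two_fun"
  (infixl "\<circ>\<circ>" 75) where
  "G \<circ>\<circ> F = \<lparr>F0 = F0 G \<circ> F0 F, F1 = F1 G \<circ> F1 F, F2 = F2 G \<circ> F2 F\<rparr>"

definition eq_2fun ::
  "('o, 'f, 't) two_cat \<Rightarrow> ('o, 'f, 't, 'p, 'g, 's) two_fun \<Rightarrow> ('o, 'f, 't, 'p, 'g, 's) two_fun \<Rightarrow> bool" where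
  "eq_2fun K F G \<longleftrightarrow> (\<forall>X \<in> Ob K. F0 F X = F0 G X) \<and> (\<forall>f \<in> Cell1 K. F1 F f = F1 G f) \<and>
     (\<forall>\<alpha> \<in> Cell2 K. F2 F \<alpha> = F2 G \<alpha>)"

definition iso_2cat ::
  "('o, 'f, 't) two_cat \<Rightarrow> ('p, 'g, 's) two_cat \<Rightarrow> ('o, 'f, 't, 'p, 'g, 's) two_fun \<Rightarrow> bool" where
  "iso_2cat K L F \<longleftrightarrow> strict_2functor K L F \<and>
     (\<exists>G. strict_2functor L K G \<and> eq_2fun K (G \<circ>\<circ> F) id_2fun \<and> eq_2fun L (F \<circ>\<circ> G) id_2fun)"

definition iso_2cat_over ::
  "('o, 'f, 't) two_cat \<Rightarrow> ('p, 'g, 's) two_cat \<Rightarrow> ('q, 'h, 'r) two_cat \<Rightarrow>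
   ('o, 'f, 't, 'q, 'h, 'r) two_fun \<Rightarrow> ('p, 'g, 's, 'q, 'h, 'r) two_fun \<Rightarrow>
   ('o, 'f, 't, 'p, 'g, 's) two_fun \<Rightarrow> bool" where
  "iso_2cat_over K L M U U' F \<longleftrightarrow> strict_2functor K M U \<and> strict_2functor L M U' \<and>
     iso_2cat K L F \<and> eq_2fun K (U' \<circ>\<circ> F) U"

locale two_natural = dom: strict_2functor K L F + cod: strict_2functor K L G
  for K :: "('o, 'f, 't) two_cat" and L :: "('p, 'g, 's) two_cat" and F and G +
  fixes lam :: "'o \<Rightarrow> ('p, 'g) cell"
  assumes lam_in: "X \<in> Ob K \<Longrightarrow> lam X \<in> hom1 L (F0 F X) (F0 G X)"
    and lam_natural1: "f \<in> hom1 K X Y \<Longrightarrow> F1 G f \<odot>\<^bsub>L\<^esub> lam X = lam Y \<odot>\<^bsub>L\<^esub> F1 F f"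
    and lam_natural2: "\<lbrakk>\<alpha> \<in> hom2 K f g; src f = X; trg f = Y\<rbrakk>
      \<Longrightarrow> F2 G \<alpha> \<lhd>\<^bsub>L\<^esub> lam X = lam Y \<rhd>\<^bsub>L\<^esub> F2 F \<alpha>"

section \<open>2-monads and their algebras\<close>

record ('o, 'f, 't) monad =
  fn :: "('o, 'f, 't, 'o, 'f, 't) two_fun"
  eta :: "'o \<Rightarrow> ('o, 'f) cell"
  mu :: "'o \<Rightarrow> ('o, 'f) cell"

abbreviation "T0 T \<equiv> F0 (fn T)"
abbreviation "T1 T \<equiv> F1 (fn T)"
abbreviation "T2 T \<equiv> F2 (fn T)"

locale strict_2monad = fn: strict_2functor K K "fn T"
    + unit: two_natural K K id_2fun "fn T" "eta T"
    + mult: two_natural K K "fn T \<circ>\<circ> fn T" "fn T" "mu T"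
  for K :: "('o, 'f, 't) two_cat" and T :: "('o, 'f, 't) monad" +
  assumes unit_left: "X \<in> Ob K \<Longrightarrow> mu T X \<odot>\<^bsub>K\<^esub> eta T (T0 T X) = id1 K (T0 T X)"
    and unit_right: "X \<in> Ob K \<Longrightarrow> mu T X \<odot>\<^bsub>K\<^esub> T1 T (eta T X) = id1 K (T0 T X)"
    and assoc: "X \<in> Ob K \<Longrightarrow> mu T X \<odot>\<^bsub>K\<^esub> mu T (T0 T X) = mu T X \<odot>\<^bsub>K\<^esub> T1 T (mu T X)"

text \<open>2-categories of structured objects \<open>(X, s)\<close>, with compositions inherited from \<open>K\<close>.\<close>

definition over_2cat ::
  "('o, 'f, 't) two_cat \<Rightarrow> ('o \<times> 's) set \<Rightarrow> (('o \<times> 's, ('o, 'f) cell) cell \<Rightarrow> bool) \<Rightarrow>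
   ((('o \<times> 's, ('o, 'f) cell) cell, (('o, 'f) cell, 't) cell) cell \<Rightarrow> bool) \<Rightarrow>
   ('o \<times> 's, ('o, 'f) cell, (('o, 'f) cell, 't) cell) two_cat" where
  "over_2cat K A H1 H2 =
    (let C1 = {f. src f \<in> A \<and> trg f \<in> A \<and> body f \<in> hom1 K (fst (src f)) (fst (trg f)) \<and> H1 f};
         c1 = (\<lambda>g f. Cell (src f) (trg g) (body g \<odot>\<^bsub>K\<^esub> body f))
     in \<lparr>Ob = A,
         Cell1 = C1,
         Cell2 = {\<alpha>. src \<alpha> \<in> C1 \<and> trg \<alpha> \<in> C1 \<and> parallel (src \<alpha>) (trg \<alpha>) \<and>
                     body \<alpha> \<in> hom2 K (body (src \<alpha>)) (body (trg \<alpha>)) \<and> H2 \<alpha>},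
         id1 = \<lambda>X. Cell X X (id1 K (fst X)),
         comp1 = c1,
         id2 = \<lambda>f. Cell f f (id2 K (body f)),
         vcomp = \<lambda>\<beta> \<alpha>. Cell (src \<alpha>) (trg \<beta>) (body \<beta> \<bullet>\<^bsub>K\<^esub> body \<alpha>),
         hcomp = \<lambda>\<beta> \<alpha>. Cell (c1 (src \<beta>) (src \<alpha>)) (c1 (trg \<beta>) (trg \<alpha>)) (body \<beta> \<star>\<^bsub>K\<^esub> body \<alpha>)\<rparr>)"

definition forget ::
  "('o \<times> 's, ('o, 'f) cell, (('o, 'f) cell, 't) cell, 'o, 'f, 't) two_fun" where
  "forget = \<lparr>F0 = fst, F1 = body, F2 = body\<rparr>"

definition strict_algebra ::
  "('o, 'f, 't) two_cat \<Rightarrow> ('o, 'f, 't) monad \<Rightarrow> 'o \<Rightarrow> ('o, 'f) cell \<Rightarrow> bool" where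
  "strict_algebra K T X a \<longleftrightarrow> X \<in> Ob K \<and> a \<in> hom1 K (T0 T X) X \<and>
     a \<odot>\<^bsub>K\<^esub> eta T X = id1 K X \<and> a \<odot>\<^bsub>K\<^esub> mu T X = a \<odot>\<^bsub>K\<^esub> T1 T a"

definition Alg_s ::
  "('o, 'f, 't) two_cat \<Rightarrow> ('o, 'f, 't) monad \<Rightarrow>
   ('o \<times> ('o, 'f) cell, ('o, 'f) cell, (('o, 'f) cell, 't) cell) two_cat" where
  "Alg_s K T = over_2cat K {(X, a). strict_algebra K T X a}
     (\<lambda>f. body f \<odot>\<^bsub>K\<^esub> snd (src f) = snd (trg f) \<odot>\<^bsub>K\<^esub> T1 T (body f))
     (\<lambda>\<alpha>. body \<alpha> \<lhd>\<^bsub>K\<^esub> snd (src (src \<alpha>)) = snd (trg (src \<alpha>)) \<rhd>\<^bsub>K\<^esub> T2 T (body \<alpha>))"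

datatype ('o, 'f, 't) psalg = PsAlg
  (und: 'o) (act: "('o, 'f) cell") (ps_unit: "(('o, 'f) cell, 't) cell") (ps_mult: "(('o, 'f) cell, 't) cell")

definition pseudoalgebra ::
  "('o, 'f, 't) two_cat \<Rightarrow> ('o, 'f, 't) monad \<Rightarrow> ('o, 'f, 't) psalg \<Rightarrow> bool" where
  "pseudoalgebra K T A \<longleftrightarrow>
    (let X = und A; a = act A; \<iota> = ps_unit A; \<chi> = ps_mult A in
      X \<in> Ob K \<and> a \<in> hom1 K (T0 T X) X \<and>
      \<iota> \<in> hom2 K (id1 K X) (a \<odot>\<^bsub>K\<^esub> eta T X) \<and> invertible2 K \<iota> \<and>
      \<chi> \<in> hom2 K (a \<odot>\<^bsub>K\<^esub> T1 T a) (a \<odot>\<^bsub>K\<^esub> mu T X) \<and> invertible2 K \<chi> \<and>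
      (\<chi> \<lhd>\<^bsub>K\<^esub> T1 T (eta T X)) \<bullet>\<^bsub>K\<^esub> (a \<rhd>\<^bsub>K\<^esub> T2 T \<iota>) = id2 K a \<and>
      (\<chi> \<lhd>\<^bsub>K\<^esub> eta T (T0 T X)) \<bullet>\<^bsub>K\<^esub> (\<iota> \<lhd>\<^bsub>K\<^esub> a) = id2 K a \<and>
      (\<chi> \<lhd>\<^bsub>K\<^esub> T1 T (mu T X)) \<bullet>\<^bsub>K\<^esub> (a \<rhd>\<^bsub>K\<^esub> T2 T \<chi>) =
        (\<chi> \<lhd>\<^bsub>K\<^esub> mu T (T0 T X)) \<bullet>\<^bsub>K\<^esub> (\<chi> \<lhd>\<^bsub>K\<^esub> T1 T (T1 T a)))"

definition normal_algebra :: "('o, 'f, 't) two_cat \<Rightarrow> ('o, 'f, 't) psalg \<Rightarrow> bool" where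
  "normal_algebra K A \<longleftrightarrow> ps_unit A = id2 K (id1 K (und A))"

text \<open>The body of a pseudomorphism is the pair \<open>(f, fbar)\<close>.\<close>

type_synonym ('o, 'f, 't) psmor =
  "(('o, 'f, 't) psalg, ('o, 'f) cell \<times> (('o, 'f) cell, 't) cell) cell"

definition pseudomorphism ::
  "('o, 'f, 't) two_cat \<Rightarrow> ('o, 'f, 't) monad \<Rightarrow> ('o, 'f, 't) psmor \<Rightarrow> bool" where
  "pseudomorphism K T m \<longleftrightarrow>
    (let A = src m; B = trg m; X = und A; a = act A; b = act B; f = fst (body m); fb = snd (body m) in
      pseudoalgebra K T A \<and> pseudoalgebra K T B \<and> f \<in> hom1 K X (und B) \<and>
      fb \<in> hom2 K (b \<odot>\<^bsub>K\<^esub> T1 T f) (f \<odot>\<^bsub>K\<^esub> a) \<and> invertible2 K fb \<and>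
      (fb \<lhd>\<^bsub>K\<^esub> eta T X) \<bullet>\<^bsub>K\<^esub> (ps_unit B \<lhd>\<^bsub>K\<^esub> f) = f \<rhd>\<^bsub>K\<^esub> ps_unit A \<and>
      (fb \<lhd>\<^bsub>K\<^esub> mu T X) \<bullet>\<^bsub>K\<^esub> (ps_mult B \<lhd>\<^bsub>K\<^esub> T1 T (T1 T f)) =
        (f \<rhd>\<^bsub>K\<^esub> ps_mult A) \<bullet>\<^bsub>K\<^esub> (fb \<lhd>\<^bsub>K\<^esub> T1 T a) \<bullet>\<^bsub>K\<^esub> (b \<rhd>\<^bsub>K\<^esub> T2 T fb))"

definition alg_transformation ::
  "('o, 'f, 't) two_cat \<Rightarrow> ('o, 'f, 't) monad \<Rightarrow> (('o, 'f, 't) psmor, (('o, 'f) cell, 't) cell) cell \<Rightarrow> bool" where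
  "alg_transformation K T \<alpha> \<longleftrightarrow>
     pseudomorphism K T (src \<alpha>) \<and> pseudomorphism K T (trg \<alpha>) \<and> parallel (src \<alpha>) (trg \<alpha>) \<and>
     body \<alpha> \<in> hom2 K (fst (body (src \<alpha>))) (fst (body (trg \<alpha>))) \<and>
     (body \<alpha> \<lhd>\<^bsub>K\<^esub> act (src (src \<alpha>))) \<bullet>\<^bsub>K\<^esub> snd (body (src \<alpha>)) =
       snd (body (trg \<alpha>)) \<bullet>\<^bsub>K\<^esub> (act (trg (src \<alpha>)) \<rhd>\<^bsub>K\<^esub> T2 T (body \<alpha>))"

definition psmor_comp ::
  "('o, 'f, 't) two_cat \<Rightarrow> ('o, 'f, 't) monad \<Rightarrow> ('o, 'f, 't) psmor \<Rightarrow> ('o, 'f, 't) psmor \<Rightarrow> ('o, 'f, 't) psmor" where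
  "psmor_comp K T n m =
    (let f = fst (body m); fb = snd (body m); g = fst (body n); gb = snd (body n)
     in Cell (src m) (trg n) (g \<odot>\<^bsub>K\<^esub> f, (g \<rhd>\<^bsub>K\<^esub> fb) \<bullet>\<^bsub>K\<^esub> (gb \<lhd>\<^bsub>K\<^esub> T1 T f)))"

type_synonym ('o, 'f, 't) psalg_2cat =
  "(('o, 'f, 't) psalg, ('o, 'f) cell \<times> (('o, 'f) cell, 't) cell, (('o, 'f) cell, 't) cell) two_cat"

definition Ps_Alg :: "('o, 'f, 't) two_cat \<Rightarrow> ('o, 'f, 't) monad \<Rightarrow> ('o, 'f, 't) psalg_2cat" where
  "Ps_Alg K T =
    \<lparr>Ob = {A. pseudoalgebra K T A},
     Cell1 = {m. pseudomorphism K T m},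
     Cell2 = {\<alpha>. alg_transformation K T \<alpha>},
     id1 = \<lambda>A. Cell A A (id1 K (und A), id2 K (act A)),
     comp1 = psmor_comp K T,
     id2 = \<lambda>m. Cell m m (id2 K (fst (body m))),
     vcomp = \<lambda>\<beta> \<alpha>. Cell (src \<alpha>) (trg \<beta>) (body \<beta> \<bullet>\<^bsub>K\<^esub> body \<alpha>),
     hcomp = \<lambda>\<beta> \<alpha>. Cell (psmor_comp K T (src \<beta>) (src \<alpha>)) (psmor_comp K T (trg \<beta>) (trg \<alpha>))
                      (body \<beta> \<star>\<^bsub>K\<^esub> body \<alpha>)\<rparr>"

definition full_sub :: "('o, 'f, 't) two_cat \<Rightarrow> ('o \<Rightarrow> bool) \<Rightarrow> ('o, 'f, 't) two_cat" where
  "full_sub K S = K\<lparr>Ob := {X \<in> Ob K. S X},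
     Cell1 := {f \<in> Cell1 K. S (src f) \<and> S (trg f)},
     Cell2 := {\<alpha> \<in> Cell2 K. S (src (src \<alpha>)) \<and> S (trg (src \<alpha>))}\<rparr>"

definition Ps_Alg_n :: "('o, 'f, 't) two_cat \<Rightarrow> ('o, 'f, 't) monad \<Rightarrow> ('o, 'f, 't) psalg_2cat" where
  "Ps_Alg_n K T = full_sub (Ps_Alg K T) (normal_algebra K)"

definition ps_forget ::
  "(('o, 'f, 't) psalg, ('o, 'f) cell \<times> (('o, 'f) cell, 't) cell, (('o, 'f) cell, 't) cell, 'o, 'f, 't) two_fun" where
  "ps_forget = \<lparr>F0 = und, F1 = \<lambda>m. fst (body m), F2 = body\<rparr>"

text \<open>The inclusion of strict algebras and strict morphisms: all structure cells are identities.\<close>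

definition strict_as_ps ::
  "('o, 'f, 't) two_cat \<Rightarrow> ('o, 'f, 't) monad \<Rightarrow>
   ('o \<times> ('o, 'f) cell, ('o, 'f) cell, (('o, 'f) cell, 't) cell,
    ('o, 'f, 't) psalg, ('o, 'f) cell \<times> (('o, 'f) cell, 't) cell, (('o, 'f) cell, 't) cell) two_fun" where
  "strict_as_ps K T =
    (let j0 = (\<lambda>(X, a). PsAlg X a (id2 K (id1 K X)) (id2 K (a \<odot>\<^bsub>K\<^esub> mu T X)));
         j1 = (\<lambda>f. Cell (j0 (src f)) (j0 (trg f)) (body f, id2 K (body f \<odot>\<^bsub>K\<^esub> snd (src f))))
     in \<lparr>F0 = j0, F1 = j1, F2 = \<lambda>\<alpha>. Cell (j1 (src \<alpha>)) (j1 (trg \<alpha>)) (body \<alpha>)\<rparr>)"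

section \<open>Colax morphisms of 2-monads and restriction of scalars\<close>

locale colax_monad_morphism = T: strict_2monad K T + R: strict_2monad L R
    + lam: two_natural K L "fn R \<circ>\<circ> V" "V \<circ>\<circ> fn T" lam
    + V: strict_2functor K L V
  for K :: "('o, 'f, 't) two_cat" and T and L :: "('p, 'g, 's) two_cat" and R
    and V :: "('o, 'f, 't, 'p, 'g, 's) two_fun" and lam :: "'o \<Rightarrow> ('p, 'g) cell" +
  assumes lam_eta: "X \<in> Ob K \<Longrightarrow> lam X \<odot>\<^bsub>L\<^esub> eta R (F0 V X) = F1 V (eta T X)"
    and lam_mu: "X \<in> Ob K \<Longrightarrow>
      lam X \<odot>\<^bsub>L\<^esub> mu R (F0 V X) = F1 V (mu T X) \<odot>\<^bsub>L\<^esub> lam (T0 T X) \<odot>\<^bsub>L\<^esub> T1 R (lam X)"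

definition restrict_s ::
  "('p, 'g, 's) two_cat \<Rightarrow> ('o, 'f, 't, 'p, 'g, 's) two_fun \<Rightarrow> ('o \<Rightarrow> ('p, 'g) cell) \<Rightarrow>
   ('o \<times> ('o, 'f) cell, ('o, 'f) cell, (('o, 'f) cell, 't) cell,
    'p \<times> ('p, 'g) cell, ('p, 'g) cell, (('p, 'g) cell, 's) cell) two_fun" where
  "restrict_s L V lam =
    (let r0 = (\<lambda>(X, a). (F0 V X, F1 V a \<odot>\<^bsub>L\<^esub> lam X));
         r1 = (\<lambda>f. Cell (r0 (src f)) (r0 (trg f)) (F1 V (body f)))
     in \<lparr>F0 = r0, F1 = r1, F2 = \<lambda>\<alpha>. Cell (r1 (src \<alpha>)) (r1 (trg \<alpha>)) (F2 V (body \<alpha>))\<rparr>)"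

definition restrict_ps ::
  "('o, 'f, 't) monad \<Rightarrow> ('p, 'g, 's) two_cat \<Rightarrow> ('p, 'g, 's) monad \<Rightarrow>
   ('o, 'f, 't, 'p, 'g, 's) two_fun \<Rightarrow> ('o \<Rightarrow> ('p, 'g) cell) \<Rightarrow>
   (('o, 'f, 't) psalg, ('o, 'f) cell \<times> (('o, 'f) cell, 't) cell, (('o, 'f) cell, 't) cell,
    ('p, 'g, 's) psalg, ('p, 'g) cell \<times> (('p, 'g) cell, 's) cell, (('p, 'g) cell, 's) cell) two_fun" where
  "restrict_ps T L R V lam =
    (let r0 = (\<lambda>A. PsAlg (F0 V (und A)) (F1 V (act A) \<odot>\<^bsub>L\<^esub> lam (und A)) (F2 V (ps_unit A))
                 (F2 V (ps_mult A) \<lhd>\<^bsub>L\<^esub> (lam (T0 T (und A)) \<odot>\<^bsub>L\<^esub> T1 R (lam (und A)))));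
         r1 = (\<lambda>m. Cell (r0 (src m)) (r0 (trg m))
                 (F1 V (fst (body m)), F2 V (snd (body m)) \<lhd>\<^bsub>L\<^esub> lam (und (src m))))
     in \<lparr>F0 = r0, F1 = r1, F2 = \<lambda>\<alpha>. Cell (r1 (src \<alpha>)) (r1 (trg \<alpha>)) (F2 V (body \<alpha>))\<rparr>)"

section \<open>Arrow 2-categories and strict slices\<close>

type_synonym ('o, 'f, 't) arrow_2cat =
  "(('o, 'f) cell, ('o, 'f) cell \<times> ('o, 'f) cell,
    (('o, 'f) cell, 't) cell \<times> (('o, 'f) cell, 't) cell) two_cat"

definition Arrow :: "('o, 'f, 't) two_cat \<Rightarrow> ('o, 'f, 't) arrow_2cat" where
  "Arrow K =
    (let C1 = {Cell P Q (T, S) | P Q T S. P \<in> Cell1 K \<and> Q \<in> Cell1 K \<and>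
                 T \<in> hom1 K (src P) (src Q) \<and> S \<in> hom1 K (trg P) (trg Q) \<and>
                 Q \<odot>\<^bsub>K\<^esub> T = S \<odot>\<^bsub>K\<^esub> P};
         c1 = (\<lambda>G F. Cell (src F) (trg G)
                 (fst (body G) \<odot>\<^bsub>K\<^esub> fst (body F), snd (body G) \<odot>\<^bsub>K\<^esub> snd (body F)))
     in \<lparr>Ob = Cell1 K,
         Cell1 = C1,
         Cell2 = {Cell F G (\<beta>, \<alpha>) | F G \<beta> \<alpha>. F \<in> C1 \<and> G \<in> C1 \<and> parallel F G \<and>
                    \<beta> \<in> hom2 K (fst (body F)) (fst (body G)) \<and> \<alpha> \<in> hom2 K (snd (body F)) (snd (body G)) \<and>
                    trg F \<rhd>\<^bsub>K\<^esub> \<beta> = \<alpha> \<lhd>\<^bsub>K\<^esub> src F},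
         id1 = \<lambda>P. Cell P P (id1 K (src P), id1 K (trg P)),
         comp1 = c1,
         id2 = \<lambda>F. Cell F F (id2 K (fst (body F)), id2 K (snd (body F))),
         vcomp = \<lambda>\<psi> \<phi>. Cell (src \<phi>) (trg \<psi>)
                   (fst (body \<psi>) \<bullet>\<^bsub>K\<^esub> fst (body \<phi>), snd (body \<psi>) \<bullet>\<^bsub>K\<^esub> snd (body \<phi>)),
         hcomp = \<lambda>\<psi> \<phi>. Cell (c1 (src \<psi>) (src \<phi>)) (c1 (trg \<psi>) (trg \<phi>))
                   (fst (body \<psi>) \<star>\<^bsub>K\<^esub> fst (body \<phi>), snd (body \<psi>) \<star>\<^bsub>K\<^esub> snd (body \<phi>))\<rparr>)"

text \<open>A 1-cell of the slice over \<open>B\<close> is written as the square \<open>(T, 1\<^sub>B)\<close>, a 2-cell as \<open>(\<beta>, 1)\<close>; so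
  a 2-monad on the arrow 2-category that fixes bases restricts to the slice without change.\<close>

definition Slice :: "('o, 'f, 't) two_cat \<Rightarrow> 'o \<Rightarrow> ('o, 'f, 't) arrow_2cat" where
  "Slice K B = (Arrow K)
     \<lparr>Ob := {P \<in> Cell1 K. trg P = B},
      Cell1 := {F \<in> Cell1 (Arrow K). trg (src F) = B \<and> trg (trg F) = B \<and> snd (body F) = id1 K B},
      Cell2 := {\<phi> \<in> Cell2 (Arrow K). trg (src (src \<phi>)) = B \<and> trg (trg (src \<phi>)) = B \<and>
                  snd (body \<phi>) = id2 K (id1 K B)}\<rparr>"

definition Dom ::
  "(('o, 'f) cell, ('o, 'f) cell \<times> ('o, 'f) cell,
    (('o, 'f) cell, 't) cell \<times> (('o, 'f) cell, 't) cell, 'o, 'f, 't) two_fun" where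
  "Dom = \<lparr>F0 = src, F1 = \<lambda>F. fst (body F), F2 = \<lambda>\<phi>. fst (body \<phi>)\<rparr>"

section \<open>Categories\<close>

text \<open>Objects and arrows of categories are elements of a type that is closed under pairing and
  under formation of squares. In \<open>Sq X Y f v\<close> the pair \<open>(f, v)\<close> is an arrow from
  \<open>X\<close> to \<open>Y\<close> in a comma or arrow category.\<close>

datatype 'a univ = Atom 'a
  | Pair (pfst: "'a univ") (psnd: "'a univ")
  | Sq (sdom: "'a univ") (scod: "'a univ") (sfst: "'a univ") (ssnd: "'a univ")

text \<open>All operations take the value \<open>undefined\<close> outside their domains, so that equality of categories,
  functors and transformations is the mathematical one.\<close>

record 'u cat =
  Obj :: "'u set"
  Arr :: "'u set"
  cdom :: "'u \<Rightarrow> 'u"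
  ccod :: "'u \<Rightarrow> 'u"
  ide :: "'u \<Rightarrow> 'u"
  ccomp :: "'u \<Rightarrow> 'u \<Rightarrow> 'u" (infixl "\<cdot>\<index>" 75)

definition hom :: "'u cat \<Rightarrow> 'u \<Rightarrow> 'u \<Rightarrow> 'u set" where
  "hom C x y = {f \<in> Arr C. cdom C f = x \<and> ccod C f = y}"

locale category =
  fixes C :: "'u cat"
  assumes ends: "f \<in> Arr C \<Longrightarrow> cdom C f \<in> Obj C \<and> ccod C f \<in> Obj C"
    and ide_in: "x \<in> Obj C \<Longrightarrow> ide C x \<in> hom C x x"
    and ccomp_in: "\<lbrakk>f \<in> hom C x y; g \<in> hom C y z\<rbrakk> \<Longrightarrow> g \<cdot>\<^bsub>C\<^esub> f \<in> hom C x z"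
    and ccomp_ide: "f \<in> hom C x y \<Longrightarrow> f \<cdot>\<^bsub>C\<^esub> ide C x = f"
    and ide_ccomp: "f \<in> hom C x y \<Longrightarrow> ide C y \<cdot>\<^bsub>C\<^esub> f = f"
    and ccomp_assoc: "\<lbrakk>f \<in> hom C x y; g \<in> hom C y z; h \<in> hom C z w\<rbrakk>
      \<Longrightarrow> h \<cdot>\<^bsub>C\<^esub> (g \<cdot>\<^bsub>C\<^esub> f) = h \<cdot>\<^bsub>C\<^esub> g \<cdot>\<^bsub>C\<^esub> f"
    and dom_ext: "cdom C \<in> extensional (Arr C)"
    and cod_ext: "ccod C \<in> extensional (Arr C)"
    and ide_ext: "ide C \<in> extensional (Obj C)"
    and ccomp_ext: "\<not> (f \<in> Arr C \<and> g \<in> Arr C \<and> ccod C f = cdom C g) \<Longrightarrow> g \<cdot>\<^bsub>C\<^esub> f = undefined"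

text \<open>Small means of cardinality less than \<open>\<kappa>\<close>; for a Grothendieck universe, \<open>\<kappa>\<close> is its cardinal.\<close>

definition locally_small :: "'k rel \<Rightarrow> 'u cat \<Rightarrow> bool" where
  "locally_small \<kappa> C \<longleftrightarrow> (\<forall>x \<in> Obj C. \<forall>y \<in> Obj C. (card_of (hom C x y), \<kappa>) \<in> ordLess)"

definition inverse_arrows :: "'u cat \<Rightarrow> 'u \<Rightarrow> 'u \<Rightarrow> bool" where
  "inverse_arrows C f g \<longleftrightarrow> f \<in> Arr C \<and> g \<in> hom C (ccod C f) (cdom C f) \<and>
     g \<cdot>\<^bsub>C\<^esub> f = ide C (cdom C f) \<and> f \<cdot>\<^bsub>C\<^esub> g = ide C (ccod C f)"

definition invertible :: "'u cat \<Rightarrow> 'u \<Rightarrow> bool" where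
  "invertible C f \<longleftrightarrow> (\<exists>g. inverse_arrows C f g)"

definition inv_arrow :: "'u cat \<Rightarrow> 'u \<Rightarrow> 'u" where
  "inv_arrow C f = (THE g. inverse_arrows C f g)"

definition is_ide :: "'u cat \<Rightarrow> 'u \<Rightarrow> bool" where
  "is_ide C f \<longleftrightarrow> (\<exists>x \<in> Obj C. f = ide C x)"

type_synonym 'u func = "('u cat, ('u \<Rightarrow> 'u) \<times> ('u \<Rightarrow> 'u)) cell"
type_synonym 'u ntrans = "('u func, 'u \<Rightarrow> 'u) cell"

abbreviation fobj :: "'u func \<Rightarrow> 'u \<Rightarrow> 'u" where "fobj F \<equiv> fst (body F)"
abbreviation farr :: "'u func \<Rightarrow> 'u \<Rightarrow> 'u" where "farr F \<equiv> snd (body F)"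

definition is_functor :: "'u func \<Rightarrow> bool" where
  "is_functor F \<longleftrightarrow> (let A = src F; B = trg F in
     category A \<and> category B \<and>
     (\<forall>x \<in> Obj A. fobj F x \<in> Obj B) \<and>
     (\<forall>f \<in> Arr A. farr F f \<in> hom B (fobj F (cdom A f)) (fobj F (ccod A f))) \<and>
     (\<forall>x \<in> Obj A. farr F (ide A x) = ide B (fobj F x)) \<and>
     (\<forall>f \<in> Arr A. \<forall>g \<in> Arr A. ccod A f = cdom A g \<longrightarrow> farr F (g \<cdot>\<^bsub>A\<^esub> f) = farr F g \<cdot>\<^bsub>B\<^esub> farr F f) \<and>
     fobj F \<in> extensional (Obj A) \<and> farr F \<in> extensional (Arr A))"

definition is_ntrans :: "'u ntrans \<Rightarrow> bool" where
  "is_ntrans \<tau> \<longleftrightarrow> (let F = src \<tau>; G = trg \<tau>; A = src F; B = trg F in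
     is_functor F \<and> is_functor G \<and> parallel F G \<and>
     (\<forall>x \<in> Obj A. body \<tau> x \<in> hom B (fobj F x) (fobj G x)) \<and>
     (\<forall>f \<in> Arr A. body \<tau> (ccod A f) \<cdot>\<^bsub>B\<^esub> farr F f = farr G f \<cdot>\<^bsub>B\<^esub> body \<tau> (cdom A f)) \<and>
     body \<tau> \<in> extensional (Obj A))"

definition mk_functor :: "'u cat \<Rightarrow> 'u cat \<Rightarrow> ('u \<Rightarrow> 'u) \<Rightarrow> ('u \<Rightarrow> 'u) \<Rightarrow> 'u func" where
  "mk_functor A B o' a' = Cell A B (restrict o' (Obj A), restrict a' (Arr A))"

definition mk_ntrans :: "'u func \<Rightarrow> 'u func \<Rightarrow> ('u \<Rightarrow> 'u) \<Rightarrow> 'u ntrans" where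
  "mk_ntrans F G t = Cell F G (restrict t (Obj (src F)))"

definition id_functor :: "'u cat \<Rightarrow> 'u func" where
  "id_functor A = mk_functor A A (\<lambda>x. x) (\<lambda>f. f)"

definition comp_functor :: "'u func \<Rightarrow> 'u func \<Rightarrow> 'u func" where
  "comp_functor G F = mk_functor (src F) (trg G) (fobj G \<circ> fobj F) (farr G \<circ> farr F)"

definition id_ntrans :: "'u func \<Rightarrow> 'u ntrans" where
  "id_ntrans F = mk_ntrans F F (\<lambda>x. ide (trg F) (fobj F x))"

definition vcomp_ntrans :: "'u ntrans \<Rightarrow> 'u ntrans \<Rightarrow> 'u ntrans" where
  "vcomp_ntrans \<sigma> \<tau> = mk_ntrans (src \<tau>) (trg \<sigma>) (\<lambda>x. body \<sigma> x \<cdot>\<^bsub>trg (src \<tau>)\<^esub> body \<tau> x)"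

definition hcomp_ntrans :: "'u ntrans \<Rightarrow> 'u ntrans \<Rightarrow> 'u ntrans" where
  "hcomp_ntrans \<sigma> \<tau> = mk_ntrans (comp_functor (src \<sigma>) (src \<tau>)) (comp_functor (trg \<sigma>) (trg \<tau>))
     (\<lambda>x. farr (trg \<sigma>) (body \<tau> x) \<cdot>\<^bsub>trg (src \<sigma>)\<^esub> body \<sigma> (fobj (src \<tau>) x))"

definition CAT :: "'k rel \<Rightarrow> ('u cat, ('u \<Rightarrow> 'u) \<times> ('u \<Rightarrow> 'u), 'u \<Rightarrow> 'u) two_cat" where
  "CAT \<kappa> =
    (let obs = {C. category C \<and> locally_small \<kappa> C};
         fs = {F. is_functor F \<and> src F \<in> obs \<and> trg F \<in> obs}
     in \<lparr>Ob = obs, Cell1 = fs, Cell2 = {\<tau>. is_ntrans \<tau> \<and> src \<tau> \<in> fs \<and> trg \<tau> \<in> fs},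
         id1 = id_functor, comp1 = comp_functor,
         id2 = id_ntrans, vcomp = vcomp_ntrans, hcomp = hcomp_ntrans\<rparr>)"

abbreviation "CAT2 \<kappa> \<equiv> Arrow (CAT \<kappa>)"

type_synonym 'u square = "('u func, 'u func \<times> 'u func) cell"
type_synonym 'u square2 = "('u square, 'u ntrans \<times> 'u ntrans) cell"

section \<open>Split and normally cloven cofibrations\<close>

definition cocartesian :: "'u func \<Rightarrow> 'u \<Rightarrow> bool" where
  "cocartesian P e \<longleftrightarrow> (let E = src P; B = trg P in
     e \<in> Arr E \<and>
     (\<forall>g \<in> Arr E. cdom E g = cdom E e \<longrightarrow>
       (\<forall>v \<in> hom B (fobj P (ccod E e)) (fobj P (ccod E g)). farr P g = v \<cdot>\<^bsub>B\<^esub> farr P e \<longrightarrow>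
         (\<exists>!h. h \<in> hom E (ccod E e) (ccod E g) \<and> h \<cdot>\<^bsub>E\<^esub> e = g \<and> farr P h = v))))"

definition CoCart :: "'u func \<Rightarrow> 'u set" where
  "CoCart P = {e. cocartesian P e}"

definition vert :: "'u func \<Rightarrow> 'u set" where
  "vert P = {f \<in> Arr (src P). is_ide (trg P) (farr P f)}"

definition inv_image_Iso :: "'u func \<Rightarrow> 'u set" where
  "inv_image_Iso P = {f \<in> Arr (src P). invertible (trg P) (farr P f)}"

text \<open>A cleavage \<open>\<delta>\<close> is applied as \<open>\<delta> x u\<close>.\<close>

type_synonym 'u clv = "'u \<Rightarrow> 'u \<Rightarrow> 'u"

definition liftable :: "'u func \<Rightarrow> 'u \<Rightarrow> 'u \<Rightarrow> bool" where
  "liftable P x u \<longleftrightarrow> x \<in> Obj (src P) \<and> u \<in> Arr (trg P) \<and> cdom (trg P) u = fobj P x"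

definition is_cleavage :: "'u func \<Rightarrow> 'u clv \<Rightarrow> bool" where
  "is_cleavage P \<delta> \<longleftrightarrow>
     (\<forall>x u. liftable P x u \<longrightarrow> \<delta> x u \<in> CoCart P \<and> cdom (src P) (\<delta> x u) = x \<and> farr P (\<delta> x u) = u) \<and>
     (\<forall>x u. \<not> liftable P x u \<longrightarrow> \<delta> x u = undefined)"

definition push_obj :: "'u func \<Rightarrow> 'u clv \<Rightarrow> 'u \<Rightarrow> 'u \<Rightarrow> 'u" where
  "push_obj P \<delta> u x = ccod (src P) (\<delta> x u)"

definition push_arr :: "'u func \<Rightarrow> 'u clv \<Rightarrow> 'u \<Rightarrow> 'u \<Rightarrow> 'u" where
  "push_arr P \<delta> u f = (let E = src P; x = cdom E f; y = ccod E f in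
     THE g. g \<in> hom E (push_obj P \<delta> u x) (push_obj P \<delta> u y) \<and> g \<in> vert P \<and>
       g \<cdot>\<^bsub>E\<^esub> \<delta> x u = \<delta> y u \<cdot>\<^bsub>E\<^esub> f)"

definition normal_cleavage :: "'u func \<Rightarrow> 'u clv \<Rightarrow> bool" where
  "normal_cleavage P \<delta> \<longleftrightarrow> is_cleavage P \<delta> \<and>
     (\<forall>x \<in> Obj (src P). \<delta> x (ide (trg P) (fobj P x)) = ide (src P) x)"

definition split_cleavage :: "'u func \<Rightarrow> 'u clv \<Rightarrow> bool" where
  "split_cleavage P \<delta> \<longleftrightarrow> normal_cleavage P \<delta> \<and> (let E = src P; B = trg P in
     \<forall>u \<in> Arr B. \<forall>v \<in> Arr B. ccod B u = cdom B v \<longrightarrow>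
       (\<forall>x \<in> Obj E. fobj P x = cdom B u \<longrightarrow>
          push_obj P \<delta> (v \<cdot>\<^bsub>B\<^esub> u) x = push_obj P \<delta> v (push_obj P \<delta> u x) \<and>
          \<delta> x (v \<cdot>\<^bsub>B\<^esub> u) = \<delta> (push_obj P \<delta> u x) v \<cdot>\<^bsub>E\<^esub> \<delta> x u) \<and>
       (\<forall>f \<in> Arr E. farr P f = ide B (cdom B u) \<longrightarrow>
          push_arr P \<delta> (v \<cdot>\<^bsub>B\<^esub> u) f = push_arr P \<delta> v (push_arr P \<delta> u f)))"

text \<open>\<open>\<nu>\<^sub>f\<close>, the vertical factor of \<open>f\<close>.\<close>

definition vert_part :: "'u func \<Rightarrow> 'u clv \<Rightarrow> 'u \<Rightarrow> 'u" where
  "vert_part P \<delta> f = (let E = src P; x = cdom E f in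
     THE h. h \<in> hom E (push_obj P \<delta> (farr P f) x) (ccod E f) \<and> h \<in> vert P \<and>
       f = h \<cdot>\<^bsub>E\<^esub> \<delta> x (farr P f))"

definition designated :: "'u func \<Rightarrow> 'u clv \<Rightarrow> 'u set" where
  "designated P \<delta> = {\<delta> x u | x u. liftable P x u}"

type_synonym 'u cofib_2cat =
  "('u func \<times> 'u clv, 'u square, 'u square2) two_cat"

definition SCoFib :: "'k rel \<Rightarrow> 'u cofib_2cat" where
  "SCoFib \<kappa> = over_2cat (CAT2 \<kappa>) {(P, \<delta>). P \<in> Ob (CAT2 \<kappa>) \<and> split_cleavage P \<delta>}
     (\<lambda>F. let P = fst (src F); \<delta> = snd (src F); \<delta>' = snd (trg F); (T, S) = body (body F) in
        \<forall>x u. liftable P x u \<longrightarrow> farr T (\<delta> x u) = \<delta>' (fobj T x) (farr S u))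
     (\<lambda>_. True)"

definition NClCoFib :: "'k rel \<Rightarrow> 'u cofib_2cat" where
  "NClCoFib \<kappa> = over_2cat (CAT2 \<kappa>) {(P, \<delta>). P \<in> Ob (CAT2 \<kappa>) \<and> normal_cleavage P \<delta>}
     (\<lambda>F. let P = fst (src F); Q = fst (trg F); T = fst (body (body F)) in
        \<forall>e \<in> CoCart P. farr T e \<in> CoCart Q)
     (\<lambda>_. True)"

section \<open>The comma 2-monad\<close>

definition comma :: "'a univ func \<Rightarrow> 'a univ cat" where
  "comma P =
    (let E = src P; B = trg P;
         obs = {Pair x u | x u. liftable P x u};
         ars = {Sq (Pair x u) (Pair y w) f v | x u y w f v. liftable P x u \<and> liftable P y w \<and>
                  f \<in> hom E x y \<and> v \<in> hom B (ccod B u) (ccod B w) \<and> v \<cdot>\<^bsub>B\<^esub> u = w \<cdot>\<^bsub>B\<^esub> farr P f}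
     in \<lparr>Obj = obs, Arr = ars,
         cdom = restrict sdom ars, ccod = restrict scod ars,
         ide = restrict (\<lambda>X. Sq X X (ide E (pfst X)) (ide B (ccod B (psnd X)))) obs,
         ccomp = \<lambda>b a. if a \<in> ars \<and> b \<in> ars \<and> scod a = sdom b
           then Sq (sdom a) (scod b) (sfst b \<cdot>\<^bsub>E\<^esub> sfst a) (ssnd b \<cdot>\<^bsub>B\<^esub> ssnd a) else undefined\<rparr>)"

definition comma_cod :: "'a univ func \<Rightarrow> 'a univ func" where
  "comma_cod P = mk_functor (comma P) (trg P) (\<lambda>X. ccod (trg P) (psnd X)) ssnd"

definition comma_map :: "'a univ square \<Rightarrow> 'a univ func" where
  "comma_map F = (let P = src F; Q = trg F; (T, S) = body F;
       t = (\<lambda>X. Pair (fobj T (pfst X)) (farr S (psnd X)))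
     in mk_functor (comma P) (comma Q) t
          (\<lambda>a. Sq (t (sdom a)) (t (scod a)) (farr T (sfst a)) (farr S (ssnd a))))"

definition comma_sq :: "'a univ square \<Rightarrow> 'a univ square" where
  "comma_sq F = Cell (comma_cod (src F)) (comma_cod (trg F)) (comma_map F, snd (body F))"

definition comma_cell :: "'a univ square2 \<Rightarrow> 'a univ square2" where
  "comma_cell \<phi> = (let F = src \<phi>; G = trg \<phi>; P = src F; (\<beta>, \<alpha>) = body \<phi> in
     Cell (comma_sq F) (comma_sq G)
       (mk_ntrans (comma_map F) (comma_map G)
          (\<lambda>X. Sq (fobj (comma_map F) X) (fobj (comma_map G) X)
                 (body \<beta> (pfst X)) (body \<alpha> (ccod (trg P) (psnd X)))), \<alpha>))"

definition comma_unit :: "'a univ func \<Rightarrow> 'a univ square" where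
  "comma_unit P = (let E = src P; B = trg P; h = (\<lambda>x. Pair x (ide B (fobj P x))) in
     Cell P (comma_cod P)
       (mk_functor E (comma P) h (\<lambda>f. Sq (h (cdom E f)) (h (ccod E f)) f (farr P f)), id_functor B))"

definition comma_mult :: "'a univ func \<Rightarrow> 'a univ square" where
  "comma_mult P = (let B = trg P; m = (\<lambda>X. Pair (pfst (pfst X)) (psnd X \<cdot>\<^bsub>B\<^esub> psnd (pfst X))) in
     Cell (comma_cod (comma_cod P)) (comma_cod P)
       (mk_functor (comma (comma_cod P)) (comma P) m
          (\<lambda>a. Sq (m (sdom a)) (m (scod a)) (sfst (sfst a)) (ssnd a)), id_functor B))"

definition Comma :: "('a univ func, 'a univ func \<times> 'a univ func, 'a univ ntrans \<times> 'a univ ntrans) monad" where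
  "Comma = \<lparr>fn = \<lparr>F0 = comma_cod, F1 = comma_sq, F2 = comma_cell\<rparr>, eta = comma_unit, mu = comma_mult\<rparr>"

section \<open>The squaring 2-monad\<close>

definition arrow_cat :: "'a univ cat \<Rightarrow> 'a univ cat" where
  "arrow_cat E =
    (let ars = {Sq f g r s | f g r s. f \<in> Arr E \<and> g \<in> Arr E \<and>
                  r \<in> hom E (cdom E f) (cdom E g) \<and> s \<in> hom E (ccod E f) (ccod E g) \<and>
                  s \<cdot>\<^bsub>E\<^esub> f = g \<cdot>\<^bsub>E\<^esub> r}
     in \<lparr>Obj = Arr E, Arr = ars,
         cdom = restrict sdom ars, ccod = restrict scod ars,
         ide = restrict (\<lambda>f. Sq f f (ide E (cdom E f)) (ide E (ccod E f))) (Arr E),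
         ccomp = \<lambda>b a. if a \<in> ars \<and> b \<in> ars \<and> scod a = sdom b
           then Sq (sdom a) (scod b) (sfst b \<cdot>\<^bsub>E\<^esub> sfst a) (ssnd b \<cdot>\<^bsub>E\<^esub> ssnd a) else undefined\<rparr>)"

definition arrow_map :: "'a univ func \<Rightarrow> 'a univ func" where
  "arrow_map F = mk_functor (arrow_cat (src F)) (arrow_cat (trg F)) (farr F)
     (\<lambda>a. Sq (farr F (sdom a)) (farr F (scod a)) (farr F (sfst a)) (farr F (ssnd a)))"

definition arrow_cell :: "'a univ ntrans \<Rightarrow> 'a univ ntrans" where
  "arrow_cell \<tau> = (let F = src \<tau>; G = trg \<tau>; E = src F in
     mk_ntrans (arrow_map F) (arrow_map G)
       (\<lambda>f. Sq (farr F f) (farr G f) (body \<tau> (cdom E f)) (body \<tau> (ccod E f))))"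

definition arrow_unit :: "'a univ cat \<Rightarrow> 'a univ func" where
  "arrow_unit E = mk_functor E (arrow_cat E) (ide E)
     (\<lambda>f. Sq (ide E (cdom E f)) (ide E (ccod E f)) f f)"

definition arrow_mult :: "'a univ cat \<Rightarrow> 'a univ func" where
  "arrow_mult E = (let d = (\<lambda>a. ssnd a \<cdot>\<^bsub>E\<^esub> sdom a) in
     mk_functor (arrow_cat (arrow_cat E)) (arrow_cat E) d
       (\<lambda>c. Sq (d (sdom c)) (d (scod c)) (sfst (sfst c)) (ssnd (ssnd c))))"

definition Squaring :: "('a univ cat, ('a univ \<Rightarrow> 'a univ) \<times> ('a univ \<Rightarrow> 'a univ), 'a univ \<Rightarrow> 'a univ) monad" where
  "Squaring = \<lparr>fn = \<lparr>F0 = arrow_cat, F1 = arrow_map, F2 = arrow_cell\<rparr>,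
     eta = arrow_unit, mu = arrow_mult\<rparr>"

text \<open>The components of the transformation along which scalars are restricted.\<close>

definition kap :: "'a univ func \<Rightarrow> 'a univ func" where
  "kap P = (let E = src P; k = (\<lambda>f. Pair (cdom E f) (farr P f)) in
     mk_functor (arrow_cat E) (comma P) k
       (\<lambda>a. Sq (k (sdom a)) (k (scod a)) (sfst a) (farr P (ssnd a))))"

section \<open>The algebra of a cloven cofibration\<close>

definition lift_functor :: "'a univ func \<Rightarrow> 'a univ clv \<Rightarrow> 'a univ func" where
  "lift_functor P \<delta> = (let E = src P; d = (\<lambda>X. \<delta> (pfst X) (psnd X)) in
     mk_functor (comma P) E (\<lambda>X. ccod E (d X))
       (\<lambda>a. THE h. h \<in> hom E (ccod E (d (sdom a))) (ccod E (d (scod a))) \<and>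
          farr P h = ssnd a \<and> h \<cdot>\<^bsub>E\<^esub> d (sdom a) = d (scod a) \<cdot>\<^bsub>E\<^esub> sfst a))"

definition lift_act :: "'a univ func \<Rightarrow> 'a univ clv \<Rightarrow> 'a univ square" where
  "lift_act P \<delta> = Cell (comma_cod P) P (lift_functor P \<delta>, id_functor (trg P))"

definition lift_mult :: "'k rel \<Rightarrow> 'a univ func \<Rightarrow> 'a univ clv \<Rightarrow> 'a univ square2" where
  "lift_mult \<kappa> P \<delta> =
    (let E = src P; B = trg P; a = lift_act P \<delta>;
         F = a \<odot>\<^bsub>CAT2 \<kappa>\<^esub> comma_sq a; G = a \<odot>\<^bsub>CAT2 \<kappa>\<^esub> comma_mult P
     in Cell F G (mk_ntrans (fst (body F)) (fst (body G))
          (\<lambda>X. let x = pfst (pfst X); u = psnd (pfst X); v = psnd X; y = push_obj P \<delta> u x in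
             THE h. h \<in> hom E (push_obj P \<delta> v y) (push_obj P \<delta> (v \<cdot>\<^bsub>B\<^esub> u) x) \<and> h \<in> vert P \<and>
               h \<cdot>\<^bsub>E\<^esub> (\<delta> y v \<cdot>\<^bsub>E\<^esub> \<delta> x u) = \<delta> x (v \<cdot>\<^bsub>B\<^esub> u)),
        id_ntrans (id_functor B)))"

definition lift_unit :: "'k rel \<Rightarrow> 'a univ func \<Rightarrow> 'a univ clv \<Rightarrow> 'a univ square2" where
  "lift_unit \<kappa> P \<delta> =
    (let F = id1 (CAT2 \<kappa>) P; G = lift_act P \<delta> \<odot>\<^bsub>CAT2 \<kappa>\<^esub> comma_unit P
     in Cell F G (mk_ntrans (fst (body F)) (fst (body G)) (\<lambda>x. \<delta> x (ide (trg P) (fobj P x))),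
        id_ntrans (id_functor (trg P))))"

text \<open>The pseudoalgebra over a fixed base of an arbitrary cleavage.\<close>

definition cloven_algebra :: "'k rel \<Rightarrow> 'a univ func \<Rightarrow> 'a univ clv \<Rightarrow>
    ('a univ func, 'a univ func \<times> 'a univ func, 'a univ ntrans \<times> 'a univ ntrans) psalg" where
  "cloven_algebra \<kappa> P \<delta> = PsAlg P (lift_act P \<delta>) (lift_unit \<kappa> P \<delta>) (lift_mult \<kappa> P \<delta>)"

definition Gamma ::
  "('a univ func \<times> 'a univ clv, 'a univ square, 'a univ square2,
    'a univ func \<times> 'a univ square, 'a univ square, 'a univ square2) two_fun" where
  "Gamma =
    (let g0 = (\<lambda>(P, \<delta>). (P, lift_act P \<delta>));
         g1 = (\<lambda>F. Cell (g0 (src F)) (g0 (trg F)) (body F))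
     in \<lparr>F0 = g0, F1 = g1, F2 = \<lambda>\<alpha>. Cell (g1 (src \<alpha>)) (g1 (trg \<alpha>)) (body \<alpha>)\<rparr>)"

text \<open>The structure cell of a square \<open>(T, S)\<close> has as component at \<open>(x, u)\<close> the vertical comparison
  \<open>(S u)\<^sub>! (T x) \<rightarrow> T (u\<^sub>! x)\<close>.\<close>

definition comparison :: "'k rel \<Rightarrow> ('a univ func \<times> 'a univ clv, 'a univ square) cell \<Rightarrow> 'a univ square2" where
  "comparison \<kappa> M =
    (let (P, \<delta>) = src M; (Q, \<delta>') = trg M; (T, S) = body (body M);
         F = lift_act Q \<delta>' \<odot>\<^bsub>CAT2 \<kappa>\<^esub> comma_sq (body M);
         G = body M \<odot>\<^bsub>CAT2 \<kappa>\<^esub> lift_act P \<delta>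
     in Cell F G (mk_ntrans (fst (body F)) (fst (body G))
          (\<lambda>X. let x = pfst X; u = psnd X; y = fobj T x; w = farr S u in
             THE h. h \<in> hom (src Q) (push_obj Q \<delta>' w y) (fobj T (push_obj P \<delta> u x)) \<and> h \<in> vert Q \<and>
               h \<cdot>\<^bsub>src Q\<^esub> \<delta>' y w = farr T (\<delta> x u)),
        id_ntrans S))"

definition Gamma_n :: "'k rel \<Rightarrow>
   ('a univ func \<times> 'a univ clv, 'a univ square, 'a univ square2,
    ('a univ func, 'a univ func \<times> 'a univ func, 'a univ ntrans \<times> 'a univ ntrans) psalg,
    'a univ square \<times> 'a univ square2, 'a univ square2) two_fun" where
  "Gamma_n \<kappa> =
    (let g0 = (\<lambda>(P, \<delta>). PsAlg P (lift_act P \<delta>) (id2 (CAT2 \<kappa>) (id1 (CAT2 \<kappa>) P)) (lift_mult \<kappa> P \<delta>));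
         g1 = (\<lambda>M. Cell (g0 (src M)) (g0 (trg M)) (body M, comparison \<kappa> M))
     in \<lparr>F0 = g0, F1 = g1, F2 = \<lambda>\<alpha>. Cell (g1 (src \<alpha>)) (g1 (trg \<alpha>)) (body \<alpha>)\<rparr>)"

section \<open>Factorization systems\<close>

definition iso_closed :: "'u cat \<Rightarrow> 'u set \<Rightarrow> bool" where
  "iso_closed C L \<longleftrightarrow> (\<forall>f \<in> L. \<forall>i. invertible C i \<longrightarrow>
     (cdom C i = ccod C f \<longrightarrow> i \<cdot>\<^bsub>C\<^esub> f \<in> L) \<and> (ccod C i = cdom C f \<longrightarrow> f \<cdot>\<^bsub>C\<^esub> i \<in> L))"

definition orthogonal_fs :: "'u cat \<Rightarrow> 'u set \<Rightarrow> 'u set \<Rightarrow> bool" where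
  "orthogonal_fs C L R \<longleftrightarrow> L \<subseteq> Arr C \<and> R \<subseteq> Arr C \<and> iso_closed C L \<and> iso_closed C R \<and>
     (\<forall>f \<in> Arr C. \<exists>e \<in> L. \<exists>m \<in> R. ccod C e = cdom C m \<and> f = m \<cdot>\<^bsub>C\<^esub> e) \<and>
     (\<forall>e \<in> L. \<forall>m \<in> R. \<forall>r \<in> hom C (cdom C e) (cdom C m). \<forall>s \<in> hom C (ccod C e) (ccod C m).
        s \<cdot>\<^bsub>C\<^esub> e = m \<cdot>\<^bsub>C\<^esub> r \<longrightarrow>
        (\<exists>!d. d \<in> hom C (ccod C e) (cdom C m) \<and> d \<cdot>\<^bsub>C\<^esub> e = r \<and> m \<cdot>\<^bsub>C\<^esub> d = s))"

definition wide_subcategory :: "'u cat \<Rightarrow> 'u set \<Rightarrow> bool" where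
  "wide_subcategory C W \<longleftrightarrow> W \<subseteq> Arr C \<and> (\<forall>x \<in> Obj C. ide C x \<in> W) \<and>
     (\<forall>f \<in> W. \<forall>g \<in> W. ccod C f = cdom C g \<longrightarrow> g \<cdot>\<^bsub>C\<^esub> f \<in> W)"

definition strict_fs :: "'u cat \<Rightarrow> 'u set \<Rightarrow> 'u set \<Rightarrow> bool" where
  "strict_fs C L R \<longleftrightarrow> wide_subcategory C L \<and> wide_subcategory C R \<and>
     (\<forall>f \<in> Arr C. \<exists>!p. fst p \<in> L \<and> snd p \<in> R \<and> ccod C (fst p) = cdom C (snd p) \<and>
        f = snd p \<cdot>\<^bsub>C\<^esub> fst p)"

text \<open>The factors selected by a pseudoalgebra of the squaring 2-monad.\<close>

type_synonym 'u sq_alg = "('u cat, ('u \<Rightarrow> 'u) \<times> ('u \<Rightarrow> 'u), 'u \<Rightarrow> 'u) psalg"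

definition e_part :: "'a univ sq_alg \<Rightarrow> 'a univ \<Rightarrow> 'a univ" where
  "e_part A f = (let E = und A; x = cdom E f in
     farr (act A) (Sq (ide E x) f (ide E x) f) \<cdot>\<^bsub>E\<^esub> body (ps_unit A) x)"

definition m_part :: "'a univ sq_alg \<Rightarrow> 'a univ \<Rightarrow> 'a univ" where
  "m_part A f = (let E = und A; y = ccod E f in
     inv_arrow E (body (ps_unit A) y) \<cdot>\<^bsub>E\<^esub> farr (act A) (Sq f (ide E y) f (ide E y)))"

definition left_class :: "'a univ sq_alg \<Rightarrow> 'a univ set" where
  "left_class A = {f \<in> Arr (und A). invertible (und A) (m_part A f)}"

definition right_class :: "'a univ sq_alg \<Rightarrow> 'a univ set" where
  "right_class A = {f \<in> Arr (und A). invertible (und A) (e_part A f)}"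

definition strict_left_class :: "'a univ sq_alg \<Rightarrow> 'a univ set" where
  "strict_left_class A = {f \<in> Arr (und A). is_ide (und A) (m_part A f)}"

definition strict_right_class :: "'a univ sq_alg \<Rightarrow> 'a univ set" where
  "strict_right_class A = {f \<in> Arr (und A). is_ide (und A) (e_part A f)}"

abbreviation "kap_s \<kappa> \<equiv> restrict_s (CAT \<kappa>) Dom kap"
abbreviation "kap_ps \<kappa> \<equiv> restrict_ps Comma (CAT \<kappa>) Squaring Dom kap"

end

theory Submission
  imports Defs
begin

text \<open>
  Let \<open>L\<close> be the functor underlying a normal action of the comma 2-monad on \<open>P\<close>. The unit law says
  \<open>L (x, 1) = x\<close>, so the arrow \<open>(1, u) : (x, 1) \<rightarrow> (x, u)\<close> is sent to an arrow \<open>\<delta> x u\<close> over \<open>u\<close>, and naturality of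
  the multiplication cell makes this arrow cocartesian. The action and its multiplication cell are then forced
  by the universal property of these lifts. In the same way the structure cell of a pseudomorphism can only be
  the comparison cell, which is invertible exactly if cocartesian arrows are preserved; so the 2-functoriality
  of \<open>Gamma_n\<close> is inherited from the composition of pseudomorphisms. The strict case is the one in which all
  vertical comparison arrows are identities. Finally \<open>kap\<close> sends \<open>f\<close> to \<open>(x, P f)\<close>, whence the selected factorization
  of \<open>f\<close> is the lift of \<open>P f\<close> followed by a vertical arrow, which is invertible iff \<open>f\<close> is cocartesian.\<close>

section \<open>Calculus in strict 2-categories\<close>

text \<open>The isomorphisms are strict, so nothing may be chosen up to isomorphism. Functors,
  transformations and cleavages are \<open>undefined\<close> off their domains, hence equal once
  they agree where they mean something. Uniqueness in the universal property of the lifts is the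
  delicate point. For a normal algebra \<chi> is an identity whenever one of its two base arrows is.
  Naturality of \<chi> at the arrow ((1, u), 1) from ((x, 1), u) to ((x, u), 1) then gives a
  triangle identity exhibiting the action as left adjoint to the unit functor, and uniqueness
  follows. Working over all bases also raises the question of the base components. For normal
  algebras the unit laws force them to be identities, in the action, in \<chi> and in the structure
  cells of pseudomorphisms. An arbitrary cleavage is treated in the slice, where the base components
  are identities by definition. Smallness enters once: a product of two sets below an infinite
  cardinal stays below it, so comma and arrow categories are again locally small.\<close>

lemma mem_hom1: "f \<in> hom1 K X Y \<longleftrightarrow> f \<in> Cell1 K \<and> src f = X \<and> trg f = Y"
  by (simp add: hom1_def)

lemma mem_hom2: "\<alpha> \<in> hom2 K f g \<longleftrightarrow> \<alpha> \<in> Cell2 K \<and> src \<alpha> = f \<and> trg \<alpha> = g"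
  by (simp add: hom2_def)

text \<open>With \<open>K\<close> declared as a structure, composition needs no index.\<close>

locale two_category = strict_2category K for K (structure)

sublocale strict_2category \<subseteq> two_category
  by unfold_locales

context two_category
begin

lemma ends1 [simp]: "f \<in> Cell1 K ==> src f \<in> Ob K" "f \<in> Cell1 K ==> trg f \<in> Ob K"
  using cell1_ends by auto

lemma id1_cell [simp]:
  assumes "X \<in> Ob K"
  shows "id1 K X \<in> Cell1 K" "src (id1 K X) = X" "trg (id1 K X) = X"
  using id1_in[OF assms] by (auto simp: mem_hom1)

lemma comp1_cell [simp]:
  assumes "f \<in> Cell1 K" "g \<in> Cell1 K" "trg f = src g"
  shows "g \<odot> f \<in> Cell1 K" "src (g \<odot> f) = src f" "trg (g \<odot> f) = trg g"
  using comp1_in[of f "src f" "trg f" g "trg g"] assms by (auto simp: mem_hom1)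

lemma comp1_unit [simp]:
  "[|f \<in> Cell1 K; src f = X|] ==> f \<odot> id1 K X = f"
  "[|f \<in> Cell1 K; trg f = X|] ==> id1 K X \<odot> f = f"
  using comp1_id1[of f "src f" "trg f"] id1_comp1[of f "src f" "trg f"] by (auto simp: mem_hom1)

text \<open>As a rewrite rule this brings composites into left-nested form. A law about a twofold
  composite then no longer matches inside a longer one, which is why many laws below come with an
  \<open>_assoc\<close> variant carrying a leading factor \<open>g\<close>.\<close>

lemma comp1_assoc' [simp]:
  "[|f \<in> Cell1 K; g \<in> Cell1 K; h \<in> Cell1 K; trg f = src g; trg g = src h|]
    ==> h \<odot> (g \<odot> f) = h \<odot> g \<odot> f"
  using comp1_assoc[of f "src f" "trg f" g "trg g" h "trg h"] by (auto simp: mem_hom1)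

lemma ends2 [simp]:
  assumes "\<alpha> \<in> Cell2 K"
  shows "src \<alpha> \<in> Cell1 K" "trg \<alpha> \<in> Cell1 K" "src (trg \<alpha>) = src (src \<alpha>)" "trg (trg \<alpha>) = trg (src \<alpha>)"
  using cell2_ends[OF assms] by (auto simp: parallel_def)

lemma id2_cell [simp]:
  assumes "f \<in> Cell1 K"
  shows "id2 K f \<in> Cell2 K" "src (id2 K f) = f" "trg (id2 K f) = f"
  using id2_in[OF assms] by (auto simp: mem_hom2)

lemma vcomp_cell [simp]:
  assumes "\<alpha> \<in> Cell2 K" "\<beta> \<in> Cell2 K" "trg \<alpha> = src \<beta>"
  shows "\<beta> \<bullet> \<alpha> \<in> Cell2 K" "src (\<beta> \<bullet> \<alpha>) = src \<alpha>" "trg (\<beta> \<bullet> \<alpha>) = trg \<beta>"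
  using vcomp_in[of \<alpha> "src \<alpha>" "trg \<alpha>" \<beta> "trg \<beta>"] assms by (auto simp: mem_hom2)

lemma hcomp_cell [simp]:
  assumes "\<alpha> \<in> Cell2 K" "\<beta> \<in> Cell2 K" "trg (src \<alpha>) = src (src \<beta>)"
  shows "\<beta> \<star> \<alpha> \<in> Cell2 K" "src (\<beta> \<star> \<alpha>) = src \<beta> \<odot> src \<alpha>"
    "trg (\<beta> \<star> \<alpha>) = trg \<beta> \<odot> trg \<alpha>"
  using hcomp_in[of \<alpha> "src \<alpha>" "trg \<alpha>" \<beta> "src \<beta>" "trg \<beta>"] assms by (auto simp: mem_hom2)

lemma vcomp_unit [simp]:
  "[|\<alpha> \<in> Cell2 K; src \<alpha> = f|] ==> \<alpha> \<bullet> id2 K f = \<alpha>"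
  "[|\<alpha> \<in> Cell2 K; trg \<alpha> = f|] ==> id2 K f \<bullet> \<alpha> = \<alpha>"
  using vcomp_id2[of \<alpha> "src \<alpha>" "trg \<alpha>"] id2_vcomp[of \<alpha> "src \<alpha>" "trg \<alpha>"] by (auto simp: mem_hom2)

lemma vcomp_assoc' [simp]:
  "[|\<alpha> \<in> Cell2 K; \<beta> \<in> Cell2 K; \<gamma> \<in> Cell2 K; trg \<alpha> = src \<beta>; trg \<beta> = src \<gamma>|]
    ==> \<gamma> \<bullet> (\<beta> \<bullet> \<alpha>) = \<gamma> \<bullet> \<beta> \<bullet> \<alpha>"
  using vcomp_assoc[of \<alpha> "src \<alpha>" "trg \<alpha>" \<beta> "trg \<beta>" \<gamma> "trg \<gamma>"] by (auto simp: mem_hom2)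

lemma hcomp_unit [simp]:
  "[|\<alpha> \<in> Cell2 K; src (src \<alpha>) = X|] ==> \<alpha> \<lhd> id1 K X = \<alpha>"
  "[|\<alpha> \<in> Cell2 K; trg (src \<alpha>) = X|] ==> id1 K X \<rhd> \<alpha> = \<alpha>"
  using hcomp_id[of \<alpha> "src \<alpha>" "trg \<alpha>" "src (src \<alpha>)" "trg (src \<alpha>)"] by (auto simp: mem_hom2)

lemma hcomp_assoc' [simp]:
  "[|\<alpha> \<in> Cell2 K; \<beta> \<in> Cell2 K; \<gamma> \<in> Cell2 K; trg (src \<alpha>) = src (src \<beta>); trg (src \<beta>) = src (src \<gamma>)|]
    ==> \<gamma> \<star> (\<beta> \<star> \<alpha>) = \<gamma> \<star> \<beta> \<star> \<alpha>"
  using hcomp_assoc[of \<alpha> "src \<alpha>" "trg \<alpha>" \<beta> "src \<beta>" "trg \<beta>" \<gamma> "src \<gamma>" "trg \<gamma>"] by (auto simp: mem_hom2)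

lemma hcomp_id2' [simp]:
  "[|f \<in> Cell1 K; g \<in> Cell1 K; trg f = src g|] ==> id2 K g \<star> id2 K f = id2 K (g \<odot> f)"
  using hcomp_id2[of f "src f" "trg f" g "trg g"] by (auto simp: mem_hom1)

text \<open>In left-nested form two left whiskerings put their identities side by side and are
  merged by \<open>hcomp_id2'\<close>. Two right whiskerings never do, so they have a rule of their
  own.\<close>

lemma rwhisker_comp1 [simp]:
  "[|\<alpha> \<in> Cell2 K; f \<in> Cell1 K; g \<in> Cell1 K; trg f = src g; trg g = src (src \<alpha>)|]
    ==> \<alpha> \<lhd> g \<lhd> f = \<alpha> \<lhd> (g \<odot> f)"
  using hcomp_assoc'[of "id2 K f" "id2 K g" \<alpha>] by simp

lemma interchange':
  "[|\<alpha> \<in> Cell2 K; \<alpha>' \<in> Cell2 K; \<beta> \<in> Cell2 K; \<beta>' \<in> Cell2 K; trg \<alpha> = src \<alpha>'; trg \<beta> = src \<beta>';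
     trg (src \<alpha>) = src (src \<beta>)|]
   ==> (\<beta>' \<bullet> \<beta>) \<star> (\<alpha>' \<bullet> \<alpha>) = (\<beta>' \<star> \<alpha>') \<bullet> (\<beta> \<star> \<alpha>)"
  using interchange[of \<alpha> "src \<alpha>" "trg \<alpha>" \<alpha>' "trg \<alpha>'" \<beta> "src \<beta>" "trg \<beta>" \<beta>' "trg \<beta>'"]
  by (auto simp: mem_hom2)

lemma whisker_vcomp [simp]:
  "[|\<alpha> \<in> Cell2 K; \<beta> \<in> Cell2 K; g \<in> Cell1 K; trg \<alpha> = src \<beta>; trg (src \<alpha>) = src g|]
    ==> g \<rhd> (\<beta> \<bullet> \<alpha>) = (g \<rhd> \<beta>) \<bullet> (g \<rhd> \<alpha>)"
  "[|\<alpha> \<in> Cell2 K; \<beta> \<in> Cell2 K; f \<in> Cell1 K; trg \<alpha> = src \<beta>; src (src \<alpha>) = trg f|]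
    ==> (\<beta> \<bullet> \<alpha>) \<lhd> f = (\<beta> \<lhd> f) \<bullet> (\<alpha> \<lhd> f)"
  using interchange'[of \<alpha> \<beta> "id2 K g" "id2 K g"] interchange'[of "id2 K f" "id2 K f" \<alpha> \<beta>] by simp_all

text \<open>Interchange with identities inserted on either side. Equating the two factorizations
  slides one 2-cell past the other; this is how cells are reordered when pseudomorphisms and
  transformations are composed.\<close>

lemma exchange:
  assumes "\<alpha> \<in> Cell2 K" "\<beta> \<in> Cell2 K" "trg (src \<alpha>) = src (src \<beta>)"
  shows "(trg \<beta> \<rhd> \<alpha>) \<bullet> (\<beta> \<lhd> src \<alpha>) = \<beta> \<star> \<alpha>"
    "(\<beta> \<lhd> trg \<alpha>) \<bullet> (src \<beta> \<rhd> \<alpha>) = \<beta> \<star> \<alpha>"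
  using interchange'[of "id2 K (src \<alpha>)" \<alpha> \<beta> "id2 K (trg \<beta>)"]
    interchange'[of \<alpha> "id2 K (trg \<alpha>)" "id2 K (src \<beta>)" \<beta>] assms by simp_all

lemma invertible2_id2 [simp]: "f \<in> Cell1 K ==> invertible2 K (id2 K f)"
  unfolding invertible2_def by (auto simp: mem_hom2 intro!: bexI[of _ "id2 K f"])

lemma invertible2_vcomp:
  assumes "invertible2 K \<alpha>" "invertible2 K \<beta>" "trg \<alpha> = src \<beta>"
  shows "invertible2 K (\<beta> \<bullet> \<alpha>)"
proof -
  from assms obtain a b where a: "a \<in> hom2 K (trg \<alpha>) (src \<alpha>)" "a \<bullet> \<alpha> = id2 K (src \<alpha>)"
      "\<alpha> \<bullet> a = id2 K (trg \<alpha>)"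
    and b: "b \<in> hom2 K (trg \<beta>) (src \<beta>)" "b \<bullet> \<beta> = id2 K (src \<beta>)" "\<beta> \<bullet> b = id2 K (trg \<beta>)"
    and cells: "\<alpha> \<in> Cell2 K" "\<beta> \<in> Cell2 K"
    unfolding invertible2_def by auto
  have "a \<bullet> b \<bullet> (\<beta> \<bullet> \<alpha>) = a \<bullet> (b \<bullet> \<beta>) \<bullet> \<alpha>"
    using a(1) b(1) cells assms(3) by (simp add: mem_hom2 del: vcomp_unit)
  moreover have "\<beta> \<bullet> \<alpha> \<bullet> (a \<bullet> b) = \<beta> \<bullet> (\<alpha> \<bullet> a) \<bullet> b"
    using a(1) b(1) cells assms(3) by (simp add: mem_hom2 del: vcomp_unit)
  ultimately show ?thesis
    using a b cells assms(3) unfolding invertible2_def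
    by (auto simp: mem_hom2 intro!: bexI[of _ "a \<bullet> b"])
qed

lemma invertible2_hcomp:
  assumes "invertible2 K \<alpha>" "invertible2 K \<beta>" "trg (src \<alpha>) = src (src \<beta>)"
  shows "invertible2 K (\<beta> \<star> \<alpha>)"
proof -
  from assms obtain a b where a: "a \<in> hom2 K (trg \<alpha>) (src \<alpha>)" "a \<bullet> \<alpha> = id2 K (src \<alpha>)"
      "\<alpha> \<bullet> a = id2 K (trg \<alpha>)"
    and b: "b \<in> hom2 K (trg \<beta>) (src \<beta>)" "b \<bullet> \<beta> = id2 K (src \<beta>)" "\<beta> \<bullet> b = id2 K (trg \<beta>)"
    and cells: "\<alpha> \<in> Cell2 K" "\<beta> \<in> Cell2 K"
    unfolding invertible2_def by auto
  have "(b \<star> a) \<bullet> (\<beta> \<star> \<alpha>) = (b \<bullet> \<beta>) \<star> (a \<bullet> \<alpha>)"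
    using a(1) b(1) cells assms(3) by (subst interchange') (simp_all add: mem_hom2)
  moreover have "(\<beta> \<star> \<alpha>) \<bullet> (b \<star> a) = (\<beta> \<bullet> b) \<star> (\<alpha> \<bullet> a)"
    using a(1) b(1) cells assms(3) by (subst interchange') (simp_all add: mem_hom2)
  ultimately show ?thesis
    using a b cells assms(3) unfolding invertible2_def
    by (auto simp: mem_hom2 intro!: bexI[of _ "b \<star> a"])
qed

end

section \<open>2-functors, 2-natural transformations and isomorphisms of 2-categories\<close>

lemma comp_2fun_simps [simp]:
  "F0 (G \<circ>\<circ> F) X = F0 G (F0 F X)" "F1 (G \<circ>\<circ> F) f = F1 G (F1 F f)" "F2 (G \<circ>\<circ> F) \<alpha> = F2 G (F2 F \<alpha>)"
  by (simp_all add: comp_2fun_def)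

lemma id_2fun_simps [simp]: "F0 id_2fun X = X" "F1 id_2fun f = f" "F2 id_2fun \<alpha> = \<alpha>"
  by (simp_all add: id_2fun_def)

lemma strict_2functor_id: "strict_2category K ==> strict_2functor K K id_2fun"
  by (simp add: strict_2functor_def strict_2functor_axioms_def)

context strict_2functor
begin

lemma F0_cell [simp]: "X \<in> Ob K ==> F0 F X \<in> Ob L"
  by (rule F0_in)

lemma F1_cell [simp]:
  assumes "f \<in> Cell1 K"
  shows "F1 F f \<in> Cell1 L" "src (F1 F f) = F0 F (src f)" "trg (F1 F f) = F0 F (trg f)"
  using F1_in[of f "src f" "trg f"] assms by (auto simp: mem_hom1)

lemma F2_cell [simp]:
  assumes "\<alpha> \<in> Cell2 K"
  shows "F2 F \<alpha> \<in> Cell2 L" "src (F2 F \<alpha>) = F1 F (src \<alpha>)" "trg (F2 F \<alpha>) = F1 F (trg \<alpha>)"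
  using F2_in[of \<alpha> "src \<alpha>" "trg \<alpha>"] assms by (auto simp: mem_hom2)

lemma F_id [simp]:
  "X \<in> Ob K ==> F1 F (id1 K X) = id1 L (F0 F X)"
  "f \<in> Cell1 K ==> F2 F (id2 K f) = id2 L (F1 F f)"
  by (fact F1_id1 F2_id2)+

lemma F_comp [simp]:
  "[|f \<in> Cell1 K; g \<in> Cell1 K; trg f = src g|] ==> F1 F (g \<odot>\<^bsub>K\<^esub> f) = F1 F g \<odot>\<^bsub>L\<^esub> F1 F f"
  "[|\<alpha> \<in> Cell2 K; \<beta> \<in> Cell2 K; trg \<alpha> = src \<beta>|] ==> F2 F (\<beta> \<bullet>\<^bsub>K\<^esub> \<alpha>) = F2 F \<beta> \<bullet>\<^bsub>L\<^esub> F2 F \<alpha>"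
  "[|\<alpha> \<in> Cell2 K; \<beta> \<in> Cell2 K; trg (src \<alpha>) = src (src \<beta>)|]
    ==> F2 F (\<beta> \<star>\<^bsub>K\<^esub> \<alpha>) = F2 F \<beta> \<star>\<^bsub>L\<^esub> F2 F \<alpha>"
  using F1_comp1[of f "src f" "trg f" g "trg g"] F2_vcomp[of \<alpha> "src \<alpha>" "trg \<alpha>" \<beta> "trg \<beta>"]
    F2_hcomp[of \<alpha> "src \<alpha>" "trg \<alpha>" \<beta> "src \<beta>" "trg \<beta>"]
  by (auto simp: mem_hom1 mem_hom2)

lemma F_invertible2:
  assumes "invertible2 K \<alpha>"
  shows "invertible2 L (F2 F \<alpha>)"
proof -
  from assms obtain a where a: "\<alpha> \<in> Cell2 K" "a \<in> hom2 K (trg \<alpha>) (src \<alpha>)" "a \<bullet>\<^bsub>K\<^esub> \<alpha> = id2 K (src \<alpha>)"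
      "\<alpha> \<bullet>\<^bsub>K\<^esub> a = id2 K (trg \<alpha>)"
    unfolding invertible2_def by auto
  then show ?thesis
    unfolding invertible2_def
    by (auto simp: mem_hom2 F_comp(2)[symmetric] simp del: F_comp intro!: bexI[of _ "F2 F a"])
qed

end

lemma strict_2functor_comp:
  assumes "strict_2functor K L F" "strict_2functor L M G"
  shows "strict_2functor K M (G \<circ>\<circ> F)"
proof -
  interpret F: strict_2functor K L F by fact
  interpret G: strict_2functor L M G by fact
  show ?thesis
    by unfold_locales (auto simp: mem_hom1 mem_hom2)
qed

context two_natural
begin

lemma lam_cell [simp]:
  assumes "X \<in> Ob K"
  shows "lam X \<in> Cell1 L" "src (lam X) = F0 F X" "trg (lam X) = F0 G X"
  using lam_in[OF assms] by (auto simp: mem_hom1)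

text \<open>The axiom turned around: as a rewrite rule it moves the components of \<open>lam\<close>
  to the right, towards the source.\<close>

lemma nat1:
  "[|f \<in> Cell1 K; src f = X; trg f = Y|] ==> lam Y \<odot>\<^bsub>L\<^esub> F1 F f = F1 G f \<odot>\<^bsub>L\<^esub> lam X"
  using lam_natural1[of f "src f" "trg f"] by (auto simp: mem_hom1)

lemma nat2:
  "[|\<alpha> \<in> Cell2 K; src (src \<alpha>) = X; trg (src \<alpha>) = Y|]
    ==> lam Y \<rhd>\<^bsub>L\<^esub> F2 F \<alpha> = F2 G \<alpha> \<lhd>\<^bsub>L\<^esub> lam X"
  using lam_natural2[of \<alpha> "src \<alpha>" "trg \<alpha>"] by (auto simp: mem_hom2)

lemma nat1_assoc:
  assumes "f \<in> Cell1 K" "src f = X" "trg f = Y" "g \<in> Cell1 L" "src g = F0 G Y"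
  shows "g \<odot>\<^bsub>L\<^esub> lam Y \<odot>\<^bsub>L\<^esub> F1 F f = g \<odot>\<^bsub>L\<^esub> F1 G f \<odot>\<^bsub>L\<^esub> lam X"
proof -
  have "X \<in> Ob K" "Y \<in> Ob K"
    using assms by auto
  then show ?thesis
    using assms nat1[of f X Y] dom.cod.comp1_assoc'[of "F1 F f" "lam Y" g]
      dom.cod.comp1_assoc'[of "lam X" "F1 G f" g] by simp
qed

lemma nat2_assoc:
  assumes "\<alpha> \<in> Cell2 K" "src (src \<alpha>) = X" "trg (src \<alpha>) = Y" "g \<in> Cell1 L" "src g = F0 G Y"
  shows "(g \<odot>\<^bsub>L\<^esub> lam Y) \<rhd>\<^bsub>L\<^esub> F2 F \<alpha> = g \<rhd>\<^bsub>L\<^esub> F2 G \<alpha> \<lhd>\<^bsub>L\<^esub> lam X"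
proof -
  have "X \<in> Ob K" "Y \<in> Ob K"
    using assms by auto
  then show ?thesis
    using assms nat2[of \<alpha> X Y] dom.cod.hcomp_assoc'[of "F2 F \<alpha>" "id2 L (lam Y)" "id2 L g"]
      dom.cod.hcomp_assoc'[of "id2 L (lam X)" "F2 G \<alpha>" "id2 L g"] by simp
qed

end

text \<open>The inverse consists of the three inverse functions, and each law is transported along
  \<open>F\<close>. The one point with content is that preimages of composable cells are composable;
  it follows from injectivity in a lower dimension.\<close>

lemma iso_2catI:
  assumes "strict_2functor K L F" "bij_betw (F0 F) (Ob K) (Ob L)"
    "bij_betw (F1 F) (Cell1 K) (Cell1 L)" "bij_betw (F2 F) (Cell2 K) (Cell2 L)"
  shows "iso_2cat K L F"
proof -
  interpret F: strict_2functor K L F by fact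
  let ?a = "inv_into (Ob K) (F0 F)" and ?b = "inv_into (Cell1 K) (F1 F)" and ?c = "inv_into (Cell2 K) (F2 F)"
  have a [simp]: "\<And>X. X \<in> Ob K ==> ?a (F0 F X) = X"
    and b [simp]: "\<And>f. f \<in> Cell1 K ==> ?b (F1 F f) = f"
    and c [simp]: "\<And>\<alpha>. \<alpha> \<in> Cell2 K ==> ?c (F2 F \<alpha>) = \<alpha>"
    using assms by (auto simp: bij_betw_def)
  have A: "\<And>X. X \<in> Ob L ==> \<exists>X'\<in>Ob K. X = F0 F X'"
    and B: "\<And>f. f \<in> Cell1 L ==> \<exists>f'\<in>Cell1 K. f = F1 F f'"
    and C: "\<And>\<alpha>. \<alpha> \<in> Cell2 L ==> \<exists>\<alpha>'\<in>Cell2 K. \<alpha> = F2 F \<alpha>'"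
    using assms by (auto simp: bij_betw_def)
  have inj: "\<And>X Y. X \<in> Ob K ==> Y \<in> Ob K ==> F0 F X = F0 F Y ==> X = Y"
    "\<And>f g. f \<in> Cell1 K ==> g \<in> Cell1 K ==> F1 F f = F1 F g ==> f = g"
    by (metis a, metis b)
  define G where "G = \<lparr>F0 = ?a, F1 = ?b, F2 = ?c\<rparr>"
  have G [simp]: "F0 G = ?a" "F1 G = ?b" "F2 G = ?c"
    by (simp_all add: G_def)
  have "strict_2functor L K G"
  proof
    fix X assume "X \<in> Ob L"
    then obtain X' where "X' \<in> Ob K" "X = F0 F X'" using A by blast
    then show "F0 G X \<in> Ob K" "F1 G (id1 L X) = id1 K (F0 G X)"
      by (simp_all del: F.F_id add: F.F1_id1[symmetric])
  next
    fix f X Y assume "f \<in> hom1 L X Y"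
    then obtain f' where "f' \<in> Cell1 K" "f = F1 F f'" "X = src f" "Y = trg f" using B[of f] by (auto simp: mem_hom1)
    then show "F1 G f \<in> hom1 K (F0 G X) (F0 G Y)" by (auto simp: mem_hom1)
  next
    fix \<alpha> f g assume "\<alpha> \<in> hom2 L f g"
    then obtain a' where "a' \<in> Cell2 K" "\<alpha> = F2 F a'" "f = src \<alpha>" "g = trg \<alpha>" using C[of \<alpha>] by (auto simp: mem_hom2)
    then show "F2 G \<alpha> \<in> hom2 K (F1 G f) (F1 G g)" by (auto simp: mem_hom2)
  next
    fix f X Y g Z assume "f \<in> hom1 L X Y" "g \<in> hom1 L Y Z"
    then obtain f' g' where fg: "f' \<in> Cell1 K" "f = F1 F f'" "g' \<in> Cell1 K" "g = F1 F g'" "trg f = src g"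
      using B[of f] B[of g] by (auto simp: mem_hom1)
    \<comment> \<open>Only the images are known to be composable; injectivity on objects gives
      composability of the preimages.\<close>
    then have "trg f' = src g'"
      using inj(1) by simp
    with fg have "F1 G (F1 F (g' \<odot>\<^bsub>K\<^esub> f')) = F1 G g \<odot>\<^bsub>K\<^esub> F1 G f" by (simp del: F.F_comp)
    then show "F1 G (g \<odot>\<^bsub>L\<^esub> f) = F1 G g \<odot>\<^bsub>K\<^esub> F1 G f"
      using fg \<open>trg f' = src g'\<close> by simp
  next
    fix f assume "f \<in> Cell1 L"
    then obtain f' where "f' \<in> Cell1 K" "f = F1 F f'" using B by blast
    then show "F2 G (id2 L f) = id2 K (F1 G f)" by (simp del: F.F_id add: F.F2_id2[symmetric])
  next
    fix \<alpha> f g \<beta> h assume "\<alpha> \<in> hom2 L f g" "\<beta> \<in> hom2 L g h"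
    then obtain a' b' where ab: "a' \<in> Cell2 K" "\<alpha> = F2 F a'" "b' \<in> Cell2 K" "\<beta> = F2 F b'" "trg \<alpha> = src \<beta>"
      using C[of \<alpha>] C[of \<beta>] by (auto simp: mem_hom2)
    then have "trg a' = src b'"
      using inj(2) by simp
    with ab have "F2 G (F2 F (b' \<bullet>\<^bsub>K\<^esub> a')) = F2 G \<beta> \<bullet>\<^bsub>K\<^esub> F2 G \<alpha>" by (simp del: F.F_comp)
    then show "F2 G (\<beta> \<bullet>\<^bsub>L\<^esub> \<alpha>) = F2 G \<beta> \<bullet>\<^bsub>K\<^esub> F2 G \<alpha>"
      using ab \<open>trg a' = src b'\<close> by simp
  next
    fix \<alpha> f f' \<beta> g g' assume "\<alpha> \<in> hom2 L f f'" "\<beta> \<in> hom2 L g g'" "trg f = src g"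
    then obtain a' b' where ab: "a' \<in> Cell2 K" "\<alpha> = F2 F a'" "b' \<in> Cell2 K" "\<beta> = F2 F b'"
        "trg (src \<alpha>) = src (src \<beta>)"
      using C[of \<alpha>] C[of \<beta>] by (auto simp: mem_hom2)
    then have "trg (src a') = src (src b')"
      using inj(1) by simp
    with ab have "F2 G (F2 F (b' \<star>\<^bsub>K\<^esub> a')) = F2 G \<beta> \<star>\<^bsub>K\<^esub> F2 G \<alpha>" by (simp del: F.F_comp)
    then show "F2 G (\<beta> \<star>\<^bsub>L\<^esub> \<alpha>) = F2 G \<beta> \<star>\<^bsub>K\<^esub> F2 G \<alpha>"
      using ab \<open>trg (src a') = src (src b')\<close> by simp
  qed
  moreover have "eq_2fun K (G \<circ>\<circ> F) id_2fun"
    by (simp add: eq_2fun_def)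
  moreover have "eq_2fun L (F \<circ>\<circ> G) id_2fun"
    using A B C by (fastforce simp: eq_2fun_def)
  ultimately show ?thesis
    unfolding iso_2cat_def using assms(1) by blast
qed

section \<open>2-categories of structured objects\<close>

lemma over_2cat_simps [simp]:
  "Ob (over_2cat K A H1 H2) = A"
  "f \<in> Cell1 (over_2cat K A H1 H2) \<longleftrightarrow>
     src f \<in> A \<and> trg f \<in> A \<and> body f \<in> hom1 K (fst (src f)) (fst (trg f)) \<and> H1 f"
  "\<alpha> \<in> Cell2 (over_2cat K A H1 H2) \<longleftrightarrow> src \<alpha> \<in> Cell1 (over_2cat K A H1 H2) \<and>
     trg \<alpha> \<in> Cell1 (over_2cat K A H1 H2) \<and> parallel (src \<alpha>) (trg \<alpha>) \<and>
     body \<alpha> \<in> hom2 K (body (src \<alpha>)) (body (trg \<alpha>)) \<and> H2 \<alpha>"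
  "id1 (over_2cat K A H1 H2) X = Cell X X (id1 K (fst X))"
  "comp1 (over_2cat K A H1 H2) g f = Cell (src f) (trg g) (body g \<odot>\<^bsub>K\<^esub> body f)"
  "id2 (over_2cat K A H1 H2) f = Cell f f (id2 K (body f))"
  "vcomp (over_2cat K A H1 H2) \<beta> \<alpha> = Cell (src \<alpha>) (trg \<beta>) (body \<beta> \<bullet>\<^bsub>K\<^esub> body \<alpha>)"
  "hcomp (over_2cat K A H1 H2) \<beta> \<alpha> =
     Cell (Cell (src (src \<alpha>)) (trg (src \<beta>)) (body (src \<beta>) \<odot>\<^bsub>K\<^esub> body (src \<alpha>)))
       (Cell (src (trg \<alpha>)) (trg (trg \<beta>)) (body (trg \<beta>) \<odot>\<^bsub>K\<^esub> body (trg \<alpha>))) (body \<beta> \<star>\<^bsub>K\<^esub> body \<alpha>)"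
  by (simp_all add: over_2cat_def Let_def)

text \<open>All compositions are those of \<open>K\<close>, so the equational axioms are inherited.
  What remains is that the predicates \<open>H1\<close> and \<open>H2\<close> are closed under
  identities and compositions.\<close>

lemma over_2cat_category:
  assumes "strict_2category K"
    and "\<And>X. X \<in> A ==> fst X \<in> Ob K \<and> H1 (Cell X X (id1 K (fst X)))"
    and "\<And>f g. [|f \<in> Cell1 (over_2cat K A H1 H2); g \<in> Cell1 (over_2cat K A H1 H2); trg f = src g|]
      ==> H1 (Cell (src f) (trg g) (body g \<odot>\<^bsub>K\<^esub> body f))"
    and "\<And>f. f \<in> Cell1 (over_2cat K A H1 H2) ==> H2 (Cell f f (id2 K (body f)))"
    and "\<And>\<alpha> \<beta>. [|\<alpha> \<in> Cell2 (over_2cat K A H1 H2); \<beta> \<in> Cell2 (over_2cat K A H1 H2); trg \<alpha> = src \<beta>|]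
      ==> H2 (Cell (src \<alpha>) (trg \<beta>) (body \<beta> \<bullet>\<^bsub>K\<^esub> body \<alpha>))"
    and "\<And>\<alpha> \<beta>. [|\<alpha> \<in> Cell2 (over_2cat K A H1 H2); \<beta> \<in> Cell2 (over_2cat K A H1 H2);
        trg (src \<alpha>) = src (src \<beta>)|] ==> H2 (\<beta> \<star>\<^bsub>over_2cat K A H1 H2\<^esub> \<alpha>)"
  shows "strict_2category (over_2cat K A H1 H2)"
proof -
  interpret K: strict_2category K by fact
  have b: "body (Cell x y z) = z" for x :: 'x and y and z :: 'z
    by simp
  have fstK: "X \<in> A ==> fst X \<in> Ob K" for X
    using assms(2) by blast
  note [simp] = mem_hom1 mem_hom2 parallel_def
  show ?thesis
  proof (unfold_locales, goal_cases)
    case 2 then show ?case by auto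
  next
    case 3 then show ?case using assms(2) by auto
  next
    case (4 f X Y g Z) then show ?case using assms(3)[of f g] by auto
  next
    case (8 f) then show ?case using assms(4)[of f] by auto
  next
    case (9 \<alpha> f g \<beta> h) then show ?case using assms(5)[of \<alpha> \<beta>] by auto
  next
    case (13 \<alpha> f f' \<beta> g g') then show ?case using assms(3)[of f g] assms(3)[of f' g'] assms(6)[of \<alpha> \<beta>] by auto
  next
    case (17 \<alpha> f f' \<alpha>' f'' \<beta> g g' \<beta>' g'')
    then show ?case by (auto simp: K.interchange')
  qed (auto intro!: cell.expand)
qed

lemma forget_simps [simp]: "F0 forget X = fst X" "F1 forget f = body f" "F2 forget \<alpha> = body \<alpha>"
  by (simp_all add: forget_def)

lemma forget_2functor:
  assumes "strict_2category K" "strict_2category (over_2cat K A H1 H2)" "\<And>X. X \<in> A ==> fst X \<in> Ob K"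
  shows "strict_2functor (over_2cat K A H1 H2) K forget"
proof -
  interpret K: strict_2category K by fact
  show ?thesis
    by (intro strict_2functor.intro strict_2functor_axioms.intro assms)
      (use assms(3) in \<open>auto simp: mem_hom1 mem_hom2\<close>)
qed

text \<open>Lets an equation of twofold composites be used inside a left-nested threefold
  one.\<close>

lemma (in two_category) comp1_extend:
  assumes "g \<odot> f = g' \<odot> f'" "h \<in> Cell1 K" "g \<in> Cell1 K" "f \<in> Cell1 K" "g' \<in> Cell1 K" "f' \<in> Cell1 K"
    "src h = trg g" "src g = trg f" "src h = trg g'" "src g' = trg f'"
  shows "h \<odot> g \<odot> f = h \<odot> g' \<odot> f'"
proof -
  have "h \<odot> (g \<odot> f) = h \<odot> (g' \<odot> f')"
    by (simp only: assms(1))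
  then show ?thesis
    using assms(2-) by simp
qed

section \<open>Arrow 2-categories and sub-2-categories\<close>

text \<open>Membership is expressed through projections instead of constructors, so that cells of
  the arrow 2-category can be handled without splitting them into their parts.\<close>

lemma Arrow_simps:
  "Ob (Arrow K) = Cell1 K"
  "F \<in> Cell1 (Arrow K) \<longleftrightarrow> src F \<in> Cell1 K \<and> trg F \<in> Cell1 K \<and>
     fst (body F) \<in> Cell1 K \<and> src (fst (body F)) = src (src F) \<and> trg (fst (body F)) = src (trg F) \<and>
     snd (body F) \<in> Cell1 K \<and> src (snd (body F)) = trg (src F) \<and> trg (snd (body F)) = trg (trg F) \<and>
     trg F \<odot>\<^bsub>K\<^esub> fst (body F) = snd (body F) \<odot>\<^bsub>K\<^esub> src F"
  "\<phi> \<in> Cell2 (Arrow K) \<longleftrightarrow> src \<phi> \<in> Cell1 (Arrow K) \<and> trg \<phi> \<in> Cell1 (Arrow K) \<and>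
     src (trg \<phi>) = src (src \<phi>) \<and> trg (trg \<phi>) = trg (src \<phi>) \<and>
     fst (body \<phi>) \<in> Cell2 K \<and> src (fst (body \<phi>)) = fst (body (src \<phi>)) \<and>
     trg (fst (body \<phi>)) = fst (body (trg \<phi>)) \<and>
     snd (body \<phi>) \<in> Cell2 K \<and> src (snd (body \<phi>)) = snd (body (src \<phi>)) \<and>
     trg (snd (body \<phi>)) = snd (body (trg \<phi>)) \<and>
     trg (src \<phi>) \<rhd>\<^bsub>K\<^esub> fst (body \<phi>) = snd (body \<phi>) \<lhd>\<^bsub>K\<^esub> src (src \<phi>)"
  "id1 (Arrow K) P = Cell P P (id1 K (src P), id1 K (trg P))"
  "comp1 (Arrow K) G F = Cell (src F) (trg G)
     (fst (body G) \<odot>\<^bsub>K\<^esub> fst (body F), snd (body G) \<odot>\<^bsub>K\<^esub> snd (body F))"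
  "id2 (Arrow K) F = Cell F F (id2 K (fst (body F)), id2 K (snd (body F)))"
  "vcomp (Arrow K) \<psi> \<phi> = Cell (src \<phi>) (trg \<psi>)
     (fst (body \<psi>) \<bullet>\<^bsub>K\<^esub> fst (body \<phi>), snd (body \<psi>) \<bullet>\<^bsub>K\<^esub> snd (body \<phi>))"
  "hcomp (Arrow K) \<psi> \<phi> = Cell (comp1 (Arrow K) (src \<psi>) (src \<phi>)) (comp1 (Arrow K) (trg \<psi>) (trg \<phi>))
     (fst (body \<psi>) \<star>\<^bsub>K\<^esub> fst (body \<phi>), snd (body \<psi>) \<star>\<^bsub>K\<^esub> snd (body \<phi>))"
proof -
  show "F \<in> Cell1 (Arrow K) \<longleftrightarrow> src F \<in> Cell1 K \<and> trg F \<in> Cell1 K \<and>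
     fst (body F) \<in> Cell1 K \<and> src (fst (body F)) = src (src F) \<and> trg (fst (body F)) = src (trg F) \<and>
     snd (body F) \<in> Cell1 K \<and> src (snd (body F)) = trg (src F) \<and> trg (snd (body F)) = trg (trg F) \<and>
     trg F \<odot>\<^bsub>K\<^esub> fst (body F) = snd (body F) \<odot>\<^bsub>K\<^esub> src F" for F
    by (cases F; cases "body F") (auto simp: Arrow_def Let_def mem_hom1)
  show "\<phi> \<in> Cell2 (Arrow K) \<longleftrightarrow> src \<phi> \<in> Cell1 (Arrow K) \<and> trg \<phi> \<in> Cell1 (Arrow K) \<and>
     src (trg \<phi>) = src (src \<phi>) \<and> trg (trg \<phi>) = trg (src \<phi>) \<and>
     fst (body \<phi>) \<in> Cell2 K \<and> src (fst (body \<phi>)) = fst (body (src \<phi>)) \<and>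
     trg (fst (body \<phi>)) = fst (body (trg \<phi>)) \<and>
     snd (body \<phi>) \<in> Cell2 K \<and> src (snd (body \<phi>)) = snd (body (src \<phi>)) \<and>
     trg (snd (body \<phi>)) = snd (body (trg \<phi>)) \<and>
     trg (src \<phi>) \<rhd>\<^bsub>K\<^esub> fst (body \<phi>) = snd (body \<phi>) \<lhd>\<^bsub>K\<^esub> src (src \<phi>)"
    by (cases \<phi>; cases "body \<phi>") (auto simp: Arrow_def Let_def mem_hom2 parallel_def)
qed (simp_all add: Arrow_def Let_def)

context two_category
begin

lemma Arrow_comp1:
  assumes "F \<in> Cell1 (Arrow K)" "G \<in> Cell1 (Arrow K)" "trg F = src G"
  shows "G \<odot>\<^bsub>Arrow K\<^esub> F \<in> Cell1 (Arrow K)"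
  using assms comp1_extend[of "src G" "fst (body F)" "snd (body F)" "src F" "snd (body G)"]
  by (simp add: Arrow_simps)

lemma Arrow_hcomp:
  assumes "\<phi> \<in> Cell2 (Arrow K)" "\<psi> \<in> Cell2 (Arrow K)" "trg (src \<phi>) = src (src \<psi>)"
  shows "\<psi> \<star>\<^bsub>Arrow K\<^esub> \<phi> \<in> Cell2 (Arrow K)"
proof -
  obtain P Q R \<beta> \<alpha> \<beta>' \<alpha>' where e: "P = src (src \<phi>)" "Q = trg (src \<phi>)" "R = trg (src \<psi>)"
    "\<beta> = fst (body \<phi>)" "\<alpha> = snd (body \<phi>)" "\<beta>' = fst (body \<psi>)" "\<alpha>' = snd (body \<psi>)"
    by blast
  have c: "P \<in> Cell1 K" "Q \<in> Cell1 K" "R \<in> Cell1 K" "\<beta> \<in> Cell2 K" "\<alpha> \<in> Cell2 K" "\<beta>' \<in> Cell2 K"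
      "\<alpha>' \<in> Cell2 K" "src (src \<beta>) = src P" "trg (src \<beta>) = src Q" "src (src \<alpha>) = trg P" "trg (src \<alpha>) = trg Q"
      "src (src \<beta>') = src Q" "trg (src \<beta>') = src R" "src (src \<alpha>') = trg Q" "trg (src \<alpha>') = trg R"
    and n: "Q \<rhd> \<beta> = \<alpha> \<lhd> P" "R \<rhd> \<beta>' = \<alpha>' \<lhd> Q"
    using assms unfolding e by (auto simp: Arrow_simps)
  \<comment> \<open>The two compatibility conditions are pasted: that of \<open>\<psi>\<close>
    carries \<open>R\<close> across to \<open>Q\<close>, that of \<open>\<phi>\<close> carries
    \<open>Q\<close> across to \<open>P\<close>.\<close>
  have "R \<rhd> (\<beta>' \<star> \<beta>) = (R \<rhd> \<beta>') \<star> \<beta>"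
    using c by simp
  also have "\<dots> = \<alpha>' \<star> (Q \<rhd> \<beta>)"
    using c unfolding n(2) by simp
  also have "\<dots> = \<alpha>' \<star> \<alpha> \<lhd> P"
    using c unfolding n(1) by simp
  finally show ?thesis
    using Arrow_comp1[of "src \<phi>" "src \<psi>"] Arrow_comp1[of "trg \<phi>" "trg \<psi>"] assms(3) assms(1,2) unfolding e
    by (auto simp: Arrow_simps)
qed

lemma Arrow_cell2D:
  assumes "\<phi> \<in> Cell2 (Arrow K)"
  shows "fst (body \<phi>) \<in> Cell2 K" "snd (body \<phi>) \<in> Cell2 K"
    "src (fst (body \<phi>)) = fst (body (src \<phi>))" "trg (fst (body \<phi>)) = fst (body (trg \<phi>))"
    "src (snd (body \<phi>)) = snd (body (src \<phi>))" "trg (snd (body \<phi>)) = snd (body (trg \<phi>))"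
    "src (fst (body (src \<phi>))) = src (src (src \<phi>))" "trg (fst (body (src \<phi>))) = src (trg (src \<phi>))"
    "src (snd (body (src \<phi>))) = trg (src (src \<phi>))" "trg (snd (body (src \<phi>))) = trg (trg (src \<phi>))"
  using assms by (auto simp: Arrow_simps)

lemma Arrow_2category: "strict_2category (Arrow K)"
proof (rule strict_2category.intro, goal_cases)
  case (4 f X Y g Z)
  then show ?case using Arrow_comp1[of f g] by (auto simp: mem_hom1) (simp_all add: Arrow_simps)
next
  case (9 \<alpha> f g \<beta> h)
  then show ?case by (auto simp: mem_hom2 Arrow_simps)
next
  case (13 \<alpha> f f' \<beta> g g')
  then show ?case using Arrow_hcomp[of \<alpha> \<beta>] by (simp add: mem_hom2 Arrow_simps(8))
next
  case (17 \<alpha> f f' \<alpha>' f'' \<beta> g g' \<beta>' g'')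
  then have "\<alpha> \<in> Cell2 (Arrow K)" "\<alpha>' \<in> Cell2 (Arrow K)" "\<beta> \<in> Cell2 (Arrow K)" "\<beta>' \<in> Cell2 (Arrow K)"
    by (simp_all add: mem_hom2)
  note D = this[THEN Arrow_cell2D(1)] this[THEN Arrow_cell2D(2)] this[THEN Arrow_cell2D(3)]
    this[THEN Arrow_cell2D(4)] this[THEN Arrow_cell2D(5)] this[THEN Arrow_cell2D(6)]
    this(1,3)[THEN Arrow_cell2D(7)] this(1,3)[THEN Arrow_cell2D(8)] this(1,3)[THEN Arrow_cell2D(9)]
    this(1,3)[THEN Arrow_cell2D(10)]
  have e: "src \<alpha> = f" "trg \<alpha> = f'" "src \<alpha>' = f'" "trg \<alpha>' = f''" "src \<beta> = g" "trg \<beta> = g'"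
    "src \<beta>' = g'" "trg \<beta>' = g''" "trg f = src g"
    using 17 by (simp_all add: mem_hom2)
  have "(fst (body \<beta>') \<bullet> fst (body \<beta>)) \<star> (fst (body \<alpha>') \<bullet> fst (body \<alpha>)) =
      (fst (body \<beta>') \<star> fst (body \<alpha>')) \<bullet> (fst (body \<beta>) \<star> fst (body \<alpha>))"
    "(snd (body \<beta>') \<bullet> snd (body \<beta>)) \<star> (snd (body \<alpha>') \<bullet> snd (body \<alpha>)) =
      (snd (body \<beta>') \<star> snd (body \<alpha>')) \<bullet> (snd (body \<beta>) \<star> snd (body \<alpha>))"
    by (rule interchange'; simp add: D[unfolded e] e)+
  then show ?case
    by (simp add: Arrow_simps(5,7,8) e)
qed (auto simp: mem_hom1 mem_hom2 Arrow_simps parallel_def intro!: cell.expand prod_eqI)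

lemma Dom_2functor: "strict_2functor (Arrow K) K Dom"
  by (intro strict_2functor.intro strict_2functor_axioms.intro Arrow_2category strict_2category_axioms)
    (auto simp: mem_hom1 mem_hom2 Arrow_simps Dom_def)

end

lemma Dom_simps [simp]: "F0 Dom P = src P" "F1 Dom F = fst (body F)" "F2 Dom \<phi> = fst (body \<phi>)"
  by (simp_all add: Dom_def)

section \<open>Sub-2-categories, and the restriction of 2-functors, 2-monads and colax morphisms to
  them\<close>

locale sub_2category = strict_2category K for K :: "('o, 'f, 't) two_cat" (structure) +
  fixes A B C
  assumes sub0: "A \<subseteq> Ob K" and sub1: "B \<subseteq> Cell1 K" and sub2: "C \<subseteq> Cell2 K"
    and sub_ends1: "f \<in> B ==> src f \<in> A \<and> trg f \<in> A"
    and sub_ends2: "\<alpha> \<in> C ==> src \<alpha> \<in> B \<and> trg \<alpha> \<in> B"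
    and sub_id1: "X \<in> A ==> id1 K X \<in> B"
    and sub_comp1: "[|f \<in> B; g \<in> B; trg f = src g|] ==> g \<odot> f \<in> B"
    and sub_id2: "f \<in> B ==> id2 K f \<in> C"
    and sub_vcomp: "[|\<alpha> \<in> C; \<beta> \<in> C; trg \<alpha> = src \<beta>|] ==> \<beta> \<bullet> \<alpha> \<in> C"
    and sub_hcomp: "[|\<alpha> \<in> C; \<beta> \<in> C; trg (src \<alpha>) = src (src \<beta>)|] ==> \<beta> \<star> \<alpha> \<in> C"
begin

abbreviation "sub \<equiv> K\<lparr>Ob := A, Cell1 := B, Cell2 := C\<rparr>"

lemma sub_cells: "X \<in> A ==> X \<in> Ob K" "f \<in> B ==> f \<in> Cell1 K" "\<alpha> \<in> C ==> \<alpha> \<in> Cell2 K"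
  using sub0 sub1 sub2 by auto

lemma sub_2category: "strict_2category sub"
proof (rule strict_2category.intro, goal_cases)
  case (17 \<alpha> f f' \<alpha>' f'' \<beta> g g' \<beta>' g'')
  then show ?case by (auto simp: mem_hom2 sub_cells interchange')
qed (auto simp: mem_hom1 mem_hom2 parallel_def sub_ends1 sub_ends2 sub_id1 sub_comp1 sub_id2 sub_vcomp
    sub_hcomp sub_cells)

lemma sub_2functor: "strict_2functor K L F ==> strict_2functor sub L F"
proof -
  assume "strict_2functor K L F"
  then interpret F: strict_2functor K L F .
  show ?thesis
    by (intro strict_2functor.intro strict_2functor_axioms.intro sub_2category F.cod.strict_2category_axioms)
      (auto simp: mem_hom1 mem_hom2 sub_cells)
qed

lemma sub_2functor_into:
  assumes "strict_2functor L K F" "\<And>X. X \<in> Ob L ==> F0 F X \<in> A" "\<And>f. f \<in> Cell1 L ==> F1 F f \<in> B"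
    "\<And>\<alpha>. \<alpha> \<in> Cell2 L ==> F2 F \<alpha> \<in> C"
  shows "strict_2functor L sub F"
proof -
  interpret F: strict_2functor L K F by fact
  show ?thesis
    by (intro strict_2functor.intro strict_2functor_axioms.intro sub_2category F.dom.strict_2category_axioms)
      (auto simp: mem_hom1 mem_hom2 assms)
qed

text \<open>Only this direction is formal, since the inverse of a 2-cell in \<open>C\<close> may lie
  outside \<open>C\<close>. For the slice the converse is obtained from \<open>CAT2_inverse\<close>,
  which produces an inverse with identity base component.\<close>

lemma sub_invertible2: "invertible2 sub \<alpha> ==> invertible2 K \<alpha>"
  by (auto simp: invertible2_def mem_hom2 sub_cells)

lemma sub_monad:
  assumes "strict_2monad K T" "\<And>X. X \<in> A ==> T0 T X \<in> A \<and> eta T X \<in> B \<and> mu T X \<in> B"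
    "\<And>f. f \<in> B ==> T1 T f \<in> B" "\<And>\<alpha>. \<alpha> \<in> C ==> T2 T \<alpha> \<in> C"
  shows "strict_2monad sub T"
proof -
  interpret T: strict_2monad K T by fact
  interpret S: strict_2category sub by (rule sub_2category)
  have T: "strict_2functor sub sub (fn T)"
    by (intro strict_2functor.intro strict_2functor_axioms.intro sub_2category)
      (use assms in \<open>auto simp: mem_hom1 mem_hom2 sub_cells\<close>)
  have "two_natural sub sub id_2fun (fn T) (eta T)"
    by (intro two_natural.intro two_natural_axioms.intro T strict_2functor_id sub_2category)
      (use assms(2) T.unit.lam_natural1 T.unit.lam_natural2 in \<open>auto simp: mem_hom1 mem_hom2 sub_cells\<close>)
  moreover have "two_natural sub sub (fn T \<circ>\<circ> fn T) (fn T) (mu T)"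
    by (intro two_natural.intro two_natural_axioms.intro T strict_2functor_comp[OF T T])
      (use assms(2) T.mult.lam_natural1 T.mult.lam_natural2 in \<open>auto simp: mem_hom1 mem_hom2 sub_cells\<close>)
  ultimately show ?thesis
    by (intro strict_2monad.intro strict_2monad_axioms.intro T)
      (simp_all add: sub_cells T.unit_left T.unit_right T.assoc)
qed

lemma sub_two_natural:
  assumes "two_natural K L F G lam"
  shows "two_natural sub L F G lam"
proof -
  interpret lam: two_natural K L F G lam by fact
  show ?thesis
    by (intro two_natural.intro two_natural_axioms.intro sub_2functor lam.dom.strict_2functor_axioms
        lam.cod.strict_2functor_axioms)
      (use lam.lam_natural1 lam.lam_natural2 in \<open>auto simp: mem_hom1 mem_hom2 sub_cells\<close>)
qed

lemma sub_colax:
  assumes "colax_monad_morphism K T L R V lam" "strict_2monad sub T"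
  shows "colax_monad_morphism sub T L R V lam"
proof -
  interpret c: colax_monad_morphism K T L R V lam by fact
  show ?thesis
    by (intro colax_monad_morphism.intro assms(2) c.R.strict_2monad_axioms sub_two_natural
        c.lam.two_natural_axioms sub_2functor c.V.strict_2functor_axioms colax_monad_morphism_axioms.intro)
      (simp_all add: sub_cells c.lam_eta c.lam_mu)
qed

end

lemma full_sub_sub:
  assumes "strict_2category K"
  shows "sub_2category K {X \<in> Ob K. S X} {f \<in> Cell1 K. S (src f) \<and> S (trg f)}
    {\<alpha> \<in> Cell2 K. S (src (src \<alpha>)) \<and> S (trg (src \<alpha>))}"
proof -
  interpret strict_2category K by fact
  show ?thesis
    by (intro sub_2category.intro assms sub_2category_axioms.intro) auto
qed

text \<open>The slice is not full in the arrow 2-category: base components are prescribed. Closure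
  is therefore checked for each operation, the base component of the result being computed every
  time.\<close>

lemma Slice_sub:
  assumes "strict_2category K" "B \<in> Ob K"
  shows "sub_2category (Arrow K) {P \<in> Cell1 K. trg P = B}
    {F \<in> Cell1 (Arrow K). trg (src F) = B \<and> trg (trg F) = B \<and> snd (body F) = id1 K B}
    {\<phi> \<in> Cell2 (Arrow K). trg (src (src \<phi>)) = B \<and> trg (trg (src \<phi>)) = B \<and> snd (body \<phi>) = id2 K (id1 K B)}"
proof -
  interpret strict_2category K by fact
  interpret Arr: strict_2category "Arrow K" by (rule Arrow_2category)
  show ?thesis
  proof (intro sub_2category.intro Arr.strict_2category_axioms sub_2category_axioms.intro, goal_cases)
    case (5 \<alpha>) then show ?case using Arrow_cell2D(5,6)[of \<alpha>] id2_cell[OF id1_cell(1)[OF assms(2)]] by auto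
  next
    case (6 X) then show ?case using assms(2) by (simp add: Arrow_simps)
  next
    case (7 f g) then show ?case using assms(2) Arrow_comp1[of f g] by (auto simp: Arrow_simps)
  next
    case (8 f) then show ?case using assms(2) Arr.id2_cell(1)[of f] by (auto simp: Arrow_simps(6))
  next
    case (9 \<alpha> \<beta>) then show ?case using assms(2) Arr.vcomp_cell(1)[of \<alpha> \<beta>] by (auto simp: Arrow_simps(7))
  next
    case (10 \<alpha> \<beta>) then show ?case using assms(2) Arrow_hcomp[of \<alpha> \<beta>] by (auto simp: Arrow_simps(5,8))
  qed (auto simp: Arrow_simps(1,2))
qed

section \<open>Algebras of a strict 2-monad\<close>

locale two_monad = strict_2monad K T for K (structure) and T

sublocale strict_2monad \<subseteq> two_monad
  by unfold_locales

context two_monad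
begin

lemma eta_cell [simp]:
  assumes "X \<in> Ob K"
  shows "eta T X \<in> Cell1 K" "src (eta T X) = X" "trg (eta T X) = T0 T X"
  using unit.lam_cell[OF assms] by simp_all

lemma mu_cell [simp]:
  assumes "X \<in> Ob K"
  shows "mu T X \<in> Cell1 K" "src (mu T X) = T0 T (T0 T X)" "trg (mu T X) = T0 T X"
  using mult.lam_cell[OF assms] by simp_all

lemma eta_nat:
  "[|f \<in> Cell1 K; src f = X|] ==> T1 T f \<odot> eta T X = eta T (trg f) \<odot> f"
  using unit.nat1[of f X "trg f"] by simp

lemma mu_nat:
  "[|f \<in> Cell1 K; src f = X|] ==> T1 T f \<odot> mu T X = mu T (trg f) \<odot> T1 T (T1 T f)"
  using mult.nat1[of f X "trg f"] by simp

lemma eta_nat_assoc: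
  "[|f \<in> Cell1 K; src f = X; g \<in> Cell1 K; src g = T0 T (trg f)|]
    ==> g \<odot> T1 T f \<odot> eta T X = g \<odot> eta T (trg f) \<odot> f"
  using unit.nat1_assoc[of f X "trg f" g] by simp

lemma mu_nat_assoc:
  "[|f \<in> Cell1 K; src f = X; g \<in> Cell1 K; src g = T0 T (trg f)|]
    ==> g \<odot> T1 T f \<odot> mu T X = g \<odot> mu T (trg f) \<odot> T1 T (T1 T f)"
  using mult.nat1_assoc[of f X "trg f" g] by simp

lemma monad_assoc:
  assumes "X \<in> Ob K" "g \<in> Cell1 K" "src g = T0 T X"
  shows "g \<odot> mu T X \<odot> eta T (T0 T X) = g" "g \<odot> mu T X \<odot> T1 T (eta T X) = g"
    "g \<odot> mu T X \<odot> mu T (T0 T X) = g \<odot> mu T X \<odot> T1 T (mu T X)"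
proof -
  have "g \<odot> (mu T X \<odot> eta T (T0 T X)) = g" "g \<odot> (mu T X \<odot> T1 T (eta T X)) = g"
    using assms unit_left[of X] unit_right[of X] by (simp_all del: fn.dom.comp1_assoc')
  then show "g \<odot> mu T X \<odot> eta T (T0 T X) = g" "g \<odot> mu T X \<odot> T1 T (eta T X) = g"
    using assms by simp_all
  show "g \<odot> mu T X \<odot> mu T (T0 T X) = g \<odot> mu T X \<odot> T1 T (mu T X)"
    using assms assoc[of X] fn.dom.comp1_extend[of "mu T X" "mu T (T0 T X)" "mu T X" "T1 T (mu T X)" g] by simp
qed

text \<open>Orientation: naturality moves \<open>eta\<close> and \<open>mu\<close> to the left past
  \<open>T1 T f\<close>, and a double multiplication is written with \<open>T1 T (mu T X)\<close> on
  the right. Composites of structure 1-cells then have a common normal form.\<close>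

lemmas monad_simps [simp] = eta_nat mu_nat eta_nat_assoc mu_nat_assoc monad_assoc unit_left unit_right assoc

lemma strict_algebra_iff:
  "strict_algebra K T X a \<longleftrightarrow> X \<in> Ob K \<and> a \<in> Cell1 K \<and> src a = T0 T X \<and> trg a = X \<and>
     a \<odot> eta T X = id1 K X \<and> a \<odot> mu T X = a \<odot> T1 T a"
  by (simp add: strict_algebra_def mem_hom1)

lemma Alg_s_2category: "strict_2category (Alg_s K T)"
  unfolding Alg_s_def
proof (rule over_2cat_category, goal_cases)
  case 1
  show ?case by (rule fn.dom.strict_2category_axioms)
next
  case (2 X)
  then show ?case by (auto simp: strict_algebra_iff)
next
  case (3 f' g')
  obtain X a Y b f where f': "f' = Cell (X, a) (Y, b) f" by (metis cell.exhaust surj_pair)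
  obtain Y' b' Z c g where g': "g' = Cell (Y', b') (Z, c) g" by (metis cell.exhaust surj_pair)
  have h: "a \<in> Cell1 K" "b \<in> Cell1 K" "c \<in> Cell1 K" "f \<in> Cell1 K" "g \<in> Cell1 K" "X \<in> Ob K" "Y \<in> Ob K" "Z \<in> Ob K"
    "src f = X" "trg f = Y" "src g = Y" "trg g = Z" "src a = T0 T X" "src b = T0 T Y" "src c = T0 T Z"
    "trg a = X" "trg b = Y" "trg c = Z"
    and e: "f \<odot> a = b \<odot> T1 T f" "g \<odot> b = c \<odot> T1 T g"
    using 3 unfolding f' g' by (auto simp: mem_hom1 strict_algebra_iff)
  show ?case
    using h fn.dom.comp1_extend[OF e(1), of g] e(2) unfolding f' g' by simp
next
  case (4 f)
  then show ?case by (auto simp: mem_hom1 strict_algebra_iff)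
next
  case (5 \<alpha> \<beta>)
  then show ?case by (auto simp: mem_hom1 mem_hom2 strict_algebra_iff parallel_def)
next
  case (6 \<alpha> \<beta>)
  obtain X a Y b f f' p where \<alpha>: "\<alpha> = Cell (Cell (X, a) (Y, b) f) (Cell (X, a) (Y, b) f') p"
    using 6(1) by (cases \<alpha>; cases "src \<alpha>"; cases "trg \<alpha>") (auto simp: parallel_def)
  obtain Z c g g' q where \<beta>: "\<beta> = Cell (Cell (Y, b) (Z, c) g) (Cell (Y, b) (Z, c) g') q"
    using 6(2,3) \<alpha> by (cases \<beta>; cases "src \<beta>"; cases "trg \<beta>") (auto simp: parallel_def)
  have h: "a \<in> Cell1 K" "b \<in> Cell1 K" "c \<in> Cell1 K" "p \<in> Cell2 K" "q \<in> Cell2 K"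
    "src (src p) = X" "trg (src p) = Y" "src (src q) = Y" "trg (src q) = Z" "src a = T0 T X" "src b = T0 T Y"
    "src c = T0 T Z" "trg a = X" "trg b = Y" "trg c = Z"
    and e: "p \<lhd> a = b \<rhd> T2 T p" "q \<lhd> b = c \<rhd> T2 T q"
    using 6 unfolding \<alpha> \<beta> by (auto simp: mem_hom1 mem_hom2 strict_algebra_iff)
  have "(q \<star> p) \<lhd> a = q \<star> (p \<lhd> a)"
    using h by simp
  also have "\<dots> = (q \<lhd> b) \<star> T2 T p"
    using h unfolding e(1) by simp
  also have "\<dots> = c \<rhd> T2 T (q \<star> p)"
    using h unfolding e(2) by simp
  finally show ?case
    by (simp add: \<alpha> \<beta>)
qed

section \<open>The 2-category of pseudoalgebras, pseudomorphisms and transformations\<close>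

lemma pseudoalgebra_iff:
  "pseudoalgebra K T (PsAlg X a i c) \<longleftrightarrow> X \<in> Ob K \<and> a \<in> Cell1 K \<and> src a = T0 T X \<and> trg a = X \<and>
     i \<in> Cell2 K \<and> src i = id1 K X \<and> trg i = a \<odot> eta T X \<and> invertible2 K i \<and>
     c \<in> Cell2 K \<and> src c = a \<odot> T1 T a \<and> trg c = a \<odot> mu T X \<and> invertible2 K c \<and>
     (c \<lhd> T1 T (eta T X)) \<bullet> (a \<rhd> T2 T i) = id2 K a \<and>
     (c \<lhd> eta T (T0 T X)) \<bullet> (i \<lhd> a) = id2 K a \<and>
     (c \<lhd> T1 T (mu T X)) \<bullet> (a \<rhd> T2 T c) =
       (c \<lhd> mu T (T0 T X)) \<bullet> (c \<lhd> T1 T (T1 T a))"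
  by (simp add: pseudoalgebra_def mem_hom1 mem_hom2)

lemma pseudomorphism_iff:
  "pseudomorphism K T (Cell (PsAlg X a i c) (PsAlg Y b j d) (f, m)) \<longleftrightarrow>
     pseudoalgebra K T (PsAlg X a i c) \<and> pseudoalgebra K T (PsAlg Y b j d) \<and>
     f \<in> Cell1 K \<and> src f = X \<and> trg f = Y \<and>
     m \<in> Cell2 K \<and> src m = b \<odot> T1 T f \<and> trg m = f \<odot> a \<and> invertible2 K m \<and>
     (m \<lhd> eta T X) \<bullet> (j \<lhd> f) = f \<rhd> i \<and>
     (m \<lhd> mu T X) \<bullet> (d \<lhd> T1 T (T1 T f)) =
       (f \<rhd> c) \<bullet> (m \<lhd> T1 T a) \<bullet> (b \<rhd> T2 T m)"
  by (simp add: pseudomorphism_def mem_hom1 mem_hom2)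

lemma psmor_cases:
  obtains X a i c Y b j d f m where "F = Cell (PsAlg X a i c) (PsAlg Y b j d) (f, m)"
  by (metis cell.exhaust psalg.exhaust surj_pair)

lemma pseudomorphism_id:
  assumes "pseudoalgebra K T A"
  shows "pseudomorphism K T (Cell A A (id1 K (und A), id2 K (act A)))"
  using assms by (cases A) (simp add: pseudomorphism_iff pseudoalgebra_iff)

text \<open>Pasting of the two structure cells. Each axiom for the composite is the axiom of
  \<open>n\<close>, whiskered on the right, followed by the axiom of \<open>m\<close>, whiskered on
  the left; for the multiplication axiom one exchange of \<open>n\<close> with \<open>T2 T m\<close>
  is needed in between.\<close>

lemma pseudomorphism_comp:
  assumes "pseudomorphism K T M" "pseudomorphism K T N" "trg M = src N"
  shows "pseudomorphism K T (psmor_comp K T N M)"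
proof -
  obtain X a i c Y b j d f m where M: "M = Cell (PsAlg X a i c) (PsAlg Y b j d) (f, m)" by (rule psmor_cases)
  obtain Z e k l g n where N: "N = Cell (PsAlg Y b j d) (PsAlg Z e k l) (g, n)"
    using assms(3) M by (cases rule: psmor_cases[of N]) auto
  have A: "pseudoalgebra K T (PsAlg X a i c)" and C: "pseudoalgebra K T (PsAlg Z e k l)"
    using assms unfolding M N pseudomorphism_iff by auto
  have h: "X \<in> Ob K" "Y \<in> Ob K" "Z \<in> Ob K" "a \<in> Cell1 K" "b \<in> Cell1 K" "e \<in> Cell1 K" "f \<in> Cell1 K" "g \<in> Cell1 K"
      "i \<in> Cell2 K" "j \<in> Cell2 K" "k \<in> Cell2 K" "c \<in> Cell2 K" "d \<in> Cell2 K" "l \<in> Cell2 K" "m \<in> Cell2 K" "n \<in> Cell2 K"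
      "src a = T0 T X" "trg a = X" "src b = T0 T Y" "trg b = Y" "src e = T0 T Z" "trg e = Z"
      "src f = X" "trg f = Y" "src g = Y" "trg g = Z"
      "src i = id1 K X" "src j = id1 K Y" "src k = id1 K Z"
      "trg i = a \<odot> eta T X" "trg j = b \<odot> eta T Y" "trg k = e \<odot> eta T Z"
      "src c = a \<odot> T1 T a" "src d = b \<odot> T1 T b" "src l = e \<odot> T1 T e"
      "trg c = a \<odot> mu T X" "trg d = b \<odot> mu T Y" "trg l = e \<odot> mu T Z"
      "src m = b \<odot> T1 T f" "trg m = f \<odot> a" "src n = e \<odot> T1 T g" "trg n = g \<odot> b"
    and inv: "invertible2 K m" "invertible2 K n"
    and u: "(m \<lhd> eta T X) \<bullet> (j \<lhd> f) = f \<rhd> i" "(n \<lhd> eta T Y) \<bullet> (k \<lhd> g) = g \<rhd> j"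
    and v: "(m \<lhd> mu T X) \<bullet> (d \<lhd> T1 T (T1 T f)) =
       (f \<rhd> c) \<bullet> (m \<lhd> T1 T a) \<bullet> (b \<rhd> T2 T m)"
      "(n \<lhd> mu T Y) \<bullet> (l \<lhd> T1 T (T1 T g)) =
       (g \<rhd> d) \<bullet> (n \<lhd> T1 T b) \<bullet> (e \<rhd> T2 T n)"
    using assms(1,2) unfolding M N pseudomorphism_iff pseudoalgebra_iff by auto
  let ?h = "(g \<rhd> m) \<bullet> (n \<lhd> T1 T f)"
  have unit: "(?h \<lhd> eta T X) \<bullet> (k \<lhd> (g \<odot> f)) = (g \<odot> f) \<rhd> i"
  proof -
    have "(?h \<lhd> eta T X) \<bullet> (k \<lhd> (g \<odot> f)) =
        (g \<rhd> m \<lhd> eta T X) \<bullet> (((n \<lhd> eta T Y) \<bullet> (k \<lhd> g)) \<lhd> f)"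
      using h by simp
    also have "\<dots> = g \<rhd> ((m \<lhd> eta T X) \<bullet> (j \<lhd> f))"
      unfolding u(2) using h by simp
    also have "\<dots> = (g \<odot> f) \<rhd> i"
      unfolding u(1) using h by simp
    finally show ?thesis .
  qed
  have mult: "(?h \<lhd> mu T X) \<bullet> (l \<lhd> T1 T (T1 T (g \<odot> f))) =
      ((g \<odot> f) \<rhd> c) \<bullet> (?h \<lhd> T1 T a) \<bullet> (e \<rhd> T2 T ?h)"
  proof -
    have "(?h \<lhd> mu T X) \<bullet> (l \<lhd> T1 T (T1 T (g \<odot> f))) =
        (g \<rhd> m \<lhd> mu T X) \<bullet> (((n \<lhd> mu T Y) \<bullet> (l \<lhd> T1 T (T1 T g))) \<lhd> T1 T (T1 T f))"
      using h by simp
    also have "\<dots> = (g \<rhd> ((m \<lhd> mu T X) \<bullet> (d \<lhd> T1 T (T1 T f)))) \<bullet>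
        (n \<lhd> T1 T (b \<odot> T1 T f)) \<bullet> (e \<rhd> T2 T n \<lhd> T1 T (T1 T f))"
      unfolding v(2) using h by simp
    also have "\<dots> = ((g \<odot> f) \<rhd> c) \<bullet> (g \<rhd> m \<lhd> T1 T a) \<bullet>
        ((trg n \<rhd> T2 T m) \<bullet> (n \<lhd> src (T2 T m))) \<bullet> (e \<rhd> T2 T n \<lhd> T1 T (T1 T f))"
      unfolding v(1) using h by simp
    \<comment> \<open>After the exchange, \<open>n\<close> is next to the cell \<open>m\<close>
      whiskered by \<open>T1 T a\<close>, and \<open>T2 T m\<close> is next to
      \<open>T2 T n\<close>; the two pairs are the whiskered copies of \<open>?h\<close> that the
      axiom asks for.\<close>
    also have "(trg n \<rhd> T2 T m) \<bullet> (n \<lhd> src (T2 T m)) =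
        (n \<lhd> trg (T2 T m)) \<bullet> (src n \<rhd> T2 T m)"
      using h fn.dom.exchange[of "T2 T m" n] by simp
    finally show ?thesis
      using h by simp
  qed
  have "invertible2 K ?h"
    using h inv by (intro fn.dom.invertible2_vcomp fn.dom.invertible2_hcomp) simp_all
  then show ?thesis
    using A C h unit mult
    unfolding M N psmor_comp_def Let_def cell.sel fst_conv snd_conv pseudomorphism_iff by simp
qed

lemma transformation_iff:
  "alg_transformation K T (Cell (Cell (PsAlg X a i c) (PsAlg Y b j d) (f, m))
      (Cell (PsAlg X a i c) (PsAlg Y b j d) (f', m')) \<alpha>) \<longleftrightarrow>
     pseudomorphism K T (Cell (PsAlg X a i c) (PsAlg Y b j d) (f, m)) \<and>
     pseudomorphism K T (Cell (PsAlg X a i c) (PsAlg Y b j d) (f', m')) \<and>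
     \<alpha> \<in> Cell2 K \<and> src \<alpha> = f \<and> trg \<alpha> = f' \<and>
     (\<alpha> \<lhd> a) \<bullet> m = m' \<bullet> (b \<rhd> T2 T \<alpha>)"
  by (auto simp: alg_transformation_def mem_hom2 parallel_def)

lemma transformation_cases:
  assumes "alg_transformation K T \<tau>"
  obtains X a i c Y b j d f m f' m' \<alpha> where
    "\<tau> = Cell (Cell (PsAlg X a i c) (PsAlg Y b j d) (f, m)) (Cell (PsAlg X a i c) (PsAlg Y b j d) (f', m')) \<alpha>"
proof -
  obtain F G \<alpha> where "\<tau> = Cell F G \<alpha>" by (cases \<tau>)
  with assms that show thesis
    by (cases F rule: psmor_cases; cases G rule: psmor_cases) (auto simp: alg_transformation_def parallel_def)
qed

lemma psmor_cell:
  assumes "pseudomorphism K T M"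
  shows "pseudoalgebra K T (src M)" "pseudoalgebra K T (trg M)" "und (src M) \<in> Ob K" "und (trg M) \<in> Ob K"
    "act (src M) \<in> Cell1 K" "src (act (src M)) = T0 T (und (src M))" "trg (act (src M)) = und (src M)"
    "act (trg M) \<in> Cell1 K" "src (act (trg M)) = T0 T (und (trg M))" "trg (act (trg M)) = und (trg M)"
    "fst (body M) \<in> Cell1 K" "src (fst (body M)) = und (src M)" "trg (fst (body M)) = und (trg M)"
    "snd (body M) \<in> Cell2 K" "src (snd (body M)) = act (trg M) \<odot> T1 T (fst (body M))"
    "trg (snd (body M)) = fst (body M) \<odot> act (src M)"
  using assms by (cases M rule: psmor_cases, simp add: pseudomorphism_iff pseudoalgebra_iff)+

lemma transformation_cell:
  assumes "alg_transformation K T \<tau>"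
  shows "pseudomorphism K T (src \<tau>)" "pseudomorphism K T (trg \<tau>)" "src (trg \<tau>) = src (src \<tau>)"
    "trg (trg \<tau>) = trg (src \<tau>)" "body \<tau> \<in> Cell2 K" "src (body \<tau>) = fst (body (src \<tau>))"
    "trg (body \<tau>) = fst (body (trg \<tau>))"
  using assms by (auto simp: alg_transformation_def parallel_def mem_hom2)

lemma transformation_vcomp:
  assumes "alg_transformation K T \<sigma>" "alg_transformation K T \<tau>" "trg \<sigma> = src \<tau>"
  shows "alg_transformation K T (Cell (src \<sigma>) (trg \<tau>) (body \<tau> \<bullet> body \<sigma>))"
proof -
  obtain X a i c Y b j d f m f' m' \<alpha> where
    \<sigma>: "\<sigma> = Cell (Cell (PsAlg X a i c) (PsAlg Y b j d) (f, m)) (Cell (PsAlg X a i c) (PsAlg Y b j d) (f', m')) \<alpha>"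
    by (rule transformation_cases[OF assms(1)])
  obtain f'' m'' \<beta> where
    \<tau>: "\<tau> = Cell (Cell (PsAlg X a i c) (PsAlg Y b j d) (f', m')) (Cell (PsAlg X a i c) (PsAlg Y b j d) (f'', m'')) \<beta>"
    using assms(3) \<sigma> by (cases rule: transformation_cases[OF assms(2)]) auto
  have h: "a \<in> Cell1 K" "b \<in> Cell1 K" "f \<in> Cell1 K" "f' \<in> Cell1 K" "f'' \<in> Cell1 K"
      "\<alpha> \<in> Cell2 K" "\<beta> \<in> Cell2 K" "m \<in> Cell2 K" "m' \<in> Cell2 K" "m'' \<in> Cell2 K"
      "src a = T0 T X" "trg a = X" "src b = T0 T Y" "trg b = Y"
      "src f = X" "trg f = Y" "src f' = X" "trg f' = Y" "src f'' = X" "trg f'' = Y"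
      "src m = b \<odot> T1 T f" "trg m = f \<odot> a" "src m' = b \<odot> T1 T f'" "trg m' = f' \<odot> a"
      "src m'' = b \<odot> T1 T f''" "trg m'' = f'' \<odot> a"
      "src \<alpha> = f" "trg \<alpha> = f'" "src \<beta> = f'" "trg \<beta> = f''"
    by (fact transformation_cell[OF assms(1), unfolded \<sigma> \<tau> cell.sel psalg.sel fst_conv snd_conv]
      transformation_cell[OF assms(2), unfolded \<sigma> \<tau> cell.sel psalg.sel fst_conv snd_conv]
      psmor_cell[OF transformation_cell(1)[OF assms(1)], unfolded \<sigma> \<tau> cell.sel psalg.sel fst_conv snd_conv]
      psmor_cell[OF transformation_cell(1)[OF assms(2)], unfolded \<sigma> \<tau> cell.sel psalg.sel fst_conv snd_conv]
      psmor_cell[OF transformation_cell(2)[OF assms(2)], unfolded \<sigma> \<tau> cell.sel psalg.sel fst_conv snd_conv])+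
  have e: "(\<alpha> \<lhd> a) \<bullet> m = m' \<bullet> (b \<rhd> T2 T \<alpha>)" "(\<beta> \<lhd> a) \<bullet> m' = m'' \<bullet> (b \<rhd> T2 T \<beta>)"
    using assms(1,2) unfolding \<sigma> \<tau> transformation_iff by blast+
  have "((\<beta> \<bullet> \<alpha>) \<lhd> a) \<bullet> m = (\<beta> \<lhd> a) \<bullet> ((\<alpha> \<lhd> a) \<bullet> m)"
    using h by simp
  also have "\<dots> = ((\<beta> \<lhd> a) \<bullet> m') \<bullet> (b \<rhd> T2 T \<alpha>)"
    unfolding e(1) using h by simp
  also have "\<dots> = m'' \<bullet> (b \<rhd> T2 T (\<beta> \<bullet> \<alpha>))"
    unfolding e(2) using h by simp
  finally show ?thesis
    using assms(1,2) h unfolding \<sigma> \<tau> cell.sel transformation_iff by simp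
qed

text \<open>The horizontal composite is split into two whiskerings, so that the axioms of
  \<open>\<alpha>\<close> and of \<open>\<beta>\<close> can be applied one after the other, with the
  structure cells slid past the other transformation in between.\<close>

lemma transformation_hcomp:
  assumes "alg_transformation K T \<sigma>" "alg_transformation K T \<tau>" "trg (src \<sigma>) = src (src \<tau>)"
  shows "alg_transformation K T (Cell (psmor_comp K T (src \<tau>) (src \<sigma>)) (psmor_comp K T (trg \<tau>) (trg \<sigma>))
    (body \<tau> \<star> body \<sigma>))"
proof -
  obtain X a i c Y b j d f m f' m' \<alpha> where
    \<sigma>: "\<sigma> = Cell (Cell (PsAlg X a i c) (PsAlg Y b j d) (f, m)) (Cell (PsAlg X a i c) (PsAlg Y b j d) (f', m')) \<alpha>"
    by (rule transformation_cases[OF assms(1)])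
  obtain Z e k l g n g' n' \<beta> where
    \<tau>: "\<tau> = Cell (Cell (PsAlg Y b j d) (PsAlg Z e k l) (g, n)) (Cell (PsAlg Y b j d) (PsAlg Z e k l) (g', n')) \<beta>"
    using assms(3) \<sigma> by (cases rule: transformation_cases[OF assms(2)]) auto
  have h: "a \<in> Cell1 K" "b \<in> Cell1 K" "e \<in> Cell1 K" "f \<in> Cell1 K" "f' \<in> Cell1 K" "g \<in> Cell1 K" "g' \<in> Cell1 K"
      "\<alpha> \<in> Cell2 K" "\<beta> \<in> Cell2 K" "m \<in> Cell2 K" "m' \<in> Cell2 K" "n \<in> Cell2 K" "n' \<in> Cell2 K"
      "src a = T0 T X" "trg a = X" "src b = T0 T Y" "trg b = Y" "src e = T0 T Z" "trg e = Z"
      "src f = X" "trg f = Y" "src f' = X" "trg f' = Y" "src g = Y" "trg g = Z" "src g' = Y" "trg g' = Z"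
      "src m = b \<odot> T1 T f" "trg m = f \<odot> a" "src m' = b \<odot> T1 T f'" "trg m' = f' \<odot> a"
      "src n = e \<odot> T1 T g" "trg n = g \<odot> b" "src n' = e \<odot> T1 T g'" "trg n' = g' \<odot> b"
      "src \<alpha> = f" "trg \<alpha> = f'" "src \<beta> = g" "trg \<beta> = g'"
    by (fact transformation_cell[OF assms(1), unfolded \<sigma> \<tau> cell.sel psalg.sel fst_conv snd_conv]
      transformation_cell[OF assms(2), unfolded \<sigma> \<tau> cell.sel psalg.sel fst_conv snd_conv]
      psmor_cell[OF transformation_cell(1)[OF assms(1)], unfolded \<sigma> \<tau> cell.sel psalg.sel fst_conv snd_conv]
      psmor_cell[OF transformation_cell(1)[OF assms(2)], unfolded \<sigma> \<tau> cell.sel psalg.sel fst_conv snd_conv]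
      psmor_cell[OF transformation_cell(2)[OF assms(1)], unfolded \<sigma> \<tau> cell.sel psalg.sel fst_conv snd_conv]
      psmor_cell[OF transformation_cell(2)[OF assms(2)], unfolded \<sigma> \<tau> cell.sel psalg.sel fst_conv snd_conv])+
  have q: "(\<alpha> \<lhd> a) \<bullet> m = m' \<bullet> (b \<rhd> T2 T \<alpha>)" "(\<beta> \<lhd> b) \<bullet> n = n' \<bullet> (e \<rhd> T2 T \<beta>)"
    and pm: "pseudomorphism K T (src \<sigma>)" "pseudomorphism K T (src \<tau>)" "pseudomorphism K T (trg \<sigma>)"
      "pseudomorphism K T (trg \<tau>)"
    using assms(1,2) unfolding \<sigma> \<tau> transformation_iff cell.sel by blast+
  have split: "\<beta> \<star> \<alpha> = (\<beta> \<lhd> f') \<bullet> (g \<rhd> \<alpha>)"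
    using fn.dom.exchange(2)[of \<alpha> \<beta>] h by simp
  \<comment> \<open>\<open>x1\<close> slides \<open>m'\<close> past \<open>\<beta>\<close>, and
    \<open>x2\<close> slides \<open>n\<close> past \<open>T2 T \<alpha>\<close>; both are equated
    factorizations of one horizontal composite.\<close>
  have x1: "(\<beta> \<lhd> (f' \<odot> a)) \<bullet> (g \<rhd> m') = (g' \<rhd> m') \<bullet> (\<beta> \<lhd> (b \<odot> T1 T f'))"
    using fn.dom.exchange[of m' \<beta>] h by simp
  have x2: "((g \<odot> b) \<rhd> T2 T \<alpha>) \<bullet> (n \<lhd> T1 T f) = (n \<lhd> T1 T f') \<bullet> ((e \<odot> T1 T g) \<rhd> T2 T \<alpha>)"
    using fn.dom.exchange[of "T2 T \<alpha>" n] h by simp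
  have "((\<beta> \<star> \<alpha>) \<lhd> a) \<bullet> ((g \<rhd> m) \<bullet> (n \<lhd> T1 T f)) =
      (\<beta> \<lhd> (f' \<odot> a)) \<bullet> (g \<rhd> ((\<alpha> \<lhd> a) \<bullet> m)) \<bullet> (n \<lhd> T1 T f)"
    unfolding split using h by simp
  also have "\<dots> = ((\<beta> \<lhd> (f' \<odot> a)) \<bullet> (g \<rhd> m')) \<bullet> (((g \<odot> b) \<rhd> T2 T \<alpha>) \<bullet> (n \<lhd> T1 T f))"
    unfolding q(1) using h by simp
  also have "\<dots> = (g' \<rhd> m') \<bullet> (((\<beta> \<lhd> b) \<bullet> n) \<lhd> T1 T f') \<bullet> ((e \<odot> T1 T g) \<rhd> T2 T \<alpha>)"
    unfolding x1 x2 using h by simp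
  also have "\<dots> = ((g' \<rhd> m') \<bullet> (n' \<lhd> T1 T f')) \<bullet> (e \<rhd> T2 T (\<beta> \<star> \<alpha>))"
    unfolding q(2) split using h by simp
  finally have main: "((\<beta> \<star> \<alpha>) \<lhd> a) \<bullet> ((g \<rhd> m) \<bullet> (n \<lhd> T1 T f)) =
      ((g' \<rhd> m') \<bullet> (n' \<lhd> T1 T f')) \<bullet> (e \<rhd> T2 T (\<beta> \<star> \<alpha>))" .
  show ?thesis
    using main h pseudomorphism_comp[OF pm(1,2)] pseudomorphism_comp[OF pm(3,4)]
    unfolding \<sigma> \<tau> psmor_comp_def Let_def cell.sel fst_conv snd_conv transformation_iff by simp
qed

lemma transformation_id:
  assumes "pseudomorphism K T M"
  shows "alg_transformation K T (Cell M M (id2 K (fst (body M))))"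
  using assms by (cases M rule: psmor_cases) (simp add: transformation_iff pseudomorphism_iff pseudoalgebra_iff)

lemma Ps_Alg_simps:
  "Ob (Ps_Alg K T) = {A. pseudoalgebra K T A}"
  "M \<in> Cell1 (Ps_Alg K T) \<longleftrightarrow> pseudomorphism K T M"
  "\<tau> \<in> Cell2 (Ps_Alg K T) \<longleftrightarrow> alg_transformation K T \<tau>"
  "id1 (Ps_Alg K T) A = Cell A A (id1 K (und A), id2 K (act A))"
  "comp1 (Ps_Alg K T) N M = psmor_comp K T N M"
  "id2 (Ps_Alg K T) M = Cell M M (id2 K (fst (body M)))"
  "vcomp (Ps_Alg K T) \<tau> \<sigma> = Cell (src \<sigma>) (trg \<tau>) (body \<tau> \<bullet> body \<sigma>)"
  "hcomp (Ps_Alg K T) \<tau> \<sigma> = Cell (psmor_comp K T (src \<tau>) (src \<sigma>)) (psmor_comp K T (trg \<tau>) (trg \<sigma>))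
    (body \<tau> \<star> body \<sigma>)"
  by (simp_all add: Ps_Alg_def)

lemma psmor_comp_assoc:
  assumes "pseudomorphism K T L" "pseudomorphism K T M" "pseudomorphism K T N" "trg L = src M" "trg M = src N"
  shows "psmor_comp K T N (psmor_comp K T M L) = psmor_comp K T (psmor_comp K T N M) L"
  using assms(4,5) psmor_cell[OF assms(1)] psmor_cell[OF assms(2)] psmor_cell[OF assms(3)]
  by (simp add: psmor_comp_def Let_def)

text \<open>Since 1-cells carry their structure cells, the strict unit and associativity laws for
  1-cells include equations between pasted 2-cells. On 2-cells all compositions are inherited from
  \<open>K\<close>.\<close>

lemma Ps_Alg_2category: "strict_2category (Ps_Alg K T)"
proof (rule strict_2category.intro, goal_cases)
  case (1 f)
  then show ?case by (simp add: Ps_Alg_simps psmor_cell)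
next
  case (2 \<alpha>)
  then show ?case by (simp add: Ps_Alg_simps parallel_def transformation_cell)
next
  case (3 X)
  then show ?case by (simp add: mem_hom1 Ps_Alg_simps pseudomorphism_id)
next
  case (4 f X Y g Z)
  then show ?case using pseudomorphism_comp[of f g] by (auto simp: mem_hom1 Ps_Alg_simps) (simp_all add: psmor_comp_def Let_def)
next
  case (5 f X Y)
  then have "pseudomorphism K T f" "src f = X" "trg f = Y"
    by (auto simp: mem_hom1 Ps_Alg_simps)
  note this psmor_cell[OF this(1)]
  then show ?case by (intro cell.expand) (simp add: Ps_Alg_simps psmor_comp_def Let_def prod_eq_iff)
next
  case (6 f X Y)
  then have "pseudomorphism K T f" "src f = X" "trg f = Y"
    by (auto simp: mem_hom1 Ps_Alg_simps)
  note this psmor_cell[OF this(1)]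
  then show ?case by (intro cell.expand) (simp add: Ps_Alg_simps psmor_comp_def Let_def prod_eq_iff)
next
  case (7 f X Y g Z h W)
  then have "pseudomorphism K T f" "pseudomorphism K T g" "pseudomorphism K T h" "trg f = src g" "trg g = src h"
    by (auto simp: mem_hom1 Ps_Alg_simps)
  then show ?case by (simp add: Ps_Alg_simps psmor_comp_assoc)
next
  case (8 f)
  then show ?case by (simp add: mem_hom2 Ps_Alg_simps transformation_id)
next
  case (9 \<alpha> f g \<beta> h)
  then show ?case using transformation_vcomp[of \<alpha> \<beta>] by (simp add: mem_hom2 Ps_Alg_simps)
next
  case (10 \<alpha> f g)
  then have "alg_transformation K T \<alpha>" "src \<alpha> = f" "trg \<alpha> = g"
    by (auto simp: mem_hom2 Ps_Alg_simps)
  note this transformation_cell[OF this(1)]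
  then show ?case by (intro cell.expand) (simp add: Ps_Alg_simps)
next
  case (11 \<alpha> f g)
  then have "alg_transformation K T \<alpha>" "src \<alpha> = f" "trg \<alpha> = g"
    by (auto simp: mem_hom2 Ps_Alg_simps)
  note this transformation_cell[OF this(1)]
  then show ?case by (intro cell.expand) (simp add: Ps_Alg_simps)
next
  case (12 \<alpha> f g \<beta> h \<gamma> k)
  then have "alg_transformation K T \<alpha>" "alg_transformation K T \<beta>" "alg_transformation K T \<gamma>"
    and "trg \<alpha> = src \<beta>" "trg \<beta> = src \<gamma>"
    by (auto simp: mem_hom2 Ps_Alg_simps)
  note this transformation_cell[OF this(1)] transformation_cell[OF this(2)] transformation_cell[OF this(3)]
  then show ?case by (simp add: Ps_Alg_simps)
next
  case (13 \<alpha> f f' \<beta> g g')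
  then show ?case using transformation_hcomp[of \<alpha> \<beta>] by (simp add: mem_hom2 Ps_Alg_simps)
next
  case (14 \<alpha> f f' X Y)
  then have "alg_transformation K T \<alpha>" "src \<alpha> = f" "trg \<alpha> = f'" "src f = X" "trg f = Y"
    by (auto simp: mem_hom2 Ps_Alg_simps)
  note this transformation_cell[OF this(1)]
  note this psmor_cell[OF this(6)] psmor_cell[OF this(7)]
  then show ?case
    by (intro conjI cell.expand) (simp_all add: Ps_Alg_simps psmor_comp_def Let_def prod_eq_iff)
next
  case (15 \<alpha> f f' \<beta> g g' \<gamma> h h')
  then have "alg_transformation K T \<alpha>" "alg_transformation K T \<beta>" "alg_transformation K T \<gamma>"
    and "trg (src \<alpha>) = src (src \<beta>)" "trg (src \<beta>) = src (src \<gamma>)"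
    by (auto simp: mem_hom2 Ps_Alg_simps)
  note this transformation_cell[OF this(1)] transformation_cell[OF this(2)] transformation_cell[OF this(3)]
  then show ?case
    by (simp add: Ps_Alg_simps psmor_comp_assoc psmor_cell)
next
  case (16 f X Y g Z)
  then have "pseudomorphism K T f" "pseudomorphism K T g" "trg f = src g"
    by (auto simp: mem_hom1 Ps_Alg_simps)
  note this psmor_cell[OF this(1)] psmor_cell[OF this(2)]
  then show ?case by (simp add: Ps_Alg_simps psmor_comp_def Let_def)
next
  case (17 \<alpha> f f' \<alpha>' f'' \<beta> g g' \<beta>' g'')
  then have "alg_transformation K T \<alpha>" "alg_transformation K T \<alpha>'" "alg_transformation K T \<beta>" "alg_transformation K T \<beta>'"
    and "src \<alpha>' = trg \<alpha>" "src \<beta>' = trg \<beta>" "trg (src \<alpha>) = src (src \<beta>)"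
    by (auto simp: mem_hom2 Ps_Alg_simps)
  note this transformation_cell[OF this(1)] transformation_cell[OF this(2)] transformation_cell[OF this(3)]
    transformation_cell[OF this(4)]
  then show ?case by (simp add: Ps_Alg_simps psmor_cell fn.dom.interchange')
qed

interpretation n: sub_2category "Ps_Alg K T" "{X \<in> Ob (Ps_Alg K T). normal_algebra K X}"
    "{f \<in> Cell1 (Ps_Alg K T). normal_algebra K (src f) \<and> normal_algebra K (trg f)}"
    "{\<alpha> \<in> Cell2 (Ps_Alg K T). normal_algebra K (src (src \<alpha>)) \<and> normal_algebra K (trg (src \<alpha>))}"
  by (rule full_sub_sub[OF Ps_Alg_2category])

lemma ps_forget_2functor: "strict_2functor (Ps_Alg K T) K ps_forget"
proof (intro strict_2functor.intro strict_2functor_axioms.intro Ps_Alg_2category fn.dom.strict_2category_axioms, goal_cases)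
  case (1 X) then show ?case by (cases X) (simp add: ps_forget_def Ps_Alg_simps pseudoalgebra_iff)
next
  case (2 f X Y) then show ?case by (auto simp: ps_forget_def Ps_Alg_simps mem_hom1 psmor_cell)
next
  case (3 \<alpha> f g) then show ?case by (auto simp: ps_forget_def Ps_Alg_simps mem_hom2 transformation_cell)
qed (auto simp: ps_forget_def Ps_Alg_simps psmor_comp_def Let_def)

lemma ps_forget_n_2functor: "strict_2functor (Ps_Alg_n K T) K ps_forget"
proof -
  show ?thesis
    unfolding Ps_Alg_n_def full_sub_def by (rule n.sub_2functor[OF ps_forget_2functor])
qed

text \<open>The normal algebras form a full sub-2-category, so normality is a condition on the
  images of objects alone.\<close>

lemma functor_into_Ps_Alg_n:
  assumes "strict_2functor L (Ps_Alg K T) F" "\<And>X. X \<in> Ob L ==> normal_algebra K (F0 F X)"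
  shows "strict_2functor L (Ps_Alg_n K T) F"
proof -
  interpret F: strict_2functor L "Ps_Alg K T" F by fact
  show ?thesis
    unfolding Ps_Alg_n_def full_sub_def
    by (rule n.sub_2functor_into[OF assms(1)]) (simp_all add: assms(2))
qed

lemma functor_from_Ps_Alg_n: "strict_2functor (Ps_Alg K T) L F ==> strict_2functor (Ps_Alg_n K T) L F"
proof -
  show "strict_2functor (Ps_Alg K T) L F ==> strict_2functor (Ps_Alg_n K T) L F"
    unfolding Ps_Alg_n_def full_sub_def by (rule n.sub_2functor)
qed

lemma Ps_Alg_n_Ob: "A \<in> Ob (Ps_Alg_n K T) \<longleftrightarrow> pseudoalgebra K T A \<and> normal_algebra K A"
  by (simp add: Ps_Alg_n_def full_sub_def Ps_Alg_simps)

lemma Ps_Alg_n_Cell1: "M \<in> Cell1 (Ps_Alg_n K T) \<longleftrightarrow>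
    pseudomorphism K T M \<and> normal_algebra K (src M) \<and> normal_algebra K (trg M)"
  by (simp add: Ps_Alg_n_def full_sub_def Ps_Alg_simps)

lemma Ps_Alg_n_Cell2: "\<tau> \<in> Cell2 (Ps_Alg_n K T) \<longleftrightarrow>
    alg_transformation K T \<tau> \<and> normal_algebra K (src (src \<tau>)) \<and> normal_algebra K (trg (src \<tau>))"
  by (simp add: Ps_Alg_n_def full_sub_def Ps_Alg_simps)

section \<open>Strict algebras as pseudoalgebras\<close>

text \<open>With identity structure cells every axiom compares identities; the content is that the
  1-cells carrying these identities coincide.\<close>

lemma strict_pseudoalgebra:
  assumes "strict_algebra K T X a"
  shows "pseudoalgebra K T (PsAlg X a (id2 K (id1 K X)) (id2 K (a \<odot> mu T X)))"
proof -
  have h: "X \<in> Ob K" "a \<in> Cell1 K" "src a = T0 T X" "trg a = X"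
    and e: "a \<odot> eta T X = id1 K X" "a \<odot> T1 T a = a \<odot> mu T X"
    using assms by (simp_all add: strict_algebra_iff)
  \<comment> \<open>The associativity axiom for identity cells: naturality of \<open>mu\<close>
    brings \<open>T1 T a\<close> next to \<open>a\<close>, and the algebra law turns the pair into
    \<open>mu\<close>.\<close>
  have "a \<odot> mu T X \<odot> T1 T (T1 T a) = a \<odot> T1 T a \<odot> mu T (T0 T X)"
    using h by simp
  also have "\<dots> = a \<odot> mu T X \<odot> T1 T (mu T X)"
    unfolding e(2) using h by simp
  finally have "a \<odot> mu T X \<odot> T1 T (T1 T a) = a \<odot> mu T X \<odot> T1 T (mu T X)" .
  then show ?thesis
    using h e by (simp add: pseudoalgebra_iff)
qed

text \<open>As for algebras, the axioms compare identity cells. The facts \<open>1\<close>,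
  \<open>2\<close>, \<open>3\<close> bring the 1-cells under these identities into a common
  form.\<close>

lemma strict_pseudomorphism:
  assumes "strict_algebra K T X a" "strict_algebra K T Y b" "f \<in> Cell1 K" "src f = X" "trg f = Y"
    "f \<odot> a = b \<odot> T1 T f"
  shows "pseudomorphism K T (Cell (PsAlg X a (id2 K (id1 K X)) (id2 K (a \<odot> mu T X)))
    (PsAlg Y b (id2 K (id1 K Y)) (id2 K (b \<odot> mu T Y))) (f, id2 K (f \<odot> a)))"
proof -
  have h: "X \<in> Ob K" "Y \<in> Ob K" "a \<in> Cell1 K" "b \<in> Cell1 K" "src a = T0 T X" "trg a = X" "src b = T0 T Y" "trg b = Y"
    and e: "a \<odot> eta T X = id1 K X" "a \<odot> T1 T a = a \<odot> mu T X"
      "b \<odot> eta T Y = id1 K Y" "b \<odot> T1 T b = b \<odot> mu T Y"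
    using assms(1,2) by (simp_all add: strict_algebra_iff)
  have 1: "f \<odot> a \<odot> eta T X = f"
    using fn.dom.comp1_assoc'[of "eta T X" a f] h assms(3-5) e(1) by simp
  have 2: "f \<odot> a \<odot> T1 T a = f \<odot> a \<odot> mu T X"
    using fn.dom.comp1_extend[OF e(2), of f] h assms(3-5) by simp
  have "b \<odot> mu T Y \<odot> T1 T (T1 T f) = b \<odot> T1 T f \<odot> mu T X"
    using h assms(3-5) by simp
  then have 3: "b \<odot> mu T Y \<odot> T1 T (T1 T f) = f \<odot> a \<odot> mu T X"
    by (simp only: assms(6))
  show ?thesis
    using strict_pseudoalgebra[OF assms(1)] strict_pseudoalgebra[OF assms(2)] h assms(3-5) assms(6)[symmetric] 1 2 3
    unfolding pseudomorphism_iff by (intro conjI) simp_all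
qed

lemma strict_as_ps_simps:
  "F0 (strict_as_ps K T) (X, a) = PsAlg X a (id2 K (id1 K X)) (id2 K (a \<odot> mu T X))"
  "F1 (strict_as_ps K T) f = Cell (F0 (strict_as_ps K T) (src f)) (F0 (strict_as_ps K T) (trg f))
     (body f, id2 K (body f \<odot> snd (src f)))"
  "F2 (strict_as_ps K T) \<alpha> = Cell (F1 (strict_as_ps K T) (src \<alpha>)) (F1 (strict_as_ps K T) (trg \<alpha>)) (body \<alpha>)"
  by (simp_all add: strict_as_ps_def Let_def)

lemma Alg_s_Ob: "(X, a) \<in> Ob (Alg_s K T) \<longleftrightarrow> strict_algebra K T X a"
  by (simp add: Alg_s_def)

lemma Alg_s_Cell1: "Cell (X, a) (Y, b) f \<in> Cell1 (Alg_s K T) \<longleftrightarrow> strict_algebra K T X a \<and>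
    strict_algebra K T Y b \<and> f \<in> Cell1 K \<and> src f = X \<and> trg f = Y \<and> f \<odot> a = b \<odot> T1 T f"
  by (auto simp: Alg_s_def mem_hom1)

lemma Alg_s_Cell2: "Cell (Cell (X, a) (Y, b) f) (Cell (X', a') (Y', b') f') \<alpha> \<in> Cell2 (Alg_s K T) \<longleftrightarrow>
    Cell (X, a) (Y, b) f \<in> Cell1 (Alg_s K T) \<and> Cell (X, a) (Y, b) f' \<in> Cell1 (Alg_s K T) \<and>
    X' = X \<and> a' = a \<and> Y' = Y \<and> b' = b \<and> \<alpha> \<in> Cell2 K \<and> src \<alpha> = f \<and> trg \<alpha> = f' \<and>
    \<alpha> \<lhd> a = b \<rhd> T2 T \<alpha>"
  by (simp add: Alg_s_def mem_hom1 mem_hom2 parallel_def) (safe; metis)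

lemma Alg_s_ops:
  "id1 (Alg_s K T) X = Cell X X (id1 K (fst X))"
  "comp1 (Alg_s K T) g f = Cell (src f) (trg g) (body g \<odot> body f)"
  "id2 (Alg_s K T) f = Cell f f (id2 K (body f))"
  "vcomp (Alg_s K T) \<beta> \<alpha> = Cell (src \<alpha>) (trg \<beta>) (body \<beta> \<bullet> body \<alpha>)"
  "hcomp (Alg_s K T) \<beta> \<alpha> = Cell (comp1 (Alg_s K T) (src \<beta>) (src \<alpha>)) (comp1 (Alg_s K T) (trg \<beta>) (trg \<alpha>))
    (body \<beta> \<star> body \<alpha>)"
  by (simp_all add: Alg_s_def)

lemma alg_cell1_cases: obtains X a Y b f where "F = Cell (X, a) (Y, b) f"
  by (metis cell.exhaust surj_pair)

lemma alg_cell2_cases: obtains X a Y b f X' a' Y' b' f' \<alpha>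
  where "\<tau> = Cell (Cell (X, a) (Y, b) f) (Cell (X', a') (Y', b') f') \<alpha>"
  by (metis cell.exhaust surj_pair)

lemma strict_as_ps_Cell1:
  assumes "F \<in> Cell1 (Alg_s K T)"
  shows "pseudomorphism K T (F1 (strict_as_ps K T) F)"
proof -
  obtain X a Y b f where F: "F = Cell (X, a) (Y, b) f" by (rule alg_cell1_cases)
  show ?thesis
    unfolding F strict_as_ps_simps cell.sel snd_conv
    by (rule strict_pseudomorphism) (use assms[unfolded F Alg_s_Cell1] in blast)+
qed

lemma strict_as_ps_comp:
  assumes "F \<in> Cell1 (Alg_s K T)" "G \<in> Cell1 (Alg_s K T)" "trg F = src G"
  shows "F1 (strict_as_ps K T) (comp1 (Alg_s K T) G F) =
    psmor_comp K T (F1 (strict_as_ps K T) G) (F1 (strict_as_ps K T) F)"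
proof -
  obtain X a Y b f where F: "F = Cell (X, a) (Y, b) f" by (rule alg_cell1_cases)
  obtain Z c g where G: "G = Cell (Y, b) (Z, c) g" using assms(3) F by (cases G rule: alg_cell1_cases) auto
  have h: "a \<in> Cell1 K" "src a = T0 T X" "trg a = X" "b \<in> Cell1 K" "src b = T0 T Y" "trg b = Y"
    "f \<in> Cell1 K" "src f = X" "trg f = Y" "g \<in> Cell1 K" "src g = Y"
    and e: "f \<odot> a = b \<odot> T1 T f"
    using assms(1,2) unfolding F G Alg_s_Cell1 strict_algebra_iff by blast+
  have "g \<odot> b \<odot> T1 T f = g \<odot> f \<odot> a"
    using fn.dom.comp1_extend[OF e, of g] h by simp
  then show ?thesis
    using h by (simp add: F G strict_as_ps_simps Alg_s_ops psmor_comp_def Let_def)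
qed

lemma strict_as_ps_2functor: "strict_2functor (Alg_s K T) (Ps_Alg K T) (strict_as_ps K T)"
proof (intro strict_2functor.intro strict_2functor_axioms.intro Ps_Alg_2category Alg_s_2category, goal_cases)
  case (1 X)
  then show ?case by (cases X) (simp add: strict_as_ps_simps Alg_s_Ob Ps_Alg_simps strict_pseudoalgebra)
next
  case (2 f X Y)
  then show ?case using strict_as_ps_Cell1[of f] by (auto simp: mem_hom1 Ps_Alg_simps) (simp_all add: strict_as_ps_simps)
next
  case (3 \<alpha> f g)
  then have \<alpha>: "\<alpha> \<in> Cell2 (Alg_s K T)" "f = src \<alpha>" "g = trg \<alpha>" by (auto simp: mem_hom2)
  obtain X a Y b p X' a' Y' b' q t where d: "\<alpha> = Cell (Cell (X, a) (Y, b) p) (Cell (X', a') (Y', b') q) t"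
    by (rule alg_cell2_cases)
  have c: "Cell (X, a) (Y, b) p \<in> Cell1 (Alg_s K T)" "Cell (X, a) (Y, b) q \<in> Cell1 (Alg_s K T)"
    and e: "X' = X" "a' = a" "Y' = Y" "b' = b" and t: "t \<in> Cell2 K" "src t = p" "trg t = q" "t \<lhd> a = b \<rhd> T2 T t"
    using \<alpha>(1) unfolding d Alg_s_Cell2 by auto
  have h: "a \<in> Cell1 K" "src a = T0 T X" "trg a = X" "src p = X" "b \<in> Cell1 K" "src b = T0 T Y" "trg b = Y" "trg p = Y"
    "q \<odot> a = b \<odot> T1 T q" "p \<odot> a = b \<odot> T1 T p"
    "p \<in> Cell1 K" "q \<in> Cell1 K" "src q = X" "trg q = Y"
    using c unfolding Alg_s_Cell1 strict_algebra_iff by blast+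
  show ?case
    using strict_as_ps_Cell1[OF c(1)] strict_as_ps_Cell1[OF c(2)] t h
    unfolding \<alpha>(2,3) d e by (simp add: mem_hom2 Ps_Alg_simps strict_as_ps_simps transformation_iff)
next
  case (4 X)
  then show ?case
    by (cases X) (simp add: strict_as_ps_simps Alg_s_ops Ps_Alg_simps Alg_s_Ob strict_algebra_iff)
next
  case (5 f X Y g Z)
  then show ?case using strict_as_ps_comp[of f g] by (auto simp: mem_hom1 Ps_Alg_simps)
next
  case (6 f)
  then show ?case by (simp add: strict_as_ps_simps Alg_s_ops Ps_Alg_simps)
next
  case (7 \<alpha> f g \<beta> h)
  then show ?case by (simp add: strict_as_ps_simps Alg_s_ops Ps_Alg_simps)
next
  case (8 \<alpha> f f' \<beta> g g')
  then have "\<alpha> \<in> Cell2 (Alg_s K T)" "\<beta> \<in> Cell2 (Alg_s K T)" "trg (src \<alpha>) = src (src \<beta>)"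
    by (auto simp: mem_hom2)
  then have "src \<alpha> \<in> Cell1 (Alg_s K T)" "trg \<alpha> \<in> Cell1 (Alg_s K T)" "src \<beta> \<in> Cell1 (Alg_s K T)"
    "trg \<beta> \<in> Cell1 (Alg_s K T)" "trg (src \<alpha>) = src (src \<beta>)" "trg (trg \<alpha>) = src (trg \<beta>)"
    using two_category.ends2[OF two_category.intro[OF Alg_s_2category]] by simp_all
  then show ?case
    using strict_as_ps_comp[of "src \<alpha>" "src \<beta>"] strict_as_ps_comp[of "trg \<alpha>" "trg \<beta>"]
    by (simp add: strict_as_ps_simps(3) Alg_s_ops(5) Ps_Alg_simps(8))
qed

lemma strict_as_ps_n_2functor: "strict_2functor (Alg_s K T) (Ps_Alg_n K T) (strict_as_ps K T)"
  by (rule functor_into_Ps_Alg_n[OF strict_as_ps_2functor])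
    (auto simp: normal_algebra_def strict_as_ps_def Let_def split_beta)

end

section \<open>Restriction of scalars\<close>

locale colax_morphism = colax_monad_morphism K T L R V lam for K T and L (structure) and R V lam

sublocale colax_monad_morphism \<subseteq> colax_morphism
  by unfold_locales

context colax_morphism
begin

lemma lam_cell' [simp]:
  assumes "X \<in> Ob K"
  shows "lam X \<in> Cell1 L" "src (lam X) = T0 R (F0 V X)" "trg (lam X) = F0 V (T0 T X)"
  using lam.lam_cell[OF assms] by simp_all

lemma lam_eta_assoc:
  assumes "X \<in> Ob K" "g \<in> Cell1 L" "src g = F0 V (T0 T X)"
  shows "g \<odot> lam X \<odot> eta R (F0 V X) = g \<odot> F1 V (eta T X)"
proof -
  have "g \<odot> (lam X \<odot> eta R (F0 V X)) = g \<odot> F1 V (eta T X)"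
    using assms(1) by (simp only: lam_eta)
  then show ?thesis
    using assms by simp
qed

lemma lam_mu_assoc:
  assumes "X \<in> Ob K" "g \<in> Cell1 L" "src g = F0 V (T0 T X)"
  shows "g \<odot> lam X \<odot> mu R (F0 V X) = g \<odot> F1 V (mu T X) \<odot> lam (T0 T X) \<odot> T1 R (lam X)"
proof -
  have "g \<odot> (lam X \<odot> mu R (F0 V X)) = g \<odot> (F1 V (mu T X) \<odot> lam (T0 T X) \<odot> T1 R (lam X))"
    using assms(1) by (simp only: lam_mu)
  then show ?thesis
    using assms by simp
qed

lemma lam_nat:
  "[|f \<in> Cell1 K; trg f = Y|] ==> lam Y \<odot> T1 R (F1 V f) = F1 V (T1 T f) \<odot> lam (src f)"
  using lam.nat1[of f "src f" Y] by simp

lemma lam_nat_assoc: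
  "[|f \<in> Cell1 K; trg f = Y; g \<in> Cell1 L; src g = F0 V (T0 T Y)|]
    ==> g \<odot> lam Y \<odot> T1 R (F1 V f) = g \<odot> F1 V (T1 T f) \<odot> lam (src f)"
  using lam.nat1_assoc[of f "src f" Y g] by simp

lemma lam_nat2:
  "[|\<alpha> \<in> Cell2 K; trg (src \<alpha>) = Y|]
    ==> lam Y \<rhd> T2 R (F2 V \<alpha>) = F2 V (T2 T \<alpha>) \<lhd> lam (src (src \<alpha>))"
  using lam.nat2[of \<alpha> "src (src \<alpha>)" Y] by simp

lemma lam_nat2_assoc:
  "[|\<alpha> \<in> Cell2 K; trg (src \<alpha>) = Y; g \<in> Cell1 L; src g = F0 V (T0 T Y)|]
    ==> (g \<odot> lam Y) \<rhd> T2 R (F2 V \<alpha>) = g \<rhd> F2 V (T2 T \<alpha>) \<lhd> lam (src (src \<alpha>))"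
  using lam.nat2_assoc[of \<alpha> "src (src \<alpha>)" Y g] by simp

text \<open>The axioms over \<open>R\<close> apply \<open>T1 R\<close> to the restricted action,
  which itself contains \<open>lam\<close>. These are the images under \<open>T1 R\<close> of the
  colax laws, for use at that inner level.\<close>

lemma R_lam:
  "X \<in> Ob K ==> T1 R (lam X) \<odot> T1 R (eta R (F0 V X)) = T1 R (F1 V (eta T X))"
  "X \<in> Ob K ==> T1 R (lam X) \<odot> T1 R (mu R (F0 V X)) =
    T1 R (F1 V (mu T X)) \<odot> T1 R (lam (T0 T X)) \<odot> T1 R (T1 R (lam X))"
  "[|f \<in> Cell1 K; trg f = Y|] ==>
    T1 R (lam Y) \<odot> T1 R (T1 R (F1 V f)) = T1 R (F1 V (T1 T f)) \<odot> T1 R (lam (src f))"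
  using arg_cong[OF lam_eta[of X], of "T1 R"] arg_cong[OF lam_mu[of X], of "T1 R"]
    arg_cong[OF lam_nat[of f Y], of "T1 R"] by auto

lemma R_lam_assoc:
  "[|X \<in> Ob K; g \<in> Cell1 L; src g = T0 R (F0 V (T0 T X))|]
    ==> g \<odot> T1 R (lam X) \<odot> T1 R (eta R (F0 V X)) = g \<odot> T1 R (F1 V (eta T X))"
  "[|X \<in> Ob K; g \<in> Cell1 L; src g = T0 R (F0 V (T0 T X))|]
    ==> g \<odot> T1 R (lam X) \<odot> T1 R (mu R (F0 V X)) =
      g \<odot> T1 R (F1 V (mu T X)) \<odot> T1 R (lam (T0 T X)) \<odot> T1 R (T1 R (lam X))"
  "[|f \<in> Cell1 K; trg f = Y; g \<in> Cell1 L; src g = T0 R (F0 V (T0 T Y))|]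
    ==> g \<odot> T1 R (lam Y) \<odot> T1 R (T1 R (F1 V f)) =
      g \<odot> T1 R (F1 V (T1 T f)) \<odot> T1 R (lam (src f))"
proof -
  assume "X \<in> Ob K" "g \<in> Cell1 L" "src g = T0 R (F0 V (T0 T X))"
  then show "g \<odot> T1 R (lam X) \<odot> T1 R (eta R (F0 V X)) = g \<odot> T1 R (F1 V (eta T X))"
    "g \<odot> T1 R (lam X) \<odot> T1 R (mu R (F0 V X)) =
      g \<odot> T1 R (F1 V (mu T X)) \<odot> T1 R (lam (T0 T X)) \<odot> T1 R (T1 R (lam X))"
    using arg_cong[OF R_lam(1)[of X], of "comp1 L g"] arg_cong[OF R_lam(2)[of X], of "comp1 L g"] by simp_all
next
  assume "f \<in> Cell1 K" "trg f = Y" "g \<in> Cell1 L" "src g = T0 R (F0 V (T0 T Y))"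
  then show "g \<odot> T1 R (lam Y) \<odot> T1 R (T1 R (F1 V f)) =
      g \<odot> T1 R (F1 V (T1 T f)) \<odot> T1 R (lam (src f))"
    using arg_cong[OF R_lam(3)[of f Y], of "comp1 L g"] T.fn.dom.ends1(2)[of f] by auto
qed

lemma V_assoc:
  "[|f \<in> Cell1 K; h \<in> Cell1 K; trg h = src f; g \<in> Cell1 L; src g = F0 V (trg f)|]
    ==> g \<odot> F1 V f \<odot> F1 V h = g \<odot> F1 V (f \<odot>\<^bsub>K\<^esub> h)"
  by simp

text \<open>Images under \<open>V\<close> of the 2-monad laws. The laws themselves no longer match
  after \<open>V\<close> has been distributed over composites by the simplifier.\<close>

lemma V_monad:
  "[|f \<in> Cell1 K; src f = X|] ==> F1 V (T1 T f) \<odot> F1 V (eta T X) = F1 V (eta T (trg f)) \<odot> F1 V f"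
  "[|f \<in> Cell1 K; src f = X|]
    ==> F1 V (T1 T f) \<odot> F1 V (mu T X) = F1 V (mu T (trg f)) \<odot> F1 V (T1 T (T1 T f))"
  "X \<in> Ob K ==> F1 V (mu T X) \<odot> F1 V (eta T (T0 T X)) = id1 L (F0 V (T0 T X))"
  "X \<in> Ob K ==> F1 V (mu T X) \<odot> F1 V (T1 T (eta T X)) = id1 L (F0 V (T0 T X))"
  "X \<in> Ob K ==> F1 V (mu T X) \<odot> F1 V (mu T (T0 T X)) = F1 V (mu T X) \<odot> F1 V (T1 T (mu T X))"
  using arg_cong[OF T.eta_nat[of f X], of "F1 V"] arg_cong[OF T.mu_nat[of f X], of "F1 V"]
    arg_cong[OF T.unit_left[of X], of "F1 V"] arg_cong[OF T.unit_right[of X], of "F1 V"]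
    arg_cong[OF T.assoc[of X], of "F1 V"] by (auto simp del: T.monad_simps)

lemma V_monad_assoc:
  "[|f \<in> Cell1 K; src f = X; g \<in> Cell1 L; src g = F0 V (T0 T (trg f))|]
    ==> g \<odot> F1 V (T1 T f) \<odot> F1 V (eta T X) = g \<odot> F1 V (eta T (trg f)) \<odot> F1 V f"
  "[|f \<in> Cell1 K; src f = X; g \<in> Cell1 L; src g = F0 V (T0 T (trg f))|]
    ==> g \<odot> F1 V (T1 T f) \<odot> F1 V (mu T X) = g \<odot> F1 V (mu T (trg f)) \<odot> F1 V (T1 T (T1 T f))"
  "[|X \<in> Ob K; g \<in> Cell1 L; src g = F0 V (T0 T X)|] ==> g \<odot> F1 V (mu T X) \<odot> F1 V (eta T (T0 T X)) = g"
  "[|X \<in> Ob K; g \<in> Cell1 L; src g = F0 V (T0 T X)|] ==> g \<odot> F1 V (mu T X) \<odot> F1 V (T1 T (eta T X)) = g"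
  "[|X \<in> Ob K; g \<in> Cell1 L; src g = F0 V (T0 T X)|]
    ==> g \<odot> F1 V (mu T X) \<odot> F1 V (mu T (T0 T X)) = g \<odot> F1 V (mu T X) \<odot> F1 V (T1 T (mu T X))"
  by (subst V_assoc; auto simp: T.eta_nat T.mu_nat)+

text \<open>Together these rules move every \<open>lam\<close> and \<open>T1 R (lam X)\<close> to
  the right of all images under \<open>V\<close>. An axiom over \<open>R\<close> thereby becomes the
  \<open>V\<close>-image of the corresponding axiom over \<open>T\<close>, whiskered with a fixed
  composite of components of \<open>lam\<close>.\<close>

lemmas lam_simps [simp] = V_monad V_monad_assoc lam_eta lam_mu lam_eta_assoc lam_mu_assoc lam_nat lam_nat_assoc lam_nat2 lam_nat2_assoc
  R_lam R_lam_assoc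

lemma restrict_strict_algebra:
  assumes "strict_algebra K T X a"
  shows "strict_algebra L R (F0 V X) (F1 V a \<odot> lam X)"
proof -
  have h: "X \<in> Ob K" "a \<in> Cell1 K" "src a = T0 T X" "trg a = X"
    and e: "a \<odot>\<^bsub>K\<^esub> eta T X = id1 K X" "a \<odot>\<^bsub>K\<^esub> mu T X = a \<odot>\<^bsub>K\<^esub> T1 T a"
    using assms by (simp_all add: T.strict_algebra_iff)
  have "F1 V a \<odot> F1 V (eta T X) = F1 V (id1 K X)"
    using arg_cong[OF e(1), of "F1 V"] h by simp
  moreover have "F1 V a \<odot> F1 V (mu T X) = F1 V a \<odot> F1 V (T1 T a)"
    using arg_cong[OF e(2), of "F1 V"] h by simp
  ultimately show ?thesis
    using h by (simp add: R.strict_algebra_iff)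
qed

text \<open>Each axiom is the image under \<open>V\<close> of the given one, whiskered with the
  comparison of iterated monads: with \<open>lam X\<close> for the unit axioms, with the threefold
  comparison for associativity.\<close>

lemma restrict_pseudoalgebra:
  assumes "pseudoalgebra K T (PsAlg X a i c)"
  shows "pseudoalgebra L R (PsAlg (F0 V X) (F1 V a \<odot> lam X) (F2 V i)
    (F2 V c \<lhd> (lam (T0 T X) \<odot> T1 R (lam X))))"
proof -
  have h: "X \<in> Ob K" "a \<in> Cell1 K" "src a = T0 T X" "trg a = X" "i \<in> Cell2 K" "src i = id1 K X"
      "trg i = a \<odot>\<^bsub>K\<^esub> eta T X" "c \<in> Cell2 K" "src c = a \<odot>\<^bsub>K\<^esub> T1 T a" "trg c = a \<odot>\<^bsub>K\<^esub> mu T X"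
    and inv: "invertible2 K i" "invertible2 K c"
    and e: "(c \<lhd>\<^bsub>K\<^esub> T1 T (eta T X)) \<bullet>\<^bsub>K\<^esub> (a \<rhd>\<^bsub>K\<^esub> T2 T i) = id2 K a"
     "(c \<lhd>\<^bsub>K\<^esub> eta T (T0 T X)) \<bullet>\<^bsub>K\<^esub> (i \<lhd>\<^bsub>K\<^esub> a) = id2 K a"
     "(c \<lhd>\<^bsub>K\<^esub> T1 T (mu T X)) \<bullet>\<^bsub>K\<^esub> (a \<rhd>\<^bsub>K\<^esub> T2 T c) =
       (c \<lhd>\<^bsub>K\<^esub> mu T (T0 T X)) \<bullet>\<^bsub>K\<^esub> (c \<lhd>\<^bsub>K\<^esub> T1 T (T1 T a))"
    using assms unfolding T.pseudoalgebra_iff by blast+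
  have 1: "(F2 V c \<lhd> F1 V (T1 T (eta T X)) \<lhd> lam X) \<bullet> (F1 V a \<rhd> F2 V (T2 T i) \<lhd> lam X) =
      id2 L (F1 V a \<odot> lam X)"
    using arg_cong[OF e(1), of "\<lambda>z. F2 V z \<lhd> lam X"] h by simp
  have 2: "(F2 V c \<lhd> F1 V (eta T (T0 T X)) \<lhd> lam X) \<bullet> (F2 V i \<lhd> F1 V a \<lhd> lam X) =
      id2 L (F1 V a \<odot> lam X)"
    using arg_cong[OF e(2), of "\<lambda>z. F2 V z \<lhd> lam X"] h by simp
  \<comment> \<open>The comparison from the threefold \<open>R\<close> of \<open>V X\<close> to
    \<open>V\<close> of the threefold \<open>T\<close> of \<open>X\<close>.\<close>
  let ?l = "lam (T0 T (T0 T X)) \<odot> T1 R (lam (T0 T X)) \<odot> T1 R (T1 R (lam X))"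
  have 3: "(F2 V c \<lhd> F1 V (T1 T (mu T X)) \<lhd> ?l) \<bullet> (F1 V a \<rhd> F2 V (T2 T c) \<lhd> ?l) =
       (F2 V c \<lhd> F1 V (mu T (T0 T X)) \<lhd> ?l) \<bullet> (F2 V c \<lhd> F1 V (T1 T (T1 T a)) \<lhd> ?l)"
    using arg_cong[OF e(3), of "\<lambda>z. F2 V z \<lhd> ?l"] h by simp
  have "invertible2 L (F2 V i)" "invertible2 L (F2 V c \<lhd> (lam (T0 T X) \<odot> T1 R (lam X)))"
    using h inv by (auto intro!: V.F_invertible2 R.fn.dom.invertible2_hcomp)
  then show ?thesis
    using 1 2 3 h unfolding R.pseudoalgebra_iff by (intro conjI) simp_all
qed

lemma restrict_pseudomorphism:
  assumes "pseudomorphism K T (Cell (PsAlg X a i c) (PsAlg Y b j d) (f, m))"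
  shows "pseudomorphism L R (Cell
    (PsAlg (F0 V X) (F1 V a \<odot> lam X) (F2 V i) (F2 V c \<lhd> (lam (T0 T X) \<odot> T1 R (lam X))))
    (PsAlg (F0 V Y) (F1 V b \<odot> lam Y) (F2 V j) (F2 V d \<lhd> (lam (T0 T Y) \<odot> T1 R (lam Y))))
    (F1 V f, F2 V m \<lhd> lam X))"
proof -
  have ps: "pseudoalgebra K T (PsAlg X a i c)" "pseudoalgebra K T (PsAlg Y b j d)"
    and h1: "f \<in> Cell1 K" "src f = X" "trg f = Y"
     "m \<in> Cell2 K" "src m = b \<odot>\<^bsub>K\<^esub> T1 T f" "trg m = f \<odot>\<^bsub>K\<^esub> a" "invertible2 K m"
    and e: "(m \<lhd>\<^bsub>K\<^esub> eta T X) \<bullet>\<^bsub>K\<^esub> (j \<lhd>\<^bsub>K\<^esub> f) = f \<rhd>\<^bsub>K\<^esub> i"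
     "(m \<lhd>\<^bsub>K\<^esub> mu T X) \<bullet>\<^bsub>K\<^esub> (d \<lhd>\<^bsub>K\<^esub> T1 T (T1 T f)) =
       (f \<rhd>\<^bsub>K\<^esub> c) \<bullet>\<^bsub>K\<^esub> (m \<lhd>\<^bsub>K\<^esub> T1 T a) \<bullet>\<^bsub>K\<^esub> (b \<rhd>\<^bsub>K\<^esub> T2 T m)"
    using assms unfolding T.pseudomorphism_iff by blast+
  have h: "X \<in> Ob K" "a \<in> Cell1 K" "src a = T0 T X" "trg a = X" "i \<in> Cell2 K" "src i = id1 K X"
      "trg i = a \<odot>\<^bsub>K\<^esub> eta T X" "c \<in> Cell2 K" "src c = a \<odot>\<^bsub>K\<^esub> T1 T a" "trg c = a \<odot>\<^bsub>K\<^esub> mu T X"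
      "Y \<in> Ob K" "b \<in> Cell1 K" "src b = T0 T Y" "trg b = Y" "j \<in> Cell2 K" "src j = id1 K Y"
      "trg j = b \<odot>\<^bsub>K\<^esub> eta T Y" "d \<in> Cell2 K" "src d = b \<odot>\<^bsub>K\<^esub> T1 T b" "trg d = b \<odot>\<^bsub>K\<^esub> mu T Y"
    using ps unfolding T.pseudoalgebra_iff by blast+
  have 1: "(F2 V m \<lhd> F1 V (eta T X)) \<bullet> (F2 V j \<lhd> F1 V f) = F1 V f \<rhd> F2 V i"
    using arg_cong[OF e(1), of "F2 V"] h h1 by simp
  \<comment> \<open>The twofold comparison: the multiplication axiom of a morphism starts at the
    second power of the monad.\<close>
  let ?l = "lam (T0 T X) \<odot> T1 R (lam X)"
  have 2: "(F2 V m \<lhd> F1 V (mu T X) \<lhd> ?l) \<bullet> (F2 V d \<lhd> F1 V (T1 T (T1 T f)) \<lhd> ?l) =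
       (F1 V f \<rhd> F2 V c \<lhd> ?l) \<bullet> (F2 V m \<lhd> F1 V (T1 T a) \<lhd> ?l) \<bullet>
       (F1 V b \<rhd> F2 V (T2 T m) \<lhd> ?l)"
    using arg_cong[OF e(2), of "\<lambda>z. F2 V z \<lhd> ?l"] h h1 by simp
  have "invertible2 L (F2 V m \<lhd> lam X)"
    using h h1 by (auto intro!: V.F_invertible2 R.fn.dom.invertible2_hcomp)
  then show ?thesis
    using 1 2 h h1 restrict_pseudoalgebra[OF ps(1)] restrict_pseudoalgebra[OF ps(2)]
    unfolding R.pseudomorphism_iff by (intro conjI) simp_all
qed

lemma restrict_ps_simps:
  "F0 (restrict_ps T L R V lam) (PsAlg X a i c) = PsAlg (F0 V X) (F1 V a \<odot> lam X) (F2 V i)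
     (F2 V c \<lhd> (lam (T0 T X) \<odot> T1 R (lam X)))"
  "F1 (restrict_ps T L R V lam) M = Cell (F0 (restrict_ps T L R V lam) (src M)) (F0 (restrict_ps T L R V lam) (trg M))
     (F1 V (fst (body M)), F2 V (snd (body M)) \<lhd> lam (und (src M)))"
  "F2 (restrict_ps T L R V lam) \<alpha> = Cell (F1 (restrict_ps T L R V lam) (src \<alpha>)) (F1 (restrict_ps T L R V lam) (trg \<alpha>))
     (F2 V (body \<alpha>))"
  by (simp_all add: restrict_ps_def Let_def)

lemma restrict_ps_Cell1:
  "pseudomorphism K T M ==> pseudomorphism L R (F1 (restrict_ps T L R V lam) M)"
  by (cases M rule: T.psmor_cases) (simp add: restrict_ps_simps restrict_pseudomorphism)

lemma restrict_ps_comp: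
  assumes "pseudomorphism K T M" "pseudomorphism K T N" "trg M = src N"
  shows "F1 (restrict_ps T L R V lam) (psmor_comp K T N M) =
    psmor_comp L R (F1 (restrict_ps T L R V lam) N) (F1 (restrict_ps T L R V lam) M)"
proof -
  obtain X a i c where M: "src M = PsAlg X a i c" by (metis psalg.exhaust)
  obtain Y b j d where N: "src N = PsAlg Y b j d" by (metis psalg.exhaust)
  show ?thesis
    using T.psmor_cell[OF assms(1)] T.psmor_cell[OF assms(2)] assms(3) M N
    by (simp add: restrict_ps_simps psmor_comp_def Let_def)
qed

lemma restrict_ps_2functor: "strict_2functor (Ps_Alg K T) (Ps_Alg L R) (restrict_ps T L R V lam)"
proof (intro strict_2functor.intro strict_2functor_axioms.intro T.Ps_Alg_2category R.Ps_Alg_2category, goal_cases)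
  case (1 X)
  then show ?case
    by (cases X) (simp add: restrict_ps_simps T.Ps_Alg_simps R.Ps_Alg_simps restrict_pseudoalgebra)
next
  case (2 f X Y)
  then have "pseudomorphism K T f" "src f = X" "trg f = Y" by (auto simp: mem_hom1 T.Ps_Alg_simps)
  then show ?case using restrict_ps_Cell1[of f] by (simp add: mem_hom1 R.Ps_Alg_simps restrict_ps_simps(2))
next
  case (3 \<alpha> f g)
  then have \<alpha>: "alg_transformation K T \<alpha>" "f = src \<alpha>" "g = trg \<alpha>" by (auto simp: mem_hom2 T.Ps_Alg_simps)
  obtain X a i c Y b j d p m q m' t where
    d: "\<alpha> = Cell (Cell (PsAlg X a i c) (PsAlg Y b j d) (p, m)) (Cell (PsAlg X a i c) (PsAlg Y b j d) (q, m')) t"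
    by (rule T.transformation_cases[OF \<alpha>(1)])
  have e: "(t \<lhd>\<^bsub>K\<^esub> a) \<bullet>\<^bsub>K\<^esub> m = m' \<bullet>\<^bsub>K\<^esub> (b \<rhd>\<^bsub>K\<^esub> T2 T t)"
    and t: "t \<in> Cell2 K" "src t = p" "trg t = q"
    and pm: "pseudomorphism K T (src \<alpha>)" "pseudomorphism K T (trg \<alpha>)"
    using \<alpha>(1) unfolding d T.transformation_iff cell.sel by blast+
  have "pseudoalgebra K T (PsAlg X a i c)" "pseudoalgebra K T (PsAlg Y b j d)"
    and p: "p \<in> Cell1 K" "src p = X" "trg p = Y" "m \<in> Cell2 K" "src m = b \<odot>\<^bsub>K\<^esub> T1 T p" "trg m = p \<odot>\<^bsub>K\<^esub> a"
      "q \<in> Cell1 K" "src q = X" "trg q = Y" "m' \<in> Cell2 K" "src m' = b \<odot>\<^bsub>K\<^esub> T1 T q" "trg m' = q \<odot>\<^bsub>K\<^esub> a"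
    using pm unfolding d cell.sel T.pseudomorphism_iff by blast+
  then have h: "X \<in> Ob K" "a \<in> Cell1 K" "src a = T0 T X" "trg a = X"
      "Y \<in> Ob K" "b \<in> Cell1 K" "src b = T0 T Y" "trg b = Y"
    unfolding T.pseudoalgebra_iff by blast+
  have "(F2 V t \<lhd> F1 V a \<lhd> lam X) \<bullet> (F2 V m \<lhd> lam X) =
     (F2 V m' \<lhd> lam X) \<bullet> (F1 V b \<rhd> F2 V (T2 T t) \<lhd> lam X)"
    using arg_cong[OF e, of "\<lambda>z. F2 V z \<lhd> lam X"] h p t by simp
  then show ?case
    using restrict_ps_Cell1[OF pm(1)] restrict_ps_Cell1[OF pm(2)] h p t
    unfolding \<alpha>(2,3) d by (simp add: mem_hom2 R.Ps_Alg_simps restrict_ps_simps R.transformation_iff)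
next
  case (4 X)
  then show ?case
    by (cases X) (simp add: restrict_ps_simps T.Ps_Alg_simps R.Ps_Alg_simps T.pseudoalgebra_iff)
next
  case (5 f X Y g Z)
  then have "pseudomorphism K T f" "pseudomorphism K T g" "trg f = src g" by (auto simp: mem_hom1 T.Ps_Alg_simps)
  then show ?case using restrict_ps_comp[of f g] by (simp add: T.Ps_Alg_simps R.Ps_Alg_simps)
next
  case (6 f)
  then show ?case by (simp add: restrict_ps_simps T.Ps_Alg_simps R.Ps_Alg_simps T.psmor_cell)
next
  case (7 \<alpha> f g \<beta> h)
  then have "alg_transformation K T \<alpha>" "alg_transformation K T \<beta>" "trg \<alpha> = src \<beta>" by (auto simp: mem_hom2 T.Ps_Alg_simps)
  then show ?case
    by (simp add: restrict_ps_simps T.Ps_Alg_simps R.Ps_Alg_simps T.transformation_cell)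
next
  case (8 \<alpha> f f' \<beta> g g')
  then have "alg_transformation K T \<alpha>" "alg_transformation K T \<beta>" "trg (src \<alpha>) = src (src \<beta>)"
    by (auto simp: mem_hom2 T.Ps_Alg_simps)
  then show ?case
    by (simp add: restrict_ps_simps(3) restrict_ps_comp T.Ps_Alg_simps R.Ps_Alg_simps T.transformation_cell T.psmor_cell)
qed

text \<open>The unit cell is restricted by applying \<open>V\<close> alone, and \<open>V\<close>
  preserves identity 2-cells; so normality survives.\<close>

lemma restrict_ps_n_2functor: "strict_2functor (Ps_Alg_n K T) (Ps_Alg_n L R) (restrict_ps T L R V lam)"
proof (rule R.functor_into_Ps_Alg_n[OF T.functor_from_Ps_Alg_n[OF restrict_ps_2functor]])
  fix A assume "A \<in> Ob (Ps_Alg_n K T)"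
  then show "normal_algebra L (F0 (restrict_ps T L R V lam) A)"
    by (cases A) (auto simp: T.Ps_Alg_n_Ob normal_algebra_def restrict_ps_simps T.pseudoalgebra_iff)
qed

lemma restrict_s_simps:
  "F0 (restrict_s L V lam) (X, a) = (F0 V X, F1 V a \<odot> lam X)"
  "F1 (restrict_s L V lam) f = Cell (F0 (restrict_s L V lam) (src f)) (F0 (restrict_s L V lam) (trg f)) (F1 V (body f))"
  "F2 (restrict_s L V lam) \<alpha> = Cell (F1 (restrict_s L V lam) (src \<alpha>)) (F1 (restrict_s L V lam) (trg \<alpha>)) (F2 V (body \<alpha>))"
  by (simp_all add: restrict_s_def Let_def)

lemma restrict_s_Cell1:
  assumes "F \<in> Cell1 (Alg_s K T)"
  shows "F1 (restrict_s L V lam) F \<in> Cell1 (Alg_s L R)"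
proof -
  obtain X a Y b f where F: "F = Cell (X, a) (Y, b) f" by (rule T.alg_cell1_cases)
  have sa: "strict_algebra K T X a" "strict_algebra K T Y b" and e: "f \<odot>\<^bsub>K\<^esub> a = b \<odot>\<^bsub>K\<^esub> T1 T f"
    and h: "X \<in> Ob K" "a \<in> Cell1 K" "src a = T0 T X" "trg a = X" "Y \<in> Ob K" "b \<in> Cell1 K" "src b = T0 T Y" "trg b = Y"
      "f \<in> Cell1 K" "src f = X" "trg f = Y"
    using assms unfolding F T.Alg_s_Cell1 T.strict_algebra_iff by blast+
  have "F1 V f \<odot> F1 V a = F1 V b \<odot> F1 V (T1 T f)"
    using arg_cong[OF e, of "F1 V"] h by simp
  then show ?thesis
    using h restrict_strict_algebra[OF sa(1)] restrict_strict_algebra[OF sa(2)]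
    by (simp add: F restrict_s_simps R.Alg_s_Cell1)
qed

lemma restrict_s_2functor: "strict_2functor (Alg_s K T) (Alg_s L R) (restrict_s L V lam)"
proof -
  have cell: "body f \<in> Cell1 K \<and> src (body f) = fst (src f) \<and> trg (body f) = fst (trg f)"
    if "f \<in> Cell1 (Alg_s K T)" for f
    using that by (simp add: Alg_s_def mem_hom1)
  have cell2: "body \<alpha> \<in> Cell2 K \<and> src (body \<alpha>) = body (src \<alpha>) \<and> trg (body \<alpha>) = body (trg \<alpha>)"
    if "\<alpha> \<in> Cell2 (Alg_s K T)" for \<alpha>
    using that by (simp add: Alg_s_def mem_hom2)
  interpret A: strict_2category "Alg_s K T" by (rule T.Alg_s_2category)
  show ?thesis
  proof (intro strict_2functor.intro strict_2functor_axioms.intro T.Alg_s_2category R.Alg_s_2category, goal_cases)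
    case (1 X)
    then show ?case by (cases X) (simp add: T.Alg_s_Ob R.Alg_s_Ob restrict_s_simps restrict_strict_algebra)
  next
    case (2 f X Y)
    then show ?case using restrict_s_Cell1[of f] by (simp add: mem_hom1 restrict_s_simps(2))
  next
    case (3 \<alpha> f g)
    then have \<alpha>: "\<alpha> \<in> Cell2 (Alg_s K T)" "f = src \<alpha>" "g = trg \<alpha>" by (auto simp: mem_hom2)
    obtain X a Y b p X' a' Y' b' q t where d: "\<alpha> = Cell (Cell (X, a) (Y, b) p) (Cell (X', a') (Y', b') q) t"
      by (rule T.alg_cell2_cases)
    have c: "Cell (X, a) (Y, b) p \<in> Cell1 (Alg_s K T)" "Cell (X, a) (Y, b) q \<in> Cell1 (Alg_s K T)"
      and e: "X' = X" "a' = a" "Y' = Y" "b' = b" and t: "t \<in> Cell2 K" "src t = p" "trg t = q"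
        "t \<lhd>\<^bsub>K\<^esub> a = b \<rhd>\<^bsub>K\<^esub> T2 T t"
      using \<alpha>(1) unfolding d T.Alg_s_Cell2 by blast+
    have h: "X \<in> Ob K" "Y \<in> Ob K" "a \<in> Cell1 K" "src a = T0 T X" "trg a = X" "b \<in> Cell1 K" "src b = T0 T Y" "trg b = Y"
      "p \<in> Cell1 K" "src p = X" "trg p = Y" "q \<in> Cell1 K" "src q = X" "trg q = Y"
      using c unfolding T.Alg_s_Cell1 T.strict_algebra_iff by blast+
    have "F2 V t \<lhd> F1 V a \<lhd> lam X = F1 V b \<rhd> F2 V (T2 T t) \<lhd> lam X"
      using arg_cong[OF t(4), of "\<lambda>z. F2 V z \<lhd> lam X"] h t(1-3) by simp
    then show ?case
      using restrict_s_Cell1[OF c(1)] restrict_s_Cell1[OF c(2)] t(1-3) h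
      unfolding \<alpha>(2,3) d e by (simp add: mem_hom2 restrict_s_simps R.Alg_s_Cell2)
  next
    case (4 X)
    then show ?case
      by (cases X) (simp add: restrict_s_simps T.Alg_s_ops R.Alg_s_ops T.Alg_s_Ob T.strict_algebra_iff)
  next
    case (5 f X Y g Z)
    then show ?case using cell[of f] cell[of g] by (auto simp: mem_hom1 T.Alg_s_ops R.Alg_s_ops restrict_s_simps)
  next
    case (6 f)
    then show ?case using cell[of f] by (simp add: T.Alg_s_ops R.Alg_s_ops restrict_s_simps)
  next
    case (7 \<alpha> f g \<beta> h)
    then show ?case using cell2[of \<alpha>] cell2[of \<beta>] by (auto simp: mem_hom2 T.Alg_s_ops R.Alg_s_ops restrict_s_simps)
  next
    case (8 \<alpha> f f' \<beta> g g')
    then have c: "\<alpha> \<in> Cell2 (Alg_s K T)" "\<beta> \<in> Cell2 (Alg_s K T)" "trg (src \<alpha>) = src (src \<beta>)"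
      by (auto simp: mem_hom2)
    note b = cell2[OF c(1)] cell2[OF c(2)] cell[OF A.ends2(1)[OF c(1)]] cell[OF A.ends2(1)[OF c(2)]]
      cell[OF A.ends2(2)[OF c(1)]] cell[OF A.ends2(2)[OF c(2)]]
    show ?case
      using c b A.ends2(3,4)[OF c(1)] A.ends2(3,4)[OF c(2)]
      by (simp add: T.Alg_s_ops R.Alg_s_ops restrict_s_simps)
  qed
qed

text \<open>Whiskering an identity gives an identity, so only the 1-cells underneath matter. For the
  multiplication cell, \<open>V\<close> of \<open>a\<close> after \<open>mu T X\<close>, whiskered
  with the twofold comparison, has to be the restricted action after \<open>mu R\<close>; this is
  the law \<open>lam_mu\<close>.\<close>

lemma restrict_strict_as_ps:
  "eq_2fun (Alg_s K T) (restrict_ps T L R V lam \<circ>\<circ> strict_as_ps K T) (strict_as_ps L R \<circ>\<circ> restrict_s L V lam)"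
proof -
  interpret A: strict_2category "Alg_s K T" by (rule T.Alg_s_2category)
  have 0: "F0 (restrict_ps T L R V lam) (F0 (strict_as_ps K T) X) = F0 (strict_as_ps L R) (F0 (restrict_s L V lam) X)"
    if "X \<in> Ob (Alg_s K T)" for X
  proof -
    obtain Y a where X: "X = (Y, a)" by (cases X)
    have "Y \<in> Ob K" "a \<in> Cell1 K" "src a = T0 T Y" "trg a = Y"
      using that unfolding X T.Alg_s_Ob T.strict_algebra_iff by blast+
    then show ?thesis
      by (simp add: X T.strict_as_ps_simps R.strict_as_ps_simps restrict_ps_simps restrict_s_simps)
  qed
  have 1: "F1 (restrict_ps T L R V lam) (F1 (strict_as_ps K T) f) = F1 (strict_as_ps L R) (F1 (restrict_s L V lam) f)"
    if f: "f \<in> Cell1 (Alg_s K T)" for f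
  proof -
    obtain X a Y b g where F: "f = Cell (X, a) (Y, b) g" by (rule T.alg_cell1_cases)
    have h: "X \<in> Ob K" "a \<in> Cell1 K" "src a = T0 T X" "trg a = X" "g \<in> Cell1 K" "src g = X" "trg g = Y"
      using f unfolding F T.Alg_s_Cell1 T.strict_algebra_iff by blast+
    show ?thesis
      using 0[OF A.ends1(1)[OF f]] 0[OF A.ends1(2)[OF f]] h
      by (simp add: F T.strict_as_ps_simps R.strict_as_ps_simps restrict_ps_simps restrict_s_simps)
  qed
  have "F2 (restrict_ps T L R V lam) (F2 (strict_as_ps K T) \<alpha>) = F2 (strict_as_ps L R) (F2 (restrict_s L V lam) \<alpha>)"
    if "\<alpha> \<in> Cell2 (Alg_s K T)" for \<alpha>
    using 1[OF A.ends2(1)[OF that]] 1[OF A.ends2(2)[OF that]]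
    by (simp add: T.strict_as_ps_simps(3) R.strict_as_ps_simps(3) restrict_ps_simps(3) restrict_s_simps(3))
  with 0 1 show ?thesis
    by (simp add: eq_2fun_def)
qed

end

section \<open>The 2-category of categories\<close>

abbreviation ccomp_in ("(_ \<cdot>[_]/ _)" [75, 0, 76] 75) where
  "g \<cdot>[C] f \<equiv> g \<cdot>\<^bsub>C\<^esub> f"

lemma mem_hom: "f \<in> hom C x y \<longleftrightarrow> f \<in> Arr C \<and> cdom C f = x \<and> ccod C f = y"
  by (simp add: hom_def)

lemma cat_ends [simp]:
  "[|category C; f \<in> Arr C|] ==> cdom C f \<in> Obj C" "[|category C; f \<in> Arr C|] ==> ccod C f \<in> Obj C"
  by (auto dest: category.ends)

lemma cat_ide [simp]:
  assumes "category C" "x \<in> Obj C"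
  shows "ide C x \<in> Arr C" "cdom C (ide C x) = x" "ccod C (ide C x) = x"
  using category.ide_in[OF assms] by (auto simp: mem_hom)

lemma cat_comp [simp]:
  assumes "category C" "f \<in> Arr C" "g \<in> Arr C" "ccod C f = cdom C g"
  shows "g \<cdot>[C] f \<in> Arr C" "cdom C (g \<cdot>[C] f) = cdom C f" "ccod C (g \<cdot>[C] f) = ccod C g"
  using category.ccomp_in[OF assms(1), of f "cdom C f" "ccod C f" g "ccod C g"] assms by (auto simp: mem_hom)

lemma cat_unit [simp]:
  "[|category C; f \<in> Arr C; cdom C f = x|] ==> f \<cdot>[C] ide C x = f"
  "[|category C; f \<in> Arr C; ccod C f = x|] ==> ide C x \<cdot>[C] f = f"
  using category.ccomp_ide[of C f "cdom C f" "ccod C f"] category.ide_ccomp[of C f "cdom C f" "ccod C f"]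
  by (auto simp: mem_hom)

lemma cat_assoc [simp]:
  "[|category C; f \<in> Arr C; g \<in> Arr C; h \<in> Arr C; ccod C f = cdom C g; ccod C g = cdom C h|]
    ==> h \<cdot>[C] (g \<cdot>[C] f) = h \<cdot>[C] g \<cdot>[C] f"
  using category.ccomp_assoc[of C f "cdom C f" "ccod C f" g "ccod C g" h "ccod C h"] by (auto simp: mem_hom)

text \<open>The analogue of \<open>comp1_extend\<close> for arrows of a category, again because
  composites are kept left-nested.\<close>

lemma cat_extend:
  assumes "g \<cdot>[C] f = g' \<cdot>[C] f'" "category C" "h \<in> Arr C" "g \<in> Arr C" "f \<in> Arr C" "g' \<in> Arr C" "f' \<in> Arr C"
    "ccod C f = cdom C g" "ccod C g = cdom C h" "ccod C f' = cdom C g'" "ccod C g' = cdom C h"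
  shows "h \<cdot>[C] g \<cdot>[C] f = h \<cdot>[C] g' \<cdot>[C] f'"
  using arg_cong[OF assms(1), of "\<lambda>z. h \<cdot>[C] z"] assms(2-) by simp

lemma inverse_arrows_iff: "inverse_arrows C f g \<longleftrightarrow> f \<in> Arr C \<and> g \<in> Arr C \<and> cdom C g = ccod C f \<and> ccod C g = cdom C f \<and>
     g \<cdot>[C] f = ide C (cdom C f) \<and> f \<cdot>[C] g = ide C (ccod C f)"
  by (auto simp: inverse_arrows_def mem_hom)

lemma inverse_arrows_unique:
  assumes "category C" "inverse_arrows C f g" "inverse_arrows C f g'"
  shows "g = g'"
proof -
  have "g \<cdot>[C] (f \<cdot>[C] g') = g \<cdot>[C] f \<cdot>[C] g'"
    using assms by (intro cat_assoc) (auto simp: inverse_arrows_iff)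
  then show ?thesis
    using assms by (simp add: inverse_arrows_iff)
qed

lemma inv_arrow_eq: "[|category C; inverse_arrows C f g|] ==> inv_arrow C f = g"
  unfolding inv_arrow_def by (rule the_equality, assumption) (rule inverse_arrows_unique)

lemma inv_arrow_inverse: "[|category C; invertible C f|] ==> inverse_arrows C f (inv_arrow C f)"
  using inv_arrow_eq unfolding invertible_def by metis

lemma invertible_arr: "invertible C f ==> f \<in> Arr C"
  by (auto simp: invertible_def inverse_arrows_iff)

lemma inverse_arrows_ide: "[|category C; x \<in> Obj C|] ==> inverse_arrows C (ide C x) (ide C x)"
  by (simp add: inverse_arrows_iff)

lemma inverse_arrows_comp:
  assumes "category C" "inverse_arrows C f f'" "inverse_arrows C g g'" "ccod C f = cdom C g"
  shows "inverse_arrows C (g \<cdot>[C] f) (f' \<cdot>[C] g')"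
proof -
  have h: "f \<in> Arr C" "f' \<in> Arr C" "cdom C f' = ccod C f" "ccod C f' = cdom C f"
     "f' \<cdot>[C] f = ide C (cdom C f)" "f \<cdot>[C] f' = ide C (ccod C f)"
     "g \<in> Arr C" "g' \<in> Arr C" "cdom C g' = ccod C g" "ccod C g' = cdom C g"
     "g' \<cdot>[C] g = ide C (cdom C g)" "g \<cdot>[C] g' = ide C (ccod C g)"
    using assms(2,3) by (simp_all add: inverse_arrows_iff)
  have "f' \<cdot>[C] g' \<cdot>[C] (g \<cdot>[C] f) = f' \<cdot>[C] (g' \<cdot>[C] g) \<cdot>[C] f"
    using assms(1,4) h(1-4,7-10) by simp
  moreover have "g \<cdot>[C] f \<cdot>[C] (f' \<cdot>[C] g') = g \<cdot>[C] (f \<cdot>[C] f') \<cdot>[C] g'"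
    using assms(1,4) h(1-4,7-10) by simp
  ultimately show ?thesis
    using assms(1,4) h by (simp add: inverse_arrows_iff)
qed

lemma invertible_comp:
  "[|category C; invertible C f; invertible C g; ccod C f = cdom C g|] ==> invertible C (g \<cdot>[C] f)"
  unfolding invertible_def by (elim exE, rule exI, rule inverse_arrows_comp)

section \<open>Functors and natural transformations as extensional data\<close>

lemma functor_cats [simp]: "is_functor F ==> category (src F)" "is_functor F ==> category (trg F)"
  by (simp_all add: is_functor_def Let_def)

lemma functor_obj [simp]: "[|is_functor F; x \<in> Obj (src F); trg F = B|] ==> fobj F x \<in> Obj B"
  unfolding is_functor_def Let_def by blast

lemma functor_arr [simp]:
  assumes "is_functor F" "f \<in> Arr (src F)" "trg F = B"
  shows "farr F f \<in> Arr B" "cdom B (farr F f) = fobj F (cdom (src F) f)"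
    "ccod B (farr F f) = fobj F (ccod (src F) f)"
  using assms unfolding is_functor_def Let_def mem_hom by blast+

lemma functor_ide [simp]:
  "[|is_functor F; src F = A; x \<in> Obj A|] ==> farr F (ide A x) = ide (trg F) (fobj F x)"
  unfolding is_functor_def Let_def by blast

lemma functor_comp [simp]:
  "[|is_functor F; src F = A; f \<in> Arr A; g \<in> Arr A; ccod A f = cdom A g|]
    ==> farr F (g \<cdot>[A] f) = farr F g \<cdot>[trg F] farr F f"
  unfolding is_functor_def Let_def by blast

lemma functor_ext: "is_functor F ==> fobj F \<in> extensional (Obj (src F)) \<and> farr F \<in> extensional (Arr (src F))"
  unfolding is_functor_def Let_def by blast

text \<open>Both functions of a functor are extensional, so agreement on objects and arrows gives
  equality on the nose. The strict equations between 1-cells below rest on this.\<close>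

lemma functor_eqI:
  assumes "is_functor F" "is_functor G" "src F = src G" "trg F = trg G"
    "\<And>x. x \<in> Obj (src G) ==> fobj F x = fobj G x" "\<And>f. f \<in> Arr (src G) ==> farr F f = farr G f"
  shows "F = G"
proof -
  have "fobj F = fobj G"
    by (rule extensionalityI[of _ "Obj (src G)"]) (use assms functor_ext in \<open>metis+\<close>)
  moreover have "farr F = farr G"
    by (rule extensionalityI[of _ "Arr (src G)"]) (use assms functor_ext in \<open>metis+\<close>)
  ultimately show ?thesis
    using assms(3,4) by (intro cell.expand) (simp add: prod_eq_iff)
qed

lemma mk_functor_simps [simp]:
  "src (mk_functor A B p q) = A" "trg (mk_functor A B p q) = B"
  "x \<in> Obj A ==> fobj (mk_functor A B p q) x = p x" "f \<in> Arr A ==> farr (mk_functor A B p q) f = q f"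
  by (simp_all add: mk_functor_def)

lemma is_functor_mk:
  assumes "category A" "category B" "\<And>x. x \<in> Obj A ==> p x \<in> Obj B"
    "\<And>f. f \<in> Arr A ==> q f \<in> Arr B \<and> cdom B (q f) = p (cdom A f) \<and> ccod B (q f) = p (ccod A f)"
    "\<And>x. x \<in> Obj A ==> q (ide A x) = ide B (p x)"
    "\<And>f g. [|f \<in> Arr A; g \<in> Arr A; ccod A f = cdom A g|] ==> q (g \<cdot>[A] f) = q g \<cdot>[B] q f"
  shows "is_functor (mk_functor A B p q)"
  using assms by (auto simp: is_functor_def Let_def mk_functor_def mem_hom)

lemma functor_id [simp]:
  "src (id_functor A) = A" "trg (id_functor A) = A" "x \<in> Obj A ==> fobj (id_functor A) x = x"
  "f \<in> Arr A ==> farr (id_functor A) f = f" "category A ==> is_functor (id_functor A)"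
  by (simp_all add: id_functor_def is_functor_mk)

lemma functor_compose [simp]:
  "src (comp_functor G F) = src F" "trg (comp_functor G F) = trg G"
  "x \<in> Obj (src F) ==> fobj (comp_functor G F) x = fobj G (fobj F x)"
  "f \<in> Arr (src F) ==> farr (comp_functor G F) f = farr G (farr F f)"
  by (simp_all add: comp_functor_def)

lemma is_functor_comp [simp]:
  "[|is_functor F; is_functor G; trg F = src G|] ==> is_functor (comp_functor G F)"
  unfolding comp_functor_def by (intro is_functor_mk) auto

lemma comp_functor_id [simp]:
  "[|is_functor F; src F = A|] ==> comp_functor F (id_functor A) = F"
  "[|is_functor F; trg F = A|] ==> comp_functor (id_functor A) F = F"
  by (auto intro!: functor_eqI)

lemma comp_functor_assoc:
  "[|is_functor F; is_functor G; is_functor H; trg F = src G; trg G = src H|]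
    ==> comp_functor H (comp_functor G F) = comp_functor (comp_functor H G) F"
  by (auto intro!: functor_eqI)

lemma ntrans_functors [simp]:
  assumes "is_ntrans \<tau>"
  shows "is_functor (src \<tau>)" "is_functor (trg \<tau>)" "src (trg \<tau>) = src (src \<tau>)" "trg (trg \<tau>) = trg (src \<tau>)"
  using assms unfolding is_ntrans_def Let_def parallel_def by auto

lemma ntrans_arr [simp]:
  assumes "is_ntrans \<tau>" "x \<in> Obj (src (src \<tau>))" "trg (src \<tau>) = B"
  shows "body \<tau> x \<in> Arr B" "cdom B (body \<tau> x) = fobj (src \<tau>) x" "ccod B (body \<tau> x) = fobj (trg \<tau>) x"
  using assms unfolding is_ntrans_def Let_def mem_hom by blast+

lemma ntrans_nat:
  "[|is_ntrans \<tau>; f \<in> Arr (src (src \<tau>)); src (src \<tau>) = A; trg (src \<tau>) = B|]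
    ==> body \<tau> (ccod A f) \<cdot>[B] farr (src \<tau>) f = farr (trg \<tau>) f \<cdot>[B] body \<tau> (cdom A f)"
  unfolding is_ntrans_def Let_def by blast

lemma ntrans_ext: "is_ntrans \<tau> ==> body \<tau> \<in> extensional (Obj (src (src \<tau>)))"
  unfolding is_ntrans_def Let_def by blast

lemma ntrans_eqI:
  assumes "is_ntrans \<sigma>" "is_ntrans \<tau>" "src \<sigma> = src \<tau>" "trg \<sigma> = trg \<tau>"
    "\<And>x. x \<in> Obj (src (src \<tau>)) ==> body \<sigma> x = body \<tau> x"
  shows "\<sigma> = \<tau>"
proof -
  have "body \<sigma> = body \<tau>"
    by (rule extensionalityI[of _ "Obj (src (src \<tau>))"]) (use assms ntrans_ext in \<open>metis+\<close>)
  then show ?thesis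
    using assms(3,4) by (simp add: cell.expand)
qed

lemma mk_ntrans_simps [simp]:
  "src (mk_ntrans F G t) = F" "trg (mk_ntrans F G t) = G"
  "x \<in> Obj (src F) ==> body (mk_ntrans F G t) x = t x"
  by (simp_all add: mk_ntrans_def)

lemma is_ntrans_mk:
  assumes "is_functor F" "is_functor G" "src G = src F" "trg G = trg F"
    "\<And>x. x \<in> Obj (src F) ==> t x \<in> Arr (trg F) \<and> cdom (trg F) (t x) = fobj F x \<and> ccod (trg F) (t x) = fobj G x"
    "\<And>f. f \<in> Arr (src F) ==>
      t (ccod (src F) f) \<cdot>[trg F] farr F f = farr G f \<cdot>[trg F] t (cdom (src F) f)"
  shows "is_ntrans (mk_ntrans F G t)"
  using assms by (auto simp: is_ntrans_def Let_def mk_ntrans_def mem_hom parallel_def)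

lemma ntrans_id [simp]:
  "src (id_ntrans F) = F" "trg (id_ntrans F) = F"
  "x \<in> Obj (src F) ==> body (id_ntrans F) x = ide (trg F) (fobj F x)"
  "is_functor F ==> is_ntrans (id_ntrans F)"
  by (simp_all add: id_ntrans_def is_ntrans_mk)

lemma ntrans_vcomp [simp]:
  "src (vcomp_ntrans \<sigma> \<tau>) = src \<tau>" "trg (vcomp_ntrans \<sigma> \<tau>) = trg \<sigma>"
  "x \<in> Obj (src (src \<tau>)) ==> body (vcomp_ntrans \<sigma> \<tau>) x = body \<sigma> x \<cdot>[trg (src \<tau>)] body \<tau> x"
  by (simp_all add: vcomp_ntrans_def)

lemma is_ntrans_vcomp [simp]:
  assumes "is_ntrans \<tau>" "is_ntrans \<sigma>" "trg \<tau> = src \<sigma>"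
  shows "is_ntrans (vcomp_ntrans \<sigma> \<tau>)"
  unfolding vcomp_ntrans_def
proof (rule is_ntrans_mk, goal_cases)
  case (6 f)
  have e: "src (src \<sigma>) = src (src \<tau>)" "trg (src \<sigma>) = trg (src \<tau>)" "trg \<tau> = src \<sigma>"
    using assms ntrans_functors[of \<tau>] by auto
  have "body \<sigma> (ccod (src (src \<tau>)) f) \<cdot>[trg (src \<tau>)] (body \<tau> (ccod (src (src \<tau>)) f) \<cdot>[trg (src \<tau>)] farr (src \<tau>) f) =
      body \<sigma> (ccod (src (src \<tau>)) f) \<cdot>[trg (src \<tau>)] farr (src \<sigma>) f \<cdot>[trg (src \<tau>)] body \<tau> (cdom (src (src \<tau>)) f)"
    unfolding ntrans_nat[OF assms(1) 6 refl refl] using assms 6 e by simp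
  also have "\<dots> = farr (trg \<sigma>) f \<cdot>[trg (src \<tau>)] body \<sigma> (cdom (src (src \<tau>)) f) \<cdot>[trg (src \<tau>)] body \<tau> (cdom (src (src \<tau>)) f)"
    using ntrans_nat[OF assms(2), of f] 6 e by simp
  finally show ?case
    using assms 6 e by simp
qed (use assms ntrans_functors[of \<tau>] in auto)

lemma ntrans_hcomp [simp]:
  "src (hcomp_ntrans \<sigma> \<tau>) = comp_functor (src \<sigma>) (src \<tau>)" "trg (hcomp_ntrans \<sigma> \<tau>) = comp_functor (trg \<sigma>) (trg \<tau>)"
  "x \<in> Obj (src (src \<tau>)) ==>
    body (hcomp_ntrans \<sigma> \<tau>) x = farr (trg \<sigma>) (body \<tau> x) \<cdot>[trg (src \<sigma>)] body \<sigma> (fobj (src \<tau>) x)"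
  by (simp_all add: hcomp_ntrans_def)

lemma is_ntrans_hcomp [simp]:
  assumes "is_ntrans \<tau>" "is_ntrans \<sigma>" "trg (src \<tau>) = src (src \<sigma>)"
  shows "is_ntrans (hcomp_ntrans \<sigma> \<tau>)"
  unfolding hcomp_ntrans_def
proof (rule is_ntrans_mk, goal_cases)
  case (6 f)
  let ?A = "src (src \<tau>)" and ?B = "trg (src \<tau>)" and ?C = "trg (src \<sigma>)"
  have f: "f \<in> Arr ?A" and c: "category ?A" "category ?B" "category ?C"
    using 6 assms by auto
  have "farr (trg \<sigma>) (body \<tau> (ccod ?A f)) \<cdot>[?C] (body \<sigma> (fobj (src \<tau>) (ccod ?A f)) \<cdot>[?C] farr (src \<sigma>) (farr (src \<tau>) f)) =
      farr (trg \<sigma>) (body \<tau> (ccod ?A f)) \<cdot>[?C] (farr (trg \<sigma>) (farr (src \<tau>) f) \<cdot>[?C] body \<sigma> (fobj (src \<tau>) (cdom ?A f)))"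
    using ntrans_nat[OF assms(2), of "farr (src \<tau>) f"] f assms by simp
  also have "\<dots> = farr (trg \<sigma>) (body \<tau> (ccod ?A f) \<cdot>[?B] farr (src \<tau>) f) \<cdot>[?C] body \<sigma> (fobj (src \<tau>) (cdom ?A f))"
    using f c assms by simp
  also have "body \<tau> (ccod ?A f) \<cdot>[?B] farr (src \<tau>) f = farr (trg \<tau>) f \<cdot>[?B] body \<tau> (cdom ?A f)"
    using ntrans_nat[OF assms(1) f] by simp
  finally show ?case
    using f c assms by simp
qed (use assms in auto)

lemma CAT_simps:
  "C \<in> Ob (CAT k) \<longleftrightarrow> category C \<and> locally_small k C"
  "F \<in> Cell1 (CAT k) \<longleftrightarrow> is_functor F \<and> locally_small k (src F) \<and> locally_small k (trg F)"
  "\<tau> \<in> Cell2 (CAT k) \<longleftrightarrow> is_ntrans \<tau> \<and> locally_small k (src (src \<tau>)) \<and> locally_small k (trg (src \<tau>))"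
  "id1 (CAT k) = id_functor" "comp1 (CAT k) = comp_functor" "id2 (CAT k) = id_ntrans"
  "vcomp (CAT k) = vcomp_ntrans" "hcomp (CAT k) = hcomp_ntrans"
  by (auto simp: CAT_def Let_def)

text \<open>Componentwise, the two sides differ by the order of the two middle factors, and
  naturality of \<open>\<sigma>'\<close> at the arrow \<open>body \<tau> x\<close> exchanges
  them.\<close>

lemma hcomp_interchange:
  assumes "is_ntrans \<tau>" "is_ntrans \<tau>'" "is_ntrans \<sigma>" "is_ntrans \<sigma>'" "trg \<tau> = src \<tau>'" "trg \<sigma> = src \<sigma>'"
    "trg (src \<tau>) = src (src \<sigma>)"
  shows "hcomp_ntrans (vcomp_ntrans \<sigma>' \<sigma>) (vcomp_ntrans \<tau>' \<tau>) =
    vcomp_ntrans (hcomp_ntrans \<sigma>' \<tau>') (hcomp_ntrans \<sigma> \<tau>)"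
proof (rule ntrans_eqI, goal_cases)
  have e: "src (src \<tau>') = src (src \<tau>)" "trg (src \<tau>') = trg (src \<tau>)" "src (src \<sigma>') = src (src \<sigma>)" "trg (src \<sigma>') = trg (src \<sigma>)"
    using ntrans_functors[OF assms(1)] ntrans_functors[OF assms(3)] assms(5,6) by auto
  {
    case 1
    then show ?case using assms e by simp
  next
    case 2
    then show ?case using assms e by simp
  next
    case (5 x)
    let ?C = "trg (src \<sigma>)"
    have x: "x \<in> Obj (src (src \<tau>))" using 5 by simp
    have n: "body \<sigma>' (fobj (src \<tau>') x) \<cdot>[?C] farr (src \<sigma>') (body \<tau> x) = farr (trg \<sigma>') (body \<tau> x) \<cdot>[?C] body \<sigma>' (fobj (src \<tau>) x)"
      using ntrans_nat[OF assms(4), of "body \<tau> x"] x assms e by simp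
    have "farr (trg \<sigma>') (body \<tau>' x) \<cdot>[?C] body \<sigma>' (fobj (src \<tau>') x) \<cdot>[?C] farr (src \<sigma>') (body \<tau> x) =
        farr (trg \<sigma>') (body \<tau>' x) \<cdot>[?C] farr (trg \<sigma>') (body \<tau> x) \<cdot>[?C] body \<sigma>' (fobj (src \<tau>) x)"
      by (rule cat_extend[OF n]) (use x assms e in simp_all)
    then show ?case
      using x assms e by simp
  }
qed (use assms in simp_all)

lemma CAT_2category: "strict_2category (CAT k)"
proof (rule strict_2category.intro, goal_cases)
  case (17 \<alpha> f f' \<alpha>' f'' \<beta> g g' \<beta>' g'')
  then show ?case by (auto simp: mem_hom2 CAT_simps intro!: hcomp_interchange)
qed (auto simp: mem_hom1 mem_hom2 CAT_simps parallel_def comp_functor_assoc intro!: ntrans_eqI)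

lemmas CAT_two_category = two_category.intro[OF CAT_2category]

text \<open>The 1-cells of \<open>CAT2\<close> with the commuting condition in pointwise form, which
  can serve as a rewrite rule where an equation between composite functors cannot.
  \<open>CAT2_Cell1\<close> shows that both forms agree.\<close>

definition is_square :: "'u func \<Rightarrow> 'u func \<Rightarrow> 'u func \<Rightarrow> 'u func \<Rightarrow> bool" where
  "is_square P Q T S \<longleftrightarrow> is_functor P \<and> is_functor Q \<and> is_functor T \<and> is_functor S \<and>
     src T = src P \<and> trg T = src Q \<and> src S = trg P \<and> trg S = trg Q \<and>
     (\<forall>x \<in> Obj (src P). fobj Q (fobj T x) = fobj S (fobj P x)) \<and>
     (\<forall>f \<in> Arr (src P). farr Q (farr T f) = farr S (farr P f))"

definition is_square2 ::
  "'u func \<Rightarrow> 'u func \<Rightarrow> 'u func \<Rightarrow> 'u func \<Rightarrow> 'u func \<Rightarrow> 'u func \<Rightarrow> 'u ntrans \<Rightarrow> 'u ntrans \<Rightarrow> bool" where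
  "is_square2 P Q T S T' S' \<beta> \<alpha> \<longleftrightarrow> is_square P Q T S \<and> is_square P Q T' S' \<and> is_ntrans \<beta> \<and> is_ntrans \<alpha> \<and>
     src \<beta> = T \<and> trg \<beta> = T' \<and> src \<alpha> = S \<and> trg \<alpha> = S' \<and>
     (\<forall>x \<in> Obj (src P). farr Q (body \<beta> x) = body \<alpha> (fobj P x))"

lemma squareD:
  assumes "is_square P Q T S"
  shows "is_functor P" "is_functor Q" "is_functor T" "is_functor S" "src T = src P" "trg T = src Q"
    "src S = trg P" "trg S = trg Q" "\<And>x. x \<in> Obj (src P) ==> fobj Q (fobj T x) = fobj S (fobj P x)"
    "\<And>f. f \<in> Arr (src P) ==> farr Q (farr T f) = farr S (farr P f)"
  using assms unfolding is_square_def by blast+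

lemma square2D:
  assumes "is_square2 P Q T S T' S' \<beta> \<alpha>"
  shows "is_square P Q T S" "is_square P Q T' S'" "is_ntrans \<beta>" "is_ntrans \<alpha>" "src \<beta> = T" "trg \<beta> = T'"
    "src \<alpha> = S" "trg \<alpha> = S'" "\<And>x. x \<in> Obj (src P) ==> farr Q (body \<beta> x) = body \<alpha> (fobj P x)"
  using assms unfolding is_square2_def by blast+

lemma square2_functors:
  "is_square2 P Q T S T' S' \<beta> \<alpha> ==> is_functor P" "is_square2 P Q T S T' S' \<beta> \<alpha> ==> is_functor Q"
  by (simp_all add: is_square2_def is_square_def)

lemma CAT2_Cell1:
  "Cell P Q (T, S) \<in> Cell1 (CAT2 k) \<longleftrightarrow> is_square P Q T S \<and> locally_small k (src P) \<and> locally_small k (trg P) \<and>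
     locally_small k (src Q) \<and> locally_small k (trg Q)"
proof
  assume "Cell P Q (T, S) \<in> Cell1 (CAT2 k)"
  then have h: "is_functor P" "is_functor Q" "is_functor T" "is_functor S" "src T = src P" "trg T = src Q"
      "src S = trg P" "trg S = trg Q" "comp_functor Q T = comp_functor S P" "locally_small k (src P)"
      "locally_small k (trg P)" "locally_small k (src Q)" "locally_small k (trg Q)"
    by (simp_all add: Arrow_simps CAT_simps)
  have "fobj Q (fobj T x) = fobj S (fobj P x)" if "x \<in> Obj (src P)" for x
    using functor_compose(3)[of x T Q] functor_compose(3)[of x P S] that h by (simp del: functor_compose)
  moreover have "farr Q (farr T x) = farr S (farr P x)" if "x \<in> Arr (src P)" for x
    using functor_compose(4)[of x T Q] functor_compose(4)[of x P S] that h by (simp del: functor_compose)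
  ultimately show "is_square P Q T S \<and> locally_small k (src P) \<and> locally_small k (trg P) \<and>
     locally_small k (src Q) \<and> locally_small k (trg Q)"
    using h by (simp add: is_square_def)
next
  assume h: "is_square P Q T S \<and> locally_small k (src P) \<and> locally_small k (trg P) \<and>
     locally_small k (src Q) \<and> locally_small k (trg Q)"
  then have s: "is_square P Q T S" by simp
  have "comp_functor Q T = comp_functor S P"
    using squareD[OF s] by (auto intro!: functor_eqI)
  then show "Cell P Q (T, S) \<in> Cell1 (CAT2 k)"
    using h squareD[OF s] by (simp add: Arrow_simps CAT_simps)
qed

lemma CAT2_Cell2:
  "Cell (Cell P Q (T, S)) (Cell P' Q' (T', S')) (\<beta>, \<alpha>) \<in> Cell2 (CAT2 k) \<longleftrightarrow> P' = P \<and> Q' = Q \<and>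
     is_square2 P Q T S T' S' \<beta> \<alpha> \<and> locally_small k (src P) \<and> locally_small k (trg P) \<and>
     locally_small k (src Q) \<and> locally_small k (trg Q)"
proof -
  have "hcomp_ntrans (id_ntrans Q) \<beta> = hcomp_ntrans \<alpha> (id_ntrans P) \<longleftrightarrow>
      (\<forall>x \<in> Obj (src P). farr Q (body \<beta> x) = body \<alpha> (fobj P x))"
    if s: "is_square P Q T S" "is_square P Q T' S'" and n: "is_ntrans \<beta>" "is_ntrans \<alpha>" "src \<beta> = T" "trg \<beta> = T'"
      "src \<alpha> = S" "trg \<alpha> = S'"
  proof
    assume e: "hcomp_ntrans (id_ntrans Q) \<beta> = hcomp_ntrans \<alpha> (id_ntrans P)"
    show "\<forall>x \<in> Obj (src P). farr Q (body \<beta> x) = body \<alpha> (fobj P x)"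
    proof
      fix x assume "x \<in> Obj (src P)"
      then show "farr Q (body \<beta> x) = body \<alpha> (fobj P x)"
        using arg_cong[OF e, of "\<lambda>t. body t x"] n squareD[OF s(1)] squareD[OF s(2)] by simp
    qed
  next
    assume e: "\<forall>x \<in> Obj (src P). farr Q (body \<beta> x) = body \<alpha> (fobj P x)"
    \<comment> \<open>Transformations carry their ends, so equal components give an equation only
      after the source functors and the target functors have been identified.\<close>
    have "comp_functor Q T = comp_functor S P" "comp_functor Q T' = comp_functor S' P"
      using squareD[OF s(1)] squareD[OF s(2)] by (auto intro!: functor_eqI)
    then show "hcomp_ntrans (id_ntrans Q) \<beta> = hcomp_ntrans \<alpha> (id_ntrans P)"
      using e n squareD[OF s(1)] squareD[OF s(2)] by (intro ntrans_eqI) simp_all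
  qed
  then show ?thesis
    by (auto simp: Arrow_simps(3) CAT2_Cell1 CAT_simps is_square2_def squareD)
qed

lemma square_cases: obtains P Q T S where "F = Cell P Q (T, S)"
  by (metis cell.exhaust surj_pair)

lemma square2_cases: obtains P Q T S P' Q' T' S' \<beta> \<alpha> where "\<phi> = Cell (Cell P Q (T, S)) (Cell P' Q' (T', S')) (\<beta>, \<alpha>)"
  by (metis cell.exhaust surj_pair)

lemma CAT2_Ob: "P \<in> Ob (CAT2 k) \<longleftrightarrow> is_functor P \<and> locally_small k (src P) \<and> locally_small k (trg P)"
  by (simp add: Arrow_simps CAT_simps)

lemmas CAT2_ops = Arrow_simps(4-8)[of "CAT k", unfolded CAT_simps] for k

section \<open>The comma 2-monad\<close>

lemma comma_Obj: "Pair x u \<in> Obj (comma P) \<longleftrightarrow> x \<in> Obj (src P) \<and> u \<in> Arr (trg P) \<and> cdom (trg P) u = fobj P x"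
  by (simp add: comma_def Let_def liftable_def)

lemma comma_Arr: "Sq (Pair x u) (Pair y w) f v \<in> Arr (comma P) \<longleftrightarrow> Pair x u \<in> Obj (comma P) \<and> Pair y w \<in> Obj (comma P) \<and>
    f \<in> Arr (src P) \<and> cdom (src P) f = x \<and> ccod (src P) f = y \<and> v \<in> Arr (trg P) \<and>
    cdom (trg P) v = ccod (trg P) u \<and> ccod (trg P) v = ccod (trg P) w \<and> v \<cdot>[trg P] u = w \<cdot>[trg P] farr P f"
  by (auto simp: comma_def Let_def mem_hom)

lemma comma_ObjE:
  assumes "X \<in> Obj (comma P)"
  obtains x u where "X = Pair x u" "x \<in> Obj (src P)" "u \<in> Arr (trg P)" "cdom (trg P) u = fobj P x"
  using assms by (auto simp: comma_def Let_def liftable_def)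

lemma comma_ArrE:
  assumes "a \<in> Arr (comma P)"
  obtains x u y w f v where "a = Sq (Pair x u) (Pair y w) f v" "x \<in> Obj (src P)" "u \<in> Arr (trg P)" "cdom (trg P) u = fobj P x"
    "y \<in> Obj (src P)" "w \<in> Arr (trg P)" "cdom (trg P) w = fobj P y"
    "f \<in> Arr (src P)" "cdom (src P) f = x" "ccod (src P) f = y" "v \<in> Arr (trg P)"
    "cdom (trg P) v = ccod (trg P) u" "ccod (trg P) v = ccod (trg P) w" "v \<cdot>[trg P] u = w \<cdot>[trg P] farr P f"
proof -
  have Arr: "Arr (comma P) = {Sq (Pair x u) (Pair y w) f v | x u y w f v. liftable P x u \<and> liftable P y w \<and>
      f \<in> hom (src P) x y \<and> v \<in> hom (trg P) (ccod (trg P) u) (ccod (trg P) w) \<and>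
      v \<cdot>[trg P] u = w \<cdot>[trg P] farr P f}"
    by (simp add: comma_def Let_def)
  show thesis
    using assms unfolding Arr mem_Collect_eq liftable_def mem_hom
    by (elim exE conjE) (rule that, assumption+)
qed

text \<open>Off the comma category the operations are \<open>undefined\<close>, so evaluating a
  composite demands that each factor is known to be an arrow. This is the origin of the many facts
  of the form \<open>Sq (..) (..) f v\<close> in \<open>Arr (comma P)\<close> in the sequel.\<close>

lemma comma_ops:
  "a \<in> Arr (comma P) ==> cdom (comma P) a = sdom a" "a \<in> Arr (comma P) ==> ccod (comma P) a = scod a"
  "X \<in> Obj (comma P) ==> ide (comma P) X = Sq X X (ide (src P) (pfst X)) (ide (trg P) (ccod (trg P) (psnd X)))"
  "[|a \<in> Arr (comma P); b \<in> Arr (comma P); scod a = sdom b|] ==> b \<cdot>[comma P] a =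
     Sq (sdom a) (scod b) (sfst b \<cdot>[src P] sfst a) (ssnd b \<cdot>[trg P] ssnd a)"
  unfolding comma_def Let_def by simp_all

lemmas comma_simps = comma_Obj comma_Arr comma_ops

lemma comma_comp_arr:
  assumes P: "is_functor P" and a: "Sq (Pair x u) (Pair y w) f v \<in> Arr (comma P)"
    and b: "Sq (Pair y w) (Pair z t) g r \<in> Arr (comma P)"
  shows "Sq (Pair x u) (Pair z t) (g \<cdot>[src P] f) (r \<cdot>[trg P] v) \<in> Arr (comma P)"
proof -
  have e: "v \<cdot>[trg P] u = w \<cdot>[trg P] farr P f" "r \<cdot>[trg P] w = t \<cdot>[trg P] farr P g"
    and h: "x \<in> Obj (src P)" "u \<in> Arr (trg P)" "cdom (trg P) u = fobj P x"
      "y \<in> Obj (src P)" "w \<in> Arr (trg P)" "cdom (trg P) w = fobj P y"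
      "z \<in> Obj (src P)" "t \<in> Arr (trg P)" "cdom (trg P) t = fobj P z"
      "f \<in> Arr (src P)" "cdom (src P) f = x" "ccod (src P) f = y" "v \<in> Arr (trg P)"
      "cdom (trg P) v = ccod (trg P) u" "ccod (trg P) v = ccod (trg P) w"
      "g \<in> Arr (src P)" "cdom (src P) g = y" "ccod (src P) g = z" "r \<in> Arr (trg P)"
      "cdom (trg P) r = ccod (trg P) w" "ccod (trg P) r = ccod (trg P) t"
    using a b by (simp_all add: comma_Arr comma_Obj)
  have "r \<cdot>[trg P] v \<cdot>[trg P] u = r \<cdot>[trg P] w \<cdot>[trg P] farr P f"
    by (rule cat_extend[OF e(1)]) (use h P in simp_all)
  also have "\<dots> = t \<cdot>[trg P] farr P g \<cdot>[trg P] farr P f"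
    by (simp only: e(2))
  finally show ?thesis
    using h P by (simp add: comma_Arr comma_Obj)
qed

lemma comma_category [simp]:
  assumes P: "is_functor P"
  shows "category (comma P)"
proof (rule category.intro, goal_cases)
  case (3 a X Y b Z)
  then have ab: "a \<in> Arr (comma P)" "b \<in> Arr (comma P)" "sdom a = X" "scod a = Y" "sdom b = Y" "scod b = Z"
    by (auto simp: mem_hom comma_ops)
  obtain x u y w f v where a: "a = Sq (Pair x u) (Pair y w) f v" by (rule comma_ArrE[OF ab(1)])
  obtain y' w' z t g r where b: "b = Sq (Pair y' w') (Pair z t) g r" by (rule comma_ArrE[OF ab(2)])
  have "y' = y" "w' = w"
    using ab(3-6) a b by auto
  then show ?case
    using comma_comp_arr[OF P ab(1)[unfolded a]] ab(2-6) ab(1) unfolding a b by (auto simp: comma_ops mem_hom)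
next
  case (6 a X Y b Z c W)
  then have ab: "a \<in> Arr (comma P)" "b \<in> Arr (comma P)" "c \<in> Arr (comma P)"
      "sdom a = X" "scod a = Y" "sdom b = Y" "scod b = Z" "sdom c = Z" "scod c = W"
    by (auto simp: mem_hom comma_ops)
  obtain x u y w f v where a: "a = Sq (Pair x u) (Pair y w) f v" "f \<in> Arr (src P)" "cdom (src P) f = x" "ccod (src P) f = y"
      "v \<in> Arr (trg P)" "cdom (trg P) v = ccod (trg P) u" "ccod (trg P) v = ccod (trg P) w"
    by (rule comma_ArrE[OF ab(1)])
  obtain y' w' z t g r where b: "b = Sq (Pair y' w') (Pair z t) g r" "g \<in> Arr (src P)" "cdom (src P) g = y'" "ccod (src P) g = z"
      "r \<in> Arr (trg P)" "cdom (trg P) r = ccod (trg P) w'" "ccod (trg P) r = ccod (trg P) t"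
    by (rule comma_ArrE[OF ab(2)])
  obtain z' t' z'' t'' k q where c: "c = Sq (Pair z' t') (Pair z'' t'') k q" "k \<in> Arr (src P)" "cdom (src P) k = z'" "ccod (src P) k = z''"
      "q \<in> Arr (trg P)" "cdom (trg P) q = ccod (trg P) t'" "ccod (trg P) q = ccod (trg P) t''"
    by (rule comma_ArrE[OF ab(3)])
  have e: "y' = y" "w' = w" "z' = z" "t' = t"
    using ab(4-9) a(1) b(1) c(1) by auto
  note m = ab(1)[unfolded a(1) e] ab(2)[unfolded b(1) e] ab(3)[unfolded c(1) e]
  show ?case
    using m comma_comp_arr[OF P m(1,2)] comma_comp_arr[OF P m(2,3)] a b c P unfolding a(1) b(1) c(1) e
    by (simp add: comma_ops)
next
  case 7
  show ?case by (simp add: comma_def Let_def)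
next
  case 8
  show ?case by (simp add: comma_def Let_def)
next
  case 9
  show ?case by (simp add: comma_def Let_def)
next
  case (10 f g)
  then have "\<not> (f \<in> Arr (comma P) \<and> g \<in> Arr (comma P) \<and> scod f = sdom g)"
    by (auto simp: comma_ops)
  then show ?case
    by (auto simp: comma_def Let_def)
qed (use P in \<open>auto elim!: comma_ArrE comma_ObjE simp: mem_hom comma_simps\<close>)

text \<open>This is where the cardinal has to be infinite. The product embeds into the square of the
  disjoint union \<open>?M\<close>, which is still below \<open>k\<close>; an infinite
  \<open>?M\<close> is equinumerous with its square.\<close>

lemma card_of_Times_ordLess:
  assumes k: "Card_order k" "infinite (Field k)" and "(card_of A, k) \<in> ordLess" "(card_of B, k) \<in> ordLess"
  shows "(card_of (A \<times> B), k) \<in> ordLess"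
proof -
  let ?M = "A <+> B"
  have M: "(card_of ?M, k) \<in> ordLess"
    using assms by (intro card_of_Plus_ordLess_infinite_Field) auto
  \<comment> \<open>The two sets have different types, so the square of their disjoint union is used
    and the pairs are recovered by the two projections.\<close>
  have "A \<times> B \<subseteq> (\<lambda>(p, q). (projl p, projr q)) ` (?M \<times> ?M)"
  proof (intro subsetI image_eqI)
    show "x = (\<lambda>(p, q). (projl p, projr q)) (Inl (fst x), Inr (snd x))" for x :: "'b \<times> 'c"
      by simp
  qed auto
  then have *: "(card_of (A \<times> B), card_of (?M \<times> ?M)) \<in> ordLeq"
    using card_of_mono1 card_of_image ordLeq_transitive by blast
  show ?thesis
  \<comment> \<open>A finite \<open>?M\<close> need not be idempotent, but then the product is
    finite and so below any infinite cardinal.\<close>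
  proof (cases "finite ?M")
    case True
    then have "finite (A \<times> B)"
      by (auto intro: finite_cartesian_product)
    then show ?thesis
      using k card_of_Well_order[of "A \<times> B"] finite_ordLess_infinite[of "card_of (A \<times> B)" k]
      by (simp add: Field_card_of card_order_on_well_order_on)
  next
    case False
    then have "(card_of (?M \<times> ?M), card_of ?M) \<in> ordIso"
      by (rule card_of_Times_same_infinite)
    then show ?thesis
      using * M ordLeq_ordIso_trans ordLeq_ordLess_trans by blast
  qed
qed

text \<open>Between fixed objects an arrow of the comma category is determined by its two
  components, so the hom-set is no larger than a product of one hom-set of \<open>E\<close> and one
  of \<open>B\<close>.\<close>

lemma comma_small:
  assumes "Card_order k" "infinite (Field k)" "is_functor P" "locally_small k (src P)" "locally_small k (trg P)"
  shows "locally_small k (comma P)"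
  unfolding locally_small_def
proof (intro ballI)
  fix X Y assume "X \<in> Obj (comma P)" "Y \<in> Obj (comma P)"
  then obtain x u y w where X: "X = Pair x u" "x \<in> Obj (src P)" "u \<in> Arr (trg P)"
    and Y: "Y = Pair y w" "y \<in> Obj (src P)" "w \<in> Arr (trg P)"
    by (elim comma_ObjE)
  let ?A = "hom (src P) x y \<times> hom (trg P) (ccod (trg P) u) (ccod (trg P) w)"
  have "hom (comma P) X Y \<subseteq> (\<lambda>(f, v). Sq X Y f v) ` ?A"
  proof
    fix a assume "a \<in> hom (comma P) X Y"
    then have a: "a \<in> Arr (comma P)" "sdom a = X" "scod a = Y"
      by (auto simp: mem_hom comma_ops)
    then have "a = (\<lambda>(f, v). Sq X Y f v) (sfst a, ssnd a)" "(sfst a, ssnd a) \<in> ?A"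
      using X Y by (auto simp: mem_hom elim!: comma_ArrE)
    then show "a \<in> (\<lambda>(f, v). Sq X Y f v) ` ?A"
      by (rule image_eqI)
  qed
  then have "(card_of (hom (comma P) X Y), card_of ?A) \<in> ordLeq"
    using card_of_mono1 card_of_image ordLeq_transitive by blast
  moreover have "(card_of ?A, k) \<in> ordLess"
    using assms X Y by (intro card_of_Times_ordLess) (auto simp: locally_small_def)
  ultimately show "(card_of (hom (comma P) X Y), k) \<in> ordLess"
    by (rule ordLeq_ordLess_trans)
qed

lemma comma_cod_simps [simp]:
  "src (comma_cod P) = comma P" "trg (comma_cod P) = trg P"
  "Pair x u \<in> Obj (comma P) ==> fobj (comma_cod P) (Pair x u) = ccod (trg P) u"
  "Sq X Y f v \<in> Arr (comma P) ==> farr (comma_cod P) (Sq X Y f v) = v"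
  by (simp_all add: comma_cod_def)

lemma comma_cod_functor [simp]: "is_functor P ==> is_functor (comma_cod P)"
  unfolding comma_cod_def
  by (rule is_functor_mk) (auto elim!: comma_ArrE comma_ObjE simp: comma_simps)

lemma comma_map_simps [simp]:
  "src (comma_map (Cell P Q (T, S))) = comma P" "trg (comma_map (Cell P Q (T, S))) = comma Q"
  "Pair x u \<in> Obj (comma P) ==> fobj (comma_map (Cell P Q (T, S))) (Pair x u) = Pair (fobj T x) (farr S u)"
  "Sq (Pair x u) (Pair y w) f v \<in> Arr (comma P) ==> farr (comma_map (Cell P Q (T, S))) (Sq (Pair x u) (Pair y w) f v) =
     Sq (Pair (fobj T x) (farr S u)) (Pair (fobj T y) (farr S w)) (farr T f) (farr S v)"
  by (simp_all add: comma_map_def)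

lemma comma_map_arr:
  assumes s: "is_square P Q T S" and a: "Sq (Pair x u) (Pair y w) f v \<in> Arr (comma P)"
  shows "Sq (Pair (fobj T x) (farr S u)) (Pair (fobj T y) (farr S w)) (farr T f) (farr S v) \<in> Arr (comma Q)"
proof -
  note [simp] = squareD[OF s]
  have e: "v \<cdot>[trg P] u = w \<cdot>[trg P] farr P f"
    and h: "x \<in> Obj (src P)" "u \<in> Arr (trg P)" "cdom (trg P) u = fobj P x"
      "y \<in> Obj (src P)" "w \<in> Arr (trg P)" "cdom (trg P) w = fobj P y"
      "f \<in> Arr (src P)" "cdom (src P) f = x" "ccod (src P) f = y" "v \<in> Arr (trg P)"
      "cdom (trg P) v = ccod (trg P) u" "ccod (trg P) v = ccod (trg P) w"
    using a by (simp_all add: comma_Arr comma_Obj)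
  have "farr S v \<cdot>[trg Q] farr S u = farr S w \<cdot>[trg Q] farr S (farr P f)"
    using arg_cong[OF e, of "farr S"] h by simp
  then show ?thesis
    using h by (simp add: comma_Arr comma_Obj)
qed

lemma comma_map_functor [simp]:
  assumes s: "is_square P Q T S"
  shows "is_functor (comma_map (Cell P Q (T, S)))"
proof -
  note [simp] = squareD[OF s]
  show ?thesis
    unfolding comma_map_def Let_def cell.sel prod.case
  proof (rule is_functor_mk, goal_cases)
    case (4 a)
    then show ?case
      using comma_map_arr[OF s] by (auto elim!: comma_ArrE simp: comma_ops comma_Arr comma_Obj)
  next
    case (6 a b)
    obtain x u y w f v where a: "a = Sq (Pair x u) (Pair y w) f v" "f \<in> Arr (src P)" "cdom (src P) f = x" "ccod (src P) f = y"
        "v \<in> Arr (trg P)" "cdom (trg P) v = ccod (trg P) u" "ccod (trg P) v = ccod (trg P) w"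
      by (rule comma_ArrE[OF 6(1)])
    obtain y' w' z t g r where b: "b = Sq (Pair y' w') (Pair z t) g r" "g \<in> Arr (src P)" "cdom (src P) g = y'" "ccod (src P) g = z"
        "r \<in> Arr (trg P)" "cdom (trg P) r = ccod (trg P) w'" "ccod (trg P) r = ccod (trg P) t"
      by (rule comma_ArrE[OF 6(2)])
    have e: "y' = y" "w' = w"
      using 6 a(1) b(1) by (simp_all add: comma_ops)
    show ?case
      using a b 6 comma_map_arr[OF s 6(1)[unfolded a(1)]] comma_map_arr[OF s 6(2)[unfolded b(1)]]
      unfolding e by (simp add: comma_ops)
  qed (auto elim!: comma_ArrE comma_ObjE simp: comma_simps)
qed

lemma comma_map_square:
  assumes s: "is_square P Q T S"
  shows "is_square (comma_cod P) (comma_cod Q) (comma_map (Cell P Q (T, S))) S"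
proof -
  note [simp] = squareD[OF s]
  have *: "farr (comma_map (Cell P Q (T, S))) f \<in> Arr (comma Q)" if "f \<in> Arr (comma P)" for f
    using that comma_map_functor[OF s] by simp
  have **: "fobj (comma_map (Cell P Q (T, S))) f \<in> Obj (comma Q)" if "f \<in> Obj (comma P)" for f
    using that comma_map_functor[OF s] by simp
  have "farr (comma_cod Q) (farr (comma_map (Cell P Q (T, S))) f) = farr S (farr (comma_cod P) f)"
    if "f \<in> Arr (comma P)" for f
    using that *[OF that] by (cases rule: comma_ArrE[OF that]) simp
  moreover have "fobj (comma_cod Q) (fobj (comma_map (Cell P Q (T, S))) f) = fobj S (fobj (comma_cod P) f)"
    if "f \<in> Obj (comma P)" for f
    using that **[OF that] by (cases rule: comma_ObjE[OF that]) simp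
  ultimately show ?thesis
    using s by (simp add: is_square_def)
qed

lemma square_id: "is_functor P ==> is_square P P (id_functor (src P)) (id_functor (trg P))"
  by (simp add: is_square_def)

lemma square_comp:
  assumes "is_square P Q T S" "is_square Q R T' S'"
  shows "is_square P R (comp_functor T' T) (comp_functor S' S)"
  using squareD[OF assms(1)] squareD[OF assms(2)] by (simp add: is_square_def)

lemma comma_map_id: "is_functor P ==> comma_map (Cell P P (id_functor (src P), id_functor (trg P))) = id_functor (comma P)"
  by (rule functor_eqI) (auto elim!: comma_ArrE comma_ObjE simp: comma_simps square_id)

lemma comma_map_comp:
  assumes s: "is_square P Q T S" "is_square Q R T' S'"
  shows "comma_map (Cell P R (comp_functor T' T, comp_functor S' S)) =
    comp_functor (comma_map (Cell Q R (T', S'))) (comma_map (Cell P Q (T, S)))"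
proof (rule functor_eqI, goal_cases)
  have F: "is_functor (comma_map (Cell P Q (T, S)))"
    by (simp add: s)
  {
    case (5 x)
    then have "x \<in> Obj (comma P)" by simp
    then show ?case using functor_obj[OF F, of x] squareD[OF s(1)] by (auto elim!: comma_ObjE simp: comma_Obj)
  next
    case (6 f)
    then have "f \<in> Arr (comma P)" by simp
    then show ?case using functor_arr(1)[OF F, of f] squareD[OF s(1)] by (cases rule: comma_ArrE) (simp add: comma_Arr comma_Obj)
  }
qed (simp_all add: s square_comp[OF s])

text \<open>The total part of \<open>comma_cell\<close>. Squares and transformations are separate
  arguments, so that equations about it can be stated without building 2-cells of
  \<open>CAT2\<close> first.\<close>

definition comma_nt where
  "comma_nt P Q T S T' S' \<beta> \<alpha> = mk_ntrans (comma_map (Cell P Q (T, S))) (comma_map (Cell P Q (T', S')))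
     (\<lambda>X. Sq (fobj (comma_map (Cell P Q (T, S))) X) (fobj (comma_map (Cell P Q (T', S'))) X)
                 (body \<beta> (pfst X)) (body \<alpha> (ccod (trg P) (psnd X))))"

lemma comma_nt_simps [simp]:
  "src (comma_nt P Q T S T' S' \<beta> \<alpha>) = comma_map (Cell P Q (T, S))"
  "trg (comma_nt P Q T S T' S' \<beta> \<alpha>) = comma_map (Cell P Q (T', S'))"
  "Pair x u \<in> Obj (comma P) ==> body (comma_nt P Q T S T' S' \<beta> \<alpha>) (Pair x u) =
    Sq (Pair (fobj T x) (farr S u)) (Pair (fobj T' x) (farr S' u)) (body \<beta> x) (body \<alpha> (ccod (trg P) u))"
  by (simp_all add: comma_nt_def)

lemma comma_sq_simps:
  "comma_sq (Cell P Q (T, S)) = Cell (comma_cod P) (comma_cod Q) (comma_map (Cell P Q (T, S)), S)"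
  "comma_cell (Cell (Cell P Q (T, S)) (Cell P Q (T', S')) (\<beta>, \<alpha>)) =
     Cell (comma_sq (Cell P Q (T, S))) (comma_sq (Cell P Q (T', S'))) (comma_nt P Q T S T' S' \<beta> \<alpha>, \<alpha>)"
  by (simp_all add: comma_sq_def comma_cell_def comma_nt_def Let_def)

lemma comma_nt_ntrans:
  assumes s: "is_square2 P Q T S T' S' \<beta> \<alpha>"
  shows "is_ntrans (comma_nt P Q T S T' S' \<beta> \<alpha>)"
proof -
  note [simp] = square2D[OF s] squareD[OF square2D(1)[OF s]] squareD[OF square2D(2)[OF s]]
  let ?B = "trg Q" and ?E = "src Q"
  have nb: "body \<beta> (ccod (src P) f) \<cdot>[?E] farr T f = farr T' f \<cdot>[?E] body \<beta> (cdom (src P) f)" if "f \<in> Arr (src P)" for f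
    using ntrans_nat[of \<beta> f] that by simp
  have na: "body \<alpha> (ccod (trg P) f) \<cdot>[?B] farr S f = farr S' f \<cdot>[?B] body \<alpha> (cdom (trg P) f)" if "f \<in> Arr (trg P)" for f
    using ntrans_nat[of \<alpha> f] that by simp
  show ?thesis
    unfolding comma_nt_def
  proof (rule is_ntrans_mk, goal_cases)
    case (5 X)
    then obtain x u where X: "X = Pair x u" "x \<in> Obj (src P)" "u \<in> Arr (trg P)" "cdom (trg P) u = fobj P x"
      by (auto elim: comma_ObjE)
    then have "Sq (Pair (fobj T x) (farr S u)) (Pair (fobj T' x) (farr S' u)) (body \<beta> x) (body \<alpha> (ccod (trg P) u)) \<in> Arr (comma Q)"
      using na[of u] by (simp add: comma_simps)
    then show ?case
      using X by (simp add: comma_Obj comma_ops)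
  next
    case (6 a)
    then have "a \<in> Arr (comma P)" by simp
    then obtain x u y w f v where a: "a = Sq (Pair x u) (Pair y w) f v" "x \<in> Obj (src P)" "u \<in> Arr (trg P)" "cdom (trg P) u = fobj P x"
      "y \<in> Obj (src P)" "w \<in> Arr (trg P)" "cdom (trg P) w = fobj P y"
      "f \<in> Arr (src P)" "cdom (src P) f = x" "ccod (src P) f = y" "v \<in> Arr (trg P)"
      "cdom (trg P) v = ccod (trg P) u" "ccod (trg P) v = ccod (trg P) w" "v \<cdot>[trg P] u = w \<cdot>[trg P] farr P f"
      by (rule comma_ArrE)
    have e: "farr S v \<cdot>[?B] farr S u = farr S w \<cdot>[?B] farr S (farr P f)" "farr S' v \<cdot>[?B] farr S' u = farr S' w \<cdot>[?B] farr S' (farr P f)"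
      using arg_cong[OF a(14), of "farr S"] arg_cong[OF a(14), of "farr S'"] a(2-13) by simp_all
    show ?case
      using a(1-13) e na[of u] na[of w] nb[of f] na[of v] by (simp add: a(14) comma_simps)
  qed simp_all
qed

lemma comma_nt_square2:
  assumes s: "is_square2 P Q T S T' S' \<beta> \<alpha>"
  shows "is_square2 (comma_cod P) (comma_cod Q) (comma_map (Cell P Q (T, S))) S (comma_map (Cell P Q (T', S'))) S'
    (comma_nt P Q T S T' S' \<beta> \<alpha>) \<alpha>"
proof -
  note [simp] = square2D[OF s] squareD[OF square2D(1)[OF s]] squareD[OF square2D(2)[OF s]]
  have "farr (comma_cod Q) (body (comma_nt P Q T S T' S' \<beta> \<alpha>) X) = body \<alpha> (fobj (comma_cod P) X)"
    if "X \<in> Obj (comma P)" for X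
    using that ntrans_arr(1)[OF comma_nt_ntrans[OF s], of X]
    by (cases rule: comma_ObjE[OF that]) (simp add: comma_Obj)
  then show ?thesis
    by (simp add: is_square2_def comma_map_square comma_nt_ntrans[OF s])
qed

lemma square2_id:
  assumes "is_square P Q T S"
  shows "is_square2 P Q T S T S (id_ntrans T) (id_ntrans S)"
  using squareD[OF assms] assms by (simp add: is_square2_def)

lemma square2_vcomp:
  assumes "is_square2 P Q T S T' S' \<beta> \<alpha>" "is_square2 P Q T' S' T'' S'' \<beta>' \<alpha>'"
  shows "is_square2 P Q T S T'' S'' (vcomp_ntrans \<beta>' \<beta>) (vcomp_ntrans \<alpha>' \<alpha>)"
  using square2D[OF assms(1)] square2D[OF assms(2)] squareD[OF square2D(1)[OF assms(1)]]
    squareD[OF square2D(2)[OF assms(1)]] squareD[OF square2D(2)[OF assms(2)]]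
  by (simp add: is_square2_def)

lemma square2_hcomp:
  assumes "is_square2 P Q T S T' S' \<beta> \<alpha>" "is_square2 Q R U W U' W' \<beta>' \<alpha>'"
  shows "is_square2 P R (comp_functor U T) (comp_functor W S) (comp_functor U' T') (comp_functor W' S')
    (hcomp_ntrans \<beta>' \<beta>) (hcomp_ntrans \<alpha>' \<alpha>)"
  using square2D[OF assms(1)] square2D[OF assms(2)] squareD[OF square2D(1)[OF assms(1)]]
    squareD[OF square2D(2)[OF assms(1)]] squareD[OF square2D(1)[OF assms(2)]] squareD[OF square2D(2)[OF assms(2)]]
    square_comp[OF square2D(1)[OF assms(1)] square2D(1)[OF assms(2)]]
    square_comp[OF square2D(2)[OF assms(1)] square2D(2)[OF assms(2)]]
  by (simp add: is_square2_def)

lemma comma_nt_id: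
  assumes "is_square P Q T S"
  shows "comma_nt P Q T S T S (id_ntrans T) (id_ntrans S) = id_ntrans (comma_map (Cell P Q (T, S)))"
  using squareD[OF assms] assms
  by (intro ntrans_eqI) (auto simp: comma_nt_ntrans square2_id comma_simps elim!: comma_ObjE)

lemma comma_nt_vcomp:
  assumes "is_square2 P Q T S T' S' \<beta> \<alpha>" "is_square2 P Q T' S' T'' S'' \<beta>' \<alpha>'"
  shows "comma_nt P Q T S T'' S'' (vcomp_ntrans \<beta>' \<beta>) (vcomp_ntrans \<alpha>' \<alpha>) =
    vcomp_ntrans (comma_nt P Q T' S' T'' S'' \<beta>' \<alpha>') (comma_nt P Q T S T' S' \<beta> \<alpha>)"
proof -
  note n = comma_nt_ntrans[OF assms(1)] comma_nt_ntrans[OF assms(2)] comma_nt_ntrans[OF square2_vcomp[OF assms]]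
  note d = square2D[OF assms(1)] square2D[OF assms(2)] squareD[OF square2D(1)[OF assms(1)]]
    squareD[OF square2D(2)[OF assms(1)]] squareD[OF square2D(2)[OF assms(2)]]
  show ?thesis
  proof (rule ntrans_eqI, goal_cases)
    case (5 X)
    then have "X \<in> Obj (comma P)" by simp
    then show ?case
      using ntrans_arr(1)[OF n(1), of X] ntrans_arr(1)[OF n(2), of X] d
      by (cases rule: comma_ObjE) (simp add: comma_Obj comma_ops)
  qed (simp_all add: n)
qed

lemma comma_map_comp2:
  assumes "is_square2 P Q T S T' S' \<beta> \<alpha>" "is_square2 Q R U W U' W' \<beta>' \<alpha>'"
  shows "comma_map (Cell P R (comp_functor U T, comp_functor W S)) =
    comp_functor (comma_map (Cell Q R (U, W))) (comma_map (Cell P Q (T, S)))"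
    "comma_map (Cell P R (comp_functor U' T', comp_functor W' S')) =
    comp_functor (comma_map (Cell Q R (U', W'))) (comma_map (Cell P Q (T', S')))"
  using comma_map_comp[OF square2D(1)[OF assms(1)] square2D(1)[OF assms(2)]]
    comma_map_comp[OF square2D(2)[OF assms(1)] square2D(2)[OF assms(2)]] by simp_all

lemma comma_nt_hcomp:
  assumes "is_square2 P Q T S T' S' \<beta> \<alpha>" "is_square2 Q R U W U' W' \<beta>' \<alpha>'"
  shows "comma_nt P R (comp_functor U T) (comp_functor W S) (comp_functor U' T') (comp_functor W' S')
      (hcomp_ntrans \<beta>' \<beta>) (hcomp_ntrans \<alpha>' \<alpha>) =
    hcomp_ntrans (comma_nt Q R U W U' W' \<beta>' \<alpha>') (comma_nt P Q T S T' S' \<beta> \<alpha>)"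
proof -
  note s = square2D(1)[OF assms(1)] square2D(2)[OF assms(1)] square2D(1)[OF assms(2)] square2D(2)[OF assms(2)]
  note n = comma_nt_ntrans[OF assms(1)] comma_nt_ntrans[OF assms(2)] comma_nt_ntrans[OF square2_hcomp[OF assms]]
  note d = square2D[OF assms(1)] square2D[OF assms(2)] squareD[OF s(1)] squareD[OF s(2)] squareD[OF s(3)] squareD[OF s(4)]
  show ?thesis
  proof (rule ntrans_eqI, goal_cases)
    case (5 X)
    then have "X \<in> Obj (comma P)" by simp
    then obtain x u where X: "X = Pair x u" "x \<in> Obj (src P)" "u \<in> Arr (trg P)" "cdom (trg P) u = fobj P x"
      by (auto elim: comma_ObjE)
    \<comment> \<open>The facts \<open>o\<close>, \<open>a1\<close>, \<open>a2\<close>,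
      \<open>a3\<close> cover the comma objects and arrows that appear when both sides are evaluated
      at \<open>Pair x u\<close>; the evaluation rules hold on members only.\<close>
    have o: "Pair (fobj T x) (farr S u) \<in> Obj (comma Q)"
      using X d by (simp add: comma_Obj)
    have a1: "Sq (Pair (fobj T x) (farr S u)) (Pair (fobj T' x) (farr S' u)) (body \<beta> x) (body \<alpha> (ccod (trg P) u)) \<in> Arr (comma Q)"
      using ntrans_arr(1)[OF n(1), of X] X by (simp add: comma_Obj)
    have a2: "Sq (Pair (fobj U' (fobj T x)) (farr W' (farr S u))) (Pair (fobj U' (fobj T' x)) (farr W' (farr S' u)))
        (farr U' (body \<beta> x)) (farr W' (body \<alpha> (ccod (trg P) u))) \<in> Arr (comma R)"
      by (rule comma_map_arr[OF s(4) a1])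
    have a3: "Sq (Pair (fobj U (fobj T x)) (farr W (farr S u))) (Pair (fobj U' (fobj T x)) (farr W' (farr S u)))
        (body \<beta>' (fobj T x)) (body \<alpha>' (ccod (trg Q) (farr S u))) \<in> Arr (comma R)"
      using ntrans_arr(1)[OF n(2), of "Pair (fobj T x) (farr S u)"] o by simp
    show ?case
      using X o a1 a2 a3 d by (simp add: comma_Obj comma_ops)
  qed (simp_all add: n comma_map_comp s d)
qed

lemma Comma_simps [simp]: "F0 (fn Comma) = comma_cod" "F1 (fn Comma) = comma_sq" "F2 (fn Comma) = comma_cell"
  "eta Comma = comma_unit" "mu Comma = comma_mult"
  by (simp_all add: Comma_def)

lemma comma_2functor:
  assumes k: "Card_order k" "infinite (Field k)"
  shows "strict_2functor (CAT2 k) (CAT2 k) (fn (Comma :: ('a univ func, _, _) monad))"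
proof -
  interpret CAT: strict_2category "CAT k" by (rule CAT_2category)
  note fn = Comma_simps
  note sm = comma_small[OF k]
  have 1: "comma_sq F \<in> Cell1 (CAT2 k)" if "F \<in> Cell1 (CAT2 k)" for F :: "'a univ square"
    using that by (cases F rule: square_cases) (auto simp: comma_sq_simps CAT2_Cell1 comma_map_square sm squareD)
  show ?thesis
  proof (intro strict_2functor.intro strict_2functor_axioms.intro CAT.Arrow_2category, goal_cases)
    case (1 P) then show ?case by (simp add: fn CAT2_Ob sm)
  next
    case (2 F P Q)
    then show ?case using 1[of F] by (cases F rule: square_cases) (auto simp: mem_hom1 fn comma_sq_simps)
  next
    case (3 \<phi> F G)
    then show ?case
      by (cases \<phi> rule: square2_cases)
        (auto simp: mem_hom2 fn comma_sq_simps CAT2_Cell2 comma_nt_square2 intro!: sm elim: square2_functors)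
  next
    case (4 P) then show ?case by (simp add: fn CAT2_Ob CAT2_ops comma_sq_simps comma_map_id)
  next
    case (5 F P Q G R)
    then show ?case
      by (cases F rule: square_cases; cases G rule: square_cases)
        (auto simp: mem_hom1 fn CAT2_ops CAT2_Cell1 comma_sq_simps comma_map_comp)
  next
    case (6 F)
    then show ?case
      by (cases F rule: square_cases) (auto simp: fn CAT2_ops CAT2_Cell1 comma_sq_simps comma_nt_id)
  next
    case (7 \<phi> F G \<psi> H)
    then show ?case
      by (cases \<phi> rule: square2_cases; cases \<psi> rule: square2_cases)
        (auto simp: mem_hom2 fn CAT2_ops CAT2_Cell2 comma_sq_simps comma_nt_vcomp)
  next
    case (8 \<phi> F F' \<psi> G G')
    then show ?case
      by (cases \<phi> rule: square2_cases; cases \<psi> rule: square2_cases)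
        (auto simp: mem_hom2 fn CAT2_ops CAT2_Cell2 comma_sq_simps comma_nt_hcomp intro: comma_map_comp2)
  qed
qed

section \<open>Unit, multiplication and laws of the comma 2-monad\<close>

definition "comma_H P = fst (body (comma_unit P))"
abbreviation "comma2 P \<equiv> comma (comma_cod P)"

definition "comma_M P = fst (body (comma_mult P))"

lemma comma_unit_eq: "comma_unit P = Cell P (comma_cod P) (comma_H P, id_functor (trg P))"
  by (simp add: comma_H_def comma_unit_def Let_def)

lemma comma_mult_eq: "comma_mult P = Cell (comma_cod (comma_cod P)) (comma_cod P) (comma_M P, id_functor (trg P))"
  by (simp add: comma_M_def comma_mult_def Let_def)

lemma comma_H_simps [simp]:
  "src (comma_H P) = src P" "trg (comma_H P) = comma P"
  "x \<in> Obj (src P) ==> fobj (comma_H P) x = Pair x (ide (trg P) (fobj P x))"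
  "f \<in> Arr (src P) ==> farr (comma_H P) f =
    Sq (Pair (cdom (src P) f) (ide (trg P) (fobj P (cdom (src P) f))))
      (Pair (ccod (src P) f) (ide (trg P) (fobj P (ccod (src P) f)))) f (farr P f)"
  by (simp_all add: comma_H_def comma_unit_def Let_def)

lemma comma_M_simps [simp]:
  "src (comma_M P) = comma2 P" "trg (comma_M P) = comma P"
  "Pair (Pair x u) v \<in> Obj (comma2 P) ==> fobj (comma_M P) (Pair (Pair x u) v) =
     Pair x (v \<cdot>[trg P] u)"
  "Sq (Pair (Pair x u) v) (Pair (Pair y w) t) (Sq (Pair x u) (Pair y w) f r) s \<in> Arr (comma2 P) ==>
     farr (comma_M P) (Sq (Pair (Pair x u) v) (Pair (Pair y w) t) (Sq (Pair x u) (Pair y w) f r) s) =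
       Sq (Pair x (v \<cdot>[trg P] u)) (Pair y (t \<cdot>[trg P] w)) f s"
  by (simp_all add: comma_M_def comma_mult_def Let_def)

lemma comma_H_functor [simp]:
  assumes "is_functor P"
  shows "is_functor (comma_H P)"
  unfolding comma_H_def comma_unit_def Let_def cell.sel fst_conv
  by (rule is_functor_mk) (use assms in \<open>auto simp: comma_simps\<close>)

lemma comma2_ObjE:
  assumes "X \<in> Obj (comma2 P)"
  obtains x u v where "X = Pair (Pair x u) v" "x \<in> Obj (src P)" "u \<in> Arr (trg P)" "cdom (trg P) u = fobj P x"
    "v \<in> Arr (trg P)" "cdom (trg P) v = ccod (trg P) u"
  using assms by (auto elim!: comma_ObjE simp: comma_Obj)

lemma comma2_ArrE:
  assumes "a \<in> Arr (comma2 P)"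
  obtains x u v y w t f r s where
    "a = Sq (Pair (Pair x u) v) (Pair (Pair y w) t) (Sq (Pair x u) (Pair y w) f r) s"
    "Pair (Pair x u) v \<in> Obj (comma2 P)" "Pair (Pair y w) t \<in> Obj (comma2 P)"
    "Sq (Pair x u) (Pair y w) f r \<in> Arr (comma P)" "s \<in> Arr (trg P)" "cdom (trg P) s = ccod (trg P) v"
    "ccod (trg P) s = ccod (trg P) t" "s \<cdot>[trg P] v = t \<cdot>[trg P] r"
proof -
  obtain X v Y t F s where a: "a = Sq (Pair X v) (Pair Y t) F s" "X \<in> Obj (comma P)" "v \<in> Arr (trg P)" "cdom (trg P) v = fobj (comma_cod P) X"
      "Y \<in> Obj (comma P)" "t \<in> Arr (trg P)" "cdom (trg P) t = fobj (comma_cod P) Y"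
      "F \<in> Arr (comma P)" "cdom (comma P) F = X" "ccod (comma P) F = Y" "s \<in> Arr (trg P)"
      "cdom (trg P) s = ccod (trg P) v" "ccod (trg P) s = ccod (trg P) t" "s \<cdot>[trg P] v = t \<cdot>[trg P] farr (comma_cod P) F"
    using assms by (rule comma_ArrE[of a "comma_cod P", unfolded comma_cod_simps(1,2)])
  obtain x u y w f r where F: "F = Sq (Pair x u) (Pair y w) f r" by (rule comma_ArrE[OF a(8)])
  have XY: "X = Pair x u" "Y = Pair y w"
    using a(8-10) F by (simp_all add: comma_ops)
  show thesis
    by (rule that[of x u v y w t f r s]) (use a F XY in \<open>simp_all add: comma_Obj\<close>)
qed

lemma comma2_Obj: "Pair (Pair x u) v \<in> Obj (comma2 P) \<longleftrightarrow> Pair x u \<in> Obj (comma P) \<and> v \<in> Arr (trg P) \<and>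
    cdom (trg P) v = ccod (trg P) u"
  by (auto simp: comma_Obj)

lemma comma2_Arr: "Sq (Pair (Pair x u) v) (Pair (Pair y w) t) (Sq (Pair x u) (Pair y w) f r) s \<in> Arr (comma2 P) \<longleftrightarrow>
    Pair (Pair x u) v \<in> Obj (comma2 P) \<and> Pair (Pair y w) t \<in> Obj (comma2 P) \<and>
    Sq (Pair x u) (Pair y w) f r \<in> Arr (comma P) \<and> s \<in> Arr (trg P) \<and> cdom (trg P) s = ccod (trg P) v \<and>
    ccod (trg P) s = ccod (trg P) t \<and> s \<cdot>[trg P] v = t \<cdot>[trg P] r"
  by (auto simp: comma_Arr[of "Pair x u" v "Pair y w"] comma_ops)

text \<open>The commuting square over the inner base arrows and the one over the outer base arrows
  share the side \<open>r\<close>; pasting along it gives the square for the composites.\<close>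

lemma comma_mult_arr:
  assumes P: "is_functor P"
    and a: "Sq (Pair (Pair x u) v) (Pair (Pair y w) t) (Sq (Pair x u) (Pair y w) f r) s \<in> Arr (comma2 P)"
  shows "Sq (Pair x (v \<cdot>[trg P] u)) (Pair y (t \<cdot>[trg P] w)) f s \<in> Arr (comma P)"
proof -
  have h: "x \<in> Obj (src P)" "u \<in> Arr (trg P)" "cdom (trg P) u = fobj P x" "v \<in> Arr (trg P)" "cdom (trg P) v = ccod (trg P) u"
    "y \<in> Obj (src P)" "w \<in> Arr (trg P)" "cdom (trg P) w = fobj P y" "t \<in> Arr (trg P)" "cdom (trg P) t = ccod (trg P) w"
    "f \<in> Arr (src P)" "cdom (src P) f = x" "ccod (src P) f = y" "r \<in> Arr (trg P)"
    "cdom (trg P) r = ccod (trg P) u" "ccod (trg P) r = ccod (trg P) w" "s \<in> Arr (trg P)" "cdom (trg P) s = ccod (trg P) v"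
    "ccod (trg P) s = ccod (trg P) t"
    and e: "r \<cdot>[trg P] u = w \<cdot>[trg P] farr P f" "s \<cdot>[trg P] v = t \<cdot>[trg P] r"
    using a by (simp_all add: comma2_Obj comma_Obj comma_Arr comma2_Arr)
  have "t \<cdot>[trg P] r \<cdot>[trg P] u = t \<cdot>[trg P] w \<cdot>[trg P] farr P f"
    by (rule cat_extend[OF e(1)]) (use h P in simp_all)
  then have "s \<cdot>[trg P] v \<cdot>[trg P] u = t \<cdot>[trg P] w \<cdot>[trg P] farr P f"
    by (simp only: e(2))
  then show ?thesis
    using h P by (simp add: comma_Arr comma_Obj)
qed

lemma comma_M_functor [simp]:
  assumes P: "is_functor P"
  shows "is_functor (comma_M P)"
  unfolding comma_M_def comma_mult_def Let_def cell.sel fst_conv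
proof (rule is_functor_mk, goal_cases)
  case (4 a)
  obtain x u v y w t f r s where a: "a = Sq (Pair (Pair x u) v) (Pair (Pair y w) t) (Sq (Pair x u) (Pair y w) f r) s"
    by (rule comma2_ArrE[OF 4])
  show ?case
    using 4 comma_mult_arr[OF P 4[unfolded a]] unfolding a by (simp add: comma_ops)
next
  case (5 X)
  then show ?case using P by (auto elim!: comma2_ObjE simp: comma_simps)
next
  case (6 a b)
  obtain x u v y w t f r s where a: "a = Sq (Pair (Pair x u) v) (Pair (Pair y w) t) (Sq (Pair x u) (Pair y w) f r) s"
      "Sq (Pair x u) (Pair y w) f r \<in> Arr (comma P)"
    by (rule comma2_ArrE[OF 6(1)])
  obtain x' u' v' y' w' t' f' r' s' where b: "b = Sq (Pair (Pair x' u') v') (Pair (Pair y' w') t') (Sq (Pair x' u') (Pair y' w') f' r') s'"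
      "Sq (Pair x' u') (Pair y' w') f' r' \<in> Arr (comma P)"
    by (rule comma2_ArrE[OF 6(2)])
  have e: "x' = y" "u' = w" "v' = t"
    using 6 a(1) b(1) by (simp_all add: comma_ops)
  show ?case
    using a b 6 comma_mult_arr[OF P 6(1)[unfolded a(1)]] comma_mult_arr[OF P 6(2)[unfolded b(1)]]
    unfolding e by (simp add: comma_ops)
qed (use P in \<open>auto elim!: comma2_ObjE simp: comma_simps\<close>)

text \<open>From here on horizontal composites occur mostly as whiskerings, whose components reduce
  to a single arrow. The general formula, with its factor that is an identity in these cases, is
  therefore taken out of the simplifier below.\<close>

lemma whisker_right_body [simp]:
  assumes "is_ntrans \<sigma>" "is_functor F" "trg F = src (src \<sigma>)" "x \<in> Obj (src F)"
  shows "body (hcomp_ntrans \<sigma> (id_ntrans F)) x = body \<sigma> (fobj F x)"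
  using assms by simp

lemma whisker_left_body [simp]:
  assumes "is_ntrans \<tau>" "is_functor G" "trg (src \<tau>) = src G" "x \<in> Obj (src (src \<tau>))"
  shows "body (hcomp_ntrans (id_ntrans G) \<tau>) x = farr G (body \<tau> x)"
  using assms by simp

declare ntrans_hcomp(3) [simp del]

lemma comma_H_square: "is_functor P ==> is_square P (comma_cod P) (comma_H P) (id_functor (trg P))"
  by (simp add: is_square_def comma_simps)

lemma comma_M_square:
  assumes P: "is_functor P"
  shows "is_square (comma_cod (comma_cod P)) (comma_cod P) (comma_M P) (id_functor (trg P))"
proof -
  have "fobj (comma_cod P) (fobj (comma_M P) X) = fobj (id_functor (trg P)) (fobj (comma_cod (comma_cod P)) X)"
    if "X \<in> Obj (comma2 P)" for X
    by (rule comma2_ObjE[OF that]) (use P in \<open>simp add: comma2_Obj comma_Obj\<close>)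
  moreover have "farr (comma_cod P) (farr (comma_M P) a) = farr (id_functor (trg P)) (farr (comma_cod (comma_cod P)) a)"
    if a: "a \<in> Arr (comma2 P)" for a
  proof (rule comma2_ArrE[OF that])
    fix x u v y w t f r s
    assume "a = Sq (Pair (Pair x u) v) (Pair (Pair y w) t) (Sq (Pair x u) (Pair y w) f r) s" and s: "s \<in> Arr (trg P)"
    then show ?thesis using a comma_mult_arr[OF P, of x u v y w t f r s] by simp
  qed
  ultimately show ?thesis
    using P by (simp add: is_square_def)
qed

lemma comma_H_nat:
  assumes s: "is_square P Q T S"
  shows "comp_functor (comma_map (Cell P Q (T, S))) (comma_H P) = comp_functor (comma_H Q) T"
  by (rule functor_eqI) (use s squareD[OF s] in \<open>auto simp: comma_simps\<close>)

lemma comma_M_nat: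
  assumes s: "is_square P Q T S"
  shows "comp_functor (comma_map (Cell P Q (T, S))) (comma_M P) =
    comp_functor (comma_M Q) (comma_map (Cell (comma_cod P) (comma_cod Q) (comma_map (Cell P Q (T, S)), S)))"
proof (rule functor_eqI, goal_cases)
  note d = squareD[OF s]
  note s2 = comma_map_square[OF s]
  {
    case (5 X)
    then have X: "X \<in> Obj (comma2 P)" using d by simp
    show ?case
      by (rule comma2_ObjE[OF X]) (use d in \<open>simp add: comma2_Obj comma_Obj\<close>)
  next
    case (6 a)
    then have a: "a \<in> Arr (comma2 P)" using d by simp
    show ?case
    proof (rule comma2_ArrE[OF a])
      fix x u v y w t f r s'
      assume e: "a = Sq (Pair (Pair x u) v) (Pair (Pair y w) t) (Sq (Pair x u) (Pair y w) f r) s'"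
        and o: "Pair (Pair x u) v \<in> Obj (comma2 P)" "Pair (Pair y w) t \<in> Obj (comma2 P)"
        and fr: "Sq (Pair x u) (Pair y w) f r \<in> Arr (comma P)"
      have xu: "Pair x u \<in> Obj (comma P)" "Pair y w \<in> Obj (comma P)"
        using o by (auto simp: comma2_Obj)
      have b: "Sq (Pair (Pair (fobj T x) (farr S u)) (farr S v)) (Pair (Pair (fobj T y) (farr S w)) (farr S t))
          (Sq (Pair (fobj T x) (farr S u)) (Pair (fobj T y) (farr S w)) (farr T f) (farr S r)) (farr S s') \<in> Arr (comma (comma_cod Q))"
        using comma_map_arr[OF s2 a[unfolded e]] xu fr by simp
      have uv: "u \<in> Arr (src S)" "v \<in> Arr (src S)" "ccod (src S) u = cdom (src S) v"
          "w \<in> Arr (src S)" "t \<in> Arr (src S)" "ccod (src S) w = cdom (src S) t"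
        using o d by (auto simp: comma2_Obj comma_Obj)
      show ?thesis
        using a b xu fr comma_mult_arr[OF d(1) a[unfolded e]] uv d unfolding e by simp
    qed
  }
qed (use s comma_map_square[OF s] squareD[OF s] in simp_all)

lemma square2_whisker:
  assumes "is_square2 P Q T S T' S' \<beta> \<alpha>"
  shows "hcomp_ntrans \<alpha> (id_ntrans (id_functor (trg P))) = hcomp_ntrans (id_ntrans (id_functor (trg Q))) \<alpha>"
  using square2D[OF assms] squareD[OF square2D(1)[OF assms]] squareD[OF square2D(2)[OF assms]]
  by (intro ntrans_eqI) auto

lemma comma_H_nat2:
  assumes s: "is_square2 P Q T S T' S' \<beta> \<alpha>"
  shows "hcomp_ntrans (comma_nt P Q T S T' S' \<beta> \<alpha>) (id_ntrans (comma_H P)) = hcomp_ntrans (id_ntrans (comma_H Q)) \<beta>"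
proof -
  note d = square2D[OF s] squareD[OF square2D(1)[OF s]] squareD[OF square2D(2)[OF s]]
  note n = comma_nt_ntrans[OF s]
  show ?thesis
  proof (rule ntrans_eqI, goal_cases)
    case (5 x)
    then have x: "x \<in> Obj (src P)" using d by simp
    have o: "Pair x (ide (trg P) (fobj P x)) \<in> Obj (comma P)" using x d by (simp add: comma_Obj)
    have a: "Sq (Pair (fobj T x) (ide (trg Q) (fobj Q (fobj T x)))) (Pair (fobj T' x) (ide (trg Q) (fobj Q (fobj T' x)))) (body \<beta> x) (farr Q (body \<beta> x)) \<in> Arr (comma Q)"
      using functor_arr(1)[OF comma_H_functor[OF d(11)], of "body \<beta> x"] d x by simp
    show ?case
      using x o a d n by simp
  qed (use d n in \<open>simp_all add: comma_H_nat\<close>)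
qed

lemma comma_M_nat2:
  assumes s: "is_square2 P Q T S T' S' \<beta> \<alpha>"
  shows "hcomp_ntrans (comma_nt P Q T S T' S' \<beta> \<alpha>) (id_ntrans (comma_M P)) =
    hcomp_ntrans (id_ntrans (comma_M Q)) (comma_nt (comma_cod P) (comma_cod Q) (comma_map (Cell P Q (T, S))) S
      (comma_map (Cell P Q (T', S'))) S' (comma_nt P Q T S T' S' \<beta> \<alpha>) \<alpha>)"
proof -
  note d = square2D[OF s] squareD[OF square2D(1)[OF s]] squareD[OF square2D(2)[OF s]]
  note n = comma_nt_ntrans[OF s] comma_nt_ntrans[OF comma_nt_square2[OF s]]
  show ?thesis
  proof (rule ntrans_eqI, goal_cases)
    case (5 X)
    then have X: "X \<in> Obj (comma2 P)" using d by simp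
    show ?case
    proof (rule comma2_ObjE[OF X])
      fix x u v assume e: "X = Pair (Pair x u) v" and h: "x \<in> Obj (src P)" "u \<in> Arr (trg P)" "cdom (trg P) u = fobj P x"
        "v \<in> Arr (trg P)" "cdom (trg P) v = ccod (trg P) u"
      have o: "Pair x u \<in> Obj (comma P)" "Pair (Pair x u) v \<in> Obj (comma2 P)" "Pair x (v \<cdot>[trg P] u) \<in> Obj (comma P)"
        using h d by (simp_all add: comma2_Obj comma_Obj)
      have a: "Sq (Pair (Pair (fobj T x) (farr S u)) (farr S v)) (Pair (Pair (fobj T' x) (farr S' u)) (farr S' v))
          (Sq (Pair (fobj T x) (farr S u)) (Pair (fobj T' x) (farr S' u)) (body \<beta> x) (body \<alpha> (ccod (trg P) u))) (body \<alpha> (ccod (trg P) v)) \<in> Arr (comma (comma_cod Q))"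
        using ntrans_arr(1)[OF n(2), of X] X o d h unfolding e by (simp add: comma_map_square)
      have b: "Sq (Pair (fobj T x) (farr S v \<cdot>[trg Q] farr S u)) (Pair (fobj T' x) (farr S' v \<cdot>[trg Q] farr S' u)) (body \<beta> x) (body \<alpha> (ccod (trg P) v)) \<in> Arr (comma Q)"
        using comma_mult_arr[OF d(11) a] .
      show ?thesis
        using X o a b d h n unfolding e
        by (simp add: comma_map_square)
    qed
  qed (use d n in \<open>simp_all add: comma_M_nat comma_map_square\<close>)
qed

lemma comma_unit_laws:
  assumes P: "is_functor P"
  shows "comp_functor (comma_M P) (comma_H (comma_cod P)) = id_functor (comma P)"
    "comp_functor (comma_M P) (comma_map (Cell P (comma_cod P) (comma_H P, id_functor (trg P)))) = id_functor (comma P)"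
  by (rule functor_eqI; use P comma_H_square[OF P] in \<open>auto elim!: comma_ObjE comma_ArrE simp: comma2_Obj comma2_Arr comma_simps\<close>)+

text \<open>On objects this is associativity of composition in the base: (((x, u), v), w) goes to x
  with the composite of u, v, w. On arrows both sides keep the innermost total component and the
  outermost base component.\<close>

lemma comma_assoc_law:
  assumes P: "is_functor P"
  shows "comp_functor (comma_M P) (comma_M (comma_cod P)) =
    comp_functor (comma_M P) (comma_map (Cell (comma_cod (comma_cod P)) (comma_cod P) (comma_M P, id_functor (trg P))))"
proof (rule functor_eqI, goal_cases)
  case (5 X)
  then have X: "X \<in> Obj (comma (comma_cod (comma_cod P)))" by simp
  obtain Y w where "X = Pair Y w" "Y \<in> Obj (comma2 P)" "w \<in> Arr (trg P)" "cdom (trg P) w = fobj (comma_cod (comma_cod P)) Y"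
    by (rule comma_ObjE[OF X]) auto
  then show ?case
    using P by (auto elim!: comma2_ObjE simp: comma2_Obj comma_Obj[of _ _ "comma_cod (comma_cod P)"] comma_Obj[of _ _ P] comma_Obj[of _ _ "comma_cod P"])
next
  case (6 a)
  then have a: "a \<in> Arr (comma (comma_cod (comma_cod P)))" by simp
  obtain Y w Y' w' F s where 1: "a = Sq (Pair Y w) (Pair Y' w') F s" "F \<in> Arr (comma2 P)"
      "cdom (comma2 P) F = Y" "ccod (comma2 P) F = Y'" "w \<in> Arr (trg P)" "cdom (trg P) w = fobj (comma_cod (comma_cod P)) Y"
      "w' \<in> Arr (trg P)" "cdom (trg P) w' = fobj (comma_cod (comma_cod P)) Y'" "s \<in> Arr (trg P)"
    by (rule comma_ArrE[OF a]) auto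
  obtain x u v y t q f r r2 where 2: "F = Sq (Pair (Pair x u) v) (Pair (Pair y t) q) (Sq (Pair x u) (Pair y t) f r) r2"
      "Pair (Pair x u) v \<in> Obj (comma2 P)" "Pair (Pair y t) q \<in> Obj (comma2 P)"
    by (rule comma2_ArrE[OF 1(2)])
  have e: "Y = Pair (Pair x u) v" "Y' = Pair (Pair y t) q"
    using 1(2-4) 2 by (simp_all add: comma_ops)
  have m1: "Sq (Pair (Pair x u) (w \<cdot>[trg P] v)) (Pair (Pair y t) (w' \<cdot>[trg P] q)) (Sq (Pair x u) (Pair y t) f r) s \<in> Arr (comma2 P)"
    using comma_mult_arr[OF comma_cod_functor[OF P], of "Pair x u" v w "Pair y t" q w'] a unfolding 1(1) 2(1) e by simp
  have m2: "Sq (Pair (Pair x (v \<cdot>[trg P] u)) w) (Pair (Pair y (q \<cdot>[trg P] t)) w') (Sq (Pair x (v \<cdot>[trg P] u)) (Pair y (q \<cdot>[trg P] t)) f r2) s \<in> Arr (comma2 P)"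
    using comma_map_arr[OF comma_M_square[OF P] a[unfolded 1(1) e 2(1)]] 1(2)[unfolded 2(1)] 1(5,7,9) 2(2,3) by simp
  have h: "u \<in> Arr (trg P)" "v \<in> Arr (trg P)" "t \<in> Arr (trg P)" "q \<in> Arr (trg P)" "cdom (trg P) v = ccod (trg P) u"
    "cdom (trg P) q = ccod (trg P) t" "cdom (trg P) w = ccod (trg P) v" "cdom (trg P) w' = ccod (trg P) q"
    using 2 1(6,8) unfolding e by (simp_all add: comma2_Obj comma_Obj)
  show ?case
    using a 1 2 m1 m2 h P unfolding e by simp
qed (use P comma_M_square[OF P] in simp_all)

text \<open>An equation of 2-cells includes the equality of their ends. This fact,
  \<open>square2_H\<close> and \<open>square2_M\<close> provide it for the naturality of unit and
  multiplication on 2-cells.\<close>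

lemma square2_base:
  assumes "is_square2 P Q T S T' S' \<beta> \<alpha>"
  shows "comp_functor S (id_functor (trg P)) = comp_functor (id_functor (trg Q)) S"
    "comp_functor S' (id_functor (trg P)) = comp_functor (id_functor (trg Q)) S'"
  using squareD[OF square2D(1)[OF assms]] squareD[OF square2D(2)[OF assms]] by simp_all

lemma square2_H:
  assumes "is_square2 P Q T S T' S' \<beta> \<alpha>"
  shows "comp_functor (comma_map (Cell P Q (T, S))) (comma_H P) = comp_functor (comma_H Q) T"
    "comp_functor (comma_map (Cell P Q (T', S'))) (comma_H P) = comp_functor (comma_H Q) T'"
  by (rule comma_H_nat[OF square2D(1)[OF assms]], rule comma_H_nat[OF square2D(2)[OF assms]])

lemma square2_M:
  assumes "is_square2 P Q T S T' S' \<beta> \<alpha>"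
  shows "comp_functor (comma_map (Cell P Q (T, S))) (comma_M P) =
      comp_functor (comma_M Q) (comma_map (Cell (comma_cod P) (comma_cod Q) (comma_map (Cell P Q (T, S)), S)))"
    "comp_functor (comma_map (Cell P Q (T', S'))) (comma_M P) =
      comp_functor (comma_M Q) (comma_map (Cell (comma_cod P) (comma_cod Q) (comma_map (Cell P Q (T', S')), S')))"
  by (rule comma_M_nat[OF square2D(1)[OF assms]], rule comma_M_nat[OF square2D(2)[OF assms]])

lemma comma_2monad:
  assumes k: "Card_order k" "infinite (Field k)"
  shows "strict_2monad (CAT2 k) (Comma :: ('a univ func, _, _) monad)"
proof -
  interpret CAT: strict_2category "CAT k :: ('a univ cat, _, _) two_cat" by (rule CAT_2category)
  note fn = comma_2functor[OF k] and A = CAT.Arrow_2category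
  note sm = comma_small[OF k]
  have "two_natural (CAT2 k) (CAT2 k) id_2fun (fn Comma) (eta (Comma :: ('a univ func, _, _) monad))"
  proof (intro two_natural.intro two_natural_axioms.intro fn strict_2functor_id A, goal_cases)
    case (1 P)
    then show ?case by (simp add: CAT2_Ob mem_hom1 comma_unit_eq CAT2_Cell1 comma_H_square sm)
  next
    case (2 F P Q)
    then show ?case
      by (cases F rule: square_cases)
        (auto simp: mem_hom1 CAT2_Cell1 comma_unit_eq comma_sq_simps CAT2_ops comma_H_nat squareD)
  next
    case (3 \<phi> F G P Q)
    then show ?case
      by (cases \<phi> rule: square2_cases)
        (auto simp: mem_hom2 CAT2_Cell2 comma_unit_eq comma_sq_simps CAT2_ops comma_H_nat2 comma_H_nat square2_whisker
          intro: square2_base square2_H)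
  qed
  moreover have "two_natural (CAT2 k) (CAT2 k) (fn Comma \<circ>\<circ> fn Comma) (fn Comma) (mu (Comma :: ('a univ func, _, _) monad))"
  proof (intro two_natural.intro two_natural_axioms.intro fn strict_2functor_comp[OF fn fn], goal_cases)
    case (1 P)
    then show ?case by (simp add: CAT2_Ob mem_hom1 comma_mult_eq CAT2_Cell1 comma_M_square sm)
  next
    case (2 F P Q)
    then show ?case
      by (cases F rule: square_cases)
        (auto simp: mem_hom1 CAT2_Cell1 comma_mult_eq comma_sq_simps CAT2_ops comma_M_nat squareD)
  next
    case (3 \<phi> F G P Q)
    then show ?case
      by (cases \<phi> rule: square2_cases)
        (auto simp: mem_hom2 CAT2_Cell2 comma_mult_eq comma_sq_simps CAT2_ops comma_M_nat2 comma_M_nat square2_whisker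
          intro: square2_base square2_M)
  qed
  ultimately show ?thesis
    by (intro strict_2monad.intro fn strict_2monad_axioms.intro)
      (simp_all add: CAT2_Ob comma_mult_eq comma_unit_eq CAT2_ops comma_sq_simps comma_unit_laws comma_assoc_law)
qed

section \<open>The squaring 2-monad\<close>

lemma arrow_Obj [simp]: "Obj (arrow_cat E) = Arr E"
  by (simp add: arrow_cat_def Let_def)

lemma arrow_Arr: "Sq f g r s \<in> Arr (arrow_cat E) \<longleftrightarrow> f \<in> Arr E \<and> g \<in> Arr E \<and> r \<in> Arr E \<and> cdom E r = cdom E f \<and>
    ccod E r = cdom E g \<and> s \<in> Arr E \<and> cdom E s = ccod E f \<and> ccod E s = ccod E g \<and> s \<cdot>[E] f = g \<cdot>[E] r"
  by (auto simp: arrow_cat_def Let_def mem_hom)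

lemma arrow_ArrE:
  assumes "a \<in> Arr (arrow_cat E)"
  obtains f g r s where "a = Sq f g r s" "f \<in> Arr E" "g \<in> Arr E" "r \<in> Arr E" "cdom E r = cdom E f"
    "ccod E r = cdom E g" "s \<in> Arr E" "cdom E s = ccod E f" "ccod E s = ccod E g" "s \<cdot>[E] f = g \<cdot>[E] r"
proof -
  have Arr: "Arr (arrow_cat E) = {Sq f g r s | f g r s. f \<in> Arr E \<and> g \<in> Arr E \<and>
                  r \<in> hom E (cdom E f) (cdom E g) \<and> s \<in> hom E (ccod E f) (ccod E g) \<and>
                  s \<cdot>[E] f = g \<cdot>[E] r}"
    by (simp add: arrow_cat_def Let_def)
  show thesis
    using assms unfolding Arr mem_Collect_eq mem_hom
    by (elim exE conjE) (rule that, assumption+)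
qed

lemma arrow_ops:
  "a \<in> Arr (arrow_cat E) ==> cdom (arrow_cat E) a = sdom a" "a \<in> Arr (arrow_cat E) ==> ccod (arrow_cat E) a = scod a"
  "f \<in> Arr E ==> ide (arrow_cat E) f = Sq f f (ide E (cdom E f)) (ide E (ccod E f))"
  "[|a \<in> Arr (arrow_cat E); b \<in> Arr (arrow_cat E); scod a = sdom b|] ==> b \<cdot>[arrow_cat E] a =
     Sq (sdom a) (scod b) (sfst b \<cdot>[E] sfst a) (ssnd b \<cdot>[E] ssnd a)"
  unfolding arrow_cat_def Let_def by simp_all

lemma arrow_comp_arr:
  assumes E: "category E" and a: "Sq f g r s \<in> Arr (arrow_cat E)" and b: "Sq g h r' s' \<in> Arr (arrow_cat E)"
  shows "Sq f h (r' \<cdot>[E] r) (s' \<cdot>[E] s) \<in> Arr (arrow_cat E)"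
proof -
  have e: "s \<cdot>[E] f = g \<cdot>[E] r" "s' \<cdot>[E] g = h \<cdot>[E] r'"
    and h: "f \<in> Arr E" "g \<in> Arr E" "h \<in> Arr E" "r \<in> Arr E" "cdom E r = cdom E f" "ccod E r = cdom E g"
      "s \<in> Arr E" "cdom E s = ccod E f" "ccod E s = ccod E g" "r' \<in> Arr E" "cdom E r' = cdom E g" "ccod E r' = cdom E h"
      "s' \<in> Arr E" "cdom E s' = ccod E g" "ccod E s' = ccod E h"
    using a b by (simp_all add: arrow_Arr)
  have "s' \<cdot>[E] s \<cdot>[E] f = s' \<cdot>[E] g \<cdot>[E] r"
    by (rule cat_extend[OF e(1)]) (use h E in simp_all)
  also have "\<dots> = h \<cdot>[E] r' \<cdot>[E] r"
    by (simp only: e(2))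
  finally show ?thesis
    using h E by (simp add: arrow_Arr)
qed

lemma arrow_category [simp]:
  assumes E: "category E"
  shows "category (arrow_cat E)"
proof (rule category.intro, goal_cases)
  case (3 a X Y b Z)
  then have ab: "a \<in> Arr (arrow_cat E)" "b \<in> Arr (arrow_cat E)" "sdom a = X" "scod a = Y" "sdom b = Y" "scod b = Z"
    by (auto simp: mem_hom arrow_ops)
  obtain r s where a: "a = Sq X Y r s" by (rule arrow_ArrE[OF ab(1)]) (use ab(3,4) in auto)
  obtain r' s' where b: "b = Sq Y Z r' s'" by (rule arrow_ArrE[OF ab(2)]) (use ab(5,6) in auto)
  show ?case
    using arrow_comp_arr[OF E ab(1,2)[unfolded a b]] ab(1,2) unfolding a b by (simp add: arrow_ops mem_hom)
next
  case (6 a X Y b Z c W)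
  then have ab: "a \<in> Arr (arrow_cat E)" "b \<in> Arr (arrow_cat E)" "c \<in> Arr (arrow_cat E)"
      "sdom a = X" "scod a = Y" "sdom b = Y" "scod b = Z" "sdom c = Z" "scod c = W"
    by (auto simp: mem_hom arrow_ops)
  obtain r s where a: "a = Sq X Y r s" by (rule arrow_ArrE[OF ab(1)]) (use ab(4,5) in auto)
  obtain r' s' where b: "b = Sq Y Z r' s'" by (rule arrow_ArrE[OF ab(2)]) (use ab(6,7) in auto)
  obtain r'' s'' where c: "c = Sq Z W r'' s''" by (rule arrow_ArrE[OF ab(3)]) (use ab(8,9) in auto)
  note m = ab(1-3)[unfolded a b c]
  have h: "r \<in> Arr E" "r' \<in> Arr E" "r'' \<in> Arr E" "s \<in> Arr E" "s' \<in> Arr E" "s'' \<in> Arr E" "ccod E r = cdom E r'"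
    "ccod E r' = cdom E r''" "ccod E s = cdom E s'" "ccod E s' = cdom E s''"
    using m by (simp_all add: arrow_Arr)
  show ?case
    using m arrow_comp_arr[OF E m(1,2)] arrow_comp_arr[OF E m(2,3)] h E unfolding a b c by (simp add: arrow_ops)
next
  case (10 f g)
  then have "\<not> (f \<in> Arr (arrow_cat E) \<and> g \<in> Arr (arrow_cat E) \<and> scod f = sdom g)"
    by (auto simp: arrow_ops)
  then show ?case
    by (auto simp: arrow_cat_def Let_def)
next
  case 7
  show ?case by (simp add: arrow_cat_def Let_def)
next
  case 8
  show ?case by (simp add: arrow_cat_def Let_def)
next
  case 9
  show ?case by (simp add: arrow_cat_def Let_def)
qed (use E in \<open>auto elim!: arrow_ArrE simp: mem_hom arrow_ops arrow_Arr\<close>)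

lemma arrow_small:
  assumes k: "Card_order k" "infinite (Field k)" and "category E" "locally_small k E"
  shows "locally_small k (arrow_cat E)"
  unfolding locally_small_def
proof (intro ballI)
  fix X Y assume "X \<in> Obj (arrow_cat E)" "Y \<in> Obj (arrow_cat E)"
  then have XY: "X \<in> Arr E" "Y \<in> Arr E" by simp_all
  let ?A = "hom E (cdom E X) (cdom E Y) \<times> hom E (ccod E X) (ccod E Y)"
  have "hom (arrow_cat E) X Y \<subseteq> (\<lambda>(f, v). Sq X Y f v) ` ?A"
  proof
    fix a assume "a \<in> hom (arrow_cat E) X Y"
    then have a: "a \<in> Arr (arrow_cat E)" "sdom a = X" "scod a = Y"
      by (auto simp: mem_hom arrow_ops)
    then have "a = (\<lambda>(f, v). Sq X Y f v) (sfst a, ssnd a)" "(sfst a, ssnd a) \<in> ?A"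
      by (auto simp: mem_hom elim!: arrow_ArrE)
    then show "a \<in> (\<lambda>(f, v). Sq X Y f v) ` ?A"
      by (rule image_eqI)
  qed
  then have "(card_of (hom (arrow_cat E) X Y), card_of ?A) \<in> ordLeq"
    using card_of_mono1 card_of_image ordLeq_transitive by blast
  moreover have "(card_of ?A, k) \<in> ordLess"
    using assms XY by (intro card_of_Times_ordLess) (auto simp: locally_small_def)
  ultimately show "(card_of (hom (arrow_cat E) X Y), k) \<in> ordLess"
    by (rule ordLeq_ordLess_trans)
qed

lemma arrow_map_simps [simp]:
  "src (arrow_map F) = arrow_cat (src F)" "trg (arrow_map F) = arrow_cat (trg F)"
  "f \<in> Arr (src F) ==> fobj (arrow_map F) f = farr F f"
  "Sq f g r s \<in> Arr (arrow_cat (src F)) ==> farr (arrow_map F) (Sq f g r s) = Sq (farr F f) (farr F g) (farr F r) (farr F s)"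
  by (simp_all add: arrow_map_def)

lemma arrow_map_arr:
  assumes F: "is_functor F" and a: "Sq f g r s \<in> Arr (arrow_cat (src F))"
  shows "Sq (farr F f) (farr F g) (farr F r) (farr F s) \<in> Arr (arrow_cat (trg F))"
proof -
  have e: "s \<cdot>[src F] f = g \<cdot>[src F] r"
    and h: "f \<in> Arr (src F)" "g \<in> Arr (src F)" "r \<in> Arr (src F)" "cdom (src F) r = cdom (src F) f" "ccod (src F) r = cdom (src F) g"
      "s \<in> Arr (src F)" "cdom (src F) s = ccod (src F) f" "ccod (src F) s = ccod (src F) g"
    using a by (simp_all add: arrow_Arr)
  have "farr F s \<cdot>[trg F] farr F f = farr F g \<cdot>[trg F] farr F r"
    using arg_cong[OF e, of "farr F"] h F by simp
  then show ?thesis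
    using h F by (simp add: arrow_Arr)
qed

lemma arrow_map_functor [simp]:
  assumes F: "is_functor F"
  shows "is_functor (arrow_map F)"
  unfolding arrow_map_def
proof (rule is_functor_mk, goal_cases)
  case (4 a)
  obtain f g r s where a: "a = Sq f g r s"
    by (rule arrow_ArrE[OF 4])
  show ?case
    using 4 arrow_map_arr[OF F 4[unfolded a]] unfolding a by (simp add: arrow_ops)
next
  case (6 a b)
  obtain f g r s where a: "a = Sq f g r s" "r \<in> Arr (src F)" "s \<in> Arr (src F)" "ccod (src F) r = cdom (src F) g" "ccod (src F) s = ccod (src F) g"
    by (rule arrow_ArrE[OF 6(1)])
  obtain g' h r' s' where b: "b = Sq g' h r' s'" "r' \<in> Arr (src F)" "s' \<in> Arr (src F)" "cdom (src F) r' = cdom (src F) g'" "cdom (src F) s' = ccod (src F) g'"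
    by (rule arrow_ArrE[OF 6(2)])
  have e: "g' = g"
    using 6 a(1) b(1) by (simp_all add: arrow_ops)
  show ?case
    using a b 6 arrow_map_arr[OF F 6(1)[unfolded a(1)]] arrow_map_arr[OF F 6(2)[unfolded b(1)]] F
    unfolding e by (simp add: arrow_ops)
qed (use F in \<open>auto elim!: arrow_ArrE simp: arrow_ops arrow_Arr\<close>)

lemma arrow_map_id: "category E ==> arrow_map (id_functor E) = id_functor (arrow_cat E)"
  by (rule functor_eqI) (auto elim!: arrow_ArrE simp: arrow_Arr)

lemma arrow_map_comp:
  assumes F: "is_functor F" and G: "is_functor G" and e: "trg F = src G"
  shows "arrow_map (comp_functor G F) = comp_functor (arrow_map G) (arrow_map F)"
proof (rule functor_eqI, goal_cases)
  case (6 a)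
  then have a: "a \<in> Arr (arrow_cat (src F))" by simp
  obtain f g r s where f: "a = Sq f g r s" "f \<in> Arr (src F)" "g \<in> Arr (src F)" "r \<in> Arr (src F)" "s \<in> Arr (src F)"
    by (rule arrow_ArrE[OF a])
  show ?case
    using arrow_map_arr[OF F a[unfolded f(1)]] a f(2-5) e unfolding f(1) by simp
qed (use assms in simp_all)

lemma arrow_cell_simps [simp]:
  "src (arrow_cell \<tau>) = arrow_map (src \<tau>)" "trg (arrow_cell \<tau>) = arrow_map (trg \<tau>)"
  "f \<in> Arr (src (src \<tau>)) ==> body (arrow_cell \<tau>) f = Sq (farr (src \<tau>) f) (farr (trg \<tau>) f)
     (body \<tau> (cdom (src (src \<tau>)) f)) (body \<tau> (ccod (src (src \<tau>)) f))"
  by (simp_all add: arrow_cell_def Let_def)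

lemma arrow_cell_arr:
  assumes t: "is_ntrans \<tau>" and f: "f \<in> Arr (src (src \<tau>))"
  shows "Sq (farr (src \<tau>) f) (farr (trg \<tau>) f) (body \<tau> (cdom (src (src \<tau>)) f)) (body \<tau> (ccod (src (src \<tau>)) f))
    \<in> Arr (arrow_cat (trg (src \<tau>)))"
  using t f ntrans_nat[OF t f refl refl] by (simp add: arrow_Arr)

lemma arrow_cell_ntrans [simp]:
  assumes t: "is_ntrans \<tau>"
  shows "is_ntrans (arrow_cell \<tau>)"
  unfolding arrow_cell_def Let_def
proof (rule is_ntrans_mk, goal_cases)
  case (5 f)
  then show ?case using arrow_cell_arr[OF t, of f] t by (simp add: arrow_ops)
next
  case (6 a)
  then have a: "a \<in> Arr (arrow_cat (src (src \<tau>)))" by simp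
  obtain f g r s where f: "a = Sq f g r s" "f \<in> Arr (src (src \<tau>))" "g \<in> Arr (src (src \<tau>))" "r \<in> Arr (src (src \<tau>))"
      "cdom (src (src \<tau>)) r = cdom (src (src \<tau>)) f" "ccod (src (src \<tau>)) r = cdom (src (src \<tau>)) g"
      "s \<in> Arr (src (src \<tau>))" "cdom (src (src \<tau>)) s = ccod (src (src \<tau>)) f" "ccod (src (src \<tau>)) s = ccod (src (src \<tau>)) g"
    by (rule arrow_ArrE[OF a])
  have b: "Sq (farr (src \<tau>) f) (farr (src \<tau>) g) (farr (src \<tau>) r) (farr (src \<tau>) s) \<in> Arr (arrow_cat (trg (src \<tau>)))"
    "Sq (farr (trg \<tau>) f) (farr (trg \<tau>) g) (farr (trg \<tau>) r) (farr (trg \<tau>) s) \<in> Arr (arrow_cat (trg (src \<tau>)))"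
    using arrow_map_arr[of "src \<tau>" f g r s] arrow_map_arr[of "trg \<tau>" f g r s] t a unfolding f(1) by simp_all
  show ?case
    using a b arrow_cell_arr[OF t f(2)] arrow_cell_arr[OF t f(3)] t f(2-9)
      ntrans_nat[OF t f(4) refl refl] ntrans_nat[OF t f(7) refl refl]
    unfolding f(1) by (simp add: arrow_ops)
qed (use t in simp_all)

lemma arrow_cell_id: "is_functor F ==> arrow_cell (id_ntrans F) = id_ntrans (arrow_map F)"
  by (rule ntrans_eqI) (simp_all add: arrow_ops)

lemma arrow_cell_vcomp:
  assumes t: "is_ntrans \<sigma>" "is_ntrans \<tau>" "trg \<sigma> = src \<tau>"
  shows "arrow_cell (vcomp_ntrans \<tau> \<sigma>) = vcomp_ntrans (arrow_cell \<tau>) (arrow_cell \<sigma>)"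
proof (rule ntrans_eqI, goal_cases)
  have e: "src (src \<tau>) = src (src \<sigma>)" "trg (src \<tau>) = trg (src \<sigma>)"
    using ntrans_functors[OF t(1)] t(3) by auto
  {
    case (5 f)
    then have f: "f \<in> Arr (src (src \<sigma>))" by simp
    show ?case
      using arrow_cell_arr[OF t(1) f] arrow_cell_arr[OF t(2), of f] f t e by (simp add: arrow_ops)
  }
qed (use t in simp_all)

lemma arrow_cell_hcomp:
  assumes t: "is_ntrans \<sigma>" "is_ntrans \<tau>" "trg (src \<sigma>) = src (src \<tau>)"
  shows "arrow_cell (hcomp_ntrans \<tau> \<sigma>) = hcomp_ntrans (arrow_cell \<tau>) (arrow_cell \<sigma>)"
proof (rule ntrans_eqI, goal_cases)
  case (5 f)
  then have f: "f \<in> Arr (src (src \<sigma>))" by simp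
  have m: "Sq (farr (trg \<tau>) (farr (src \<sigma>) f)) (farr (trg \<tau>) (farr (trg \<sigma>) f))
     (farr (trg \<tau>) (body \<sigma> (cdom (src (src \<sigma>)) f))) (farr (trg \<tau>) (body \<sigma> (ccod (src (src \<sigma>)) f))) \<in> Arr (arrow_cat (trg (src \<tau>)))"
    using arrow_map_arr[of "trg \<tau>", OF _ ] arrow_cell_arr[OF t(1) f] t by simp
  have n: "Sq (farr (src \<tau>) (farr (src \<sigma>) f)) (farr (trg \<tau>) (farr (src \<sigma>) f)) (body \<tau> (fobj (src \<sigma>) (cdom (src (src \<sigma>)) f)))
     (body \<tau> (fobj (src \<sigma>) (ccod (src (src \<sigma>)) f))) \<in> Arr (arrow_cat (trg (src \<tau>)))"
    using arrow_cell_arr[OF t(2), of "farr (src \<sigma>) f"] f t by simp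
  show ?case
    using arrow_cell_arr[OF t(1) f] m n f t by (simp add: arrow_ops ntrans_hcomp(3))
qed (use t in \<open>simp_all add: arrow_map_comp\<close>)

section \<open>Unit, multiplication and laws of the squaring 2-monad\<close>

lemma arrow_unit_simps [simp]:
  "src (arrow_unit E) = E" "trg (arrow_unit E) = arrow_cat E" "x \<in> Obj E ==> fobj (arrow_unit E) x = ide E x"
  "f \<in> Arr E ==> farr (arrow_unit E) f = Sq (ide E (cdom E f)) (ide E (ccod E f)) f f"
  by (simp_all add: arrow_unit_def)

lemma arrow_mult_simps [simp]:
  "src (arrow_mult E) = arrow_cat (arrow_cat E)" "trg (arrow_mult E) = arrow_cat E"
  "Sq f g r s \<in> Arr (arrow_cat E) ==> fobj (arrow_mult E) (Sq f g r s) = s \<cdot>[E] f"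
  "Sq (Sq f g r s) (Sq f' g' r' s') (Sq f f' p q) (Sq g g' p' q') \<in> Arr (arrow_cat (arrow_cat E)) ==>
    farr (arrow_mult E) (Sq (Sq f g r s) (Sq f' g' r' s') (Sq f f' p q) (Sq g g' p' q')) =
      Sq (s \<cdot>[E] f) (s' \<cdot>[E] f') p q'"
  by (simp_all add: arrow_mult_def Let_def)

lemma arrow_unit_functor [simp]: "category E ==> is_functor (arrow_unit E)"
  unfolding arrow_unit_def by (rule is_functor_mk) (auto simp: arrow_Arr arrow_ops)

text \<open>An arrow of the iterated arrow category is a commuting cube: four of its faces are the
  four displayed squares, and the last two equations are the remaining faces.\<close>

lemma arrow2_ArrE:
  assumes "a \<in> Arr (arrow_cat (arrow_cat E))"
  obtains f g r s f' g' r' s' p q p' q' where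
    "a = Sq (Sq f g r s) (Sq f' g' r' s') (Sq f f' p q) (Sq g g' p' q')" "Sq f g r s \<in> Arr (arrow_cat E)"
    "Sq f' g' r' s' \<in> Arr (arrow_cat E)" "Sq f f' p q \<in> Arr (arrow_cat E)" "Sq g g' p' q' \<in> Arr (arrow_cat E)"
    "p' \<cdot>[E] r = r' \<cdot>[E] p" "q' \<cdot>[E] s = s' \<cdot>[E] q"
proof -
  obtain X Y A B where a: "a = Sq X Y A B" "X \<in> Arr (arrow_cat E)" "Y \<in> Arr (arrow_cat E)" "A \<in> Arr (arrow_cat E)"
      "cdom (arrow_cat E) A = cdom (arrow_cat E) X" "ccod (arrow_cat E) A = cdom (arrow_cat E) Y"
      "B \<in> Arr (arrow_cat E)" "cdom (arrow_cat E) B = ccod (arrow_cat E) X"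
      "ccod (arrow_cat E) B = ccod (arrow_cat E) Y" "B \<cdot>[arrow_cat E] X = Y \<cdot>[arrow_cat E] A"
    by (rule arrow_ArrE[OF assms])
  obtain f g r s where X: "X = Sq f g r s" by (rule arrow_ArrE[OF a(2)])
  obtain f' g' r' s' where Y: "Y = Sq f' g' r' s'" by (rule arrow_ArrE[OF a(3)])
  obtain p q where A: "A = Sq f f' p q" by (rule arrow_ArrE[OF a(4)]) (use a(2-6) X Y in \<open>auto simp: arrow_ops\<close>)
  obtain p' q' where B: "B = Sq g g' p' q'" by (rule arrow_ArrE[OF a(7)]) (use a(2,3,7-9) X Y in \<open>auto simp: arrow_ops\<close>)
  show thesis
    by (rule that[of f g r s f' g' r' s' p q p' q']) (use a X Y A B in \<open>simp_all add: arrow_ops\<close>)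
qed

lemma arrow2_Arr: "Sq (Sq f g r s) (Sq f' g' r' s') (Sq f f' p q) (Sq g g' p' q') \<in> Arr (arrow_cat (arrow_cat E)) \<longleftrightarrow>
    Sq f g r s \<in> Arr (arrow_cat E) \<and> Sq f' g' r' s' \<in> Arr (arrow_cat E) \<and>
    Sq f f' p q \<in> Arr (arrow_cat E) \<and> Sq g g' p' q' \<in> Arr (arrow_cat E) \<and>
    p' \<cdot>[E] r = r' \<cdot>[E] p \<and> q' \<cdot>[E] s = s' \<cdot>[E] q"
  unfolding arrow_Arr[of "Sq f g r s" "Sq f' g' r' s'" "Sq f f' p q" "Sq g g' p' q'" "arrow_cat E"]
  by (auto simp: arrow_ops)

lemma arrow_mult_arr:
  assumes E: "category E" and a: "Sq (Sq f g r s) (Sq f' g' r' s') (Sq f f' p q) (Sq g g' p' q') \<in> Arr (arrow_cat (arrow_cat E))"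
  shows "Sq (s \<cdot>[E] f) (s' \<cdot>[E] f') p q' \<in> Arr (arrow_cat E)"
proof -
  have e: "q \<cdot>[E] f = f' \<cdot>[E] p" "q' \<cdot>[E] s = s' \<cdot>[E] q"
    and h: "f \<in> Arr E" "f' \<in> Arr E" "s \<in> Arr E" "s' \<in> Arr E" "p \<in> Arr E" "q \<in> Arr E" "q' \<in> Arr E"
      "cdom E s = ccod E f" "cdom E s' = ccod E f'" "cdom E p = cdom E f" "ccod E p = cdom E f'"
      "cdom E q = ccod E f" "ccod E q = ccod E f'" "cdom E q' = ccod E s" "ccod E q' = ccod E s'"
    using a unfolding arrow2_Arr by (simp_all add: arrow_Arr)
  have "s' \<cdot>[E] q \<cdot>[E] f = s' \<cdot>[E] f' \<cdot>[E] p"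
    by (rule cat_extend[OF e(1)]) (use h E in simp_all)
  then have "q' \<cdot>[E] s \<cdot>[E] f = s' \<cdot>[E] f' \<cdot>[E] p"
    by (simp only: e(2))
  then show ?thesis
    using h E by (simp add: arrow_Arr)
qed

lemma arrow_mult_functor [simp]:
  assumes E: "category E"
  shows "is_functor (arrow_mult E)"
  unfolding arrow_mult_def Let_def
proof (rule is_functor_mk, goal_cases)
  case (3 X)
  then have "X \<in> Arr (arrow_cat E)" by simp
  then show ?case using E by (auto elim!: arrow_ArrE)
next
  case (4 a)
  obtain f g r s f' g' r' s' p q p' q' where a: "a = Sq (Sq f g r s) (Sq f' g' r' s') (Sq f f' p q) (Sq g g' p' q')"
    by (rule arrow2_ArrE[OF 4])
  show ?case
    using 4 arrow_mult_arr[OF E 4[unfolded a]] unfolding a by (simp add: arrow_ops)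
next
  case (5 X)
  then have X: "X \<in> Arr (arrow_cat E)" by simp
  obtain f g r s where f: "X = Sq f g r s" "f \<in> Arr E" "s \<in> Arr E" "cdom E s = ccod E f" "g \<in> Arr E" "ccod E s = ccod E g"
    by (rule arrow_ArrE[OF X])
  show ?case
    using X f(2-6) E unfolding f(1) by (simp add: arrow_ops)
next
  case (6 a b)
  obtain f g r s f' g' r' s' p q p' q' where a: "a = Sq (Sq f g r s) (Sq f' g' r' s') (Sq f f' p q) (Sq g g' p' q')"
      "Sq f f' p q \<in> Arr (arrow_cat E)" "Sq g g' p' q' \<in> Arr (arrow_cat E)"
    by (rule arrow2_ArrE[OF 6(1)])
  obtain F G R S F' G' R' S' P Q P' Q' where b: "b = Sq (Sq F G R S) (Sq F' G' R' S') (Sq F F' P Q) (Sq G G' P' Q')"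
      "Sq F F' P Q \<in> Arr (arrow_cat E)" "Sq G G' P' Q' \<in> Arr (arrow_cat E)"
    by (rule arrow2_ArrE[OF 6(2)])
  have e: "F = f'" "G = g'" "R = r'" "S = s'"
    using 6 a(1) b(1) by (simp_all add: arrow_ops)
  show ?case
    using a b 6 arrow_mult_arr[OF E 6(1)[unfolded a(1)]] arrow_mult_arr[OF E 6(2)[unfolded b(1)]]
    unfolding e by (simp add: arrow_ops)
qed (use E in simp_all)

lemma arrow_unit_nat:
  "is_functor F ==> comp_functor (arrow_map F) (arrow_unit (src F)) = comp_functor (arrow_unit (trg F)) F"
  by (rule functor_eqI) (auto simp: arrow_Arr)

lemma arrow_mult_nat:
  assumes F: "is_functor F"
  shows "comp_functor (arrow_map F) (arrow_mult (src F)) = comp_functor (arrow_mult (trg F)) (arrow_map (arrow_map F))"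
proof (rule functor_eqI, goal_cases)
  case (5 X)
  then have X: "X \<in> Arr (arrow_cat (src F))" by simp
  obtain f g r s where f: "X = Sq f g r s" "f \<in> Arr (src F)" "s \<in> Arr (src F)" "cdom (src F) s = ccod (src F) f"
    by (rule arrow_ArrE[OF X])
  show ?case
    using X arrow_map_arr[OF F X[unfolded f(1)]] f(2-4) F unfolding f(1) by simp
next
  case (6 a)
  then have A: "a \<in> Arr (arrow_cat (arrow_cat (src F)))" by simp
  obtain f g r s f' g' r' s' p q p' q' where a: "a = Sq (Sq f g r s) (Sq f' g' r' s') (Sq f f' p q) (Sq g g' p' q')"
      "Sq f g r s \<in> Arr (arrow_cat (src F))" "Sq f' g' r' s' \<in> Arr (arrow_cat (src F))"
      "Sq f f' p q \<in> Arr (arrow_cat (src F))" "Sq g g' p' q' \<in> Arr (arrow_cat (src F))"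
    by (rule arrow2_ArrE[OF A])
  have b: "Sq (Sq (farr F f) (farr F g) (farr F r) (farr F s)) (Sq (farr F f') (farr F g') (farr F r') (farr F s'))
      (Sq (farr F f) (farr F f') (farr F p) (farr F q)) (Sq (farr F g) (farr F g') (farr F p') (farr F q')) \<in> Arr (arrow_cat (arrow_cat (trg F)))"
    using arrow_map_arr[OF arrow_map_functor[OF F], of "Sq f g r s" "Sq f' g' r' s'" "Sq f f' p q" "Sq g g' p' q'"] A a(2-5) unfolding a(1) by simp
  have "f \<in> Arr (src F)" "s \<in> Arr (src F)" "cdom (src F) s = ccod (src F) f" "f' \<in> Arr (src F)" "s' \<in> Arr (src F)" "cdom (src F) s' = ccod (src F) f'"
    using a(2,3) by (simp_all add: arrow_Arr)
  then show ?case
    using A a(2-5) b F arrow_mult_arr[OF functor_cats(1)[OF F] A[unfolded a(1)]] unfolding a(1) by simp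
qed (use F in simp_all)

lemma arrow_unit_nat2:
  "is_ntrans \<tau> ==> hcomp_ntrans (arrow_cell \<tau>) (id_ntrans (arrow_unit (src (src \<tau>)))) =
    hcomp_ntrans (id_ntrans (arrow_unit (trg (src \<tau>)))) \<tau>"
  using arrow_unit_nat[of "src \<tau>"] arrow_unit_nat[of "trg \<tau>"] by (intro ntrans_eqI) simp_all

lemma arrow_mult_nat2:
  assumes t: "is_ntrans \<tau>"
  shows "hcomp_ntrans (arrow_cell \<tau>) (id_ntrans (arrow_mult (src (src \<tau>)))) =
    hcomp_ntrans (id_ntrans (arrow_mult (trg (src \<tau>)))) (arrow_cell (arrow_cell \<tau>))"
proof (rule ntrans_eqI, goal_cases)
  case (5 X)
  let ?A = "src (src \<tau>)"
  have X: "X \<in> Arr (arrow_cat ?A)" using 5 by simp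
  obtain f g r s where f: "X = Sq f g r s" "f \<in> Arr ?A" "g \<in> Arr ?A" "r \<in> Arr ?A" "cdom ?A r = cdom ?A f" "ccod ?A r = cdom ?A g" "s \<in> Arr ?A" "cdom ?A s = ccod ?A f" "ccod ?A s = ccod ?A g"
    by (rule arrow_ArrE[OF X])
  have m: "Sq (farr (src \<tau>) f) (farr (src \<tau>) g) (farr (src \<tau>) r) (farr (src \<tau>) s) \<in> Arr (arrow_cat (trg (src \<tau>)))"
    "Sq (farr (trg \<tau>) f) (farr (trg \<tau>) g) (farr (trg \<tau>) r) (farr (trg \<tau>) s) \<in> Arr (arrow_cat (trg (src \<tau>)))"
    using arrow_map_arr[of "src \<tau>" f g r s] arrow_map_arr[of "trg \<tau>" f g r s] t X unfolding f(1) by simp_all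
  have n: "Sq (Sq (farr (src \<tau>) f) (farr (src \<tau>) g) (farr (src \<tau>) r) (farr (src \<tau>) s))
      (Sq (farr (trg \<tau>) f) (farr (trg \<tau>) g) (farr (trg \<tau>) r) (farr (trg \<tau>) s))
      (Sq (farr (src \<tau>) f) (farr (trg \<tau>) f) (body \<tau> (cdom ?A f)) (body \<tau> (ccod ?A f)))
      (Sq (farr (src \<tau>) g) (farr (trg \<tau>) g) (body \<tau> (cdom ?A g)) (body \<tau> (ccod ?A g))) \<in> Arr (arrow_cat (arrow_cat (trg (src \<tau>))))"
    using arrow_cell_arr[OF arrow_cell_ntrans[OF t], of X] X f(2-9) t unfolding f(1) by (simp add: arrow_ops)
  show ?case
    using X m n f(2-9) t unfolding f(1) by (simp add: arrow_ops)
qed (use t arrow_mult_nat[of "src \<tau>"] arrow_mult_nat[of "trg \<tau>"] in simp_all)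

lemma arrow_unit_laws:
  assumes E: "category E"
  shows "comp_functor (arrow_mult E) (arrow_unit (arrow_cat E)) = id_functor (arrow_cat E)"
    "comp_functor (arrow_mult E) (arrow_map (arrow_unit E)) = id_functor (arrow_cat E)"
proof -
  have a: "Sq (Sq f f (ide E (cdom E f)) (ide E (ccod E f))) (Sq g g (ide E (cdom E g)) (ide E (ccod E g))) (Sq f g r s) (Sq f g r s) \<in> Arr (arrow_cat (arrow_cat E))"
    "Sq (Sq (ide E (cdom E f)) (ide E (ccod E f)) f f) (Sq (ide E (cdom E g)) (ide E (ccod E g)) g g) (Sq (ide E (cdom E f)) (ide E (cdom E g)) r r)
      (Sq (ide E (ccod E f)) (ide E (ccod E g)) s s) \<in> Arr (arrow_cat (arrow_cat E))"
    if "Sq f g r s \<in> Arr (arrow_cat E)" for f g r s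
    using that E unfolding arrow2_Arr by (simp_all add: arrow_Arr)
  show "comp_functor (arrow_mult E) (arrow_unit (arrow_cat E)) = id_functor (arrow_cat E)"
  proof (rule functor_eqI, goal_cases)
    case (6 b)
    then have b: "b \<in> Arr (arrow_cat E)" by simp
    obtain f g r s where f: "b = Sq f g r s" "f \<in> Arr E" "g \<in> Arr E" by (rule arrow_ArrE[OF b])
    show ?case using a(1) b f(2,3) E unfolding f(1) by (simp add: arrow_ops)
  qed (use E in \<open>simp_all add: arrow_ops arrow_Arr\<close>)
  show "comp_functor (arrow_mult E) (arrow_map (arrow_unit E)) = id_functor (arrow_cat E)"
  proof (rule functor_eqI, goal_cases)
    case (6 b)
    then have b: "b \<in> Arr (arrow_cat E)" by simp
    obtain f g r s where f: "b = Sq f g r s" "f \<in> Arr E" "g \<in> Arr E" "r \<in> Arr E" "s \<in> Arr E" "cdom E r = cdom E f"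
      "ccod E r = cdom E g" "cdom E s = ccod E f" "ccod E s = ccod E g" by (rule arrow_ArrE[OF b])
    show ?case using a(2) b f(2-9) E unfolding f(1) by simp
  qed (use E in \<open>simp_all add: arrow_Arr\<close>)
qed

text \<open>Both sides send a cube to its long diagonal and a morphism of cubes to its components at
  the initial and the terminal corner. Most of the work is to name the edges involved.\<close>

lemma arrow_assoc_law:
  assumes E: "category E"
  shows "comp_functor (arrow_mult E) (arrow_mult (arrow_cat E)) = comp_functor (arrow_mult E) (arrow_map (arrow_mult E))"
proof (rule functor_eqI, goal_cases)
  case (5 X)
  then have A: "X \<in> Arr (arrow_cat (arrow_cat E))" by simp
  obtain f g r s f' g' r' s' p q p' q' where a: "X = Sq (Sq f g r s) (Sq f' g' r' s') (Sq f f' p q) (Sq g g' p' q')"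
      "Sq f g r s \<in> Arr (arrow_cat E)" "Sq f' g' r' s' \<in> Arr (arrow_cat E)"
      "Sq f f' p q \<in> Arr (arrow_cat E)" "Sq g g' p' q' \<in> Arr (arrow_cat E)"
    by (rule arrow2_ArrE[OF A])
  have h: "f \<in> Arr E" "s \<in> Arr E" "q' \<in> Arr E" "cdom E s = ccod E f" "cdom E q' = ccod E s"
    using a(2,5) by (simp_all add: arrow_Arr)
  have m: "Sq f g' (p' \<cdot>[E] r) (q' \<cdot>[E] s) \<in> Arr (arrow_cat E)"
    by (rule arrow_comp_arr[OF E a(2,5)])
  show ?case
    using A a(2-5) arrow_mult_arr[OF E A[unfolded a(1)]] m h E unfolding a(1) by (simp add: arrow_ops)
next
  case (6 c)
  then have c: "c \<in> Arr (arrow_cat (arrow_cat (arrow_cat E)))" by simp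
  obtain f g r s f' g' r' s' p q p' q' where d: "c = Sq (Sq f g r s) (Sq f' g' r' s') (Sq f f' p q) (Sq g g' p' q')"
      "Sq f g r s \<in> Arr (arrow_cat (arrow_cat E))" "Sq f' g' r' s' \<in> Arr (arrow_cat (arrow_cat E))"
      "Sq f f' p q \<in> Arr (arrow_cat (arrow_cat E))" "Sq g g' p' q' \<in> Arr (arrow_cat (arrow_cat E))"
    by (rule arrow2_ArrE[OF c])
  obtain f0 f1 f2 f3 g0 g1 g2 g3 r2 r3 s2 s3 where
    1: "f = Sq f0 f1 f2 f3" "g = Sq g0 g1 g2 g3" "r = Sq f0 g0 r2 r3" "s = Sq f1 g1 s2 s3" and
    m1: "f \<in> Arr (arrow_cat E)" "g \<in> Arr (arrow_cat E)" "s \<in> Arr (arrow_cat E)"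
    by (rule arrow2_ArrE[OF d(2)]) auto
  obtain f0' f1' f2' f3' g0' g1' g2' g3' r2' r3' s2' s3' where
    2: "f' = Sq f0' f1' f2' f3'" "g' = Sq g0' g1' g2' g3'" "r' = Sq f0' g0' r2' r3'" "s' = Sq f1' g1' s2' s3'" and
    m2: "f' \<in> Arr (arrow_cat E)" "g' \<in> Arr (arrow_cat E)" "s' \<in> Arr (arrow_cat E)"
    by (rule arrow2_ArrE[OF d(3)]) auto
  obtain p2 p3 q2 q3 where 3: "p = Sq f0 f0' p2 p3" "q = Sq f1 f1' q2 q3"
    by (rule arrow2_ArrE[OF d(4)]) (use 1 2 in auto)
  obtain p2' p3' q2' q3' where 4: "p' = Sq g0 g0' p2' p3'" "q' = Sq g1 g1' q2' q3'"
    by (rule arrow2_ArrE[OF d(5)]) (use 1 2 in auto)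
  note m1 = m1[unfolded 1] and m2 = m2[unfolded 2]
  have h: "f0 \<in> Arr E" "f3 \<in> Arr E" "s3 \<in> Arr E" "ccod E f0 = cdom E f3" "ccod E f3 = cdom E s3"
    "f0' \<in> Arr E" "f3' \<in> Arr E" "s3' \<in> Arr E" "ccod E f0' = cdom E f3'" "ccod E f3' = cdom E s3'"
    using m1 m2 by (simp_all add: arrow_Arr)
  note D = d[unfolded 1 2 3 4]
  \<comment> \<open>\<open>x1\<close> and \<open>x2\<close> are the images of \<open>c\<close> under
    the two inner functors. The outer multiplication can be evaluated only once they are known to be
    arrows.\<close>
  have x1: "Sq (Sq f0 g1 (s2 \<cdot>[E] f2) (s3 \<cdot>[E] f3)) (Sq f0' g1' (s2' \<cdot>[E] f2') (s3' \<cdot>[E] f3')) (Sq f0 f0' p2 p3) (Sq g1 g1' q2' q3')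
      \<in> Arr (arrow_cat (arrow_cat E))"
    using arrow_mult_arr[OF arrow_category[OF E] c[unfolded D(1)]] m1 m2 by (simp add: arrow_ops)
  have x2: "Sq (Sq (f3 \<cdot>[E] f0) (g3 \<cdot>[E] g0) r2 s3) (Sq (f3' \<cdot>[E] f0') (g3' \<cdot>[E] g0') r2' s3') (Sq (f3 \<cdot>[E] f0) (f3' \<cdot>[E] f0') p2 q3)
      (Sq (g3 \<cdot>[E] g0) (g3' \<cdot>[E] g0') p2' q3') \<in> Arr (arrow_cat (arrow_cat E))"
    using arrow_map_arr[OF arrow_mult_functor[OF E], of "Sq (Sq f0 f1 f2 f3) (Sq g0 g1 g2 g3) (Sq f0 g0 r2 r3) (Sq f1 g1 s2 s3)"
      "Sq (Sq f0' f1' f2' f3') (Sq g0' g1' g2' g3') (Sq f0' g0' r2' r3') (Sq f1' g1' s2' s3')"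
      "Sq (Sq f0 f1 f2 f3) (Sq f0' f1' f2' f3') (Sq f0 f0' p2 p3) (Sq f1 f1' q2 q3)"
      "Sq (Sq g0 g1 g2 g3) (Sq g0' g1' g2' g3') (Sq g0 g0' p2' p3') (Sq g1 g1' q2' q3')"] c D(2-5)
    unfolding D(1) by simp
  show ?case
    using c m1 m2 x1 x2 D(2-5) h E unfolding D(1) by (simp add: arrow_ops)
qed (use E in simp_all)

lemma Squaring_simps [simp]: "F0 (fn Squaring) = arrow_cat" "F1 (fn Squaring) = arrow_map" "F2 (fn Squaring) = arrow_cell"
  "eta Squaring = arrow_unit" "mu Squaring = arrow_mult"
  by (simp_all add: Squaring_def)

lemma squaring_2functor:
  assumes k: "Card_order k" "infinite (Field k)"
  shows "strict_2functor (CAT k) (CAT k) (fn (Squaring :: ('a univ cat, _, _) monad))"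
  by (intro strict_2functor.intro strict_2functor_axioms.intro CAT_2category)
    (auto simp: mem_hom1 mem_hom2 CAT_simps arrow_map_id arrow_map_comp arrow_cell_id arrow_cell_vcomp arrow_cell_hcomp
      intro!: arrow_small[OF k])

lemma squaring_2monad:
  assumes k: "Card_order k" "infinite (Field k)"
  shows "strict_2monad (CAT k) (Squaring :: ('a univ cat, _, _) monad)"
proof -
  note fn = squaring_2functor[OF k]
  have "two_natural (CAT k) (CAT k) id_2fun (fn Squaring) (eta (Squaring :: ('a univ cat, _, _) monad))"
    by (intro two_natural.intro two_natural_axioms.intro fn strict_2functor_id CAT_2category)
      (auto simp: mem_hom1 mem_hom2 CAT_simps arrow_unit_nat arrow_unit_nat2 intro!: arrow_small[OF k])
  moreover have "two_natural (CAT k) (CAT k) (fn Squaring \<circ>\<circ> fn Squaring) (fn Squaring) (mu (Squaring :: ('a univ cat, _, _) monad))"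
    by (intro two_natural.intro two_natural_axioms.intro fn strict_2functor_comp[OF fn fn])
      (auto simp: mem_hom1 mem_hom2 CAT_simps arrow_mult_nat arrow_mult_nat2 intro!: arrow_small[OF k])
  ultimately show ?thesis
    by (intro strict_2monad.intro fn strict_2monad_axioms.intro)
      (simp_all add: CAT_simps arrow_unit_laws arrow_assoc_law)
qed

section \<open>The colax morphism from the comma to the squaring 2-monad\<close>

lemma kap_simps [simp]:
  "src (kap P) = arrow_cat (src P)" "trg (kap P) = comma P"
  "f \<in> Arr (src P) ==> fobj (kap P) f = Pair (cdom (src P) f) (farr P f)"
  "Sq f g r s \<in> Arr (arrow_cat (src P)) ==> farr (kap P) (Sq f g r s) =
    Sq (Pair (cdom (src P) f) (farr P f)) (Pair (cdom (src P) g) (farr P g)) r (farr P s)"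
  by (simp_all add: kap_def Let_def)

lemma kap_arr:
  assumes P: "is_functor P" and a: "Sq f g r s \<in> Arr (arrow_cat (src P))"
  shows "Sq (Pair (cdom (src P) f) (farr P f)) (Pair (cdom (src P) g) (farr P g)) r (farr P s) \<in> Arr (comma P)"
proof -
  have e: "s \<cdot>[src P] f = g \<cdot>[src P] r"
    and h: "f \<in> Arr (src P)" "g \<in> Arr (src P)" "r \<in> Arr (src P)" "cdom (src P) r = cdom (src P) f" "ccod (src P) r = cdom (src P) g"
      "s \<in> Arr (src P)" "cdom (src P) s = ccod (src P) f" "ccod (src P) s = ccod (src P) g"
    using a by (simp_all add: arrow_Arr)
  have "farr P s \<cdot>[trg P] farr P f = farr P g \<cdot>[trg P] farr P r"
    using arg_cong[OF e, of "farr P"] h P by simp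
  then show ?thesis
    using h P by (simp add: comma_Arr comma_Obj)
qed

lemma kap_functor [simp]:
  assumes P: "is_functor P"
  shows "is_functor (kap P)"
  unfolding kap_def Let_def
proof (rule is_functor_mk, goal_cases)
  case (4 a)
  obtain f g r s where a: "a = Sq f g r s"
    by (rule arrow_ArrE[OF 4])
  show ?case
    using 4 kap_arr[OF P 4[unfolded a]] unfolding a by (simp add: arrow_ops comma_ops)
next
  case (6 a b)
  obtain f g r s where a: "a = Sq f g r s" "r \<in> Arr (src P)" "s \<in> Arr (src P)" "ccod (src P) r = cdom (src P) g" "ccod (src P) s = ccod (src P) g"
    by (rule arrow_ArrE[OF 6(1)])
  obtain g' h r' s' where b: "b = Sq g' h r' s'" "r' \<in> Arr (src P)" "s' \<in> Arr (src P)" "cdom (src P) r' = cdom (src P) g'" "cdom (src P) s' = ccod (src P) g'"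
    by (rule arrow_ArrE[OF 6(2)])
  have e: "g' = g"
    using 6 a(1) b(1) by (simp_all add: arrow_ops)
  show ?case
    using a b 6 kap_arr[OF P 6(1)[unfolded a(1)]] kap_arr[OF P 6(2)[unfolded b(1)]] P
    unfolding e by (simp add: arrow_ops comma_ops)
qed (use P in \<open>auto simp: arrow_ops comma_simps\<close>)

lemma kap_nat:
  assumes s: "is_square P Q T S"
  shows "comp_functor (comma_map (Cell P Q (T, S))) (kap P) = comp_functor (kap Q) (arrow_map T)"
proof (rule functor_eqI, goal_cases)
  note d = squareD[OF s]
  {
    case (5 f)
    then have "f \<in> Arr (src P)" using d by simp
    then show ?case using d by (simp add: comma_Obj)
  next
    case (6 a)
    then have A: "a \<in> Arr (arrow_cat (src P))" using d by simp
    obtain f g r t where a: "a = Sq f g r t" "f \<in> Arr (src P)" "g \<in> Arr (src P)" "t \<in> Arr (src P)" by (rule arrow_ArrE[OF A])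
    have b: "Sq (farr T f) (farr T g) (farr T r) (farr T t) \<in> Arr (arrow_cat (src Q))"
      using arrow_map_arr[OF d(3), of f g r t] A d unfolding a(1) by simp
    show ?case
      using A b kap_arr[OF d(1) A[unfolded a(1)]] a(2-4) d unfolding a(1) by simp
  }
qed (use s squareD[OF s] in simp_all)

lemma kap_nat2:
  assumes s: "is_square2 P Q T S T' S' \<beta> \<alpha>"
  shows "hcomp_ntrans (comma_nt P Q T S T' S' \<beta> \<alpha>) (id_ntrans (kap P)) = hcomp_ntrans (id_ntrans (kap Q)) (arrow_cell \<beta>)"
proof (rule ntrans_eqI, goal_cases)
  note d = square2D[OF s] squareD[OF square2D(1)[OF s]] squareD[OF square2D(2)[OF s]]
  note n = comma_nt_ntrans[OF s]
  {
    case 1 then show ?case using d n by simp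
  next
    case 2 then show ?case using d n by simp
  next
    case 3 then show ?case using d kap_nat[OF d(1)] by simp
  next
    case 4 then show ?case using d kap_nat[OF d(2)] by simp
  next
    case (5 f)
    then have f: "f \<in> Arr (src P)" using d by simp
    have o: "Pair (cdom (src P) f) (farr P f) \<in> Obj (comma P)" using f d by (simp add: comma_Obj)
    have a: "Sq (farr T f) (farr T' f) (body \<beta> (cdom (src P) f)) (body \<beta> (ccod (src P) f)) \<in> Arr (arrow_cat (src Q))"
      using arrow_cell_arr[OF d(3), of f] f d by simp
    show ?case
      using f o a n d by simp
  }
qed

lemma kap_unit: "is_functor P ==> comp_functor (kap P) (arrow_unit (src P)) = comma_H P"
  by (rule functor_eqI) (auto simp: arrow_Arr)

text \<open>The diagonal of a square is a composite of two arrows, and \<open>P\<close> preserves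
  it. So passing to the diagonal and then to the base gives the same pair as recording both arrows
  in the base and composing them by \<open>comma_M\<close>.\<close>

lemma kap_mult:
  assumes P: "is_functor P"
  shows "comp_functor (kap P) (arrow_mult (src P)) =
    comp_functor (comp_functor (comma_M P) (kap (comma_cod P))) (arrow_map (kap P))"
proof (rule functor_eqI, goal_cases)
  case (5 X)
  then have X: "X \<in> Arr (arrow_cat (src P))" by simp
  obtain f g r s where f: "X = Sq f g r s" "f \<in> Arr (src P)" "s \<in> Arr (src P)" "cdom (src P) s = ccod (src P) f"
    by (rule arrow_ArrE[OF X])
  have o: "Pair (Pair (cdom (src P) f) (farr P f)) (farr P s) \<in> Obj (comma2 P)"
    using f P by (simp add: comma2_Obj comma_Obj)
  show ?case
    using X o kap_arr[OF P X[unfolded f(1)]] f(2-4) P unfolding f(1) by (simp add: comma_ops)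
next
  case (6 a)
  then have A: "a \<in> Arr (arrow_cat (arrow_cat (src P)))" by simp
  obtain f g r s f' g' r' s' p q p' q' where a: "a = Sq (Sq f g r s) (Sq f' g' r' s') (Sq f f' p q) (Sq g g' p' q')"
      "Sq f g r s \<in> Arr (arrow_cat (src P))" "Sq f' g' r' s' \<in> Arr (arrow_cat (src P))"
      "Sq f f' p q \<in> Arr (arrow_cat (src P))" "Sq g g' p' q' \<in> Arr (arrow_cat (src P))"
    by (rule arrow2_ArrE[OF A])
  note k = kap_arr[OF P a(2)] kap_arr[OF P a(3)] kap_arr[OF P a(4)] kap_arr[OF P a(5)]
  let ?k = "\<lambda>f. Pair (cdom (src P) f) (farr P f)"
  have b: "Sq (Sq (?k f) (?k g) r (farr P s)) (Sq (?k f') (?k g') r' (farr P s'))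
      (Sq (?k f) (?k f') p (farr P q)) (Sq (?k g) (?k g') p' (farr P q')) \<in> Arr (arrow_cat (comma P))"
    using arrow_map_arr[OF kap_functor[OF P], of "Sq f g r s" "Sq f' g' r' s'" "Sq f f' p q" "Sq g g' p' q'"] A a(2-5)
    unfolding a(1) by simp
  have c: "Sq (Pair (?k f) (farr P s)) (Pair (?k f') (farr P s')) (Sq (?k f) (?k f') p (farr P q)) (farr P q') \<in> Arr (comma2 P)"
    using kap_arr[OF comma_cod_functor[OF P], of "Sq (?k f) (?k g) r (farr P s)" "Sq (?k f') (?k g') r' (farr P s')"
      "Sq (?k f) (?k f') p (farr P q)" "Sq (?k g) (?k g') p' (farr P q')"] b k by (simp add: comma_ops)
  have h: "f \<in> Arr (src P)" "s \<in> Arr (src P)" "cdom (src P) s = ccod (src P) f"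
    "f' \<in> Arr (src P)" "s' \<in> Arr (src P)" "cdom (src P) s' = ccod (src P) f'"
    using a(2,3) by (simp_all add: arrow_Arr)
  show ?case
    using A a(2-5) b c k h arrow_mult_arr[OF functor_cats(1)[OF P] A[unfolded a(1)]] P unfolding a(1) by (simp add: comma_ops)
qed (use P in simp_all)

lemma kap_colax:
  assumes k: "Card_order k" "infinite (Field k)"
  shows "colax_monad_morphism (CAT2 k) Comma (CAT k) Squaring Dom (kap :: 'a univ func \<Rightarrow> _)"
proof -
  have V: "strict_2functor (CAT2 k) (CAT k) (Dom :: ('a univ func, _, _, _, _, _) two_fun)"
    by (rule two_category.Dom_2functor[OF CAT_two_category])
  have "two_natural (CAT2 k) (CAT k) (fn Squaring \<circ>\<circ> Dom) (Dom \<circ>\<circ> fn Comma) (kap :: 'a univ func \<Rightarrow> _)"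
  proof (intro two_natural.intro two_natural_axioms.intro strict_2functor_comp[OF V squaring_2functor[OF k]]
      strict_2functor_comp[OF comma_2functor[OF k] V], goal_cases)
    case (1 P)
    then show ?case by (auto simp: mem_hom1 CAT2_Ob CAT_simps intro!: comma_small[OF k] arrow_small[OF k])
  next
    case (2 F P Q)
    then show ?case
      by (cases F rule: square_cases) (auto simp: mem_hom1 CAT2_Cell1 CAT_simps comma_sq_simps kap_nat)
  next
    case (3 \<phi> F G P Q)
    then show ?case
      by (cases \<phi> rule: square2_cases) (auto simp: mem_hom2 CAT2_Cell2 CAT_simps comma_sq_simps kap_nat2)
  qed
  then show ?thesis
    by (intro colax_monad_morphism.intro comma_2monad[OF k] squaring_2monad[OF k] V colax_monad_morphism_axioms.intro)
      (simp_all add: CAT2_Ob CAT_simps comma_unit_eq comma_mult_eq kap_unit kap_mult)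
qed

section \<open>The comma 2-monad and its colax morphism over a fixed base\<close>

lemma Slice_simps:
  "Ob (Slice K B) = {P \<in> Cell1 K. trg P = B}"
  "Cell1 (Slice K B) = {F \<in> Cell1 (Arrow K). trg (src F) = B \<and> trg (trg F) = B \<and> snd (body F) = id1 K B}"
  "Cell2 (Slice K B) = {\<phi> \<in> Cell2 (Arrow K). trg (src (src \<phi>)) = B \<and> trg (trg (src \<phi>)) = B \<and>
                  snd (body \<phi>) = id2 K (id1 K B)}"
  "id1 (Slice K B) = id1 (Arrow K)" "comp1 (Slice K B) = comp1 (Arrow K)" "id2 (Slice K B) = id2 (Arrow K)"
  "vcomp (Slice K B) = vcomp (Arrow K)" "hcomp (Slice K B) = hcomp (Arrow K)"
  by (simp_all add: Slice_def)

text \<open>Unit and multiplication have identity base components, and the comma construction leaves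
  the base component of a square or of a 2-cell as it is. Hence the whole structure restricts to the
  slice.\<close>

lemma comma_Slice_2monad:
  assumes k: "Card_order k" "infinite (Field k)" and B: "B \<in> Ob (CAT k)"
  shows "strict_2monad (Slice (CAT k) B) (Comma :: ('a univ func, _, _) monad)"
    "colax_monad_morphism (Slice (CAT k) B) Comma (CAT k) Squaring Dom (kap :: 'a univ func \<Rightarrow> _)"
proof -
  interpret sub_2category "CAT2 k" "{P \<in> Cell1 (CAT k). trg P = B}"
    "{F \<in> Cell1 (CAT2 k). trg (src F) = B \<and> trg (trg F) = B \<and> snd (body F) = id1 (CAT k) B}"
    "{\<phi> \<in> Cell2 (CAT2 k). trg (src (src \<phi>)) = B \<and> trg (trg (src \<phi>)) = B \<and> snd (body \<phi>) = id2 (CAT k) (id1 (CAT k) B)}"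
    by (rule Slice_sub[OF CAT_2category B])
  interpret C: strict_2monad "CAT2 k" "Comma :: ('a univ func, _, _) monad"
    by (rule comma_2monad[OF k])
  have eq: "sub = Slice (CAT k) B"
    by (simp add: Slice_def)
  have "strict_2monad sub (Comma :: ('a univ func, _, _) monad)"
  proof (rule sub_monad[OF comma_2monad[OF k]], goal_cases)
    case (1 P)
    then have P: "P \<in> Ob (CAT2 k)" "trg P = B" by (simp_all add: Arrow_simps(1))
    then show ?case
      using C.eta_cell(1)[OF P(1)] C.mu_cell(1)[OF P(1)] C.fn.F0_cell[OF P(1)]
      by (simp add: comma_unit_eq comma_mult_eq CAT_simps(4) Arrow_simps(1))
  next
    case (2 F)
    then show ?case
      using C.fn.F1_cell(1)[of F] by (cases F rule: square_cases) (simp add: comma_sq_simps)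
  next
    case (3 \<phi>)
    then have c: "\<phi> \<in> Cell2 (CAT2 k)" by simp
    obtain P Q T S P' Q' T' S' \<beta> \<alpha> where f: "\<phi> = Cell (Cell P Q (T, S)) (Cell P' Q' (T', S')) (\<beta>, \<alpha>)"
      by (rule square2_cases)
    have "P' = P" "Q' = Q" using c unfolding f CAT2_Cell2 by auto
    then show ?case
      using C.fn.F2_cell(1)[OF c] 3 unfolding f by (simp add: comma_sq_simps)
  qed
  then show "strict_2monad (Slice (CAT k) B) (Comma :: ('a univ func, _, _) monad)"
    and "colax_monad_morphism (Slice (CAT k) B) Comma (CAT k) Squaring Dom (kap :: 'a univ func \<Rightarrow> _)"
    using sub_colax[OF kap_colax[OF k]] unfolding eq by simp_all
qed

section \<open>Cocartesian arrows\<close>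

lemma CoCart_arr: "e \<in> CoCart P ==> e \<in> Arr (src P)"
  by (simp add: CoCart_def cocartesian_def Let_def)

lemma CoCart_lift:
  assumes "e \<in> CoCart P" "g \<in> Arr (src P)" "cdom (src P) g = cdom (src P) e" "v \<in> Arr (trg P)"
    "cdom (trg P) v = fobj P (ccod (src P) e)" "ccod (trg P) v = fobj P (ccod (src P) g)"
    "farr P g = v \<cdot>[trg P] farr P e"
  shows "\<exists>!h. h \<in> Arr (src P) \<and> cdom (src P) h = ccod (src P) e \<and> ccod (src P) h = ccod (src P) g \<and>
    h \<cdot>[src P] e = g \<and> farr P h = v"
proof -
  have "v \<in> hom (trg P) (fobj P (ccod (src P) e)) (fobj P (ccod (src P) g))"
    using assms by (simp add: mem_hom)
  then have "\<exists>!h. h \<in> hom (src P) (ccod (src P) e) (ccod (src P) g) \<and> h \<cdot>[src P] e = g \<and> farr P h = v"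
    using assms(1,2,3,7) unfolding CoCart_def cocartesian_def Let_def mem_Collect_eq by blast
  then show ?thesis
    by (simp add: mem_hom conj_assoc)
qed

text \<open>Uniqueness is phrased as a cancellation property of two candidates; the test arrow and
  its base factor are then recovered from either of them.\<close>

lemma CoCart_I:
  assumes "e \<in> Arr (src P)"
    "\<And>g v. [|g \<in> Arr (src P); cdom (src P) g = cdom (src P) e; v \<in> Arr (trg P);
      cdom (trg P) v = fobj P (ccod (src P) e); ccod (trg P) v = fobj P (ccod (src P) g);
      farr P g = v \<cdot>[trg P] farr P e|] ==> \<exists>h. h \<in> Arr (src P) \<and> cdom (src P) h = ccod (src P) e \<and>
        ccod (src P) h = ccod (src P) g \<and> h \<cdot>[src P] e = g \<and> farr P h = v"
    "\<And>h h'. [|h \<in> Arr (src P); h' \<in> Arr (src P); cdom (src P) h = ccod (src P) e; cdom (src P) h' = ccod (src P) e;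
      ccod (src P) h = ccod (src P) h'; h \<cdot>[src P] e = h' \<cdot>[src P] e; farr P h = farr P h'|] ==> h = h'"
  shows "e \<in> CoCart P"
  unfolding CoCart_def cocartesian_def Let_def mem_Collect_eq mem_hom
proof (intro conjI ballI impI allI assms(1), goal_cases)
  case (1 g v)
  then obtain h where h: "h \<in> Arr (src P)" "cdom (src P) h = ccod (src P) e"
      "ccod (src P) h = ccod (src P) g" "h \<cdot>[src P] e = g" "farr P h = v"
    using assms(2)[of g v] by (auto simp: mem_hom)
  show ?case
    by (rule ex1I[of _ h]) (use h assms(3) in auto)
qed

text \<open>The cancellation form of the universal property. Most equations between lifts below are
  obtained by precomposing with a suitable cocartesian arrow and comparing the images in the
  base.\<close>

lemma CoCart_unique:
  assumes P: "is_functor P" and "e \<in> CoCart P" "h \<in> Arr (src P)" "h' \<in> Arr (src P)" "cdom (src P) h = ccod (src P) e"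
    "cdom (src P) h' = ccod (src P) e" "ccod (src P) h = ccod (src P) h'" "h \<cdot>[src P] e = h' \<cdot>[src P] e"
    "farr P h = farr P h'"
  shows "h = h'"
proof -
  have e: "e \<in> Arr (src P)" using assms(2) by (rule CoCart_arr)
  have "\<exists>!k. k \<in> Arr (src P) \<and> cdom (src P) k = ccod (src P) e \<and> ccod (src P) k = ccod (src P) (h \<cdot>[src P] e) \<and>
    k \<cdot>[src P] e = h \<cdot>[src P] e \<and> farr P k = farr P h"
    by (rule CoCart_lift[OF assms(2)]) (use assms e in simp_all)
  then show ?thesis
    using assms e by (elim ex1E) (metis cat_comp(3) functor_cats(1))
qed

text \<open>A test arrow is first factored through \<open>e\<close>, over \<open>v\<close> composed
  with the image of \<open>e'\<close>; the result is then factored through \<open>e'\<close> over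
  \<open>v\<close>.\<close>

lemma CoCart_comp:
  assumes P: "is_functor P" and e: "e \<in> CoCart P" and e': "e' \<in> CoCart P" and c: "ccod (src P) e = cdom (src P) e'"
  shows "e' \<cdot>[src P] e \<in> CoCart P"
proof (rule CoCart_I)
  note a = CoCart_arr[OF e] CoCart_arr[OF e']
  show "e' \<cdot>[src P] e \<in> Arr (src P)" using a c P by simp
  {
    fix g v
    assume g: "g \<in> Arr (src P)" "cdom (src P) g = cdom (src P) (e' \<cdot>[src P] e)" "v \<in> Arr (trg P)"
      "cdom (trg P) v = fobj P (ccod (src P) (e' \<cdot>[src P] e))" "ccod (trg P) v = fobj P (ccod (src P) g)"
      "farr P g = v \<cdot>[trg P] farr P (e' \<cdot>[src P] e)"
    have "\<exists>!h. h \<in> Arr (src P) \<and> cdom (src P) h = ccod (src P) e \<and> ccod (src P) h = ccod (src P) g \<and>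
        h \<cdot>[src P] e = g \<and> farr P h = v \<cdot>[trg P] farr P e'"
      by (rule CoCart_lift[OF e]) (use g a c P in simp_all)
    then obtain h where h: "h \<in> Arr (src P)" "cdom (src P) h = ccod (src P) e" "ccod (src P) h = ccod (src P) g"
        "h \<cdot>[src P] e = g" "farr P h = v \<cdot>[trg P] farr P e'" by blast
    have "\<exists>!k. k \<in> Arr (src P) \<and> cdom (src P) k = ccod (src P) e' \<and> ccod (src P) k = ccod (src P) h \<and>
        k \<cdot>[src P] e' = h \<and> farr P k = v"
      by (rule CoCart_lift[OF e']) (use g h a c P in simp_all)
    then obtain k where k: "k \<in> Arr (src P)" "cdom (src P) k = ccod (src P) e'" "ccod (src P) k = ccod (src P) h"
        "k \<cdot>[src P] e' = h" "farr P k = v" by blast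
    have "k \<cdot>[src P] (e' \<cdot>[src P] e) = k \<cdot>[src P] e' \<cdot>[src P] e"
      using k(1-3) a c P by simp
    then show "\<exists>h. h \<in> Arr (src P) \<and> cdom (src P) h = ccod (src P) (e' \<cdot>[src P] e) \<and>
        ccod (src P) h = ccod (src P) g \<and> h \<cdot>[src P] (e' \<cdot>[src P] e) = g \<and> farr P h = v"
      using k h a c P by (intro exI[of _ k]) simp
  next
    fix h h' assume h: "h \<in> Arr (src P)" "h' \<in> Arr (src P)" "cdom (src P) h = ccod (src P) (e' \<cdot>[src P] e)"
      "cdom (src P) h' = ccod (src P) (e' \<cdot>[src P] e)" "ccod (src P) h = ccod (src P) h'"
      "h \<cdot>[src P] (e' \<cdot>[src P] e) = h' \<cdot>[src P] (e' \<cdot>[src P] e)" "farr P h = farr P h'"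
    have ends: "cdom (src P) h = ccod (src P) e'" "cdom (src P) h' = ccod (src P) e'"
      using h(3,4) a c P by simp_all
    have "h \<cdot>[src P] e' \<cdot>[src P] e = h \<cdot>[src P] (e' \<cdot>[src P] e)"
      "h' \<cdot>[src P] e' \<cdot>[src P] e = h' \<cdot>[src P] (e' \<cdot>[src P] e)"
      using h(1,2) ends a c P by simp_all
    then have 1: "h \<cdot>[src P] e' \<cdot>[src P] e = h' \<cdot>[src P] e' \<cdot>[src P] e"
      by (simp only: h(6))
    have 2: "h \<cdot>[src P] e' = h' \<cdot>[src P] e'"
      by (rule CoCart_unique[OF P e]) (use 1 h(1,2,5,7) ends a c P in simp_all)
    show "h = h'"
      by (rule CoCart_unique[OF P e']) (use 2 h(1,2,5,7) ends in simp_all)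
  }
qed

lemma functor_inverse:
  assumes "is_functor P" "inverse_arrows (src P) f g"
  shows "inverse_arrows (trg P) (farr P f) (farr P g)"
proof -
  have h: "f \<in> Arr (src P)" "g \<in> Arr (src P)" "cdom (src P) g = ccod (src P) f" "ccod (src P) g = cdom (src P) f"
    and e: "g \<cdot>[src P] f = ide (src P) (cdom (src P) f)" "f \<cdot>[src P] g = ide (src P) (ccod (src P) f)"
    using assms(2) by (simp_all add: inverse_arrows_iff)
  have "farr P g \<cdot>[trg P] farr P f = ide (trg P) (fobj P (cdom (src P) f))"
    "farr P f \<cdot>[trg P] farr P g = ide (trg P) (fobj P (ccod (src P) f))"
    using arg_cong[OF e(1), of "farr P"] arg_cong[OF e(2), of "farr P"] h assms(1) by simp_all
  then show ?thesis
    using h assms(1) by (simp add: inverse_arrows_iff)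
qed

text \<open>The only possible factorization is precomposition with the inverse, and it lies over the
  right base arrow because \<open>P\<close> preserves inverses.\<close>

lemma CoCart_iso:
  assumes P: "is_functor P" and i: "inverse_arrows (src P) e e'"
  shows "e \<in> CoCart P"
proof (rule CoCart_I)
  have h: "e \<in> Arr (src P)" "e' \<in> Arr (src P)" "cdom (src P) e' = ccod (src P) e" "ccod (src P) e' = cdom (src P) e"
    and q: "e' \<cdot>[src P] e = ide (src P) (cdom (src P) e)" "e \<cdot>[src P] e' = ide (src P) (ccod (src P) e)"
    using i by (simp_all add: inverse_arrows_iff)
  have Pq: "farr P e \<cdot>[trg P] farr P e' = ide (trg P) (fobj P (ccod (src P) e))"
    using functor_inverse[OF P i] h P by (simp add: inverse_arrows_iff)
  show "e \<in> Arr (src P)" by (rule h(1))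
  {
    fix g v
    assume g: "g \<in> Arr (src P)" "cdom (src P) g = cdom (src P) e" "v \<in> Arr (trg P)"
      "cdom (trg P) v = fobj P (ccod (src P) e)" "ccod (trg P) v = fobj P (ccod (src P) g)"
      "farr P g = v \<cdot>[trg P] farr P e"
    have "g \<cdot>[src P] e' \<cdot>[src P] e = g \<cdot>[src P] (e' \<cdot>[src P] e)"
      using g(1,2) h P by simp
    moreover have "v \<cdot>[trg P] farr P e \<cdot>[trg P] farr P e' = v \<cdot>[trg P] (farr P e \<cdot>[trg P] farr P e')"
      using g(3,4) h P by simp
    ultimately show "\<exists>h. h \<in> Arr (src P) \<and> cdom (src P) h = ccod (src P) e \<and>
        ccod (src P) h = ccod (src P) g \<and> h \<cdot>[src P] e = g \<and> farr P h = v"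
      using g h q Pq P by (intro exI[of _ "g \<cdot>[src P] e'"]) simp
  next
    fix k k' assume k: "k \<in> Arr (src P)" "k' \<in> Arr (src P)" "cdom (src P) k = ccod (src P) e" "cdom (src P) k' = ccod (src P) e"
      "k \<cdot>[src P] e = k' \<cdot>[src P] e"
    have "k \<cdot>[src P] (e \<cdot>[src P] e') = k \<cdot>[src P] e \<cdot>[src P] e'" "k' \<cdot>[src P] (e \<cdot>[src P] e') = k' \<cdot>[src P] e \<cdot>[src P] e'"
      using k(1-4) h P by simp_all
    then show "k = k'"
      using k q h P by simp
  }
qed

text \<open>Lifting \<open>w\<close> along \<open>e'\<close> gives a candidate \<open>k\<close> in
  the opposite direction. Both composites of \<open>h\<close> and \<open>k\<close> equal identities
  after precomposition with \<open>e\<close> or \<open>e'\<close> and lie over identities, so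
  cancellation applies. Invertibility of every comparison arrow below comes from here.\<close>

lemma CoCart_comparison_inverse:
  assumes P: "is_functor P" and e: "e \<in> CoCart P" and e': "e' \<in> CoCart P"
    and h: "h \<in> Arr (src P)" "cdom (src P) h = ccod (src P) e" "h \<cdot>[src P] e = e'"
    and i: "inverse_arrows (trg P) (farr P h) w"
  obtains k where "inverse_arrows (src P) h k" "farr P k = w" "k \<cdot>[src P] e' = e"
proof -
  note a = CoCart_arr[OF e] CoCart_arr[OF e']
  have c: "ccod (src P) h = ccod (src P) e'" "cdom (src P) e' = cdom (src P) e"
    using h a P by auto
  have w: "w \<in> Arr (trg P)" "cdom (trg P) w = fobj P (ccod (src P) e')" "ccod (trg P) w = fobj P (ccod (src P) e)"
    and q: "w \<cdot>[trg P] farr P h = ide (trg P) (fobj P (ccod (src P) e))" "farr P h \<cdot>[trg P] w = ide (trg P) (fobj P (ccod (src P) e'))"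
    using i h(1,2) c P by (simp_all add: inverse_arrows_iff)
  have "farr P e' = farr P h \<cdot>[trg P] farr P e"
    unfolding h(3)[symmetric] using h(1,2) a P by simp
  then have Pe: "farr P e = w \<cdot>[trg P] farr P e'"
    using q(1) w h(1,2) a c P by simp
  have "\<exists>!k. k \<in> Arr (src P) \<and> cdom (src P) k = ccod (src P) e' \<and> ccod (src P) k = ccod (src P) e \<and>
      k \<cdot>[src P] e' = e \<and> farr P k = w"
    by (rule CoCart_lift[OF e']) (use w a c Pe in simp_all)
  then obtain k where k: "k \<in> Arr (src P)" "cdom (src P) k = ccod (src P) e'" "ccod (src P) k = ccod (src P) e"
      "k \<cdot>[src P] e' = e" "farr P k = w" by blast
  have 1: "k \<cdot>[src P] h \<cdot>[src P] e = k \<cdot>[src P] (h \<cdot>[src P] e)" "h \<cdot>[src P] k \<cdot>[src P] e' = h \<cdot>[src P] (k \<cdot>[src P] e')"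
    using k(1-3) h(1,2) a c P by simp_all
  have "k \<cdot>[src P] h = ide (src P) (ccod (src P) e)"
    by (rule CoCart_unique[OF P e]) (use 1 k h a c P q in simp_all)
  moreover have "h \<cdot>[src P] k = ide (src P) (ccod (src P) e')"
    by (rule CoCart_unique[OF P e']) (use 1 k h a c P q in simp_all)
  ultimately show thesis
    using k h c by (intro that[of k]) (auto simp: inverse_arrows_iff)
qed

text \<open>An instance of the comparison of two cocartesian arrows: the first is an identity, and
  the comparison arrow is \<open>e\<close> itself.\<close>

lemma CoCart_invertible:
  assumes P: "is_functor P" and e: "e \<in> CoCart P" and i: "invertible (trg P) (farr P e)"
  shows "invertible (src P) e"
proof -
  obtain w where w: "inverse_arrows (trg P) (farr P e) w"
    using i by (auto simp: invertible_def)
  have a: "e \<in> Arr (src P)" by (rule CoCart_arr[OF e])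
  have d: "ide (src P) (cdom (src P) e) \<in> CoCart P"
    using a P by (intro CoCart_iso[OF P inverse_arrows_ide]) simp_all
  show ?thesis
    by (rule CoCart_comparison_inverse[OF P d e a _ _ w]) (use a P in \<open>auto simp: invertible_def\<close>)
qed

lemma functor_invertible: "is_functor P ==> invertible (src P) f ==> invertible (trg P) (farr P f)"
  by (auto simp: invertible_def dest: functor_inverse)

section \<open>Cleavages\<close>

locale cleavage =
  fixes P :: "'a univ func" and d :: "'a univ clv"
  assumes P [simp]: "is_functor P" and clv: "is_cleavage P d"
begin

abbreviation "E \<equiv> src P"
abbreviation "B \<equiv> trg P"
abbreviation "L \<equiv> lift_functor P d"

lemma clv_arr [simp]:
  assumes "x \<in> Obj E" "u \<in> Arr B" "cdom B u = fobj P x"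
  shows "d x u \<in> CoCart P" "d x u \<in> Arr E" "cdom E (d x u) = x" "farr P (d x u) = u" "fobj P (ccod E (d x u)) = ccod B u"
proof -
  show 1: "d x u \<in> CoCart P" "cdom E (d x u) = x" "farr P (d x u) = u"
    using clv assms by (auto simp: is_cleavage_def liftable_def)
  show 2: "d x u \<in> Arr E" by (rule CoCart_arr[OF 1(1)])
  show "fobj P (ccod E (d x u)) = ccod B u"
    using functor_arr(3)[OF P 2 refl] 1 by simp
qed

lemma lift_exists:
  assumes a: "Sq (Pair x u) (Pair y w) f v \<in> Arr (comma P)"
  shows "\<exists>!h. h \<in> Arr E \<and> cdom E h = ccod E (d x u) \<and> ccod E h = ccod E (d y w) \<and> h \<cdot>[E] d x u = d y w \<cdot>[E] f \<and> farr P h = v"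
proof -
  have h: "x \<in> Obj E" "u \<in> Arr B" "cdom B u = fobj P x" "y \<in> Obj E" "w \<in> Arr B" "cdom B w = fobj P y" "f \<in> Arr E"
    "cdom E f = x" "ccod E f = y" "v \<in> Arr B" "cdom B v = ccod B u" "ccod B v = ccod B w" "v \<cdot>[B] u = w \<cdot>[B] farr P f"
    using a by (simp_all add: comma_Arr comma_Obj)
  have "\<exists>!k. k \<in> Arr E \<and> cdom E k = ccod E (d x u) \<and> ccod E k = ccod E (d y w \<cdot>[E] f) \<and> k \<cdot>[E] d x u = d y w \<cdot>[E] f \<and> farr P k = v"
    by (rule CoCart_lift) (use h in simp_all)
  then show ?thesis using h by simp
qed

lemma lift_functor_ends [simp]: "src L = comma P" "trg L = E"
  by (simp_all add: lift_functor_def Let_def)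

lemma lift_obj [simp]: "Pair x u \<in> Obj (comma P) ==> fobj L (Pair x u) = ccod E (d x u)"
  by (simp add: lift_functor_def Let_def)

lemma lift_arr:
  assumes a: "Sq (Pair x u) (Pair y w) f v \<in> Arr (comma P)"
  shows "farr L (Sq (Pair x u) (Pair y w) f v) \<in> Arr E" "cdom E (farr L (Sq (Pair x u) (Pair y w) f v)) = ccod E (d x u)"
    "ccod E (farr L (Sq (Pair x u) (Pair y w) f v)) = ccod E (d y w)"
    "farr L (Sq (Pair x u) (Pair y w) f v) \<cdot>[E] d x u = d y w \<cdot>[E] f" "farr P (farr L (Sq (Pair x u) (Pair y w) f v)) = v"
proof -
  \<comment> \<open>The same predicate as in the definition of \<open>lift_functor\<close>, with the
    conjuncts reordered to match \<open>lift_exists\<close>.\<close>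
  have "farr L (Sq (Pair x u) (Pair y w) f v) =
      (THE h. h \<in> Arr E \<and> cdom E h = ccod E (d x u) \<and> ccod E h = ccod E (d y w) \<and> h \<cdot>[E] d x u = d y w \<cdot>[E] f \<and> farr P h = v)"
    using a by (simp add: lift_functor_def Let_def mem_hom) (rule arg_cong[of _ _ The], auto)
  with theI'[OF lift_exists[OF a]] show "farr L (Sq (Pair x u) (Pair y w) f v) \<in> Arr E" "cdom E (farr L (Sq (Pair x u) (Pair y w) f v)) = ccod E (d x u)"
    "ccod E (farr L (Sq (Pair x u) (Pair y w) f v)) = ccod E (d y w)"
    "farr L (Sq (Pair x u) (Pair y w) f v) \<cdot>[E] d x u = d y w \<cdot>[E] f" "farr P (farr L (Sq (Pair x u) (Pair y w) f v)) = v"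
    by simp_all
qed

lemma lift_arr_eqI:
  assumes a: "Sq (Pair x u) (Pair y w) f v \<in> Arr (comma P)"
    and "h \<in> Arr E" "cdom E h = ccod E (d x u)" "ccod E h = ccod E (d y w)" "h \<cdot>[E] d x u = d y w \<cdot>[E] f" "farr P h = v"
  shows "farr L (Sq (Pair x u) (Pair y w) f v) = h"
  using lift_exists[OF a] lift_arr[OF a] assms by auto

text \<open>Identities and composites satisfy the equation that characterizes the value of
  \<open>L\<close>, so functoriality is a consequence of uniqueness of lifts.\<close>

lemma lift_functor_functor [simp]: "is_functor L"
  unfolding lift_functor_def Let_def
proof (rule is_functor_mk, goal_cases)
  case (3 X)
  then show ?case by (auto elim!: comma_ObjE)
next
  case (4 a)
  obtain x u y w f v where a: "a = Sq (Pair x u) (Pair y w) f v" by (rule comma_ArrE[OF 4])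
  show ?case using lift_arr[OF 4[unfolded a]] 4 unfolding a by (simp add: lift_functor_def Let_def comma_ops)
next
  case (5 X)
  obtain x u where X: "X = Pair x u" "x \<in> Obj E" "u \<in> Arr B" "cdom B u = fobj P x" by (rule comma_ObjE[OF 5])
  have o: "Pair x u \<in> Obj (comma P)" using X by (simp add: comma_Obj)
  have m: "Sq (Pair x u) (Pair x u) (ide E x) (ide B (ccod B u)) \<in> Arr (comma P)"
    using X by (simp add: comma_Arr comma_Obj)
  have "farr L (ide (comma P) X) = ide E (ccod E (d x u))"
    using lift_arr_eqI[OF m, of "ide E (ccod E (d x u))"] o X by (simp add: comma_ops)
  then show ?case using o m X by (simp add: lift_functor_def Let_def comma_ops)
next
  case (6 a b)
  obtain x u y w f v where a: "a = Sq (Pair x u) (Pair y w) f v" by (rule comma_ArrE[OF 6(1)])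
  obtain y' w' z t g r where b: "b = Sq (Pair y' w') (Pair z t) g r" by (rule comma_ArrE[OF 6(2)])
  have e: "y' = y" "w' = w" using 6 a b by (simp_all add: comma_ops)
  note m = 6(1)[unfolded a] 6(2)[unfolded b e]
  note l1 = lift_arr[OF m(1)] and l2 = lift_arr[OF m(2)]
  note c = comma_comp_arr[OF P m]
  have h: "x \<in> Obj E" "u \<in> Arr B" "cdom B u = fobj P x" "y \<in> Obj E" "w \<in> Arr B" "cdom B w = fobj P y" "z \<in> Obj E"
    "t \<in> Arr B" "cdom B t = fobj P z" "f \<in> Arr E" "cdom E f = x" "ccod E f = y" "g \<in> Arr E" "cdom E g = y" "ccod E g = z"
    using m by (simp_all add: comma_Arr comma_Obj)
  let ?a = "farr L (Sq (Pair x u) (Pair y w) f v)" and ?b = "farr L (Sq (Pair y w) (Pair z t) g r)"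
  have "?b \<cdot>[E] ?a \<cdot>[E] d x u = ?b \<cdot>[E] d y w \<cdot>[E] f"
    by (rule cat_extend[OF l1(4)]) (use l1(1-3) l2(1-3) h in simp_all)
  also have "\<dots> = d z t \<cdot>[E] (g \<cdot>[E] f)"
    unfolding l2(4) using h by simp
  finally have e2: "?b \<cdot>[E] ?a \<cdot>[E] d x u = d z t \<cdot>[E] (g \<cdot>[E] f)" .
  have "farr L (Sq (Pair x u) (Pair z t) (g \<cdot>[E] f) (r \<cdot>[B] v)) = ?b \<cdot>[E] ?a"
    by (rule lift_arr_eqI[OF c]) (use e2 l1 l2 in simp_all)
  then have "farr L (b \<cdot>[comma P] a) = farr L b \<cdot>[E] farr L a"
    using m unfolding a b e by (simp add: comma_ops)
  then show ?case
    using 6 cat_comp(1)[OF comma_category[OF P] 6] by (simp add: lift_functor_def Let_def)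
qed simp_all

lemma lift_square: "is_square (comma_cod P) P L (id_functor B)"
proof -
  have "fobj P (fobj L X) = fobj (comma_cod P) X" if "X \<in> Obj (comma P)" for X
    by (rule comma_ObjE[OF that]) (simp add: comma_Obj)
  moreover have "farr P (farr L a) = farr (comma_cod P) a" if a: "a \<in> Arr (comma P)" for a
    by (rule comma_ArrE[OF a]) (use a lift_arr(5) in simp)
  moreover have "fobj (comma_cod P) X \<in> Obj B" if "X \<in> Obj (comma P)" for X
    using that functor_obj[OF comma_cod_functor[OF P], of X] by simp
  moreover have "farr (comma_cod P) a \<in> Arr B" if "a \<in> Arr (comma P)" for a
    using that functor_arr(1)[OF comma_cod_functor[OF P], of a] by simp
  ultimately show ?thesis
    by (simp add: is_square_def)
qed

end

lemma cat_extend1: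
  assumes "g \<cdot>[C] f = k" "category C" "h \<in> Arr C" "g \<in> Arr C" "f \<in> Arr C" "ccod C f = cdom C g" "ccod C g = cdom C h"
  shows "h \<cdot>[C] g \<cdot>[C] f = h \<cdot>[C] k"
  using arg_cong[OF assms(1), of "\<lambda>z. h \<cdot>[C] z"] assms(2-) by simp

lemma invertible_ide: "category C ==> x \<in> Obj C ==> invertible C (ide C x)"
  unfolding invertible_def by (rule exI, rule inverse_arrows_ide)

lemma vert_iff: "is_functor P ==> h \<in> vert P \<longleftrightarrow> h \<in> Arr (src P) \<and> farr P h = ide (trg P) (fobj P (cdom (src P) h))"
  by (auto simp: vert_def is_ide_def) (metis cat_ide(2) functor_arr(2) functor_cats(2))

text \<open>The lift over an identity, in the shape used by the definite descriptions for
  \<open>vert_part\<close>, \<open>push_arr\<close>, the components of \<open>lift_mult\<close> and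
  those of \<open>comparison\<close>; it justifies all of them.\<close>

lemma CoCart_vertical_lift:
  assumes P: "is_functor P" and e: "e \<in> CoCart P" and g: "g \<in> Arr (src P)" "cdom (src P) g = cdom (src P) e" "farr P g = farr P e"
  shows "\<exists>!h. h \<in> hom (src P) (ccod (src P) e) (ccod (src P) g) \<and> h \<in> vert P \<and> h \<cdot>[src P] e = g"
proof -
  have a: "e \<in> Arr (src P)" by (rule CoCart_arr[OF e])
  have c: "fobj P (ccod (src P) g) = fobj P (ccod (src P) e)"
    using functor_arr(3)[OF P g(1) refl] functor_arr(3)[OF P a refl] g(3) by simp
  have "\<exists>!h. h \<in> Arr (src P) \<and> cdom (src P) h = ccod (src P) e \<and> ccod (src P) h = ccod (src P) g \<and>
    h \<cdot>[src P] e = g \<and> farr P h = ide (trg P) (fobj P (ccod (src P) e))"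
    by (rule CoCart_lift[OF e]) (use g a c P in simp_all)
  then obtain h where h: "h \<in> Arr (src P)" "cdom (src P) h = ccod (src P) e" "ccod (src P) h = ccod (src P) g"
    "h \<cdot>[src P] e = g" "farr P h = ide (trg P) (fobj P (ccod (src P) e))" by blast
  show ?thesis
  proof (rule ex1I[of _ h])
    show "h \<in> hom (src P) (ccod (src P) e) (ccod (src P) g) \<and> h \<in> vert P \<and> h \<cdot>[src P] e = g"
      using h by (simp add: mem_hom vert_iff[OF P])
  next
    fix k assume "k \<in> hom (src P) (ccod (src P) e) (ccod (src P) g) \<and> k \<in> vert P \<and> k \<cdot>[src P] e = g"
    then have k: "k \<in> Arr (src P)" "cdom (src P) k = ccod (src P) e" "ccod (src P) k = ccod (src P) g"
      "k \<cdot>[src P] e = g" "farr P k = ide (trg P) (fobj P (ccod (src P) e))"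
      by (auto simp: mem_hom vert_iff[OF P])
    show "k = h"
      by (rule CoCart_unique[OF P e k(1) h(1) k(2) h(2)]) (simp_all only: h k)
  qed
qed

lemma ntrans_inverse:
  assumes t: "is_ntrans \<tau>" and i: "\<And>x. x \<in> Obj (src (src \<tau>)) ==> invertible (trg (src \<tau>)) (body \<tau> x)"
  defines "\<sigma> \<equiv> mk_ntrans (trg \<tau>) (src \<tau>) (\<lambda>x. inv_arrow (trg (src \<tau>)) (body \<tau> x))"
  shows "is_ntrans \<sigma>" "vcomp_ntrans \<sigma> \<tau> = id_ntrans (src \<tau>)" "vcomp_ntrans \<tau> \<sigma> = id_ntrans (trg \<tau>)"
proof -
  let ?A = "src (src \<tau>)" and ?C = "trg (src \<tau>)"
  have v: "inv_arrow ?C (body \<tau> x) \<in> Arr ?C" "cdom ?C (inv_arrow ?C (body \<tau> x)) = fobj (trg \<tau>) x"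
    "ccod ?C (inv_arrow ?C (body \<tau> x)) = fobj (src \<tau>) x"
    "inv_arrow ?C (body \<tau> x) \<cdot>[?C] body \<tau> x = ide ?C (fobj (src \<tau>) x)"
    "body \<tau> x \<cdot>[?C] inv_arrow ?C (body \<tau> x) = ide ?C (fobj (trg \<tau>) x)" if "x \<in> Obj ?A" for x
    using inv_arrow_inverse[OF _ i[OF that]] that t by (simp_all add: inverse_arrows_iff)
  show s: "is_ntrans \<sigma>"
    unfolding \<sigma>_def
  proof (rule is_ntrans_mk, goal_cases)
    case (6 f)
    then have f: "f \<in> Arr ?A" using t by simp
    let ?x = "cdom ?A f" and ?y = "ccod ?A f"
    let ?ix = "inv_arrow ?C (body \<tau> ?x)" and ?iy = "inv_arrow ?C (body \<tau> ?y)"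
    have xy: "?x \<in> Obj ?A" "?y \<in> Obj ?A" using f t by simp_all
    note vx = v[OF xy(1)] and vy = v[OF xy(2)]
    have "?iy \<cdot>[?C] farr (trg \<tau>) f \<cdot>[?C] (body \<tau> ?x \<cdot>[?C] ?ix) = ?iy \<cdot>[?C] (farr (trg \<tau>) f \<cdot>[?C] body \<tau> ?x) \<cdot>[?C] ?ix"
      using f xy vx(1-3) vy(1-3) t by simp
    also have "\<dots> = ?iy \<cdot>[?C] body \<tau> ?y \<cdot>[?C] farr (src \<tau>) f \<cdot>[?C] ?ix"
      unfolding ntrans_nat[OF t f refl refl, symmetric] using f xy vx(1-3) vy(1-3) t by simp
    finally show ?case
      using f xy vx vy t by simp
  qed (use t v in simp_all)
  have e: "src \<sigma> = trg \<tau>" "trg \<sigma> = src \<tau>" by (simp_all add: \<sigma>_def)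
  have b: "body \<sigma> x = inv_arrow ?C (body \<tau> x)" if "x \<in> Obj ?A" for x
    using that t by (simp add: \<sigma>_def)
  show "vcomp_ntrans \<sigma> \<tau> = id_ntrans (src \<tau>)"
    by (rule ntrans_eqI) (use s e b v t in simp_all)
  show "vcomp_ntrans \<tau> \<sigma> = id_ntrans (trg \<tau>)"
    by (rule ntrans_eqI) (use s e b v t in simp_all)
qed

text \<open>The inverse is taken componentwise on the total part. The components of
  \<open>\<beta>\<close> are vertical, hence so are their inverses, and the base part of the inverse
  2-cell can again be an identity; therefore the inverse belongs to the slice whenever the cell
  does.\<close>

lemma CAT2_inverse:
  assumes c: "Cell (Cell P Q (T, S)) (Cell P Q (T', S)) (\<beta>, id_ntrans S) \<in> Cell2 (CAT2 k)" (is "?\<phi> \<in> _")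
    and i: "\<And>x. x \<in> Obj (src P) ==> invertible (src Q) (body \<beta> x)"
  obtains \<psi> where "\<psi> \<in> hom2 (CAT2 k) (trg ?\<phi>) (src ?\<phi>)" "snd (body \<psi>) = id_ntrans S"
    "\<psi> \<bullet>\<^bsub>CAT2 k\<^esub> ?\<phi> = id2 (CAT2 k) (src ?\<phi>)" "?\<phi> \<bullet>\<^bsub>CAT2 k\<^esub> \<psi> = id2 (CAT2 k) (trg ?\<phi>)"
proof -
  have s: "is_square2 P Q T S T' S \<beta> (id_ntrans S)" and sm: "locally_small k (src P)" "locally_small k (trg P)"
     "locally_small k (src Q)" "locally_small k (trg Q)"
    using c unfolding CAT2_Cell2 by simp_all
  note d = square2D[OF s] squareD[OF square2D(1)[OF s]] squareD[OF square2D(2)[OF s]]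
  let ?\<sigma> = "mk_ntrans T' T (\<lambda>x. inv_arrow (src Q) (body \<beta> x))"
  have n: "is_ntrans ?\<sigma>" "vcomp_ntrans ?\<sigma> \<beta> = id_ntrans T" "vcomp_ntrans \<beta> ?\<sigma> = id_ntrans T'"
    using ntrans_inverse[OF d(3)] i d by simp_all
  have "farr Q (inv_arrow (src Q) (body \<beta> x)) = ide (trg Q) (fobj S (fobj P x))" if x: "x \<in> Obj (src P)" for x
  proof -
    have v: "inverse_arrows (src Q) (body \<beta> x) (inv_arrow (src Q) (body \<beta> x))"
      using inv_arrow_inverse[OF _ i[OF x]] d by simp
    have o: "fobj S (fobj P x) \<in> Obj (trg Q)" using x d by simp
    have "farr Q (body \<beta> x) = ide (trg Q) (fobj S (fobj P x))"
      using d(9)[OF x] x d by simp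
    then have "inverse_arrows (trg Q) (ide (trg Q) (fobj S (fobj P x))) (farr Q (inv_arrow (src Q) (body \<beta> x)))"
      using functor_inverse[OF _ v] d by simp
    then show ?thesis
      using inverse_arrows_unique inverse_arrows_ide[of "trg Q", OF _ o] d by (metis functor_cats(2))
  qed
  then have s': "is_square2 P Q T' S T S ?\<sigma> (id_ntrans S)"
    using d n by (simp add: is_square2_def)
  have v: "vcomp_ntrans (id_ntrans S) (id_ntrans S) = id_ntrans S"
    using d by (intro ntrans_eqI) simp_all
  show thesis
    by (rule that[of "Cell (Cell P Q (T', S)) (Cell P Q (T, S)) (?\<sigma>, id_ntrans S)"])
      (use s' sm n v in \<open>simp_all add: mem_hom2 CAT2_Cell2 CAT2_ops\<close>)
qed

lemma CAT2_inverse_components: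
  assumes i: "invertible2 (CAT2 k) (Cell (Cell P Q (T, S)) (Cell P Q (T', S')) (\<beta>, \<alpha>))" and x: "x \<in> Obj (src P)"
  shows "invertible (src Q) (body \<beta> x)"
proof -
  obtain \<psi> where p: "Cell (Cell P Q (T, S)) (Cell P Q (T', S')) (\<beta>, \<alpha>) \<in> Cell2 (CAT2 k)"
      "\<psi> \<in> hom2 (CAT2 k) (Cell P Q (T', S')) (Cell P Q (T, S))"
      "\<psi> \<bullet>\<^bsub>CAT2 k\<^esub> Cell (Cell P Q (T, S)) (Cell P Q (T', S')) (\<beta>, \<alpha>) = id2 (CAT2 k) (Cell P Q (T, S))"
      "Cell (Cell P Q (T, S)) (Cell P Q (T', S')) (\<beta>, \<alpha>) \<bullet>\<^bsub>CAT2 k\<^esub> \<psi> = id2 (CAT2 k) (Cell P Q (T', S'))"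
    using i by (auto simp: invertible2_def)
  obtain \<sigma> \<rho> where \<psi>: "\<psi> = Cell (Cell P Q (T', S')) (Cell P Q (T, S)) (\<sigma>, \<rho>)"
    using p(2) by (cases \<psi>) (auto simp: mem_hom2)
  have s: "is_square2 P Q T S T' S' \<beta> \<alpha>" "is_square2 P Q T' S' T S \<sigma> \<rho>"
    using p(1,2) unfolding \<psi> by (simp_all add: CAT2_Cell2 mem_hom2)
  have v: "vcomp_ntrans \<sigma> \<beta> = id_ntrans T" "vcomp_ntrans \<beta> \<sigma> = id_ntrans T'"
    using p(3,4) unfolding \<psi> by (simp_all add: CAT2_ops)
  note d = square2D[OF s(1)] square2D[OF s(2)] squareD[OF square2D(1)[OF s(1)]] squareD[OF square2D(2)[OF s(1)]]
  have "body \<sigma> x \<cdot>[src Q] body \<beta> x = ide (src Q) (fobj T x)" "body \<beta> x \<cdot>[src Q] body \<sigma> x = ide (src Q) (fobj T' x)"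
    using arg_cong[OF v(1), of "\<lambda>t. body t x"] arg_cong[OF v(2), of "\<lambda>t. body t x"] x d by simp_all
  then show ?thesis
    using x d unfolding invertible_def by (intro exI[of _ "body \<sigma> x"]) (simp add: inverse_arrows_iff)
qed

section \<open>Coherence of the comparison cells of an arbitrary cleavage\<close>

context cleavage
begin

text \<open>The component of \<open>lift_mult\<close> at ((x, u), v). The arguments follow the
  nesting of this pair, so their order is opposite to that of the subscripts in the usual
  notation.\<close>

definition chi :: "'a univ \<Rightarrow> 'a univ \<Rightarrow> 'a univ \<Rightarrow> 'a univ" where
  "chi x u v = (THE h. h \<in> hom E (push_obj P d v (push_obj P d u x)) (push_obj P d (v \<cdot>[B] u) x) \<and> h \<in> vert P \<and>
     h \<cdot>[E] (d (push_obj P d u x) v \<cdot>[E] d x u) = d x (v \<cdot>[B] u))"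

lemma chi:
  assumes "x \<in> Obj E" "u \<in> Arr B" "cdom B u = fobj P x" "v \<in> Arr B" "cdom B v = ccod B u"
  shows "chi x u v \<in> Arr E" "cdom E (chi x u v) = ccod E (d (ccod E (d x u)) v)" "ccod E (chi x u v) = ccod E (d x (v \<cdot>[B] u))"
    "farr P (chi x u v) = ide B (ccod B v)" "chi x u v \<cdot>[E] d (ccod E (d x u)) v \<cdot>[E] d x u = d x (v \<cdot>[B] u)"
    "invertible E (chi x u v)" "d (ccod E (d x u)) v \<cdot>[E] d x u \<in> CoCart P"
proof -
  let ?y = "ccod E (d x u)"
  let ?e = "d ?y v \<cdot>[E] d x u"
  show e: "?e \<in> CoCart P"
    using assms by (intro CoCart_comp[OF P]) simp_all
  have "\<exists>!h. h \<in> hom E (ccod E ?e) (ccod E (d x (v \<cdot>[B] u))) \<and> h \<in> vert P \<and> h \<cdot>[E] ?e = d x (v \<cdot>[B] u)"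
    by (rule CoCart_vertical_lift[OF P e]) (use assms in simp_all)
  then have "\<exists>!h. h \<in> hom E (push_obj P d v (push_obj P d u x)) (push_obj P d (v \<cdot>[B] u) x) \<and> h \<in> vert P \<and>
     h \<cdot>[E] (d (push_obj P d u x) v \<cdot>[E] d x u) = d x (v \<cdot>[B] u)"
    using assms by (simp add: push_obj_def)
  from theI'[OF this] have h: "chi x u v \<in> Arr E" "cdom E (chi x u v) = ccod E (d ?y v)"
      "ccod E (chi x u v) = ccod E (d x (v \<cdot>[B] u))" "chi x u v \<in> vert P" "chi x u v \<cdot>[E] ?e = d x (v \<cdot>[B] u)"
    unfolding chi_def[symmetric] by (simp_all add: push_obj_def mem_hom)
  show "chi x u v \<in> Arr E" "cdom E (chi x u v) = ccod E (d ?y v)" "ccod E (chi x u v) = ccod E (d x (v \<cdot>[B] u))"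
    by (rule h)+
  show f: "farr P (chi x u v) = ide B (ccod B v)"
    using h(2,4) assms by (simp add: vert_iff)
  show "chi x u v \<cdot>[E] d ?y v \<cdot>[E] d x u = d x (v \<cdot>[B] u)"
    using h(1-3,5) assms by simp
  have i: "inverse_arrows B (farr P (chi x u v)) (ide B (ccod B v))"
    unfolding f using assms by (intro inverse_arrows_ide) simp_all
  have e': "d x (v \<cdot>[B] u) \<in> CoCart P" using assms by simp
  have c: "cdom E (chi x u v) = ccod E ?e" using h assms by simp
  show "invertible E (chi x u v)"
    by (rule CoCart_comparison_inverse[OF P e e' h(1) c h(5) i]) (auto simp: invertible_def)
qed

lemma chi_eqI:
  assumes a: "x \<in> Obj E" "u \<in> Arr B" "cdom B u = fobj P x" "v \<in> Arr B" "cdom B v = ccod B u"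
    and h: "h \<in> Arr E" "cdom E h = ccod E (d (ccod E (d x u)) v)" "ccod E h = ccod E (d x (v \<cdot>[B] u))"
    "farr P h = ide B (ccod B v)" "h \<cdot>[E] d (ccod E (d x u)) v \<cdot>[E] d x u = d x (v \<cdot>[B] u)"
  shows "chi x u v = h"
  by (rule CoCart_unique[OF P chi(7)[OF a]]) (use a h chi[OF a] in simp_all)

abbreviation "Lb \<equiv> comma_map (Cell (comma_cod P) P (L, id_functor B))"

definition "chi_nt = mk_ntrans (comp_functor L Lb) (comp_functor L (comma_M P))
  (\<lambda>X. chi (pfst (pfst X)) (psnd (pfst X)) (psnd X))"

definition "iota_nt = mk_ntrans (id_functor E) (comp_functor L (comma_H P)) (\<lambda>x. d x (ide B (fobj P x)))"

lemma Lb_functor [simp]: "is_functor Lb" "src Lb = comma2 P" "trg Lb = comma P"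
  using lift_square by simp_all

lemma lift_act_eq: "lift_act P d = Cell (comma_cod P) P (L, id_functor B)"
  by (simp add: lift_act_def)

lemma lift_mult_eq: "lift_mult k P d = Cell (Cell (comma_cod (comma_cod P)) P (comp_functor L Lb, id_functor B))
    (Cell (comma_cod (comma_cod P)) P (comp_functor L (comma_M P), id_functor B)) (chi_nt, id_ntrans (id_functor B))"
  by (simp add: lift_mult_def Let_def lift_act_eq comma_sq_simps CAT2_ops comma_mult_eq chi_nt_def chi_def)

lemma lift_unit_eq: "lift_unit k P d = Cell (Cell P P (id_functor E, id_functor B))
    (Cell P P (comp_functor L (comma_H P), id_functor B)) (iota_nt, id_ntrans (id_functor B))"
  by (simp add: lift_unit_def Let_def lift_act_eq CAT2_ops comma_unit_eq iota_nt_def)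

lemma Lb_arr:
  assumes "Sq (Pair (Pair x u) v) (Pair (Pair y w) t) (Sq (Pair x u) (Pair y w) f r) s \<in> Arr (comma2 P)"
  shows "Sq (Pair (ccod E (d x u)) v) (Pair (ccod E (d y w)) t) (farr L (Sq (Pair x u) (Pair y w) f r)) s \<in> Arr (comma P)"
proof -
  have "Pair (Pair x u) v \<in> Obj (comma2 P)" "Pair (Pair y w) t \<in> Obj (comma2 P)" "s \<in> Arr B"
    using assms by (simp_all add: comma2_Arr)
  then show ?thesis
    using comma_map_arr[OF lift_square assms] by (simp add: comma2_Obj)
qed

text \<open>The lift of \<open>u\<close> followed by the lift of \<open>v\<close> is cocartesian, so
  naturality may be checked after precomposing with it. Both sides then become \<open>f\<close>
  followed by the lift of the composite of \<open>w\<close> and \<open>t\<close>.\<close>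

lemma chi_ntrans: "is_ntrans chi_nt"
  unfolding chi_nt_def
proof (rule is_ntrans_mk, goal_cases)
  case (5 X)
  then have X: "X \<in> Obj (comma2 P)" by simp
  obtain x u v where h: "X = Pair (Pair x u) v" "x \<in> Obj E" "u \<in> Arr B" "cdom B u = fobj P x" "v \<in> Arr B" "cdom B v = ccod B u"
    by (rule comma2_ObjE[OF X])
  then show ?case using X chi[OF h(2-6)] by (simp add: comma_Obj)
next
  case (6 a)
  then have a: "a \<in> Arr (comma2 P)" by simp
  obtain x u v y w t f r s where A: "a = Sq (Pair (Pair x u) v) (Pair (Pair y w) t) (Sq (Pair x u) (Pair y w) f r) s"
      "Pair (Pair x u) v \<in> Obj (comma2 P)" "Pair (Pair y w) t \<in> Obj (comma2 P)"
      "Sq (Pair x u) (Pair y w) f r \<in> Arr (comma P)" "s \<in> Arr B"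
    by (rule comma2_ArrE[OF a])
  note a = a[unfolded A(1)]
  have h: "x \<in> Obj E" "u \<in> Arr B" "cdom B u = fobj P x" "v \<in> Arr B" "cdom B v = ccod B u"
    "y \<in> Obj E" "w \<in> Arr B" "cdom B w = fobj P y" "t \<in> Arr B" "cdom B t = ccod B w"
    "f \<in> Arr E" "cdom E f = x" "ccod E f = y"
    using A(2-4) by (simp_all add: comma2_Obj comma_Obj comma_Arr)
  have st: "cdom B s = ccod B v" "ccod B s = ccod B t"
    using a by (simp_all add: comma2_Arr)
  note cx = chi[OF h(1-5)] and cy = chi[OF h(6-10)]
  let ?u = "d x u" and ?w = "d y w" and ?v = "d (ccod E (d x u)) v" and ?t = "d (ccod E (d y w)) t"
  let ?k = "farr L (Sq (Pair x u) (Pair y w) f r)"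
  let ?l = "farr L (Sq (Pair (ccod E ?u) v) (Pair (ccod E ?w) t) ?k s)"
  let ?m = "farr L (Sq (Pair x (v \<cdot>[B] u)) (Pair y (t \<cdot>[B] w)) f s)"
  note l0 = lift_arr[OF A(4)] and l = lift_arr[OF Lb_arr[OF a]] and m = lift_arr[OF comma_mult_arr[OF P a]]
  have "?l \<cdot>[E] ?v \<cdot>[E] ?u = ?t \<cdot>[E] ?k \<cdot>[E] ?u"
    by (simp only: l(4))
  also have "\<dots> = ?t \<cdot>[E] (?w \<cdot>[E] f)"
    by (rule cat_extend1[OF l0(4)]) (use l0 h in simp_all)
  finally have 1: "?l \<cdot>[E] ?v \<cdot>[E] ?u = ?t \<cdot>[E] (?w \<cdot>[E] f)" .
  have "chi y w t \<cdot>[E] ?l \<cdot>[E] (?v \<cdot>[E] ?u) = chi y w t \<cdot>[E] (?l \<cdot>[E] ?v \<cdot>[E] ?u)"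
    using l(1-3) cy(1-3) h by simp
  also have "\<dots> = chi y w t \<cdot>[E] ?t \<cdot>[E] ?w \<cdot>[E] f"
    unfolding 1 using cy(1-3) h by simp
  also have "\<dots> = d y (t \<cdot>[B] w) \<cdot>[E] f"
    by (simp only: cy(5))
  also have "\<dots> = ?m \<cdot>[E] d x (v \<cdot>[B] u)"
    by (simp only: m(4))
  also have "\<dots> = ?m \<cdot>[E] (chi x u v \<cdot>[E] ?v \<cdot>[E] ?u)"
    by (simp only: cx(5))
  also have "\<dots> = ?m \<cdot>[E] chi x u v \<cdot>[E] (?v \<cdot>[E] ?u)"
    using m(1-3) cx(1-3) h by simp
  finally have 2: "chi y w t \<cdot>[E] ?l \<cdot>[E] (?v \<cdot>[E] ?u) = ?m \<cdot>[E] chi x u v \<cdot>[E] (?v \<cdot>[E] ?u)" .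
  have "chi y w t \<cdot>[E] ?l = ?m \<cdot>[E] chi x u v"
    by (rule CoCart_unique[OF P cx(7)]) (use 2 l(1-3,5) m(1-3,5) cx(1-4) cy(1-4) h st A(5) in simp_all)
  moreover have "farr (comp_functor L Lb) a = ?l"
    using a A h by (simp add: comma_Obj)
  moreover have "farr (comp_functor L (comma_M P)) a = ?m"
    using a A h by simp
  ultimately show ?case
    using a A(1) 6 by (simp add: comma_ops)
qed (use lift_square in simp_all)

lemma iota_ntrans: "is_ntrans iota_nt"
  unfolding iota_nt_def
proof (rule is_ntrans_mk, goal_cases)
  case (6 f)
  then have f: "f \<in> Arr E" by simp
  have m: "Sq (Pair (cdom E f) (ide B (fobj P (cdom E f)))) (Pair (ccod E f) (ide B (fobj P (ccod E f)))) f (farr P f) \<in> Arr (comma P)"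
    using f by (simp add: comma_simps)
  show ?case using f lift_arr(4)[OF m] by simp
qed (simp_all add: comma_Obj)

lemma chi_nt_body [simp]: "Pair (Pair x u) v \<in> Obj (comma2 P) ==> body chi_nt (Pair (Pair x u) v) = chi x u v"
  by (simp add: chi_nt_def)

lemma iota_nt_body [simp]: "x \<in> Obj E ==> body iota_nt x = d x (ide B (fobj P x))"
  by (simp add: iota_nt_def)

lemma nt_ends [simp]: "src chi_nt = comp_functor L Lb" "trg chi_nt = comp_functor L (comma_M P)"
  "src iota_nt = id_functor E" "trg iota_nt = comp_functor L (comma_H P)"
  by (simp_all add: chi_nt_def iota_nt_def)

declare chi_ntrans [simp] iota_ntrans [simp]

text \<open>The case in which the inner base arrow is an identity. The whiskered unit cell appears
  here as the value of \<open>L\<close> on the arrow whose total component is the lift of that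
  identity.\<close>

lemma chi_unit_left:
  assumes h: "x \<in> Obj E" "u \<in> Arr B" "cdom B u = fobj P x"
  shows "Sq (Pair x u) (Pair (ccod E (d x (ide B (fobj P x)))) u) (d x (ide B (fobj P x))) (ide B (ccod B u)) \<in> Arr (comma P)"
    "chi x (ide B (fobj P x)) u \<cdot>[E] farr L (Sq (Pair x u) (Pair (ccod E (d x (ide B (fobj P x)))) u) (d x (ide B (fobj P x))) (ide B (ccod B u))) =
      ide E (ccod E (d x u))"
proof -
  let ?i = "d x (ide B (fobj P x))"
  show m: "Sq (Pair x u) (Pair (ccod E ?i) u) ?i (ide B (ccod B u)) \<in> Arr (comma P)"
    using h by (simp add: comma_simps)
  let ?k = "farr L (Sq (Pair x u) (Pair (ccod E ?i) u) ?i (ide B (ccod B u)))"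
  note k = lift_arr[OF m]
  have c: "chi x (ide B (fobj P x)) u \<in> Arr E" "cdom E (chi x (ide B (fobj P x)) u) = ccod E (d (ccod E ?i) u)"
    "ccod E (chi x (ide B (fobj P x)) u) = ccod E (d x u)" "farr P (chi x (ide B (fobj P x)) u) = ide B (ccod B u)"
    "chi x (ide B (fobj P x)) u \<cdot>[E] d (ccod E ?i) u \<cdot>[E] ?i = d x u"
    using chi[of x "ide B (fobj P x)" u] h by simp_all
  have 1: "chi x (ide B (fobj P x)) u \<cdot>[E] ?k \<cdot>[E] d x u = chi x (ide B (fobj P x)) u \<cdot>[E] (d (ccod E ?i) u \<cdot>[E] ?i)"
    by (rule cat_extend1[OF k(4)]) (use k c h in simp_all)
  have 2: "\<dots> = d x u"
    using c h by simp
  show "chi x (ide B (fobj P x)) u \<cdot>[E] ?k = ide E (ccod E (d x u))"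
    by (rule CoCart_unique[OF P clv_arr(1)[OF h]]) (use 1 2 k c h in simp_all)
qed

text \<open>The case in which the outer base arrow is an identity; here the unit cell is taken at
  the object \<open>ccod E (d x u)\<close>.\<close>

lemma chi_unit_right:
  assumes h: "x \<in> Obj E" "u \<in> Arr B" "cdom B u = fobj P x"
  shows "chi x u (ide B (ccod B u)) \<cdot>[E] d (ccod E (d x u)) (ide B (ccod B u)) = ide E (ccod E (d x u))"
  by (rule CoCart_unique[OF P clv_arr(1)[OF h]]) (use chi[of x u "ide B (ccod B u)"] h in simp_all)

text \<open>The successive lifts of \<open>u\<close>, \<open>v\<close>, \<open>w\<close> compose to
  a cocartesian arrow. Precomposed with it, both sides give the lift of the threefold composite
  along the base, so they agree.\<close>

lemma chi_assoc:
  assumes h: "x \<in> Obj E" "u \<in> Arr B" "cdom B u = fobj P x" "v \<in> Arr B" "cdom B v = ccod B u" "w \<in> Arr B" "cdom B w = ccod B v"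
  shows "Sq (Pair (ccod E (d (ccod E (d x u)) v)) w) (Pair (ccod E (d x (v \<cdot>[B] u))) w) (chi x u v) (ide B (ccod B w)) \<in> Arr (comma P)"
    "chi x (v \<cdot>[B] u) w \<cdot>[E] farr L (Sq (Pair (ccod E (d (ccod E (d x u)) v)) w) (Pair (ccod E (d x (v \<cdot>[B] u))) w) (chi x u v) (ide B (ccod B w))) =
      chi x u (w \<cdot>[B] v) \<cdot>[E] chi (ccod E (d x u)) v w"
proof -
  let ?u = "d x u"
  let ?v = "d (ccod E ?u) v"
  let ?w = "d (ccod E ?v) w"
  let ?vu = "d x (v \<cdot>[B] u)"
  note c1 = chi[OF h(1-5)]
  have c2: "chi x (v \<cdot>[B] u) w \<in> Arr E" "cdom E (chi x (v \<cdot>[B] u) w) = ccod E (d (ccod E ?vu) w)"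
      "ccod E (chi x (v \<cdot>[B] u) w) = ccod E (d x (w \<cdot>[B] v \<cdot>[B] u))" "farr P (chi x (v \<cdot>[B] u) w) = ide B (ccod B w)"
      "chi x (v \<cdot>[B] u) w \<cdot>[E] d (ccod E ?vu) w \<cdot>[E] ?vu = d x (w \<cdot>[B] v \<cdot>[B] u)"
    using chi[of x "v \<cdot>[B] u" w] h by simp_all
  have c3: "chi x u (w \<cdot>[B] v) \<in> Arr E" "cdom E (chi x u (w \<cdot>[B] v)) = ccod E (d (ccod E ?u) (w \<cdot>[B] v))"
      "ccod E (chi x u (w \<cdot>[B] v)) = ccod E (d x (w \<cdot>[B] v \<cdot>[B] u))" "farr P (chi x u (w \<cdot>[B] v)) = ide B (ccod B w)"
      "chi x u (w \<cdot>[B] v) \<cdot>[E] d (ccod E ?u) (w \<cdot>[B] v) \<cdot>[E] ?u = d x (w \<cdot>[B] v \<cdot>[B] u)"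
    using chi[of x u "w \<cdot>[B] v"] h by simp_all
  have c4: "chi (ccod E ?u) v w \<in> Arr E" "cdom E (chi (ccod E ?u) v w) = ccod E ?w"
      "ccod E (chi (ccod E ?u) v w) = ccod E (d (ccod E ?u) (w \<cdot>[B] v))" "farr P (chi (ccod E ?u) v w) = ide B (ccod B w)"
      "chi (ccod E ?u) v w \<cdot>[E] ?w \<cdot>[E] ?v = d (ccod E ?u) (w \<cdot>[B] v)"
    using chi[of "ccod E ?u" v w] h by simp_all
  show m: "Sq (Pair (ccod E ?v) w) (Pair (ccod E ?vu) w) (chi x u v) (ide B (ccod B w)) \<in> Arr (comma P)"
    using h c1 by (simp add: comma_simps)
  let ?k = "farr L (Sq (Pair (ccod E ?v) w) (Pair (ccod E ?vu) w) (chi x u v) (ide B (ccod B w)))"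
  note k = lift_arr[OF m]
  have cc: "?w \<cdot>[E] (?v \<cdot>[E] ?u) \<in> CoCart P"
    by (rule CoCart_comp[OF P c1(7)]) (use h in simp_all)
  have "chi x (v \<cdot>[B] u) w \<cdot>[E] ?k \<cdot>[E] (?w \<cdot>[E] (?v \<cdot>[E] ?u)) = chi x (v \<cdot>[B] u) w \<cdot>[E] (?k \<cdot>[E] ?w) \<cdot>[E] (?v \<cdot>[E] ?u)"
    using c2(1-3) k(1-3) h by simp
  also have "\<dots> = chi x (v \<cdot>[B] u) w \<cdot>[E] d (ccod E ?vu) w \<cdot>[E] (chi x u v \<cdot>[E] ?v \<cdot>[E] ?u)"
    unfolding k(4) using c2(1-3) c1(1-3) h by simp
  also have "\<dots> = d x (w \<cdot>[B] v \<cdot>[B] u)"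
    unfolding c1(5) by (rule c2(5))
  finally have 1: "chi x (v \<cdot>[B] u) w \<cdot>[E] ?k \<cdot>[E] (?w \<cdot>[E] (?v \<cdot>[E] ?u)) = d x (w \<cdot>[B] v \<cdot>[B] u)" .
  have "chi x u (w \<cdot>[B] v) \<cdot>[E] chi (ccod E ?u) v w \<cdot>[E] (?w \<cdot>[E] (?v \<cdot>[E] ?u)) = chi x u (w \<cdot>[B] v) \<cdot>[E] (chi (ccod E ?u) v w \<cdot>[E] ?w \<cdot>[E] ?v) \<cdot>[E] ?u"
    using c3(1-3) c4(1-3) h by simp
  also have "\<dots> = d x (w \<cdot>[B] v \<cdot>[B] u)"
    unfolding c4(5) by (rule c3(5))
  finally have 2: "chi x u (w \<cdot>[B] v) \<cdot>[E] chi (ccod E ?u) v w \<cdot>[E] (?w \<cdot>[E] (?v \<cdot>[E] ?u)) = d x (w \<cdot>[B] v \<cdot>[B] u)" .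
  show "chi x (v \<cdot>[B] u) w \<cdot>[E] ?k = chi x u (w \<cdot>[B] v) \<cdot>[E] chi (ccod E ?u) v w"
  proof (rule CoCart_unique[OF P cc])
    show "chi x (v \<cdot>[B] u) w \<cdot>[E] ?k \<cdot>[E] (?w \<cdot>[E] (?v \<cdot>[E] ?u)) =
      chi x u (w \<cdot>[B] v) \<cdot>[E] chi (ccod E ?u) v w \<cdot>[E] (?w \<cdot>[E] (?v \<cdot>[E] ?u))"
      by (simp only: 1 2)
  qed (use k(1-3,5) c1(1-4) c2(1-4) c3(1-4) c4(1-4) h in simp_all)
qed

end

text \<open>Records that the two sides of each axiom are parallel, which is the precondition for
  comparing them component by component.\<close>

lemma (in two_monad) pseudoalgebra_ends:
  assumes "X \<in> Ob K" "a \<in> Cell1 K" "src a = T0 T X" "trg a = X" "i \<in> Cell2 K" "src i = id1 K X"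
    "trg i = a \<odot> eta T X" "c \<in> Cell2 K" "src c = a \<odot> T1 T a" "trg c = a \<odot> mu T X"
  shows "(c \<lhd> T1 T (eta T X)) \<bullet> (a \<rhd> T2 T i) \<in> hom2 K a a"
     "(c \<lhd> eta T (T0 T X)) \<bullet> (i \<lhd> a) \<in> hom2 K a a"
     "(c \<lhd> T1 T (mu T X)) \<bullet> (a \<rhd> T2 T c) \<in> hom2 K (a \<odot> T1 T a \<odot> T1 T (T1 T a)) (a \<odot> mu T X \<odot> T1 T (mu T X))"
     "(c \<lhd> mu T (T0 T X)) \<bullet> (c \<lhd> T1 T (T1 T a)) \<in> hom2 K (a \<odot> T1 T a \<odot> T1 T (T1 T a)) (a \<odot> mu T X \<odot> T1 T (mu T X))"
  using assms by (simp_all add: mem_hom2)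

text \<open>All 2-cells of the slice have the same base component, an identity, so the total
  components decide.\<close>

lemma Slice_cell2_eqI:
  assumes "\<phi> \<in> hom2 (Slice (CAT k) C) F G" "\<psi> \<in> hom2 (Slice (CAT k) C) F G"
    "\<And>x. x \<in> Obj (src (src F)) ==> body (fst (body \<phi>)) x = body (fst (body \<psi>)) x"
  shows "\<phi> = \<psi>"
proof -
  have c: "\<phi> \<in> Cell2 (CAT2 k)" "\<psi> \<in> Cell2 (CAT2 k)" and e: "src \<phi> = F" "trg \<phi> = G" "src \<psi> = F" "trg \<psi> = G"
    and s: "snd (body \<phi>) = snd (body \<psi>)"
    using assms(1,2) by (auto simp: mem_hom2 Slice_simps)
  note d = two_category.Arrow_cell2D[OF CAT_two_category c(1)] two_category.Arrow_cell2D[OF CAT_two_category c(2)]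
  have "fst (body \<phi>) = fst (body \<psi>)"
    using d e assms(3) by (intro ntrans_eqI) (simp_all add: CAT_simps)
  then show ?thesis
    using e s by (intro cell.expand) (simp add: prod_eq_iff)
qed

context cleavage
begin

text \<open>Normality is nowhere assumed: the unit cell is invertible because its components are
  cocartesian over identities, and the multiplication cell because its components compare two
  cocartesian lifts of the same base arrow.\<close>

lemma cloven_pseudoalgebra:
  assumes k: "Card_order k" "infinite (Field k)" and Pk: "P \<in> Ob (CAT2 k)"
  shows "pseudoalgebra (Slice (CAT k) B) Comma (cloven_algebra k P d)"
proof -
  have sm: "locally_small k E" "locally_small k B" using Pk by (simp_all add: CAT2_Ob)
  have Bo: "B \<in> Ob (CAT k)" using sm by (simp add: CAT_simps)
  interpret T: strict_2monad "Slice (CAT k) B" "Comma :: ('a univ func, _, _) monad"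
    by (rule comma_Slice_2monad(1)[OF k Bo])
  let ?a = "lift_act P d" and ?i = "lift_unit k P d" and ?c = "lift_mult k P d"
  let ?K = "Slice (CAT k) B"
  note csm = comma_small[OF k]
  have sqM: "is_square (comma_cod (comma_cod P)) P (comp_functor L (comma_M P)) (id_functor B)"
    and sqL: "is_square (comma_cod (comma_cod P)) P (comp_functor L Lb) (id_functor B)"
    and sqH: "is_square P P (comp_functor L (comma_H P)) (id_functor B)"
    using square_comp[OF comma_M_square[OF P] lift_square] square_comp[OF comma_map_square[OF lift_square] lift_square]
      square_comp[OF comma_H_square[OF P] lift_square] by simp_all
  have PO: "P \<in> Ob ?K" using sm by (simp add: Slice_simps CAT_simps)
  have a: "?a \<in> Cell1 ?K" "src ?a = T0 Comma P" "trg ?a = P"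
    using sm by (simp_all add: Slice_simps lift_act_eq CAT2_Cell1 lift_square csm CAT_simps)
  have i2: "is_square2 P P (id_functor E) (id_functor B) (comp_functor L (comma_H P)) (id_functor B) iota_nt (id_ntrans (id_functor B))"
    using sqH square_id[OF P] by (simp add: is_square2_def)
  then have i: "?i \<in> Cell2 ?K" "src ?i = id1 ?K P" "trg ?i = ?a \<odot>\<^bsub>?K\<^esub> eta Comma P"
    using sm by (simp_all add: Slice_simps lift_unit_eq lift_act_eq CAT2_Cell2 CAT_simps CAT2_ops comma_unit_eq)
  have c2: "is_square2 (comma_cod (comma_cod P)) P (comp_functor L Lb) (id_functor B) (comp_functor L (comma_M P)) (id_functor B)
      chi_nt (id_ntrans (id_functor B))"
    using sqM sqL chi by (auto simp: is_square2_def comma2_Obj comma_Obj elim!: comma2_ObjE)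
  then have c: "?c \<in> Cell2 ?K" "src ?c = ?a \<odot>\<^bsub>?K\<^esub> T1 Comma ?a" "trg ?c = ?a \<odot>\<^bsub>?K\<^esub> mu Comma P"
    using sm by (simp_all add: Slice_simps lift_mult_eq lift_act_eq CAT2_Cell2 CAT_simps CAT2_ops comma_mult_eq comma_sq_simps csm)
  have inv: "invertible2 ?K ?i" "invertible2 ?K ?c"
  proof -
    have "invertible E (d x (ide B (fobj P x)))" if "x \<in> Obj E" for x
      using that by (intro CoCart_invertible[OF P]) (simp_all add: invertible_ide)
    then have v: "invertible E (body iota_nt x)" if "x \<in> Obj E" for x
      using that by simp
    have "Cell (Cell P P (id_functor E, id_functor B)) (Cell P P (comp_functor L (comma_H P), id_functor B))
        (iota_nt, id_ntrans (id_functor B)) \<in> Cell2 (CAT2 k)"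
      unfolding CAT2_Cell2 using i2 sm by blast
    \<comment> \<open>The inverse found here has identity base component, so it is a 2-cell of the
      slice and not only of \<open>CAT2\<close>.\<close>
    from CAT2_inverse[OF this v] obtain \<psi> where "\<psi> \<in> hom2 (CAT2 k) (trg ?i) (src ?i)" "snd (body \<psi>) = id_ntrans (id_functor B)"
      "\<psi> \<bullet>\<^bsub>CAT2 k\<^esub> ?i = id2 (CAT2 k) (src ?i)" "?i \<bullet>\<^bsub>CAT2 k\<^esub> \<psi> = id2 (CAT2 k) (trg ?i)"
      unfolding lift_unit_eq by blast
    then show "invertible2 ?K ?i"
      using i(1) unfolding invertible2_def
      by (intro conjI bexI[of _ \<psi>]) (auto simp: mem_hom2 Slice_simps CAT_simps lift_unit_eq)
    have v: "invertible E (body chi_nt X)" if "X \<in> Obj (comma2 P)" for X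
      by (rule comma2_ObjE[OF that]) (use chi(6) in \<open>simp add: comma2_Obj comma_Obj\<close>)
    have "Cell (Cell (comma_cod (comma_cod P)) P (comp_functor L Lb, id_functor B))
        (Cell (comma_cod (comma_cod P)) P (comp_functor L (comma_M P), id_functor B)) (chi_nt, id_ntrans (id_functor B)) \<in> Cell2 (CAT2 k)"
      unfolding CAT2_Cell2 using c2 sm by (simp add: csm)
    from CAT2_inverse[OF this] v obtain \<psi> where "\<psi> \<in> hom2 (CAT2 k) (trg ?c) (src ?c)" "snd (body \<psi>) = id_ntrans (id_functor B)"
      "\<psi> \<bullet>\<^bsub>CAT2 k\<^esub> ?c = id2 (CAT2 k) (src ?c)" "?c \<bullet>\<^bsub>CAT2 k\<^esub> \<psi> = id2 (CAT2 k) (trg ?c)"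
      unfolding lift_mult_eq comma_cod_simps by metis
    then show "invertible2 ?K ?c"
      using c(1) unfolding invertible2_def
      by (intro conjI bexI[of _ \<psi>]) (auto simp: mem_hom2 Slice_simps CAT_simps lift_mult_eq)
  qed
  note ends = T.pseudoalgebra_ends[OF PO a i c]
  have src_a: "src (src ?a) = comma P" by (simp add: lift_act_eq)
  note ops = Slice_simps(4-8) CAT2_ops lift_act_eq lift_unit_eq lift_mult_eq comma_unit_eq comma_mult_eq comma_sq_simps
  \<comment> \<open>At the object (x, u) the two unit axioms are \<open>chi_unit_left\<close> and
    \<open>chi_unit_right\<close>; at (((x, u), v), w) the associativity axiom is
    \<open>chi_assoc\<close>. The rest of each proof evaluates whiskered cells.\<close>
  have 1: "(?c \<lhd>\<^bsub>?K\<^esub> T1 Comma (eta Comma P)) \<bullet>\<^bsub>?K\<^esub> (?a \<rhd>\<^bsub>?K\<^esub> T2 Comma ?i) = id2 ?K ?a"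
  proof (rule Slice_cell2_eqI[OF ends(1) T.fn.dom.id2_in[OF a(1)]])
    fix X assume "X \<in> Obj (src (src ?a))"
    then have "X \<in> Obj (comma P)" by (simp add: src_a)
    then obtain x u where X: "X = Pair x u" and h: "x \<in> Obj E" "u \<in> Arr B" "cdom B u = fobj P x" by (rule comma_ObjE)
    show "body (fst (body ((?c \<lhd>\<^bsub>?K\<^esub> T1 Comma (eta Comma P)) \<bullet>\<^bsub>?K\<^esub> (?a \<rhd>\<^bsub>?K\<^esub> T2 Comma ?i)))) X = body (fst (body (id2 ?K ?a))) X"
      using h chi_unit_left[OF h] comma_H_square[OF P] comma_map_square[OF comma_H_square[OF P]] lift_square comma_nt_ntrans[OF i2] unfolding X by (simp add: ops comma2_Obj comma_Obj)
  qed
  have 2: "(?c \<lhd>\<^bsub>?K\<^esub> eta Comma (T0 Comma P)) \<bullet>\<^bsub>?K\<^esub> (?i \<lhd>\<^bsub>?K\<^esub> ?a) = id2 ?K ?a"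
  proof (rule Slice_cell2_eqI[OF ends(2) T.fn.dom.id2_in[OF a(1)]])
    fix X assume "X \<in> Obj (src (src ?a))"
    then have "X \<in> Obj (comma P)" by (simp add: src_a)
    then obtain x u where X: "X = Pair x u" and h: "x \<in> Obj E" "u \<in> Arr B" "cdom B u = fobj P x" by (rule comma_ObjE)
    show "body (fst (body ((?c \<lhd>\<^bsub>?K\<^esub> eta Comma (T0 Comma P)) \<bullet>\<^bsub>?K\<^esub> (?i \<lhd>\<^bsub>?K\<^esub> ?a)))) X = body (fst (body (id2 ?K ?a))) X"
      using h chi_unit_right[OF h] unfolding X by (simp add: ops comma2_Obj comma_Obj)
  qed
  have 3: "(?c \<lhd>\<^bsub>?K\<^esub> T1 Comma (mu Comma P)) \<bullet>\<^bsub>?K\<^esub> (?a \<rhd>\<^bsub>?K\<^esub> T2 Comma ?c) =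
      (?c \<lhd>\<^bsub>?K\<^esub> mu Comma (T0 Comma P)) \<bullet>\<^bsub>?K\<^esub> (?c \<lhd>\<^bsub>?K\<^esub> T1 Comma (T1 Comma ?a))"
  proof (rule Slice_cell2_eqI[OF ends(3,4)])
    fix X assume "X \<in> Obj (src (src (?a \<odot>\<^bsub>?K\<^esub> T1 Comma ?a \<odot>\<^bsub>?K\<^esub> T1 Comma (T1 Comma ?a))))"
    then have X: "X \<in> Obj (comma (comma_cod (comma_cod P)))" by (simp add: ops)
    obtain Y w where Y: "X = Pair Y w" "Y \<in> Obj (comma2 P)" "w \<in> Arr B" "cdom B w = fobj (comma_cod (comma_cod P)) Y"
      by (rule comma_ObjE[OF X]) auto
    obtain x u v where "Y = Pair (Pair x u) v" and h: "x \<in> Obj E" "u \<in> Arr B" "cdom B u = fobj P x" "v \<in> Arr B" "cdom B v = ccod B u"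
      by (rule comma2_ObjE[OF Y(2)])
    then have X': "X = Pair (Pair (Pair x u) v) w" and w: "w \<in> Arr B" "cdom B w = ccod B v"
      using Y by (simp_all add: comma2_Obj comma_Obj)
    have o: "Pair x u \<in> Obj (comma P)" "Pair (Pair x u) v \<in> Obj (comma2 P)"
      "Pair (Pair x u) (w \<cdot>[B] v) \<in> Obj (comma2 P)" "Pair (Pair x (v \<cdot>[B] u)) w \<in> Obj (comma2 P)"
      "Pair x (v \<cdot>[B] u) \<in> Obj (comma P)" "Pair (ccod E (d x u)) v \<in> Obj (comma P)"
      "Pair (Pair (ccod E (d x u)) v) w \<in> Obj (comma2 P)" "X \<in> Obj (comma (comma_cod (comma_cod P)))"
      using h w X by (simp_all add: comma2_Obj comma_Obj)
    show "body (fst (body ((?c \<lhd>\<^bsub>?K\<^esub> T1 Comma (mu Comma P)) \<bullet>\<^bsub>?K\<^esub> (?a \<rhd>\<^bsub>?K\<^esub> T2 Comma ?c)))) X =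
        body (fst (body ((?c \<lhd>\<^bsub>?K\<^esub> mu Comma (T0 Comma P)) \<bullet>\<^bsub>?K\<^esub> (?c \<lhd>\<^bsub>?K\<^esub> T1 Comma (T1 Comma ?a))))) X"
      using h w o chi_assoc[OF h w] comma_M_square[OF P] comma_map_square[OF lift_square] comma_map_square[OF comma_M_square[OF P]]
        comma_map_square[OF comma_map_square[OF lift_square]] lift_square comma_nt_ntrans[OF c2] unfolding X' by (simp add: ops)
  qed
  show ?thesis
    unfolding cloven_algebra_def T.pseudoalgebra_iff using PO a i c inv 1 2 3 by blast
qed

end

section \<open>The cleavage of a normal pseudoalgebra\<close>

text \<open>The data of a normal pseudoalgebra after its base components have been recognized as
  identities. The assumptions \<open>chi_left\<close> and \<open>chi_right\<close> are the two unit
  axioms at the object (x, u).\<close>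

locale normal_action =
  fixes P :: "'a univ func" and A :: "'a univ func" and \<chi> :: "'a univ ntrans"
  assumes P [simp]: "is_functor P" and sqA: "is_square (comma_cod P) P A (id_functor (trg P))"
    and unit: "comp_functor A (comma_H P) = id_functor (src P)"
    and chi_nat: "is_ntrans \<chi>"
    and chi_src: "src \<chi> = comp_functor A (comma_map (Cell (comma_cod P) P (A, id_functor (trg P))))"
    and chi_trg: "trg \<chi> = comp_functor A (comma_M P)"
    and chi_vert: "Pair (Pair x u) v \<in> Obj (comma2 P) ==>
      farr P (body \<chi> (Pair (Pair x u) v)) = ide (trg P) (ccod (trg P) v)"
    and chi_left: "Pair x u \<in> Obj (comma P) ==>
      body \<chi> (Pair (Pair x (ide (trg P) (fobj P x))) u) = ide (src P) (fobj A (Pair x u))"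
    and chi_right: "Pair x u \<in> Obj (comma P) ==>
      body \<chi> (Pair (Pair x u) (ide (trg P) (ccod (trg P) u))) = ide (src P) (fobj A (Pair x u))"
begin

abbreviation "E \<equiv> src P"
abbreviation "B \<equiv> trg P"
abbreviation "one x \<equiv> ide B (fobj P x)"

text \<open>The value off the liftable pairs is dictated by \<open>is_cleavage\<close>; it makes the
  cleavage recoverable from the action as a function, not merely on its domain.\<close>

definition dA :: "'a univ clv" where
  "dA x u = (if liftable P x u then farr A (Sq (Pair x (one x)) (Pair x u) (ide E x) u) else undefined)"

lemma A_ends [simp]: "is_functor A" "src A = comma P" "trg A = E"
  using squareD[OF sqA] by simp_all

lemma A_obj:
  assumes "x \<in> Obj E" "u \<in> Arr B" "cdom B u = fobj P x"
  shows "fobj A (Pair x u) \<in> Obj E" "fobj P (fobj A (Pair x u)) = ccod B u"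
proof -
  have o: "Pair x u \<in> Obj (comma P)" using assms by (simp add: comma_Obj)
  show "fobj A (Pair x u) \<in> Obj E" using o by simp
  show "fobj P (fobj A (Pair x u)) = ccod B u" using squareD(9)[OF sqA, of "Pair x u"] o assms by simp
qed

lemma A_arr:
  assumes a: "Sq (Pair x u) (Pair y w) f v \<in> Arr (comma P)"
  shows "farr A (Sq (Pair x u) (Pair y w) f v) \<in> Arr E" "cdom E (farr A (Sq (Pair x u) (Pair y w) f v)) = fobj A (Pair x u)"
    "ccod E (farr A (Sq (Pair x u) (Pair y w) f v)) = fobj A (Pair y w)" "farr P (farr A (Sq (Pair x u) (Pair y w) f v)) = v"
proof -
  have "v \<in> Arr B" using a by (simp add: comma_Arr)
  then show "farr A (Sq (Pair x u) (Pair y w) f v) \<in> Arr E" "cdom E (farr A (Sq (Pair x u) (Pair y w) f v)) = fobj A (Pair x u)"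
    "ccod E (farr A (Sq (Pair x u) (Pair y w) f v)) = fobj A (Pair y w)" "farr P (farr A (Sq (Pair x u) (Pair y w) f v)) = v"
    using a squareD(10)[OF sqA, of "Sq (Pair x u) (Pair y w) f v"] by (simp_all add: comma_ops)
qed

lemma A_unit_obj: "x \<in> Obj E ==> fobj A (Pair x (one x)) = x"
  using functor_compose(3)[of x "comma_H P" A] by (simp add: unit del: functor_compose)

lemma A_unit_arr:
  assumes "f \<in> Arr E"
  shows "farr A (Sq (Pair (cdom E f) (one (cdom E f))) (Pair (ccod E f) (one (ccod E f))) f (farr P f)) = f"
  using functor_compose(4)[of f "comma_H P" A] assms by (simp add: unit del: functor_compose)

lemma A_comp:
  assumes a: "Sq (Pair x u) (Pair y w) f v \<in> Arr (comma P)" and b: "Sq (Pair y w) (Pair z t) g r \<in> Arr (comma P)"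
  shows "farr A (Sq (Pair y w) (Pair z t) g r) \<cdot>[E] farr A (Sq (Pair x u) (Pair y w) f v) =
    farr A (Sq (Pair x u) (Pair z t) (g \<cdot>[E] f) (r \<cdot>[B] v))"
  using functor_comp[OF A_ends(1,2) a b] a b by (simp add: comma_ops)

lemma A_ide:
  assumes "x \<in> Obj E" "u \<in> Arr B" "cdom B u = fobj P x"
  shows "farr A (Sq (Pair x u) (Pair x u) (ide E x) (ide B (ccod B u))) = ide E (fobj A (Pair x u))"
proof -
  have "Pair x u \<in> Obj (comma P)" using assms by (simp add: comma_Obj)
  then show ?thesis
    using functor_ide[OF A_ends(1,2), of "Pair x u"] by (simp add: comma_ops del: functor_ide)
qed

context
  fixes x u
  assumes h: "x \<in> Obj E" "u \<in> Arr B" "cdom B u = fobj P x"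
begin

lemma m_arr: "Sq (Pair x (one x)) (Pair x u) (ide E x) u \<in> Arr (comma P)"
  using h by (simp add: comma_simps)

lemma dA_eq: "dA x u = farr A (Sq (Pair x (one x)) (Pair x u) (ide E x) u)"
  using h by (simp add: dA_def liftable_def)

lemma dA: "dA x u \<in> Arr E" "cdom E (dA x u) = x" "ccod E (dA x u) = fobj A (Pair x u)" "farr P (dA x u) = u"
  using A_arr[OF m_arr] A_unit_obj h by (simp_all add: dA_eq)

text \<open>One triangle identity for \<open>A\<close> as left adjoint of \<open>comma_H P\<close>:
  the displayed arrow is the component of the adjunction unit at (x, u), and the counit is an
  identity by the unit law. The proof uses naturality of \<open>\<chi>\<close> at an arrow at both
  ends of which \<open>\<chi>\<close> is an identity.\<close>

lemma A_dA: "Sq (Pair x u) (Pair (fobj A (Pair x u)) (ide B (ccod B u))) (dA x u) (ide B (ccod B u)) \<in> Arr (comma P)"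
    "farr A (Sq (Pair x u) (Pair (fobj A (Pair x u)) (ide B (ccod B u))) (dA x u) (ide B (ccod B u))) = ide E (fobj A (Pair x u))"
proof -
  show m: "Sq (Pair x u) (Pair (fobj A (Pair x u)) (ide B (ccod B u))) (dA x u) (ide B (ccod B u)) \<in> Arr (comma P)"
    using h dA A_obj[OF h] by (simp add: comma_simps)
  have o: "Pair (Pair x (one x)) u \<in> Obj (comma2 P)" "Pair (Pair x u) (ide B (ccod B u)) \<in> Obj (comma2 P)"
      "Pair x u \<in> Obj (comma P)" "Pair x (one x) \<in> Obj (comma P)"
    using h by (simp_all add: comma2_Obj comma_Obj)
  \<comment> \<open>Its source has an identity as inner base arrow and its target one as outer base
    arrow, so \<open>\<chi>\<close> is an identity at both. The multiplication sends the arrow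
    itself to an identity, while the action on the inner level produces the adjunction unit.\<close>
  let ?a = "Sq (Pair (Pair x (one x)) u) (Pair (Pair x u) (ide B (ccod B u))) (Sq (Pair x (one x)) (Pair x u) (ide E x) u) (ide B (ccod B u))"
  have a: "?a \<in> Arr (comma2 P)"
    using h o m_arr by (simp add: comma2_Arr)
  have M: "farr (comma_M P) ?a = Sq (Pair x u) (Pair x u) (ide E x) (ide B (ccod B u))"
    using a h by simp
  have L: "farr (comma_map (Cell (comma_cod P) P (A, id_functor B))) ?a =
      Sq (Pair x u) (Pair (fobj A (Pair x u)) (ide B (ccod B u))) (dA x u) (ide B (ccod B u))"
    using a h by (simp add: A_unit_obj dA_eq)
  have "body \<chi> (ccod (comma2 P) ?a) \<cdot>[E] farr (src \<chi>) ?a = farr (trg \<chi>) ?a \<cdot>[E] body \<chi> (cdom (comma2 P) ?a)"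
    by (rule ntrans_nat[OF chi_nat]) (use a chi_src in simp_all)
  then show "farr A (Sq (Pair x u) (Pair (fobj A (Pair x u)) (ide B (ccod B u))) (dA x u) (ide B (ccod B u))) = ide E (fobj A (Pair x u))"
    using a M L o A_ide[OF h] A_arr(1-3)[OF m] A_obj[OF h] A_unit_obj[OF A_obj(1)[OF h]]
    by (simp add: chi_left chi_right chi_src chi_trg comma_ops)
qed

text \<open>Existence: \<open>A\<close> applied to (g, v), viewed as an arrow from (x, u) into the
  unit object on the codomain of \<open>g\<close>. Uniqueness: a factorization is the value of
  \<open>A\<close> on an arrow built only from its composite with the lift and from its image in the
  base.\<close>

lemma dA_CoCart: "dA x u \<in> CoCart P"
proof (rule CoCart_I)
  show "dA x u \<in> Arr E" by (rule dA)
  fix g v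
  assume g: "g \<in> Arr E" "cdom E g = cdom E (dA x u)" "v \<in> Arr B" "cdom B v = fobj P (ccod E (dA x u))"
    "ccod B v = fobj P (ccod E g)" "farr P g = v \<cdot>[B] farr P (dA x u)"
  have c: "cdom E g = x" "cdom B v = ccod B u" "farr P g = v \<cdot>[B] u"
    using g dA A_obj[OF h] by simp_all
  have b: "Sq (Pair x u) (Pair (ccod E g) (one (ccod E g))) g v \<in> Arr (comma P)"
    using g(1,3,5) h c by (simp add: comma_simps)
  let ?h = "farr A (Sq (Pair x u) (Pair (ccod E g) (one (ccod E g))) g v)"
  have "?h \<cdot>[E] dA x u = farr A (Sq (Pair x (one x)) (Pair (ccod E g) (one (ccod E g))) g (farr P g))"
    using A_comp[OF m_arr b] g(1) c by (simp add: dA_eq)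
  also have "\<dots> = g"
    using A_unit_arr[OF g(1)] c(1) by simp
  finally show "\<exists>h. h \<in> Arr E \<and> cdom E h = ccod E (dA x u) \<and> ccod E h = ccod E g \<and> h \<cdot>[E] dA x u = g \<and> farr P h = v"
    using A_arr[OF b] A_unit_obj g(1) dA by (intro exI[of _ ?h]) simp
next
  \<comment> \<open>By the unit law \<open>k\<close> is a value of \<open>A\<close>, and by the
    triangle identity the adjunction unit may be inserted before it; functoriality merges both into
    a single arrow out of (x, u).\<close>
  have *: "k = farr A (Sq (Pair x u) (Pair (ccod E k) (one (ccod E k))) (k \<cdot>[E] dA x u) (farr P k))"
    if k: "k \<in> Arr E" "cdom E k = ccod E (dA x u)" for k
  proof -
    let ?y = "fobj A (Pair x u)"
    have c: "cdom E k = ?y" "one ?y = ide B (ccod B u)" using k dA A_obj[OF h] by simp_all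
    have b: "Sq (Pair ?y (ide B (ccod B u))) (Pair (ccod E k) (one (ccod E k))) k (farr P k) \<in> Arr (comma P)"
      using k c A_obj[OF h] h by (simp add: comma_simps)
    have "farr P k \<cdot>[B] ide B (ccod B u) = farr P k" using k c A_obj[OF h] by simp
    then have "farr A (Sq (Pair x u) (Pair (ccod E k) (one (ccod E k))) (k \<cdot>[E] dA x u) (farr P k)) =
        farr A (Sq (Pair ?y (ide B (ccod B u))) (Pair (ccod E k) (one (ccod E k))) k (farr P k)) \<cdot>[E]
        farr A (Sq (Pair x u) (Pair ?y (ide B (ccod B u))) (dA x u) (ide B (ccod B u)))"
      using A_comp[OF A_dA(1) b] by simp
    also have "\<dots> = k"
      using A_unit_arr[OF k(1)] A_dA(2) k c by simp
    finally show ?thesis by simp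
  qed
  fix k k' assume k: "k \<in> Arr E" "k' \<in> Arr E" "cdom E k = ccod E (dA x u)" "cdom E k' = ccod E (dA x u)"
      "ccod E k = ccod E k'" "k \<cdot>[E] dA x u = k' \<cdot>[E] dA x u" "farr P k = farr P k'"
  show "k = k'"
    using *[OF k(1,3)] *[OF k(2,4)] unfolding k(5-7) by (rule trans[OF _ sym])
qed

end

lemma dA_normal: "normal_cleavage P dA"
proof -
  have "dA x (one x) = ide E x" if "x \<in> Obj E" for x
    using A_unit_arr[of "ide E x"] that by (simp add: dA_eq)
  then show ?thesis
    using dA_CoCart dA by (auto simp: normal_cleavage_def is_cleavage_def liftable_def dA_def)
qed

sublocale d: cleavage P dA
  using dA_normal by unfold_locales (simp_all add: normal_cleavage_def)

text \<open>In the comma category, (f, v) after (1, u) and (1, w) after (f, P f) are the same arrow.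
  Applying \<open>A\<close> gives the equation that characterizes the value of the lift
  functor.\<close>

lemma dA_lift: "lift_functor P dA = A"
proof (rule functor_eqI, goal_cases)
  case (5 X)
  then have "X \<in> Obj (comma P)" by simp
  then show ?case by (rule comma_ObjE) (simp add: comma_Obj dA)
next
  case (6 a)
  then have a: "a \<in> Arr (comma P)" by simp
  obtain x u y w f v where A: "a = Sq (Pair x u) (Pair y w) f v" "x \<in> Obj E" "u \<in> Arr B" "cdom B u = fobj P x"
    "y \<in> Obj E" "w \<in> Arr B" "cdom B w = fobj P y"
    "f \<in> Arr E" "cdom E f = x" "ccod E f = y" "v \<in> Arr B"
    "cdom B v = ccod B u" "ccod B v = ccod B w" "v \<cdot>[B] u = w \<cdot>[B] farr P f"
    by (rule comma_ArrE[OF a])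
  note a = a[unfolded A(1)]
  have f: "Sq (Pair x (one x)) (Pair y (one y)) f (farr P f) \<in> Arr (comma P)"
    using A(2-13) by (simp add: comma_simps)
  have "farr A (Sq (Pair x u) (Pair y w) f v) \<cdot>[E] dA x u = farr A (Sq (Pair x (one x)) (Pair y w) f (v \<cdot>[B] u))"
    using A_comp[OF m_arr[OF A(2-4)] a] A(2-4,8-10) by (simp add: dA_eq)
  also have "\<dots> = dA y w \<cdot>[E] f"
    using A_comp[OF f m_arr[OF A(5-7)]] A_unit_arr[OF A(8)] A(5-10,14) by (simp add: dA_eq)
  finally show ?case
    unfolding A(1) by (intro d.lift_arr_eqI[OF a]) (use A_arr[OF a] dA A(2-7) in simp_all)
qed simp_all

text \<open>Naturality of \<open>\<chi>\<close> at a suitable arrow out of ((x, 1), 1), where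
  \<open>\<chi>\<close> is an identity, yields the triangle that defines the comparison of
  lifts.\<close>

lemma dA_chi:
  assumes h: "x \<in> Obj E" "u \<in> Arr B" "cdom B u = fobj P x" "v \<in> Arr B" "cdom B v = ccod B u"
  shows "d.chi x u v = body \<chi> (Pair (Pair x u) v)"
proof (rule d.chi_eqI[OF h])
  have o: "Pair (Pair x u) v \<in> Obj (comma2 P)" "Pair (Pair x (one x)) (one x) \<in> Obj (comma2 P)"
      "Pair x (one x) \<in> Obj (comma P)" "Pair x u \<in> Obj (comma P)" "Pair x (v \<cdot>[B] u) \<in> Obj (comma P)"
    using h by (simp_all add: comma2_Obj comma_Obj)
  let ?y = "fobj A (Pair x u)"
  have y: "?y \<in> Obj E" "fobj P ?y = ccod B u" by (rule A_obj[OF h(1-3)])+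
  have yv: "?y \<in> Obj E" "v \<in> Arr B" "cdom B v = fobj P ?y" using y h by simp_all
  have b: "body \<chi> (Pair (Pair x u) v) \<in> Arr E" "cdom E (body \<chi> (Pair (Pair x u) v)) = fobj A (Pair ?y v)"
      "ccod E (body \<chi> (Pair (Pair x u) v)) = fobj A (Pair x (v \<cdot>[B] u))"
    using ntrans_arr[OF chi_nat, of "Pair (Pair x u) v" E] o h by (simp_all add: chi_src chi_trg)
  show "body \<chi> (Pair (Pair x u) v) \<in> Arr E" "cdom E (body \<chi> (Pair (Pair x u) v)) = ccod E (dA (ccod E (dA x u)) v)"
    "ccod E (body \<chi> (Pair (Pair x u) v)) = ccod E (dA x (v \<cdot>[B] u))"
    using b dA[OF h(1-3)] dA[OF yv] dA(3)[of x "v \<cdot>[B] u"] h by simp_all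
  show "farr P (body \<chi> (Pair (Pair x u) v)) = ide B (ccod B v)"
    by (rule chi_vert[OF o(1)])
  \<comment> \<open>The action sends this arrow to the successive lifts of \<open>u\<close> and
    \<open>v\<close>, the multiplication sends it to the lift of their composite, and its target is
    the object at which \<open>\<chi>\<close> is to be computed.\<close>
  let ?a = "Sq (Pair (Pair x (one x)) (one x)) (Pair (Pair x u) v) (Sq (Pair x (one x)) (Pair x u) (ide E x) u) (v \<cdot>[B] u)"
  have a: "?a \<in> Arr (comma2 P)"
    using h o m_arr[OF h(1-3)] by (simp add: comma2_Arr)
  have M: "farr (comma_M P) ?a = Sq (Pair x (one x)) (Pair x (v \<cdot>[B] u)) (ide E x) (v \<cdot>[B] u)"
    using a h by simp
  have L: "farr (comma_map (Cell (comma_cod P) P (A, id_functor B))) ?a = Sq (Pair x (one x)) (Pair ?y v) (dA x u) (v \<cdot>[B] u)"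
    using a h by (simp add: A_unit_obj dA_eq)
  have m1: "Sq (Pair x (one x)) (Pair ?y (one ?y)) (dA x u) u \<in> Arr (comma P)"
    using h y dA[OF h(1-3)] by (simp add: comma_simps)
  have 1: "farr A (Sq (Pair x (one x)) (Pair ?y v) (dA x u) (v \<cdot>[B] u)) = dA ?y v \<cdot>[E] dA x u"
    using A_comp[OF m1 m_arr[OF yv]] A_unit_arr[OF dA(1)[OF h(1-3)]] dA[OF h(1-3)] y by (simp add: dA_eq[OF yv])
  have 2: "farr A (Sq (Pair x (one x)) (Pair x (v \<cdot>[B] u)) (ide E x) (v \<cdot>[B] u)) = dA x (v \<cdot>[B] u)"
    using dA_eq[of x "v \<cdot>[B] u"] h by simp
  have "body \<chi> (ccod (comma2 P) ?a) \<cdot>[E] farr (src \<chi>) ?a = farr (trg \<chi>) ?a \<cdot>[E] body \<chi> (cdom (comma2 P) ?a)"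
    by (rule ntrans_nat[OF chi_nat]) (use a chi_src in simp_all)
  then have "body \<chi> (Pair (Pair x u) v) \<cdot>[E] (dA ?y v \<cdot>[E] dA x u) = dA x (v \<cdot>[B] u)"
    using a M L 1 2 o dA[of x "v \<cdot>[B] u"] h by (simp add: chi_left chi_src chi_trg A_unit_obj comma_ops)
  then show "body \<chi> (Pair (Pair x u) v) \<cdot>[E] dA (ccod E (dA x u)) v \<cdot>[E] dA x u = dA x (v \<cdot>[B] u)"
    using dA[OF h(1-3)] dA[OF yv] b by simp
qed

lemma dA_chi_nt: "d.chi_nt = \<chi>"
proof (rule ntrans_eqI, goal_cases)
  case (5 X)
  then have X: "X \<in> Obj (comma2 P)" by (simp add: chi_src)
  show ?case
    by (rule comma2_ObjE[OF X]) (simp add: comma2_Obj comma_Obj dA_chi)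
qed (simp_all add: chi_nat chi_src chi_trg dA_lift)

end

section \<open>Normal pseudoalgebras and normally cloven cofibrations\<close>

context two_monad
begin

text \<open>With an identity unit cell the second factor of each unit axiom is an identity, and the
  axiom becomes a statement on the multiplication cell alone.\<close>

lemma normal_pseudoalgebraD:
  assumes "pseudoalgebra K T (PsAlg X a (id2 K (id1 K X)) c)"
  shows "c \<lhd> T1 T (eta T X) = id2 K a" "c \<lhd> eta T (T0 T X) = id2 K a"
proof -
  have h: "X \<in> Ob K" "a \<in> Cell1 K" "src a = T0 T X" "trg a = X" "c \<in> Cell2 K" "src c = a \<odot> T1 T a" "trg c = a \<odot> mu T X"
    and u': "trg (id2 K (id1 K X)) = a \<odot> eta T X"
    and 1: "(c \<lhd> T1 T (eta T X)) \<bullet> (a \<rhd> T2 T (id2 K (id1 K X))) = id2 K a"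
      "(c \<lhd> eta T (T0 T X)) \<bullet> (id2 K (id1 K X) \<lhd> a) = id2 K a"
    using assms unfolding pseudoalgebra_iff by blast+
  have u: "id1 K X = a \<odot> eta T X"
    using u' h(1) by simp
  have e: "a \<odot> T1 T a \<odot> T1 T (eta T X) = a" "a \<odot> T1 T a \<odot> eta T (T0 T X) = a"
  proof -
    have "T1 T a \<odot> T1 T (eta T X) = id1 K (T0 T X)"
    proof -
      have "T1 T a \<odot> T1 T (eta T X) = T1 T (a \<odot> eta T X)" using h by simp
      also have "\<dots> = id1 K (T0 T X)" unfolding u[symmetric] using h by simp
      finally show ?thesis .
    qed
    then have "a \<odot> (T1 T a \<odot> T1 T (eta T X)) = a" using h by (simp del: fn.dom.comp1_assoc')
    then show "a \<odot> T1 T a \<odot> T1 T (eta T X) = a" using h by simp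
    have "a \<odot> T1 T a \<odot> eta T (T0 T X) = a \<odot> eta T X \<odot> a"
      using h by simp
    then show "a \<odot> T1 T a \<odot> eta T (T0 T X) = a"
      using h by (simp flip: u)
  qed
  show "c \<lhd> T1 T (eta T X) = id2 K a" "c \<lhd> eta T (T0 T X) = id2 K a"
    using 1 h e by simp_all
qed

text \<open>The unit axiom of a pseudomorphism between normal algebras, with both unit cells
  removed. It later fixes the structure cell at the objects (x, 1).\<close>

lemma normal_pseudomorphismD:
  assumes "pseudomorphism K T (Cell (PsAlg X a (id2 K (id1 K X)) c) (PsAlg Y b (id2 K (id1 K Y)) d) (f, m))"
  shows "m \<lhd> eta T X = id2 K f"
proof -
  have h: "X \<in> Ob K" "Y \<in> Ob K" "b \<in> Cell1 K" "src b = T0 T Y" "trg b = Y" "f \<in> Cell1 K" "src f = X" "trg f = Y"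
      "m \<in> Cell2 K" "src m = b \<odot> T1 T f"
      "trg m = f \<odot> a" and u': "trg (id2 K (id1 K Y)) = b \<odot> eta T Y"
    and 1: "(m \<lhd> eta T X) \<bullet> (id2 K (id1 K Y) \<lhd> f) = f \<rhd> id2 K (id1 K X)"
    using assms unfolding pseudomorphism_iff pseudoalgebra_iff by blast+
  have u: "id1 K Y = b \<odot> eta T Y"
    using u' h(2) by simp
  have "b \<odot> T1 T f \<odot> eta T X = b \<odot> eta T Y \<odot> f"
    using h by simp
  then have "b \<odot> T1 T f \<odot> eta T X = f"
    using h by (simp flip: u)
  then show ?thesis
    using 1 h assms by (simp add: pseudomorphism_iff pseudoalgebra_iff)
qed

lemma pseudomorphism_ends:
  assumes "pseudoalgebra K T (PsAlg X a i c)" "pseudoalgebra K T (PsAlg Y b j d)"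
    "f \<in> Cell1 K" "src f = X" "trg f = Y" "m \<in> Cell2 K" "src m = b \<odot> T1 T f" "trg m = f \<odot> a"
  shows "(m \<lhd> eta T X) \<bullet> (j \<lhd> f) \<in> hom2 K f (f \<odot> a \<odot> eta T X)"
    "f \<rhd> i \<in> hom2 K f (f \<odot> a \<odot> eta T X)"
    "(m \<lhd> mu T X) \<bullet> (d \<lhd> T1 T (T1 T f)) \<in> hom2 K (b \<odot> T1 T b \<odot> T1 T (T1 T f)) (f \<odot> a \<odot> mu T X)"
    "(f \<rhd> c) \<bullet> (m \<lhd> T1 T a) \<bullet> (b \<rhd> T2 T m) \<in>
       hom2 K (b \<odot> T1 T b \<odot> T1 T (T1 T f)) (f \<odot> a \<odot> mu T X)"
  using assms by (simp_all add: mem_hom2 pseudoalgebra_iff)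

lemma transformation_ends:
  assumes "pseudomorphism K T (Cell (PsAlg X a i c) (PsAlg Y b j d) (f, m))"
    "pseudomorphism K T (Cell (PsAlg X a i c) (PsAlg Y b j d) (f', m'))" "\<alpha> \<in> Cell2 K" "src \<alpha> = f" "trg \<alpha> = f'"
  shows "(\<alpha> \<lhd> a) \<bullet> m \<in> hom2 K (b \<odot> T1 T f) (f' \<odot> a)"
    "m' \<bullet> (b \<rhd> T2 T \<alpha>) \<in> hom2 K (b \<odot> T1 T f) (f' \<odot> a)"
  using assms by (simp_all add: mem_hom2 pseudomorphism_iff pseudoalgebra_iff)

end

lemma CAT2_cell2_eqI:
  assumes "\<phi> \<in> hom2 (CAT2 k) F G" "\<psi> \<in> hom2 (CAT2 k) F G"
    "\<And>x. x \<in> Obj (src (src F)) ==> body (fst (body \<phi>)) x = body (fst (body \<psi>)) x"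
    "\<And>x. x \<in> Obj (trg (src F)) ==> body (snd (body \<phi>)) x = body (snd (body \<psi>)) x"
  shows "\<phi> = \<psi>"
proof -
  have c: "\<phi> \<in> Cell2 (CAT2 k)" "\<psi> \<in> Cell2 (CAT2 k)" and e: "src \<phi> = F" "trg \<phi> = G" "src \<psi> = F" "trg \<psi> = G"
    using assms(1,2) by (auto simp: mem_hom2)
  note d = two_category.Arrow_cell2D[OF CAT_two_category c(1)] two_category.Arrow_cell2D[OF CAT_two_category c(2)]
  have "fst (body \<phi>) = fst (body \<psi>)"
    using d e assms(3) by (intro ntrans_eqI) (simp_all add: CAT_simps)
  moreover have "snd (body \<phi>) = snd (body \<psi>)"
    using d e assms(4) by (intro ntrans_eqI) (simp_all add: CAT_simps)
  ultimately show ?thesis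
    using e by (intro cell.expand) (simp add: prod_eq_iff)
qed

text \<open>Identity components force the two functors to agree on objects; naturality then forces
  agreement on arrows. In this way equations between functors are read off from comparison cells,
  which links the pseudo case with the strict one.\<close>

lemma ntrans_identity:
  assumes t: "is_ntrans \<tau>" and i: "\<And>x. x \<in> Obj (src (src \<tau>)) ==> is_ide (trg (src \<tau>)) (body \<tau> x)"
  shows "src \<tau> = trg \<tau>" "\<tau> = id_ntrans (src \<tau>)"
proof -
  let ?C = "trg (src \<tau>)"
  have b: "fobj (src \<tau>) x = fobj (trg \<tau>) x" "body \<tau> x = ide ?C (fobj (src \<tau>) x)" if x: "x \<in> Obj (src (src \<tau>))" for x
  proof -
    obtain z where z: "z \<in> Obj ?C" "body \<tau> x = ide ?C z" using i[OF x] by (auto simp: is_ide_def)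
    have C: "category ?C" using t by simp
    have "fobj (src \<tau>) x = z" "fobj (trg \<tau>) x = z"
      using ntrans_arr(2,3)[OF t x refl] cat_ide[OF C z(1)] unfolding z(2) by simp_all
    then show "fobj (src \<tau>) x = fobj (trg \<tau>) x" "body \<tau> x = ide ?C (fobj (src \<tau>) x)" using z by simp_all
  qed
  show e: "src \<tau> = trg \<tau>"
  proof (rule functor_eqI)
    fix f assume "f \<in> Arr (src (trg \<tau>))"
    then have f: "f \<in> Arr (src (src \<tau>))" using t by simp
    have o: "cdom (src (src \<tau>)) f \<in> Obj (src (src \<tau>))" "ccod (src (src \<tau>)) f \<in> Obj (src (src \<tau>))" using f t by simp_all
    show "farr (src \<tau>) f = farr (trg \<tau>) f"
      using ntrans_nat[OF t f refl refl] f o t b[OF o(1)] b[OF o(2)] by simp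
  qed (use t b in simp_all)
  show "\<tau> = id_ntrans (src \<tau>)"
    by (rule ntrans_eqI) (use t b(2) e[symmetric] in simp_all)
qed

text \<open>The operations of the slice are those of \<open>CAT2\<close>, so the axioms carry over
  verbatim; invertibility carries over by \<open>sub_invertible2\<close>. Thus the verification made
  over a fixed base also serves for \<open>Gamma_n\<close>.\<close>

lemma Slice_pseudoalgebra:
  fixes C :: "'a univ cat"
  assumes k: "Card_order k" "infinite (Field k)" and C: "C \<in> Ob (CAT k)"
    and A: "pseudoalgebra (Slice (CAT k) C) Comma A"
  shows "pseudoalgebra (CAT2 k) Comma A"
proof -
  interpret S: strict_2monad "Slice (CAT k) C" "Comma :: ('a univ func, _, _) monad"
    by (rule comma_Slice_2monad(1)[OF k C])
  interpret T: strict_2monad "CAT2 k" "Comma :: ('a univ func, _, _) monad"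
    by (rule comma_2monad[OF k])
  interpret sub: sub_2category "CAT2 k" "{P \<in> Cell1 (CAT k). trg P = C}"
    "{F \<in> Cell1 (CAT2 k). trg (src F) = C \<and> trg (trg F) = C \<and> snd (body F) = id1 (CAT k) C}"
    "{\<phi> \<in> Cell2 (CAT2 k). trg (src (src \<phi>)) = C \<and> trg (trg (src \<phi>)) = C \<and> snd (body \<phi>) = id2 (CAT k) (id1 (CAT k) C)}"
    by (rule Slice_sub[OF CAT_2category C])
  have inv: "invertible2 (Slice (CAT k) C) \<phi> ==> invertible2 (CAT2 k) \<phi>" for \<phi> :: "'a univ square2"
    unfolding Slice_def by (rule sub.sub_invertible2)
  obtain P a i c where PA: "A = PsAlg P a i c" by (cases A)
  show ?thesis
    using A inv[of i] inv[of c] unfolding PA S.pseudoalgebra_iff T.pseudoalgebra_iff Slice_simps(4-8)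
    by (auto simp: Slice_simps(1-3) CAT2_Ob CAT_simps)
qed

lemma Gamma_n_simps:
  "F0 (Gamma_n k) (P, d) = PsAlg P (lift_act P d) (id2 (CAT2 k) (id1 (CAT2 k) P)) (lift_mult k P d)"
  "F1 (Gamma_n k) M = Cell (F0 (Gamma_n k) (src M)) (F0 (Gamma_n k) (trg M)) (body M, comparison k M)"
  "F2 (Gamma_n k) \<alpha> = Cell (F1 (Gamma_n k) (src \<alpha>)) (F1 (Gamma_n k) (trg \<alpha>)) (body \<alpha>)"
  by (simp_all add: Gamma_n_def Let_def)

text \<open>As the lift of the identity is the identity of \<open>x\<close>, the designated lift of
  \<open>u\<close> solves the equation that defines this value of \<open>L\<close>. So the
  construction \<open>dA\<close> inverts the passage from a normal cleavage to its action.\<close>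

lemma (in cleavage) normal_lift:
  assumes n: "normal_cleavage P d" and h: "x \<in> Obj E" "u \<in> Arr B" "cdom B u = fobj P x"
  shows "farr L (Sq (Pair x (ide B (fobj P x))) (Pair x u) (ide E x) u) = d x u"
proof (rule lift_arr_eqI)
  have "d x (ide B (fobj P x)) = ide E x" using n h by (simp add: normal_cleavage_def)
  then show "Sq (Pair x (ide B (fobj P x))) (Pair x u) (ide E x) u \<in> Arr (comma P)"
    "cdom E (d x u) = ccod E (d x (ide B (fobj P x)))" "d x u \<cdot>[E] d x (ide B (fobj P x)) = d x u \<cdot>[E] ide E x"
    using h by (simp_all add: comma_simps)
qed (use h in simp_all)

lemma normal_cleavage_locale: "is_functor P ==> normal_cleavage P d ==> cleavage P d"
  by unfold_locales (simp_all add: normal_cleavage_def)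

lemma normal_cleavage_unique:
  assumes "is_functor P" "normal_cleavage P d" "normal_cleavage P d'" "lift_act P d = lift_act P d'"
  shows "d = d'"
proof (intro ext)
  fix x u
  interpret cleavage P d by (rule normal_cleavage_locale[OF assms(1,2)])
  interpret d': cleavage P d' by (rule normal_cleavage_locale[OF assms(1,3)])
  have e: "L = d'.L" using assms(4) by (simp add: lift_act_eq d'.lift_act_eq)
  show "d x u = d' x u"
  proof (cases "liftable P x u")
    case True
    then have h: "x \<in> Obj E" "u \<in> Arr B" "cdom B u = fobj P x" by (simp_all add: liftable_def)
    show ?thesis
      using normal_lift[OF assms(2) h] d'.normal_lift[OF assms(3) h] unfolding e by (rule trans[OF sym])
  next
    \<comment> \<open>Here both cleavages are \<open>undefined\<close>; without this convention the
      action would determine the cleavage only on liftable pairs.\<close>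
    case False
    then show ?thesis using clv d'.clv by (simp add: is_cleavage_def)
  qed
qed

text \<open>The components of the unit transformation are identities, which also identifies its two
  ends; so the cell equals the identity 2-cell used by \<open>Gamma_n\<close>.\<close>

lemma (in cleavage) normal_lift_unit:
  assumes n: "normal_cleavage P d"
  shows "lift_unit k P d = id2 (CAT2 k) (id1 (CAT2 k) P)"
proof -
  have i: "is_ide E (body iota_nt x)" if "x \<in> Obj E" for x
    using that n by (auto simp: is_ide_def normal_cleavage_def)
  have "comp_functor L (comma_H P) = id_functor E" "iota_nt = id_ntrans (id_functor E)"
    using ntrans_identity[OF iota_ntrans] i by simp_all
  then show ?thesis
    by (simp add: lift_unit_eq CAT2_ops)
qed

lemma Gamma_n_Ob:
  fixes P :: "'a univ func"
  assumes k: "Card_order k" "infinite (Field k)" and Pk: "P \<in> Ob (CAT2 k)" and n: "normal_cleavage P d"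
  shows "F0 (Gamma_n k) (P, d) = cloven_algebra k P d" "F0 (Gamma_n k) (P, d) \<in> Ob (Ps_Alg_n (CAT2 k) Comma)"
proof -
  interpret cleavage P d by (rule normal_cleavage_locale[OF _ n]) (use Pk in \<open>simp add: CAT2_Ob\<close>)
  interpret T: strict_2monad "CAT2 k" "Comma :: ('a univ func, _, _) monad"
    by (rule comma_2monad[OF k])
  show e: "F0 (Gamma_n k) (P, d) = cloven_algebra k P d"
    by (simp add: Gamma_n_simps cloven_algebra_def normal_lift_unit[OF n])
  have "B \<in> Ob (CAT k)" using Pk by (simp add: CAT2_Ob CAT_simps)
  then have "pseudoalgebra (CAT2 k) Comma (cloven_algebra k P d)"
    by (rule Slice_pseudoalgebra[OF k _ cloven_pseudoalgebra[OF k Pk]])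
  then show "F0 (Gamma_n k) (P, d) \<in> Ob (Ps_Alg_n (CAT2 k) Comma)"
    unfolding T.Ps_Alg_n_Ob e[symmetric] by (simp add: normal_algebra_def Gamma_n_simps)
qed

text \<open>In \<open>CAT2\<close> the base components of an action and of its multiplication cell
  are a priori arbitrary. Normality settles both: the unit law fixes the first, the base part of the
  unit axioms the second.\<close>

lemma normal_pseudoalgebra_action:
  fixes P :: "'a univ func"
  assumes k: "Card_order k" "infinite (Field k)"
    and A: "pseudoalgebra (CAT2 k) Comma (PsAlg P a (id2 (CAT2 k) (id1 (CAT2 k) P)) c)"
  obtains L \<chi> where "a = Cell (comma_cod P) P (L, id_functor (trg P))" "normal_action P L \<chi>"
    "c = Cell (Cell (comma_cod (comma_cod P)) P (comp_functor L (comma_map a), id_functor (trg P)))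
      (Cell (comma_cod (comma_cod P)) P (comp_functor L (comma_M P), id_functor (trg P))) (\<chi>, id_ntrans (id_functor (trg P)))"
proof -
  interpret T: strict_2monad "CAT2 k" "Comma :: ('a univ func, _, _) monad"
    by (rule comma_2monad[OF k])
  let ?B = "trg P"
  have P: "P \<in> Ob (CAT2 k)" and a: "a \<in> Cell1 (CAT2 k)" "src a = comma_cod P" "trg a = P"
    and u': "trg (id2 (CAT2 k) (id1 (CAT2 k) P)) = a \<odot>\<^bsub>CAT2 k\<^esub> comma_unit P"
    and c: "c \<in> Cell2 (CAT2 k)" "src c = a \<odot>\<^bsub>CAT2 k\<^esub> comma_sq a" "trg c = a \<odot>\<^bsub>CAT2 k\<^esub> comma_mult P"
    using A unfolding T.pseudoalgebra_iff Comma_simps by blast+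
  have u: "id1 (CAT2 k) P = a \<odot>\<^bsub>CAT2 k\<^esub> comma_unit P"
    using u' by (simp only: Arrow_simps(6) cell.sel)
  have Pf: "is_functor P" using P by (simp add: CAT2_Ob)
  obtain L S where aLS: "a = Cell (comma_cod P) P (L, S)" using a by (metis cell.collapse surj_pair)
  have s: "is_square (comma_cod P) P L S" using a(1) unfolding aLS CAT2_Cell1 by blast
  have "comp_functor L (comma_H P) = id_functor (src P)" "comp_functor S (id_functor ?B) = id_functor ?B"
    using u unfolding aLS comma_unit_eq CAT2_ops by simp_all
  \<comment> \<open>The base component of the monad unit is an identity functor, so the unit law
    leaves \<open>S\<close> itself on the base.\<close>
  then have LH: "comp_functor L (comma_H P) = id_functor (src P)" and S: "S = id_functor ?B"
    using squareD[OF s] by simp_all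
  note aL = aLS[unfolded S] and s = s[unfolded S]
  obtain \<chi> \<alpha> where "c = Cell (src c) (trg c) (\<chi>, \<alpha>)" by (metis cell.collapse surj_pair)
  then have cx: "c = Cell (Cell (comma_cod (comma_cod P)) P (comp_functor L (comma_map a), id_functor ?B))
      (Cell (comma_cod (comma_cod P)) P (comp_functor L (comma_M P), id_functor ?B)) (\<chi>, \<alpha>)"
    using Pf unfolding c by (simp add: aL CAT2_ops comma_sq_simps comma_mult_eq)
  have s2: "is_square2 (comma_cod (comma_cod P)) P (comp_functor L (comma_map a)) (id_functor ?B)
      (comp_functor L (comma_M P)) (id_functor ?B) \<chi> \<alpha>"
    using c(1) unfolding cx CAT2_Cell2 by blast
  note d = square2D[OF s2]
  note n1 = T.normal_pseudoalgebraD(1)[OF A] and n2 = T.normal_pseudoalgebraD(2)[OF A]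
  note ops = cx aL CAT2_ops comma_unit_eq comma_sq_simps
  have v1: "hcomp_ntrans \<chi> (id_ntrans (comma_map (comma_unit P))) = id_ntrans L"
    and v2: "hcomp_ntrans \<chi> (id_ntrans (comma_H (comma_cod P))) = id_ntrans L"
    and v3: "hcomp_ntrans \<alpha> (id_ntrans (id_functor ?B)) = id_ntrans (id_functor ?B)"
    using n1 n2 by (simp_all add: ops)
  \<comment> \<open>On the base the whiskering in the unit axiom is along an identity functor, so
    the axiom speaks of \<open>\<alpha>\<close> itself.\<close>
  have \<alpha>: "\<alpha> = id_ntrans (id_functor ?B)"
  proof (rule ntrans_eqI)
    fix x assume "x \<in> Obj (src (src (id_ntrans (id_functor ?B))))"
    then have x: "x \<in> Obj ?B" by simp
    show "body \<alpha> x = body (id_ntrans (id_functor ?B)) x"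
      using arg_cong[OF v3, of "\<lambda>t. body t x"] x d(4,7,8) Pf by simp
  qed (use d Pf in simp_all)
  have H1: "is_square P (comma_cod P) (comma_H P) (id_functor ?B)" by (rule comma_H_square[OF Pf])
  note sd = squareD[OF s] squareD[OF comma_map_square[OF s]]
  have "normal_action P L \<chi>"
  proof (rule normal_action.intro)
    fix x v w
    assume "Pair (Pair x v) w \<in> Obj (comma2 P)"
    then show "farr P (body \<chi> (Pair (Pair x v) w)) = ide ?B (ccod ?B w)"
      using d(9)[of "Pair (Pair x v) w"] Pf unfolding \<alpha> by (simp add: comma2_Obj)
  next
    fix x v
    assume o: "Pair x v \<in> Obj (comma P)"
    then have h: "x \<in> Obj (src P)" "v \<in> Arr ?B" "cdom ?B v = fobj P x" by (simp_all add: comma_Obj)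
    show "body \<chi> (Pair (Pair x (ide ?B (fobj P x))) v) = ide (src P) (fobj L (Pair x v))"
      using arg_cong[OF v1, of "\<lambda>t. body t (Pair x v)"] o h d(3,5,6) Pf sd comma_map_square[OF H1] H1
      by (simp add: comma_unit_eq aL)
    show "body \<chi> (Pair (Pair x v) (ide ?B (ccod ?B v))) = ide (src P) (fobj L (Pair x v))"
      using arg_cong[OF v2, of "\<lambda>t. body t (Pair x v)"] o h d(3,5,6) Pf sd
      by (simp add: aL)
  qed (use Pf s LH d aL in simp_all)
  then show thesis
    using aL cx \<alpha> by (intro that) simp_all
qed

lemma normal_pseudoalgebra_cleavage:
  fixes P :: "'a univ func"
  assumes k: "Card_order k" "infinite (Field k)"
    and A: "pseudoalgebra (CAT2 k) Comma (PsAlg P a (id2 (CAT2 k) (id1 (CAT2 k) P)) c)"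
  obtains d where "normal_cleavage P d" "a = lift_act P d" "c = lift_mult k P d"
proof -
  obtain L \<chi> where a: "a = Cell (comma_cod P) P (L, id_functor (trg P))" and n: "normal_action P L \<chi>" and
    c: "c = Cell (Cell (comma_cod (comma_cod P)) P (comp_functor L (comma_map a), id_functor (trg P)))
      (Cell (comma_cod (comma_cod P)) P (comp_functor L (comma_M P), id_functor (trg P))) (\<chi>, id_ntrans (id_functor (trg P)))"
    by (rule normal_pseudoalgebra_action[OF k A])
  interpret normal_action P L \<chi> by fact
  show thesis
  proof (rule that[OF dA_normal])
    show "a = lift_act P dA" by (simp add: a d.lift_act_eq dA_lift)
    show "c = lift_mult k P dA" by (simp add: c a d.lift_mult_eq dA_lift dA_chi_nt)
  qed
qed

section \<open>Comparison cells\<close>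

lemma CoCart_iso_comp:
  assumes P: "is_functor P" and e: "e \<in> CoCart P" and i: "invertible (src P) i" "cdom (src P) i = ccod (src P) e"
  shows "i \<cdot>[src P] e \<in> CoCart P"
  using i CoCart_comp[OF P e _ i(2)[symmetric]] CoCart_iso[OF P] by (auto simp: invertible_def)

locale cleavage_square = cleavage P d + Q: cleavage Q d'
  for P :: "'a univ func" and d and Q :: "'a univ func" and d' +
  fixes T S
  assumes sq: "is_square P Q T S"
begin

lemma TS [simp]: "is_functor T" "is_functor S" "src T = E" "trg T = Q.E" "src S = B" "trg S = Q.B"
    "x \<in> Obj E ==> fobj Q (fobj T x) = fobj S (fobj P x)" "f \<in> Arr E ==> farr Q (farr T f) = farr S (farr P f)"
  using squareD[OF sq] by simp_all

definition cmp :: "'a univ \<Rightarrow> 'a univ \<Rightarrow> 'a univ" where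
  "cmp x u = (THE h. h \<in> hom (src Q) (push_obj Q d' (farr S u) (fobj T x)) (fobj T (push_obj P d u x)) \<and> h \<in> vert Q \<and>
     h \<cdot>[src Q] d' (fobj T x) (farr S u) = farr T (d x u))"

lemma cmp:
  assumes h: "x \<in> Obj E" "u \<in> Arr B" "cdom B u = fobj P x"
  shows "cmp x u \<in> Arr Q.E" "cdom Q.E (cmp x u) = ccod Q.E (d' (fobj T x) (farr S u))"
    "ccod Q.E (cmp x u) = fobj T (ccod E (d x u))" "farr Q (cmp x u) = ide Q.B (ccod Q.B (farr S u))"
    "cmp x u \<cdot>[Q.E] d' (fobj T x) (farr S u) = farr T (d x u)"
    "d' (fobj T x) (farr S u) \<in> CoCart Q"
proof -
  let ?e = "d' (fobj T x) (farr S u)"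
  show e: "?e \<in> CoCart Q" using h by simp
  have "\<exists>!h. h \<in> hom Q.E (ccod Q.E ?e) (ccod Q.E (farr T (d x u))) \<and> h \<in> vert Q \<and> h \<cdot>[Q.E] ?e = farr T (d x u)"
    by (rule CoCart_vertical_lift[OF Q.P e]) (use h in simp_all)
  then have "\<exists>!k. k \<in> hom (src Q) (push_obj Q d' (farr S u) (fobj T x)) (fobj T (push_obj P d u x)) \<and> k \<in> vert Q \<and>
     k \<cdot>[src Q] d' (fobj T x) (farr S u) = farr T (d x u)"
    using h by (simp add: push_obj_def)
  from theI'[OF this] have c: "cmp x u \<in> Arr Q.E" "cdom Q.E (cmp x u) = ccod Q.E ?e"
    "ccod Q.E (cmp x u) = fobj T (ccod E (d x u))" "cmp x u \<in> vert Q" "cmp x u \<cdot>[Q.E] ?e = farr T (d x u)"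
    unfolding cmp_def[symmetric] by (simp_all add: push_obj_def mem_hom)
  then show "cmp x u \<in> Arr Q.E" "cdom Q.E (cmp x u) = ccod Q.E (d' (fobj T x) (farr S u))"
    "ccod Q.E (cmp x u) = fobj T (ccod E (d x u))"
    "cmp x u \<cdot>[Q.E] d' (fobj T x) (farr S u) = farr T (d x u)" by blast+
  show "farr Q (cmp x u) = ide Q.B (ccod Q.B (farr S u))"
    using c(2,4) h by (simp add: vert_iff)
qed

lemma cmp_eqI:
  assumes h: "x \<in> Obj E" "u \<in> Arr B" "cdom B u = fobj P x"
    and k: "k \<in> Arr Q.E" "cdom Q.E k = ccod Q.E (d' (fobj T x) (farr S u))" "ccod Q.E k = fobj T (ccod E (d x u))"
    "farr Q k = ide Q.B (ccod Q.B (farr S u))" "k \<cdot>[Q.E] d' (fobj T x) (farr S u) = farr T (d x u)"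
  shows "cmp x u = k"
  by (rule CoCart_unique[OF Q.P cmp(6)[OF h]]) (use k cmp[OF h] in simp_all)

abbreviation "Tb \<equiv> comma_map (Cell P Q (T, S))"

definition "cmp_nt = mk_ntrans (comp_functor Q.L Tb) (comp_functor T L) (\<lambda>X. cmp (pfst X) (psnd X))"

lemma Tb [simp]: "is_functor Tb" "src Tb = comma P" "trg Tb = comma Q"
  using sq by simp_all

lemma cmp_nt_simps [simp]: "src cmp_nt = comp_functor Q.L Tb" "trg cmp_nt = comp_functor T L"
    "Pair x u \<in> Obj (comma P) ==> body cmp_nt (Pair x u) = cmp x u"
  by (simp_all add: cmp_nt_def)

text \<open>Checked after precomposition with the lift of \<open>S u\<close>: both sides become the
  image under \<open>T\<close> of \<open>f\<close> followed by the lift of \<open>w\<close>.\<close>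

lemma cmp_nat:
  assumes a: "Sq (Pair x u) (Pair y w) f v \<in> Arr (comma P)"
  shows "cmp y w \<cdot>[Q.E] farr Q.L (farr Tb (Sq (Pair x u) (Pair y w) f v)) =
    farr T (farr L (Sq (Pair x u) (Pair y w) f v)) \<cdot>[Q.E] cmp x u"
proof -
  have h: "x \<in> Obj E" "u \<in> Arr B" "cdom B u = fobj P x" and g: "y \<in> Obj E" "w \<in> Arr B" "cdom B w = fobj P y"
    and f: "f \<in> Arr E" "cdom E f = x" "ccod E f = y" "v \<in> Arr B" "cdom B v = ccod B u" "ccod B v = ccod B w"
    using a by (simp_all add: comma_Arr comma_Obj)
  let ?l = "farr L (Sq (Pair x u) (Pair y w) f v)" and ?m = "farr Q.L (farr Tb (Sq (Pair x u) (Pair y w) f v))"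
  let ?d = "d' (fobj T x) (farr S u)" and ?e = "d' (fobj T y) (farr S w)"
  note l = lift_arr[OF a]
  have m: "?m \<in> Arr Q.E" "cdom Q.E ?m = ccod Q.E ?d" "ccod Q.E ?m = ccod Q.E ?e" "farr Q ?m = farr S v"
    "?m \<cdot>[Q.E] ?d = ?e \<cdot>[Q.E] farr T f"
    using Q.lift_arr[OF comma_map_arr[OF sq a]] a by simp_all
  note cx = cmp[OF h] and cy = cmp[OF g]
  have "cmp y w \<cdot>[Q.E] ?m \<cdot>[Q.E] ?d = cmp y w \<cdot>[Q.E] ?e \<cdot>[Q.E] farr T f"
    by (rule cat_extend[OF m(5)]) (use m(1-3) cy(1-3) h g f in simp_all)
  also have "\<dots> = farr T (d y w \<cdot>[E] f)"
    unfolding cy(5) using g f by simp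
  also have "\<dots> = farr T (?l \<cdot>[E] d x u)"
    unfolding l(4) by simp
  also have "\<dots> = farr T ?l \<cdot>[Q.E] (cmp x u \<cdot>[Q.E] ?d)"
    unfolding cx(5) using l(1-3) h by simp
  finally have e: "cmp y w \<cdot>[Q.E] ?m \<cdot>[Q.E] ?d = farr T ?l \<cdot>[Q.E] (cmp x u \<cdot>[Q.E] ?d)" .
  show ?thesis
    by (rule CoCart_unique[OF Q.P cx(6)]) (use e m(1-4) l(1-3,5) cx(1-4) cy(1-4) h g f in simp_all)
qed

lemma cmp_ntrans [simp]: "is_ntrans cmp_nt"
  unfolding cmp_nt_def
proof (rule is_ntrans_mk, goal_cases)
  case (5 X)
  then have "X \<in> Obj (comma P)" by simp
  then show ?case
    by (rule comma_ObjE) (use cmp in \<open>simp add: comma_Obj\<close>)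
next
  case (6 a)
  then have a: "a \<in> Arr (comma P)" by simp
  obtain x u y w f v where A: "a = Sq (Pair x u) (Pair y w) f v" by (rule comma_ArrE[OF a])
  show ?case using cmp_nat a unfolding A by (simp add: comma_ops)
qed simp_all

lemma cmp_square2: "is_square2 (comma_cod P) Q (comp_functor Q.L Tb) S (comp_functor T L) S cmp_nt (id_ntrans S)"
proof -
  have "is_square (comma_cod P) Q (comp_functor Q.L Tb) S" "is_square (comma_cod P) Q (comp_functor T L) S"
    using square_comp[OF comma_map_square[OF sq] Q.lift_square] square_comp[OF lift_square sq] by simp_all
  then show ?thesis
    using cmp(4) by (auto simp: is_square2_def comma_Obj elim!: comma_ObjE)
qed

lemma comparison_eq: "comparison k (Cell (P, d) (Q, d') (Cell P Q (T, S))) =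
  Cell (Cell (comma_cod P) Q (comp_functor Q.L Tb, S)) (Cell (comma_cod P) Q (comp_functor T L, S)) (cmp_nt, id_ntrans S)"
  by (simp add: comparison_def Let_def lift_act_eq Q.lift_act_eq comma_sq_simps CAT2_ops cmp_nt_def cmp_def)

lemma cmp_cocart:
  assumes "\<And>e. e \<in> CoCart P ==> farr T e \<in> CoCart Q" and h: "x \<in> Obj E" "u \<in> Arr B" "cdom B u = fobj P x"
  shows "invertible Q.E (cmp x u)"
proof -
  have i: "inverse_arrows Q.B (farr Q (cmp x u)) (ide Q.B (ccod Q.B (farr S u)))"
    unfolding cmp(4)[OF h] using h by (intro inverse_arrows_ide) simp_all
  have e: "farr T (d x u) \<in> CoCart Q" using assms by simp
  show ?thesis
    by (rule CoCart_comparison_inverse[OF Q.P cmp(6)[OF h] e cmp(1,2,5)[OF h] i]) (auto simp: invertible_def)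
qed

text \<open>An arbitrary cocartesian arrow is a designated one followed by a vertical isomorphism,
  which \<open>T\<close> preserves. The image of a designated arrow is a designated arrow followed
  by a component of the comparison, hence cocartesian when that component is invertible.\<close>

lemma cocart_preserved:
  assumes i: "\<And>x u. x \<in> Obj E ==> u \<in> Arr B ==> cdom B u = fobj P x ==> invertible Q.E (cmp x u)" and e: "e \<in> CoCart P"
  shows "farr T e \<in> CoCart Q"
proof -
  have a: "e \<in> Arr E" by (rule CoCart_arr[OF e])
  let ?x = "cdom E e" and ?u = "farr P e"
  have h: "?x \<in> Obj E" "?u \<in> Arr B" "cdom B ?u = fobj P ?x" using a by simp_all
  have "\<exists>!h. h \<in> hom E (ccod E (d ?x ?u)) (ccod E e) \<and> h \<in> vert P \<and> h \<cdot>[E] d ?x ?u = e"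
    by (rule CoCart_vertical_lift[OF P]) (use a h in simp_all)
  then obtain k where k: "k \<in> Arr E" "cdom E k = ccod E (d ?x ?u)" "k \<in> vert P" "k \<cdot>[E] d ?x ?u = e"
    by (auto simp: mem_hom)
  have "inverse_arrows B (farr P k) (ide B (ccod B ?u))"
    using k h by (simp add: vert_iff inverse_arrows_ide)
  then have "invertible E k"
    by (rule CoCart_comparison_inverse[OF P clv_arr(1)[OF h] e k(1,2,4)]) (auto simp: invertible_def)
  then have Tk: "invertible Q.E (farr T k)" using functor_invertible[of T k] by simp
  have "farr T (d ?x ?u) \<in> CoCart Q"
    unfolding cmp(5)[OF h, symmetric] using h by (intro CoCart_iso_comp i cmp) simp_all
  then have "farr T k \<cdot>[Q.E] farr T (d ?x ?u) \<in> CoCart Q"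
    using h k by (intro CoCart_iso_comp Tk) simp_all
  moreover have "farr T k \<cdot>[Q.E] farr T (d ?x ?u) = farr T e"
    using arg_cong[OF k(4), of "farr T"] k(1,2) h by simp
  ultimately show ?thesis by simp
qed

lemma cmp_unit:
  assumes "normal_cleavage P d" "normal_cleavage Q d'" and x: "x \<in> Obj E"
  shows "cmp x (ide B (fobj P x)) = ide Q.E (fobj T x)"
proof -
  have "fobj T x \<in> Obj Q.E" using x by simp
  then have "d' (fobj T x) (ide Q.B (fobj Q (fobj T x))) = ide Q.E (fobj T x)" "d x (ide B (fobj P x)) = ide E x"
    using assms unfolding normal_cleavage_def by blast+
  then show ?thesis
    using x by (intro cmp_eqI) simp_all
qed

text \<open>The multiplication axiom at ((x, u), v). The lifts of \<open>S u\<close> and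
  \<open>S v\<close> compose to a cocartesian arrow, and precomposed with it both sides give the
  image under \<open>T\<close> of the lift of the composite.\<close>

lemma cmp_mult:
  assumes h: "x \<in> Obj E" "u \<in> Arr B" "cdom B u = fobj P x" and v: "v \<in> Arr B" "cdom B v = ccod B u"
  shows "Sq (Pair (ccod Q.E (d' (fobj T x) (farr S u))) (farr S v)) (Pair (fobj T (ccod E (d x u))) (farr S v)) (cmp x u)
      (ide Q.B (ccod Q.B (farr S v))) \<in> Arr (comma Q)" (is "?a \<in> _")
    "cmp x (v \<cdot>[B] u) \<cdot>[Q.E] Q.chi (fobj T x) (farr S u) (farr S v) =
      farr T (chi x u v) \<cdot>[Q.E] (cmp (ccod E (d x u)) v \<cdot>[Q.E] farr Q.L (Sq (Pair (ccod Q.E (d' (fobj T x) (farr S u))) (farr S v)) (Pair (fobj T (ccod E (d x u))) (farr S v)) (cmp x u)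
        (ide Q.B (ccod Q.B (farr S v)))))"
proof -
  let ?y = "ccod E (d x u)" and ?z = "ccod Q.E (d' (fobj T x) (farr S u))"
  let ?d = "d' (fobj T x) (farr S u)" and ?e = "d' ?z (farr S v)"
  have y: "?y \<in> Obj E" "v \<in> Arr B" "cdom B v = fobj P ?y" using h v by simp_all
  have vu: "v \<cdot>[B] u \<in> Arr B" "cdom B (v \<cdot>[B] u) = fobj P x" using h v by simp_all
  have T: "fobj T x \<in> Obj Q.E" "farr S u \<in> Arr Q.B" "cdom Q.B (farr S u) = fobj Q (fobj T x)"
      "farr S v \<in> Arr Q.B" "cdom Q.B (farr S v) = ccod Q.B (farr S u)"
    using h v by simp_all
  note c = cmp[OF h] and cy = cmp[OF y] and cvu = cmp[OF h(1) vu] and X = Q.chi[OF T] and Y = chi[OF h v]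
  show a: "?a \<in> Arr (comma Q)"
    using h v y c by (simp add: comma_simps)
  let ?l = "farr Q.L ?a"
  note l = Q.lift_arr[OF a]
  have "cmp ?y v \<cdot>[Q.E] (?l \<cdot>[Q.E] ?e) \<cdot>[Q.E] ?d = cmp ?y v \<cdot>[Q.E] d' (fobj T ?y) (farr S v) \<cdot>[Q.E] (cmp x u \<cdot>[Q.E] ?d)"
    unfolding l(4) using c(1-3) cy(1-3) h v y by simp
  also have "\<dots> = farr T (d ?y v) \<cdot>[Q.E] farr T (d x u)"
    unfolding c(5) cy(5) by simp
  finally have 1: "cmp ?y v \<cdot>[Q.E] (?l \<cdot>[Q.E] ?e) \<cdot>[Q.E] ?d = farr T (d ?y v) \<cdot>[Q.E] farr T (d x u)" .
  have "farr T (chi x u v) \<cdot>[Q.E] (cmp ?y v \<cdot>[Q.E] ?l) \<cdot>[Q.E] (?e \<cdot>[Q.E] ?d) =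
      farr T (chi x u v) \<cdot>[Q.E] (cmp ?y v \<cdot>[Q.E] (?l \<cdot>[Q.E] ?e) \<cdot>[Q.E] ?d)"
    using c(1-3) cy(1-3) l(1-3) Y(1-3) T h v y by simp
  also have "\<dots> = farr T (chi x u v \<cdot>[E] d ?y v \<cdot>[E] d x u)"
    unfolding 1 using Y(1-3) h v y by simp
  also have "\<dots> = farr T (d x (v \<cdot>[B] u))"
    unfolding Y(5) by simp
  finally have 2: "farr T (chi x u v) \<cdot>[Q.E] (cmp ?y v \<cdot>[Q.E] ?l) \<cdot>[Q.E] (?e \<cdot>[Q.E] ?d) = farr T (d x (v \<cdot>[B] u))" .
  \<comment> \<open>The comparison at the composite is stated with \<open>S\<close> of the
    composite; it is rewritten so that it meets the codomain of the comparison \<chi> of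
    \<open>Q\<close>.\<close>
  have Svu: "farr S (v \<cdot>[B] u) = farr S v \<cdot>[Q.B] farr S u" using h v by simp
  note cvu = cvu[unfolded Svu]
  have "cmp x (v \<cdot>[B] u) \<cdot>[Q.E] Q.chi (fobj T x) (farr S u) (farr S v) \<cdot>[Q.E] (?e \<cdot>[Q.E] ?d) =
      cmp x (v \<cdot>[B] u) \<cdot>[Q.E] (Q.chi (fobj T x) (farr S u) (farr S v) \<cdot>[Q.E] ?e \<cdot>[Q.E] ?d)"
    using cvu(1-3) X(1-3) T h v y by simp
  also have "\<dots> = farr T (d x (v \<cdot>[B] u))"
    unfolding X(5) by (rule cvu(5))
  finally have 3: "cmp x (v \<cdot>[B] u) \<cdot>[Q.E] Q.chi (fobj T x) (farr S u) (farr S v) \<cdot>[Q.E] (?e \<cdot>[Q.E] ?d) = farr T (d x (v \<cdot>[B] u))" .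
  show "cmp x (v \<cdot>[B] u) \<cdot>[Q.E] Q.chi (fobj T x) (farr S u) (farr S v) = farr T (chi x u v) \<cdot>[Q.E] (cmp ?y v \<cdot>[Q.E] ?l)"
  proof (rule CoCart_unique[OF Q.P X(7)])
    show "cmp x (v \<cdot>[B] u) \<cdot>[Q.E] Q.chi (fobj T x) (farr S u) (farr S v) \<cdot>[Q.E] (?e \<cdot>[Q.E] ?d) =
      farr T (chi x u v) \<cdot>[Q.E] (cmp ?y v \<cdot>[Q.E] ?l) \<cdot>[Q.E] (?e \<cdot>[Q.E] ?d)"
      by (simp only: 2 3)
  qed (use c(1-4) cy(1-4) cvu(1-4) X(1-4) Y(1-4) l(1-3,5) T h v y in simp_all)
qed

end

text \<open>Naturality of \<open>\<beta>\<close> at the designated arrow, followed by cancellation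
  of the lift of \<open>S u\<close>. So every 2-cell of squares is compatible with the comparison
  cells, in accordance with the 2-cells of \<open>NClCoFib\<close> being all those of
  \<open>CAT2\<close>.\<close>

lemma cmp_transformation:
  assumes "cleavage_square P d Q d' T S" "cleavage_square P d Q d' T' S'"
    and s: "is_square2 P Q T S T' S' \<beta> \<alpha>" and h: "x \<in> Obj (src P)" "u \<in> Arr (trg P)" "cdom (trg P) u = fobj P x"
  shows "Sq (Pair (fobj T x) (farr S u)) (Pair (fobj T' x) (farr S' u)) (body \<beta> x) (body \<alpha> (ccod (trg P) u)) \<in> Arr (comma Q)"
      (is "?a \<in> _")
    "body \<beta> (ccod (src P) (d x u)) \<cdot>[src Q] cleavage_square.cmp P d Q d' T S x u =
      cleavage_square.cmp P d Q d' T' S' x u \<cdot>[src Q] farr (lift_functor Q d') (Sq (Pair (fobj T x) (farr S u)) (Pair (fobj T' x) (farr S' u)) (body \<beta> x) (body \<alpha> (ccod (trg P) u)))"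
proof -
  interpret cleavage_square P d Q d' T S by fact
  interpret T': cleavage_square P d Q d' T' S' by fact
  note d = square2D(3-9)[OF s]
  have o: "Pair x u \<in> Obj (comma P)" using h by (simp add: comma_Obj)
  have "body (comma_nt P Q T S T' S' \<beta> \<alpha>) (Pair x u) \<in> Arr (comma Q)"
    using ntrans_arr(1)[OF comma_nt_ntrans[OF s], of "Pair x u"] o by simp
  then show a: "?a \<in> Arr (comma Q)" using o by simp
  note l = Q.lift_arr[OF a] and c = cmp[OF h] and c' = T'.cmp[OF h]
  let ?d = "d' (fobj T x) (farr S u)" and ?d' = "d' (fobj T' x) (farr S' u)" and ?l = "farr Q.L ?a" and ?y = "ccod E (d x u)"
  have b: "body \<beta> x \<in> Arr Q.E" "cdom Q.E (body \<beta> x) = fobj T x" "ccod Q.E (body \<beta> x) = fobj T' x"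
    and bb: "body \<beta> ?y \<in> Arr Q.E" "cdom Q.E (body \<beta> ?y) = fobj T ?y" "ccod Q.E (body \<beta> ?y) = fobj T' ?y"
    and al: "body \<alpha> (ccod B u) \<in> Arr Q.B" "cdom Q.B (body \<alpha> (ccod B u)) = fobj S (ccod B u)"
      "ccod Q.B (body \<alpha> (ccod B u)) = fobj S' (ccod B u)" "farr Q (body \<beta> ?y) = body \<alpha> (ccod B u)"
    using d h by simp_all
  have "body \<beta> ?y \<cdot>[Q.E] (cmp x u \<cdot>[Q.E] ?d) = farr T' (d x u) \<cdot>[Q.E] body \<beta> x"
    unfolding c(5) using ntrans_nat[OF d(1), of "d x u"] h d by simp
  also have "\<dots> = T'.cmp x u \<cdot>[Q.E] ?d' \<cdot>[Q.E] body \<beta> x"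
    unfolding c'(5) by simp
  also have "\<dots> = T'.cmp x u \<cdot>[Q.E] (?l \<cdot>[Q.E] ?d)"
    unfolding l(4) using c'(1-3) b h by simp
  finally have 1: "body \<beta> ?y \<cdot>[Q.E] (cmp x u \<cdot>[Q.E] ?d) = T'.cmp x u \<cdot>[Q.E] (?l \<cdot>[Q.E] ?d)" .
  show "body \<beta> ?y \<cdot>[Q.E] cmp x u = T'.cmp x u \<cdot>[Q.E] ?l"
    by (rule CoCart_unique[OF Q.P c(6)]) (use 1 c(1-4) c'(1-4) l(1-3,5) bb al h in simp_all)
qed

section \<open>The isomorphisms of 2-categories\<close>

text \<open>Cells carry their ends, so bijectivity on all cells of one dimension reduces to
  bijectivity between fixed ends, given bijectivity one dimension below.\<close>

lemma iso_2cat_fullI: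
  assumes F: "strict_2functor K L F" and "inj_on (F0 F) (Ob K)"
    and "\<And>Y. Y \<in> Ob L ==> \<exists>X \<in> Ob K. F0 F X = Y"
    and "\<And>f g. [|f \<in> Cell1 K; g \<in> Cell1 K; src f = src g; trg f = trg g; F1 F f = F1 F g|] ==> f = g"
    and "\<And>X Y g. [|X \<in> Ob K; Y \<in> Ob K; g \<in> Cell1 L; src g = F0 F X; trg g = F0 F Y|] ==> \<exists>f \<in> Cell1 K. F1 F f = g"
    and "\<And>\<alpha> \<beta>. [|\<alpha> \<in> Cell2 K; \<beta> \<in> Cell2 K; src \<alpha> = src \<beta>; trg \<alpha> = trg \<beta>; F2 F \<alpha> = F2 F \<beta>|] ==> \<alpha> = \<beta>"
    and "\<And>f g \<beta>. [|f \<in> Cell1 K; g \<in> Cell1 K; src f = src g; trg f = trg g; \<beta> \<in> Cell2 L; src \<beta> = F1 F f; trg \<beta> = F1 F g|]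
      ==> \<exists>\<alpha> \<in> Cell2 K. F2 F \<alpha> = \<beta>"
  shows "iso_2cat K L F"
proof -
  interpret F: strict_2functor K L F by fact
  have i0: "X = Y" if "X \<in> Ob K" "Y \<in> Ob K" "F0 F X = F0 F Y" for X Y
    using assms(2) that by (auto dest: inj_onD)
  have i1: "f = g" if "f \<in> Cell1 K" "g \<in> Cell1 K" "F1 F f = F1 F g" for f g
  proof -
    have "F0 F (src f) = F0 F (src g)" "F0 F (trg f) = F0 F (trg g)"
      using that F.F1_cell(2,3) by metis+
    then show ?thesis using i0 that assms(4) by (metis F.dom.cell1_ends)
  qed
  show ?thesis
  proof (rule iso_2catI[OF F])
    show "bij_betw (F0 F) (Ob K) (Ob L)"
      using assms(2,3) by (force simp: bij_betw_def)
    have "g \<in> F1 F ` Cell1 K" if g: "g \<in> Cell1 L" for g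
    proof -
      obtain X Y where "X \<in> Ob K" "Y \<in> Ob K" "F0 F X = src g" "F0 F Y = trg g"
        using assms(3) F.cod.cell1_ends[OF g] by metis
      then show ?thesis using assms(5)[of X Y g] g by auto
    qed
    then show b1: "bij_betw (F1 F) (Cell1 K) (Cell1 L)"
      using i1 by (auto simp: bij_betw_def inj_on_def)
    have par: "src f = src g \<and> trg f = trg g"
      if "f \<in> Cell1 K" "g \<in> Cell1 K" "src (F1 F f) = src (F1 F g)" "trg (F1 F f) = trg (F1 F g)" for f g
      using that i0[of "src f" "src g"] i0[of "trg f" "trg g"] F.dom.cell1_ends by simp
    have "\<beta> \<in> F2 F ` Cell2 K" if b: "\<beta> \<in> Cell2 L" for \<beta>
    proof -
      have e: "src \<beta> \<in> Cell1 L" "trg \<beta> \<in> Cell1 L" "src (src \<beta>) = src (trg \<beta>)" "trg (src \<beta>) = trg (trg \<beta>)"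
        using F.cod.cell2_ends[OF b] by (auto simp: parallel_def)
      then obtain f g where fg: "f \<in> Cell1 K" "g \<in> Cell1 K" "F1 F f = src \<beta>" "F1 F g = trg \<beta>"
        using b1 unfolding bij_betw_def by (metis imageE)
      then have "src f = src g \<and> trg f = trg g" using e by (intro par) simp_all
      then show ?thesis using assms(7)[of f g \<beta>] fg b by auto
    qed
    moreover have "\<alpha> = \<beta>" if "\<alpha> \<in> Cell2 K" "\<beta> \<in> Cell2 K" "F2 F \<alpha> = F2 F \<beta>" for \<alpha> \<beta>
    proof -
      have "F1 F (src \<alpha>) = F1 F (src \<beta>)" "F1 F (trg \<alpha>) = F1 F (trg \<beta>)"
        using that F.F2_cell(2,3) by metis+
      then show ?thesis using i1 that assms(6) by (metis F.dom.cell2_ends)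
    qed
    ultimately show "bij_betw (F2 F) (Cell2 K) (Cell2 L)"
      by (auto simp: bij_betw_def inj_on_def)
  qed
qed

lemma NClCoFib_Ob: "(P, d) \<in> Ob (NClCoFib k) \<longleftrightarrow> P \<in> Ob (CAT2 k) \<and> normal_cleavage P d"
  by (simp add: NClCoFib_def)

lemma NClCoFib_Cell1:
  "M \<in> Cell1 (NClCoFib k) \<longleftrightarrow> src M \<in> Ob (NClCoFib k) \<and> trg M \<in> Ob (NClCoFib k) \<and> body M \<in> Cell1 (CAT2 k) \<and>
     src (body M) = fst (src M) \<and> trg (body M) = fst (trg M) \<and>
     (\<forall>e \<in> CoCart (fst (src M)). farr (fst (body (body M))) e \<in> CoCart (fst (trg M)))"
  unfolding NClCoFib_def over_2cat_simps mem_hom1 Let_def by auto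

lemma NClCoFib_2category: "strict_2category (NClCoFib k)"
  unfolding NClCoFib_def
proof (rule over_2cat_category, goal_cases)
  case 1
  show ?case by (rule two_category.Arrow_2category[OF CAT_two_category])
next
  case (2 X)
  then show ?case
    by (cases X) (auto simp: CAT2_ops CoCart_arr)
next
  case (3 F G)
  then show ?case
    by (auto simp: CoCart_arr Let_def mem_hom1 CAT2_ops Arrow_simps(2) CAT_simps)
qed simp_all

lemma cleavage_square_intro:
  assumes "(P, d) \<in> Ob (NClCoFib k)" "(Q, d') \<in> Ob (NClCoFib k)" "Cell P Q (T, S) \<in> Cell1 (CAT2 k)"
  shows "cleavage_square P d Q d' T S"
  using assms normal_cleavage_locale[of P d] normal_cleavage_locale[of Q d']
  by (simp add: cleavage_square_def cleavage_square_axioms_def NClCoFib_Ob CAT2_Ob CAT2_Cell1)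

context
  fixes k :: "'k rel"
  assumes k: "Card_order k" "infinite (Field k)"
begin

interpretation T: strict_2monad "CAT2 k" "Comma :: ('a univ func, _, _) monad"
  by (rule comma_2monad[OF k])

context
  fixes P :: "'a univ func" and d Q d' T S
  assumes P: "(P, d) \<in> Ob (NClCoFib k)" and Q: "(Q, d') \<in> Ob (NClCoFib k)"
    and F: "Cell P Q (T, S) \<in> Cell1 (CAT2 k)"
begin

text \<open>Invertibility is \<open>cmp_cocart\<close>, the unit axiom is \<open>cmp_unit\<close>
  and the multiplication axiom is \<open>cmp_mult\<close>, evaluated componentwise; on the base all
  cells are identities.\<close>

lemma comparison_pseudomorphism:
  assumes c: "\<And>e. e \<in> CoCart P ==> farr T e \<in> CoCart Q"
  shows "pseudomorphism (CAT2 k) Comma (F1 (Gamma_n k) (Cell (P, d) (Q, d') (Cell P Q (T, S))))"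
proof -
  interpret M: cleavage_square P d Q d' T S by (rule cleavage_square_intro[OF P Q F])
  have n: "normal_cleavage P d" "normal_cleavage Q d'" using P Q by (simp_all add: NClCoFib_Ob)
  have sm: "locally_small k (src P)" "locally_small k (trg P)" "locally_small k (src Q)" "locally_small k (trg Q)"
    using F unfolding CAT2_Cell1 by blast+
  let ?K = "CAT2 k" and ?F = "Cell P Q (T, S)" and ?a = "lift_act P d" and ?b = "lift_act Q d'"
  let ?m = "comparison k (Cell (P, d) (Q, d') ?F)"
  have A: "pseudoalgebra ?K Comma (F0 (Gamma_n k) (P, d))" "pseudoalgebra ?K Comma (F0 (Gamma_n k) (Q, d'))"
    using Gamma_n_Ob(2)[OF k, of P d] Gamma_n_Ob(2)[OF k, of Q d'] P Q unfolding NClCoFib_Ob T.Ps_Alg_n_Ob by blast+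
  note A = A[unfolded Gamma_n_simps]
  have "Cell (Cell (comma_cod P) Q (comp_functor M.Q.L M.Tb, S)) (Cell (comma_cod P) Q (comp_functor T M.L, S)) (M.cmp_nt, id_ntrans S)
      \<in> Cell2 ?K" (is "?m' \<in> _")
    unfolding CAT2_Cell2 using M.cmp_square2 sm by (simp add: comma_small[OF k])
  note m' = this
  have m: "?m \<in> Cell2 ?K" "src ?m = ?b \<odot>\<^bsub>?K\<^esub> comma_sq ?F" "trg ?m = ?F \<odot>\<^bsub>?K\<^esub> ?a"
    using m' by (simp_all add: M.comparison_eq M.lift_act_eq M.Q.lift_act_eq CAT2_ops comma_sq_simps)
  have "invertible M.Q.E (body M.cmp_nt X)" if "X \<in> Obj (src (comma_cod P))" for X
    using M.cmp_cocart[OF c] that by (auto elim!: comma_ObjE simp: comma_Obj)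
  from CAT2_inverse[OF m' this] obtain \<psi> where "\<psi> \<in> hom2 ?K (trg ?m') (src ?m')"
    "\<psi> \<bullet>\<^bsub>?K\<^esub> ?m' = id2 ?K (src ?m')" "?m' \<bullet>\<^bsub>?K\<^esub> \<psi> = id2 ?K (trg ?m')" by blast
  then have inv: "invertible2 ?K ?m"
    using m' unfolding invertible2_def M.comparison_eq by blast
  note ends = T.pseudomorphism_ends[OF A F, unfolded Comma_simps cell.sel, OF refl refl m]
  note ops = CAT2_ops M.comparison_eq M.lift_act_eq M.Q.lift_act_eq comma_unit_eq comma_mult_eq comma_sq_simps
    M.lift_mult_eq M.Q.lift_mult_eq
  have 1: "(?m \<lhd>\<^bsub>?K\<^esub> comma_unit P) \<bullet>\<^bsub>?K\<^esub> (id2 ?K (id1 ?K Q) \<lhd>\<^bsub>?K\<^esub> ?F) = ?F \<rhd>\<^bsub>?K\<^esub> id2 ?K (id1 ?K P)"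
  proof (rule CAT2_cell2_eqI[OF ends(1,2)])
    fix x assume "x \<in> Obj (src (src ?F))"
    then have x: "x \<in> Obj (src P)" by simp
    then have o: "Pair x (ide (trg P) (fobj P x)) \<in> Obj (comma P)" by (simp add: comma_Obj)
    show "body (fst (body ((?m \<lhd>\<^bsub>?K\<^esub> comma_unit P) \<bullet>\<^bsub>?K\<^esub> (id2 ?K (id1 ?K Q) \<lhd>\<^bsub>?K\<^esub> ?F)))) x =
        body (fst (body (?F \<rhd>\<^bsub>?K\<^esub> id2 ?K (id1 ?K P)))) x"
      using x o M.cmp_unit[OF n x] by (simp add: ops)
  next
    fix x assume "x \<in> Obj (trg (src ?F))"
    then show "body (snd (body ((?m \<lhd>\<^bsub>?K\<^esub> comma_unit P) \<bullet>\<^bsub>?K\<^esub> (id2 ?K (id1 ?K Q) \<lhd>\<^bsub>?K\<^esub> ?F)))) x =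
        body (snd (body (?F \<rhd>\<^bsub>?K\<^esub> id2 ?K (id1 ?K P)))) x"
      by (simp add: ops)
  qed
  have 2: "(?m \<lhd>\<^bsub>?K\<^esub> comma_mult P) \<bullet>\<^bsub>?K\<^esub> (lift_mult k Q d' \<lhd>\<^bsub>?K\<^esub> comma_sq (comma_sq ?F)) =
      (?F \<rhd>\<^bsub>?K\<^esub> lift_mult k P d) \<bullet>\<^bsub>?K\<^esub> (?m \<lhd>\<^bsub>?K\<^esub> comma_sq ?a) \<bullet>\<^bsub>?K\<^esub> (?b \<rhd>\<^bsub>?K\<^esub> comma_cell ?m)"
  proof (rule CAT2_cell2_eqI[OF ends(3,4)])
    fix X assume "X \<in> Obj (src (src (?b \<odot>\<^bsub>?K\<^esub> comma_sq ?b \<odot>\<^bsub>?K\<^esub> comma_sq (comma_sq ?F))))"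
    then have X: "X \<in> Obj (comma2 P)" by (simp add: ops)
    obtain x u v where X': "X = Pair (Pair x u) v" and h: "x \<in> Obj M.E" "u \<in> Arr M.B" "cdom M.B u = fobj P x"
        "v \<in> Arr M.B" "cdom M.B v = ccod M.B u"
      by (rule comma2_ObjE[OF X])
    have o: "Pair x u \<in> Obj (comma P)" "Pair (Pair x u) v \<in> Obj (comma2 P)"
        "Pair x (v \<cdot>[M.B] u) \<in> Obj (comma P)" "Pair (ccod M.E (d x u)) v \<in> Obj (comma P)"
        "Pair (Pair (fobj T x) (farr S u)) (farr S v) \<in> Obj (comma (comma_cod Q))" "Pair (fobj T x) (farr S u) \<in> Obj (comma Q)"
      using h by (simp_all add: comma2_Obj comma_Obj)
    have y: "ccod M.E (d x u) \<in> Obj M.E" "v \<in> Arr M.B" "cdom M.B v = fobj P (ccod M.E (d x u))" using h by simp_all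
    note cm = M.cmp_mult[OF h]
    show "body (fst (body ((?m \<lhd>\<^bsub>?K\<^esub> comma_mult P) \<bullet>\<^bsub>?K\<^esub> (lift_mult k Q d' \<lhd>\<^bsub>?K\<^esub> comma_sq (comma_sq ?F))))) X =
        body (fst (body ((?F \<rhd>\<^bsub>?K\<^esub> lift_mult k P d) \<bullet>\<^bsub>?K\<^esub> (?m \<lhd>\<^bsub>?K\<^esub> comma_sq ?a) \<bullet>\<^bsub>?K\<^esub> (?b \<rhd>\<^bsub>?K\<^esub> comma_cell ?m)))) X"
      using h o cm M.cmp_square2 comma_map_square[OF M.sq] comma_map_square[OF M.lift_square] comma_map_square[OF comma_map_square[OF M.sq]]
        M.lift_square M.Q.lift_square comma_nt_ntrans[OF M.cmp_square2] M.Q.lift_arr[OF cm(1)] M.cmp[OF h(1-3)] M.cmp[OF y]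
        M.chi[OF h]
      unfolding X' by (simp add: ops)
  next
    fix x assume "x \<in> Obj (trg (src (?b \<odot>\<^bsub>?K\<^esub> comma_sq ?b \<odot>\<^bsub>?K\<^esub> comma_sq (comma_sq ?F))))"
    then have "x \<in> Obj M.B" by (simp add: ops)
    then show "body (snd (body ((?m \<lhd>\<^bsub>?K\<^esub> comma_mult P) \<bullet>\<^bsub>?K\<^esub> (lift_mult k Q d' \<lhd>\<^bsub>?K\<^esub> comma_sq (comma_sq ?F))))) x =
        body (snd (body ((?F \<rhd>\<^bsub>?K\<^esub> lift_mult k P d) \<bullet>\<^bsub>?K\<^esub> (?m \<lhd>\<^bsub>?K\<^esub> comma_sq ?a) \<bullet>\<^bsub>?K\<^esub> (?b \<rhd>\<^bsub>?K\<^esub> comma_cell ?m)))) x"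
      by (simp add: ops)
  qed
  show ?thesis
    unfolding Gamma_n_simps cell.sel T.pseudomorphism_iff Comma_simps using A F m inv 1 2 by (intro conjI refl)
qed

text \<open>Normality makes the structure cell an identity at the objects (x, 1). Each object (x, v)
  receives the arrow (1, v) from (x, 1), which the two actions send to the lifts; naturality there
  leaves the comparison as the only possibility. Invertibility of \<open>m\<close> then gives
  preservation of cocartesian arrows.\<close>

lemma comparison_unique:
  assumes p: "pseudomorphism (CAT2 k) Comma (Cell (F0 (Gamma_n k) (P, d)) (F0 (Gamma_n k) (Q, d')) (Cell P Q (T, S), m))"
  shows "m = comparison k (Cell (P, d) (Q, d') (Cell P Q (T, S)))" "\<And>e. e \<in> CoCart P ==> farr T e \<in> CoCart Q"
proof -
  interpret M: cleavage_square P d Q d' T S by (rule cleavage_square_intro[OF P Q F])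
  have n: "normal_cleavage P d" "normal_cleavage Q d'" using P Q by (simp_all add: NClCoFib_Ob)
  let ?K = "CAT2 k" and ?F = "Cell P Q (T, S)" and ?a = "lift_act P d" and ?b = "lift_act Q d'"
  note p' = p[unfolded Gamma_n_simps T.pseudomorphism_iff Comma_simps]
  have m: "m \<in> Cell2 ?K" "src m = ?b \<odot>\<^bsub>?K\<^esub> comma_sq ?F" "trg m = ?F \<odot>\<^bsub>?K\<^esub> ?a" and inv: "invertible2 ?K m"
    using p' by blast+
  have u: "m \<lhd>\<^bsub>?K\<^esub> comma_unit P = id2 ?K ?F"
    using T.normal_pseudomorphismD[OF p[unfolded Gamma_n_simps]] by simp
  obtain \<mu> \<sigma> where "m = Cell (src m) (trg m) (\<mu>, \<sigma>)" by (metis cell.collapse surj_pair)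
  then have mx: "m = Cell (Cell (comma_cod P) Q (comp_functor M.Q.L M.Tb, S)) (Cell (comma_cod P) Q (comp_functor T M.L, S)) (\<mu>, \<sigma>)"
    unfolding m by (simp add: M.lift_act_eq M.Q.lift_act_eq CAT2_ops comma_sq_simps)
  have s2: "is_square2 (comma_cod P) Q (comp_functor M.Q.L M.Tb) S (comp_functor T M.L) S \<mu> \<sigma>"
    using m(1) unfolding mx CAT2_Cell2 by blast
  note d = square2D(3-9)[OF s2]
  have v1: "hcomp_ntrans \<mu> (id_ntrans (comma_H P)) = id_ntrans T"
    and v2: "hcomp_ntrans \<sigma> (id_ntrans (id_functor M.B)) = id_ntrans S"
    using u by (simp_all add: mx CAT2_ops comma_unit_eq)
  \<comment> \<open>The base part of the unit axiom, in which the whiskering is along an identity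
    functor.\<close>
  have \<sigma>: "\<sigma> = id_ntrans S"
  proof (rule ntrans_eqI)
    fix x assume "x \<in> Obj (src (src (id_ntrans S)))"
    then have x: "x \<in> Obj M.B" by simp
    show "body \<sigma> x = body (id_ntrans S) x"
      using arg_cong[OF v2, of "\<lambda>t. body t x"] x d(2,5,6) by simp
  qed (use d in simp_all)
  have c: "body \<mu> (Pair x v) = M.cmp x v" if h: "x \<in> Obj M.E" "v \<in> Arr M.B" "cdom M.B v = fobj P x" for x v
  proof -
    let ?x = "Pair x (ide M.B (fobj P x))"
    have o: "Pair x v \<in> Obj (comma P)" "?x \<in> Obj (comma P)" using h by (simp_all add: comma_Obj)
    have 1: "body \<mu> ?x = ide M.Q.E (fobj T x)"
      using arg_cong[OF v1, of "\<lambda>t. body t x"] h o d(1,3,4) by simp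
    have a: "Sq ?x (Pair x v) (ide M.E x) v \<in> Arr (comma P)"
      using h by (simp add: comma_simps)
    have b: "body \<mu> (Pair x v) \<in> Arr M.Q.E" "cdom M.Q.E (body \<mu> (Pair x v)) = ccod M.Q.E (d' (fobj T x) (farr S v))"
      "ccod M.Q.E (body \<mu> (Pair x v)) = fobj T (ccod M.E (d x v))"
      using ntrans_arr[OF d(1), of "Pair x v" M.Q.E] d(3,4) o h by (simp_all add: comma_Obj)
    \<comment> \<open>Naturality at the arrow (1, v) from (x, 1) to (x, v). By
      \<open>normal_lift\<close> the actions turn it into designated lifts, and the component at its
      source is an identity.\<close>
    have "body \<mu> (ccod (comma P) (Sq ?x (Pair x v) (ide M.E x) v)) \<cdot>[M.Q.E] farr (src \<mu>) (Sq ?x (Pair x v) (ide M.E x) v) =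
        farr (trg \<mu>) (Sq ?x (Pair x v) (ide M.E x) v) \<cdot>[M.Q.E] body \<mu> (cdom (comma P) (Sq ?x (Pair x v) (ide M.E x) v))"
      by (rule ntrans_nat[OF d(1)]) (use a d(3) in simp_all)
    moreover have "farr M.Q.L (Sq (Pair (fobj T x) (ide M.Q.B (fobj Q (fobj T x)))) (Pair (fobj T x) (farr S v)) (ide M.Q.E (fobj T x)) (farr S v)) =
        d' (fobj T x) (farr S v)"
      by (rule M.Q.normal_lift[OF n(2)]) (use h in simp_all)
    ultimately have "body \<mu> (Pair x v) \<cdot>[M.Q.E] d' (fobj T x) (farr S v) = farr T (d x v)"
      using a 1 h d(3,4) M.normal_lift[OF n(1) h] by (simp add: comma_ops)
    then show ?thesis
      using M.cmp_eqI[OF h b] d(7)[of "Pair x v"] o h unfolding \<sigma> by simp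
  qed
  have "\<mu> = M.cmp_nt"
  proof (rule ntrans_eqI)
    fix X assume "X \<in> Obj (src (src M.cmp_nt))"
    then have "X \<in> Obj (comma P)" by simp
    then show "body \<mu> X = body M.cmp_nt X"
      by (rule comma_ObjE) (simp add: c comma_Obj)
  qed (use d in simp_all)
  then show "m = comparison k (Cell (P, d) (Q, d') ?F)"
    by (simp add: mx M.comparison_eq \<sigma>)
  fix e assume e: "e \<in> CoCart P"
  show "farr T e \<in> CoCart Q"
  proof (rule M.cocart_preserved[OF _ e])
    fix x v assume h: "x \<in> Obj M.E" "v \<in> Arr M.B" "cdom M.B v = fobj P x"
    show "invertible M.Q.E (M.cmp x v)"
      using CAT2_inverse_components[OF inv[unfolded mx], of "Pair x v"] h c[OF h] by (simp add: comma_Obj)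
  qed
qed

end

end

context
  fixes k :: "'k rel"
  assumes k: "Card_order k" "infinite (Field k)"
begin

interpretation T: strict_2monad "CAT2 k" "Comma :: ('a univ func, _, _) monad"
  by (rule comma_2monad[OF k])

lemma NClCoFib_cases:
  assumes "M \<in> Cell1 (NClCoFib k)"
  obtains P d Q d' T S where "M = Cell (P, d) (Q, d') (Cell P Q (T, S))" "(P, d) \<in> Ob (NClCoFib k)" "(Q, d') \<in> Ob (NClCoFib k)"
    "Cell P Q (T, S) \<in> Cell1 (CAT2 k)" "\<forall>e \<in> CoCart P. farr T e \<in> CoCart Q"
proof -
  obtain P d Q d' P' Q' T S where M: "M = Cell (P, d) (Q, d') (Cell P' Q' (T, S))" by (metis cell.exhaust surj_pair)
  have h: "(P, d) \<in> Ob (NClCoFib k)" "(Q, d') \<in> Ob (NClCoFib k)" "Cell P' Q' (T, S) \<in> Cell1 (CAT2 k)" "P' = P" "Q' = Q"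
    "\<forall>e \<in> CoCart P. farr T e \<in> CoCart Q"
    using assms unfolding M NClCoFib_Cell1 cell.sel fst_conv by blast+
  show thesis
    by (rule that[OF M[unfolded h(4,5)] h(1,2) h(3)[unfolded h(4,5)]]) (rule h(6))
qed

lemma Gamma_n_Cell1:
  fixes M :: "('a univ func \<times> 'a univ clv, 'a univ square) cell"
  assumes "M \<in> Cell1 (NClCoFib k)"
  shows "pseudomorphism (CAT2 k) Comma (F1 (Gamma_n k) M)"
proof -
  obtain P d Q d' T S where "M = Cell (P, d) (Q, d') (Cell P Q (T, S))" "(P, d) \<in> Ob (NClCoFib k)" "(Q, d') \<in> Ob (NClCoFib k)"
    "Cell P Q (T, S) \<in> Cell1 (CAT2 k)" "\<forall>e \<in> CoCart P. farr T e \<in> CoCart Q"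
    using assms by (rule NClCoFib_cases)
  then show ?thesis
    using comparison_pseudomorphism[OF k] by blast
qed

text \<open>That \<open>M\<close> is a 1-cell of \<open>NClCoFib\<close> is concluded, not assumed:
  any pseudomorphism structure on the square already forces it. This gives fullness of
  \<open>Gamma_n\<close>, and it identifies structure cells obtained by pasting with comparison
  cells.\<close>

lemma Gamma_n_Cell1_unique:
  fixes M :: "('a univ func \<times> 'a univ clv, 'a univ square) cell"
  assumes M: "src M \<in> Ob (NClCoFib k)" "trg M \<in> Ob (NClCoFib k)"
    and p: "pseudomorphism (CAT2 k) Comma (Cell (F0 (Gamma_n k) (src M)) (F0 (Gamma_n k) (trg M)) (body M, m))"
  shows "F1 (Gamma_n k) M = Cell (F0 (Gamma_n k) (src M)) (F0 (Gamma_n k) (trg M)) (body M, m)" "M \<in> Cell1 (NClCoFib k)"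
proof -
  obtain P d Q d' P' Q' T S where M': "M = Cell (P, d) (Q, d') (Cell P' Q' (T, S))" by (metis cell.exhaust surj_pair)
  have c: "Cell P' Q' (T, S) \<in> Cell1 (CAT2 k)" and e: "P' = P" "Q' = Q"
    using T.psmor_cell(11-13)[OF p] unfolding M' by (simp_all add: Gamma_n_simps)
  have o: "(P, d) \<in> Ob (NClCoFib k)" "(Q, d') \<in> Ob (NClCoFib k)" using M unfolding M' by simp_all
  note u = comparison_unique[OF k o c[unfolded e] p[unfolded M' e cell.sel]]
  show "F1 (Gamma_n k) M = Cell (F0 (Gamma_n k) (src M)) (F0 (Gamma_n k) (trg M)) (body M, m)"
    unfolding Gamma_n_simps(2) by (simp add: M' e u(1))
  show "M \<in> Cell1 (NClCoFib k)"
    using o c u(2) unfolding NClCoFib_Cell1 M' e by simp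
qed

lemma Gamma_n_id1:
  fixes X :: "'a univ func \<times> 'a univ clv"
  assumes X: "X \<in> Ob (NClCoFib k)"
  shows "F1 (Gamma_n k) (id1 (NClCoFib k) X) = id1 (Ps_Alg_n (CAT2 k) Comma) (F0 (Gamma_n k) X)"
proof -
  obtain P d where X': "X = (P, d)" by (cases X)
  have "pseudoalgebra (CAT2 k) Comma (F0 (Gamma_n k) X)"
    using Gamma_n_Ob(2)[OF k, of P d] X unfolding X' NClCoFib_Ob T.Ps_Alg_n_Ob by blast
  from T.pseudomorphism_id[OF this]
  have "F1 (Gamma_n k) (Cell X X (id1 (CAT2 k) P)) =
      Cell (F0 (Gamma_n k) X) (F0 (Gamma_n k) X) (id1 (CAT2 k) P, id2 (CAT2 k) (act (F0 (Gamma_n k) X)))"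
    using Gamma_n_Cell1_unique(1)[of "Cell X X (id1 (CAT2 k) P)" "id2 (CAT2 k) (act (F0 (Gamma_n k) X))"] X
    by (simp add: X' Gamma_n_simps(1))
  then show ?thesis
    by (simp add: NClCoFib_def Ps_Alg_n_def full_sub_def Ps_Alg_def X' Gamma_n_simps(1))
qed

text \<open>Pasted comparison cells form a pseudomorphism, so uniqueness replaces a calculation with
  the comparison of a composite square.\<close>

lemma Gamma_n_comp1:
  fixes M N :: "('a univ func \<times> 'a univ clv, 'a univ square) cell"
  assumes M: "M \<in> Cell1 (NClCoFib k)" and N: "N \<in> Cell1 (NClCoFib k)" and c: "trg M = src N"
  shows "F1 (Gamma_n k) (Cell (src M) (trg N) (body N \<odot>\<^bsub>CAT2 k\<^esub> body M)) =
    psmor_comp (CAT2 k) Comma (F1 (Gamma_n k) N) (F1 (Gamma_n k) M)"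
proof -
  let ?C = "Cell (src M) (trg N) (body N \<odot>\<^bsub>CAT2 k\<^esub> body M)"
  let ?D = "psmor_comp (CAT2 k) Comma (F1 (Gamma_n k) N) (F1 (Gamma_n k) M)"
  have p: "pseudomorphism (CAT2 k) Comma ?D"
    by (rule T.pseudomorphism_comp[OF Gamma_n_Cell1[OF M] Gamma_n_Cell1[OF N]]) (simp add: Gamma_n_simps(2) c)
  have D: "?D = Cell (F0 (Gamma_n k) (src ?C)) (F0 (Gamma_n k) (trg ?C)) (body ?C, snd (body ?D))"
    by (simp add: psmor_comp_def Let_def Gamma_n_simps(2))
  have o: "src ?C \<in> Ob (NClCoFib k)" "trg ?C \<in> Ob (NClCoFib k)"
    using M N by (simp_all add: NClCoFib_Cell1)
  have "pseudomorphism (CAT2 k) Comma (Cell (F0 (Gamma_n k) (src ?C)) (F0 (Gamma_n k) (trg ?C)) (body ?C, snd (body ?D)))"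
    unfolding D[symmetric] by (rule p)
  then have "F1 (Gamma_n k) ?C = Cell (F0 (Gamma_n k) (src ?C)) (F0 (Gamma_n k) (trg ?C)) (body ?C, snd (body ?D))"
    by (rule Gamma_n_Cell1_unique(1)[OF o])
  then show ?thesis using D by (rule trans[OF _ sym])
qed

text \<open>At (x, u) the transformation axiom is \<open>cmp_transformation\<close>; on the base the
  structure cells are identities.\<close>

lemma Gamma_n_Cell2:
  fixes M N :: "('a univ func \<times> 'a univ clv, 'a univ square) cell"
  assumes M: "M \<in> Cell1 (NClCoFib k)" and N: "N \<in> Cell1 (NClCoFib k)" and e: "src M = src N" "trg M = trg N"
    and a: "\<alpha> \<in> Cell2 (CAT2 k)" "src \<alpha> = body M" "trg \<alpha> = body N"
  shows "alg_transformation (CAT2 k) Comma (Cell (F1 (Gamma_n k) M) (F1 (Gamma_n k) N) \<alpha>)"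
proof -
  obtain P d Q d' T S where M': "M = Cell (P, d) (Q, d') (Cell P Q (T, S))" and oP: "(P, d) \<in> Ob (NClCoFib k)" and oQ: "(Q, d') \<in> Ob (NClCoFib k)"
    and F: "Cell P Q (T, S) \<in> Cell1 (CAT2 k)" using M by (rule NClCoFib_cases)
  obtain T' S' where N': "N = Cell (P, d) (Q, d') (Cell P Q (T', S'))" and F': "Cell P Q (T', S') \<in> Cell1 (CAT2 k)"
    using N e unfolding M' by (cases rule: NClCoFib_cases) auto
  interpret M: cleavage_square P d Q d' T S by (rule cleavage_square_intro[OF oP oQ F])
  interpret N: cleavage_square P d Q d' T' S' by (rule cleavage_square_intro[OF oP oQ F'])
  obtain \<beta> \<tau> where "\<alpha> = Cell (src \<alpha>) (trg \<alpha>) (\<beta>, \<tau>)" by (metis cell.collapse surj_pair)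
  then have A: "\<alpha> = Cell (Cell P Q (T, S)) (Cell P Q (T', S')) (\<beta>, \<tau>)" unfolding a M' N' by simp
  have s: "is_square2 P Q T S T' S' \<beta> \<tau>" using a(1) unfolding A CAT2_Cell2 by blast
  note d = square2D(3-8)[OF s]
  let ?K = "CAT2 k"
  note p = Gamma_n_Cell1[OF M, unfolded M' Gamma_n_simps cell.sel] Gamma_n_Cell1[OF N, unfolded N' Gamma_n_simps cell.sel]
  note ends = T.transformation_ends[OF p a(1), unfolded a M' N' cell.sel, OF refl refl]
  note ops = CAT2_ops M.comparison_eq N.comparison_eq M.lift_act_eq M.Q.lift_act_eq comma_sq_simps
  have "(\<alpha> \<lhd>\<^bsub>?K\<^esub> lift_act P d) \<bullet>\<^bsub>?K\<^esub> comparison k (Cell (P, d) (Q, d') (Cell P Q (T, S))) =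
      comparison k (Cell (P, d) (Q, d') (Cell P Q (T', S'))) \<bullet>\<^bsub>?K\<^esub> (lift_act Q d' \<rhd>\<^bsub>?K\<^esub> comma_cell \<alpha>)" (is "?l = ?r")
  proof (rule CAT2_cell2_eqI[OF ends[unfolded Comma_simps]])
    fix X assume "X \<in> Obj (src (src (lift_act Q d' \<odot>\<^bsub>?K\<^esub> comma_sq (Cell P Q (T, S)))))"
    then have X: "X \<in> Obj (comma P)" by (simp add: ops)
    obtain x u where X': "X = Pair x u" and h: "x \<in> Obj M.E" "u \<in> Arr M.B" "cdom M.B u = fobj P x" by (rule comma_ObjE[OF X])
    have o: "Pair x u \<in> Obj (comma P)" using h by (simp add: comma_Obj)
    show "body (fst (body ?l)) X = body (fst (body ?r)) X"
      using h o d cmp_transformation[OF M.cleavage_square_axioms N.cleavage_square_axioms s h] comma_nt_ntrans[OF s] M.sq N.sq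
        comma_map_square[OF M.sq] comma_map_square[OF N.sq] M.lift_square M.Q.lift_square
      unfolding X' by (simp add: ops A)
  next
    fix x assume "x \<in> Obj (trg (src (lift_act Q d' \<odot>\<^bsub>?K\<^esub> comma_sq (Cell P Q (T, S)))))"
    then have "x \<in> Obj M.B" by (simp add: ops)
    then show "body (snd (body ?l)) x = body (snd (body ?r)) x"
      using d by (simp add: ops A)
  qed
  then show ?thesis
    using p a(1) unfolding M' N' Gamma_n_simps cell.sel T.transformation_iff Comma_simps by (simp add: A)
qed

lemma Gamma_n_2functor:
  "strict_2functor (NClCoFib k) (Ps_Alg_n (CAT2 k) (Comma :: ('a univ func, _, _) monad)) (Gamma_n k)"
proof (rule T.functor_into_Ps_Alg_n)
  show "strict_2functor (NClCoFib k) (Ps_Alg (CAT2 k) (Comma :: ('a univ func, _, _) monad)) (Gamma_n k)"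
  proof (intro strict_2functor.intro strict_2functor_axioms.intro NClCoFib_2category T.Ps_Alg_2category, goal_cases)
    case (1 X)
    then show ?case
      using Gamma_n_Ob(2)[OF k, of "fst X" "snd X"] by (cases X) (simp add: NClCoFib_Ob T.Ps_Alg_n_Ob T.Ps_Alg_simps)
  next
    case (2 f X Y)
    then show ?case using Gamma_n_Cell1[of f] by (auto simp: mem_hom1 T.Ps_Alg_simps Gamma_n_simps(2))
  next
    case (3 \<alpha> f g)
    then have "\<alpha> \<in> Cell2 (NClCoFib k)" "src \<alpha> = f" "trg \<alpha> = g" by (auto simp: mem_hom2)
    then have "f \<in> Cell1 (NClCoFib k)" "g \<in> Cell1 (NClCoFib k)" "src f = src g" "trg f = trg g"
      "body \<alpha> \<in> Cell2 (CAT2 k)" "src (body \<alpha>) = body f" "trg (body \<alpha>) = body g"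
      unfolding NClCoFib_def over_2cat_simps(3) mem_hom2 parallel_def by auto
    then have "alg_transformation (CAT2 k) Comma (Cell (F1 (Gamma_n k) f) (F1 (Gamma_n k) g) (body \<alpha>))"
      by (rule Gamma_n_Cell2)
    then show ?case using 3 by (auto simp: mem_hom2 T.Ps_Alg_simps Gamma_n_simps(3))
  next
    case (4 X)
    then show ?case using Gamma_n_id1[of X] by (simp add: Ps_Alg_n_def full_sub_def)
  next
    case (5 f X Y g Z)
    then show ?case
      using Gamma_n_comp1[of f g] by (simp add: mem_hom1 T.Ps_Alg_simps) (simp add: NClCoFib_def)
  next
    case (6 f)
    then show ?case by (simp add: NClCoFib_def T.Ps_Alg_simps Gamma_n_simps(2,3))
  next
    case (7 \<alpha> f g \<beta> h)
    then show ?case by (simp add: NClCoFib_def T.Ps_Alg_simps Gamma_n_simps(3))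
  next
    case (8 \<alpha> f f' \<beta> g g')
    interpret N: strict_2category "NClCoFib k :: 'a univ cofib_2cat" by (rule NClCoFib_2category)
    have c: "f \<in> Cell1 (NClCoFib k)" "g \<in> Cell1 (NClCoFib k)" "f' \<in> Cell1 (NClCoFib k)" "g' \<in> Cell1 (NClCoFib k)"
      "trg f = src g" "trg f' = src g'" and e: "src \<alpha> = f" "trg \<alpha> = f'" "src \<beta> = g" "trg \<beta> = g'"
      using 8 N.cell2_ends[of \<alpha>] N.cell2_ends[of \<beta>] by (auto simp: mem_hom2 parallel_def)
    show ?case
      using Gamma_n_comp1[OF c(1,2,5)] Gamma_n_comp1[OF c(3,4,6)]
      by (simp add: NClCoFib_def T.Ps_Alg_simps(8) Gamma_n_simps(3) e)
  qed
qed (auto simp: normal_algebra_def Gamma_n_simps(1) split: prod.splits)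

end

lemma NClCoFib_forget: "strict_2functor (NClCoFib k) (CAT2 k) forget"
  unfolding NClCoFib_def
  by (rule forget_2functor[OF two_category.Arrow_2category[OF CAT_two_category] NClCoFib_2category[unfolded NClCoFib_def]]) auto

lemma NClCoFib_Cell2:
  "\<alpha> \<in> Cell2 (NClCoFib k) \<longleftrightarrow> src \<alpha> \<in> Cell1 (NClCoFib k) \<and> trg \<alpha> \<in> Cell1 (NClCoFib k) \<and> src (src \<alpha>) = src (trg \<alpha>) \<and>
     trg (src \<alpha>) = trg (trg \<alpha>) \<and> body \<alpha> \<in> Cell2 (CAT2 k) \<and> src (body \<alpha>) = body (src \<alpha>) \<and> trg (body \<alpha>) = body (trg \<alpha>)"
  unfolding NClCoFib_def over_2cat_simps(3) mem_hom2 parallel_def by auto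

lemma Gamma_n_iso:
  fixes k :: "'k rel"
  assumes k: "Card_order k" "infinite (Field k)"
  shows "iso_2cat_over (NClCoFib k) (Ps_Alg_n (CAT2 k) Comma) (CAT2 k) forget ps_forget
     (Gamma_n k :: ('a univ func \<times> 'a univ clv, _, _, _, _, _) two_fun)"
proof -
  interpret T: strict_2monad "CAT2 k" "Comma :: ('a univ func, _, _) monad"
    by (rule comma_2monad[OF k])
  have "iso_2cat (NClCoFib k) (Ps_Alg_n (CAT2 k) Comma) (Gamma_n k :: ('a univ func \<times> 'a univ clv, _, _, _, _, _) two_fun)"
  proof (rule iso_2cat_fullI[OF Gamma_n_2functor[OF k]])
    show "inj_on (F0 (Gamma_n k)) (Ob (NClCoFib k) :: ('a univ func \<times> 'a univ clv) set)"
    proof (rule inj_onI)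
      fix X Y :: "'a univ func \<times> 'a univ clv"
      assume h: "X \<in> Ob (NClCoFib k)" "Y \<in> Ob (NClCoFib k)" "F0 (Gamma_n k) X = F0 (Gamma_n k) Y"
      obtain P d P' d' where e: "X = (P, d)" "Y = (P', d')" by (metis surj_pair)
      have "P' = P" "lift_act P d = lift_act P d'" using h(3) unfolding e Gamma_n_simps(1) by auto
      then show "X = Y"
        using h(1,2) normal_cleavage_unique[of P d d'] unfolding e NClCoFib_Ob CAT2_Ob by simp
    qed
  next
    fix A :: "('a univ func, _, _) psalg" assume A: "A \<in> Ob (Ps_Alg_n (CAT2 k) Comma)"
    obtain P a i c where A': "A = PsAlg P a i c" by (cases A)
    have i: "i = id2 (CAT2 k) (id1 (CAT2 k) P)" and p: "pseudoalgebra (CAT2 k) Comma (PsAlg P a i c)"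
      using A unfolding T.Ps_Alg_n_Ob A' normal_algebra_def psalg.sel by blast+
    obtain d where d: "normal_cleavage P d" "a = lift_act P d" "c = lift_mult k P d"
      by (rule normal_pseudoalgebra_cleavage[OF k p[unfolded i]])
    have "P \<in> Ob (CAT2 k)" using p unfolding T.pseudoalgebra_iff by blast
    then show "\<exists>X \<in> Ob (NClCoFib k). F0 (Gamma_n k) X = A"
      using d by (intro bexI[of _ "(P, d)"]) (simp_all add: Gamma_n_simps(1) A' i NClCoFib_Ob)
  next
    fix f g :: "('a univ func \<times> 'a univ clv, 'a univ square) cell"
    assume "src f = src g" "trg f = trg g" "F1 (Gamma_n k) f = F1 (Gamma_n k) g"
    then show "f = g" by (intro cell.expand) (simp add: Gamma_n_simps(2))
  next
    fix X Y :: "'a univ func \<times> 'a univ clv" and g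
    assume h: "X \<in> Ob (NClCoFib k)" "Y \<in> Ob (NClCoFib k)" "g \<in> Cell1 (Ps_Alg_n (CAT2 k) Comma)"
      "src g = F0 (Gamma_n k) X" "trg g = F0 (Gamma_n k) Y"
    obtain f m where g: "g = Cell (F0 (Gamma_n k) X) (F0 (Gamma_n k) Y) (f, m)"
      using h(4,5) by (metis cell.collapse surj_pair)
    let ?M = "Cell X Y f"
    have "pseudomorphism (CAT2 k) Comma (Cell (F0 (Gamma_n k) (src ?M)) (F0 (Gamma_n k) (trg ?M)) (body ?M, m))"
      using h(3) unfolding T.Ps_Alg_n_Cell1 g by simp
    from Gamma_n_Cell1_unique[OF k _ _ this] h(1,2) show "\<exists>f \<in> Cell1 (NClCoFib k). F1 (Gamma_n k) f = g"
      by (intro bexI[of _ ?M]) (simp_all add: g)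
  next
    fix \<alpha> \<beta> :: "(('a univ func \<times> 'a univ clv, 'a univ square) cell, 'a univ square2) cell"
    assume "src \<alpha> = src \<beta>" "trg \<alpha> = trg \<beta>" "F2 (Gamma_n k) \<alpha> = F2 (Gamma_n k) \<beta>"
    then show "\<alpha> = \<beta>" by (intro cell.expand) (simp add: Gamma_n_simps(3))
  next
    fix f g :: "('a univ func \<times> 'a univ clv, 'a univ square) cell" and \<beta>
    assume h: "f \<in> Cell1 (NClCoFib k)" "g \<in> Cell1 (NClCoFib k)" "src f = src g" "trg f = trg g"
      "\<beta> \<in> Cell2 (Ps_Alg_n (CAT2 k) Comma)" "src \<beta> = F1 (Gamma_n k) f" "trg \<beta> = F1 (Gamma_n k) g"
    have "alg_transformation (CAT2 k) Comma \<beta>" using h(5) unfolding T.Ps_Alg_n_Cell2 by blast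
    from T.transformation_cell(5-7)[OF this] have "Cell f g (body \<beta>) \<in> Cell2 (NClCoFib k)"
      using h by (simp add: NClCoFib_Cell2 Gamma_n_simps(2))
    then show "\<exists>\<alpha> \<in> Cell2 (NClCoFib k). F2 (Gamma_n k) \<alpha> = \<beta>"
      using h(6,7) by (intro bexI[of _ "Cell f g (body \<beta>)"]) (simp_all add: Gamma_n_simps(3) cell.expand)
  qed
  moreover have "eq_2fun (NClCoFib k) (ps_forget \<circ>\<circ> Gamma_n k) (forget :: ('a univ func \<times> 'a univ clv, _, _, _, _, _) two_fun)"
    by (simp add: eq_2fun_def comp_2fun_def ps_forget_def Gamma_n_simps(2,3) Gamma_n_def Let_def split: prod.splits)
  ultimately show ?thesis
    unfolding iso_2cat_over_def using NClCoFib_forget T.ps_forget_n_2functor by blast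
qed

section \<open>Split cofibrations and strict algebras\<close>

context cleavage
begin

lemma split_chi:
  assumes s: "split_cleavage P d" and h: "x \<in> Obj E" "u \<in> Arr B" "cdom B u = fobj P x" "v \<in> Arr B" "cdom B v = ccod B u"
  shows "chi x u v = ide E (ccod E (d x (v \<cdot>[B] u)))"
proof (rule chi_eqI[OF h])
  have e: "d x (v \<cdot>[B] u) = d (ccod E (d x u)) v \<cdot>[E] d x u"
    using s h by (simp add: split_cleavage_def Let_def push_obj_def)
  have c: "ccod E (d x (v \<cdot>[B] u)) = ccod E (d (ccod E (d x u)) v)" unfolding e using h by simp
  show "cdom E (ide E (ccod E (d x (v \<cdot>[B] u)))) = ccod E (d (ccod E (d x u)) v)"
    "ide E (ccod E (d x (v \<cdot>[B] u))) \<cdot>[E] d (ccod E (d x u)) v \<cdot>[E] d x u = d x (v \<cdot>[B] u)"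
    unfolding c using h by (simp_all add: e)
qed (use h in simp_all)

text \<open>The last clause is the uniqueness half of the definite description. It is used to
  recognize a pushforward along a composite.\<close>

lemma push_arr:
  assumes f: "f \<in> Arr E" "farr P f = ide B (cdom B u)" and u: "u \<in> Arr B" and c: "fobj P (cdom E f) = cdom B u"
  shows "push_arr P d u f \<in> Arr E" "cdom E (push_arr P d u f) = ccod E (d (cdom E f) u)"
    "ccod E (push_arr P d u f) = ccod E (d (ccod E f) u)" "farr P (push_arr P d u f) = ide B (ccod B u)"
    "push_arr P d u f \<cdot>[E] d (cdom E f) u = d (ccod E f) u \<cdot>[E] f"
    "[|g \<in> Arr E; cdom E g = ccod E (d (cdom E f) u); ccod E g = ccod E (d (ccod E f) u); farr P g = ide B (ccod B u);
      g \<cdot>[E] d (cdom E f) u = d (ccod E f) u \<cdot>[E] f|] ==> push_arr P d u f = g"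
proof -
  let ?x = "cdom E f" and ?y = "ccod E f"
  have "fobj P ?y = ccod B (farr P f)" using f(1) by simp
  then have y: "fobj P ?y = cdom B u" unfolding f(2) using u by simp
  have "\<exists>!g. g \<in> hom E (ccod E (d ?x u)) (ccod E (d ?y u \<cdot>[E] f)) \<and> g \<in> vert P \<and> g \<cdot>[E] d ?x u = d ?y u \<cdot>[E] f"
    by (rule CoCart_vertical_lift) (use f u c y in simp_all)
  then have "\<exists>!g. g \<in> hom E (push_obj P d u ?x) (push_obj P d u ?y) \<and> g \<in> vert P \<and> g \<cdot>[E] d ?x u = d ?y u \<cdot>[E] f"
    using f u c y by (simp add: push_obj_def)
  from theI'[OF this] have g: "push_arr P d u f \<in> Arr E" "cdom E (push_arr P d u f) = ccod E (d (cdom E f) u)"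
    "ccod E (push_arr P d u f) = ccod E (d (ccod E f) u)" "push_arr P d u f \<in> vert P"
    "push_arr P d u f \<cdot>[E] d (cdom E f) u = d (ccod E f) u \<cdot>[E] f"
    unfolding push_arr_def Let_def by (simp_all add: mem_hom push_obj_def)
  then show g': "push_arr P d u f \<in> Arr E" "cdom E (push_arr P d u f) = ccod E (d (cdom E f) u)"
    "ccod E (push_arr P d u f) = ccod E (d (ccod E f) u)"
    "push_arr P d u f \<cdot>[E] d (cdom E f) u = d (ccod E f) u \<cdot>[E] f" by blast+
  show v: "farr P (push_arr P d u f) = ide B (ccod B u)"
    using g(2,4) f u c by (simp add: vert_iff)
  show "push_arr P d u f = g" if h: "g \<in> Arr E" "cdom E g = ccod E (d (cdom E f) u)" "ccod E g = ccod E (d (ccod E f) u)"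
    "farr P g = ide B (ccod B u)" "g \<cdot>[E] d (cdom E f) u = d (ccod E f) u \<cdot>[E] f"
    by (rule CoCart_unique[OF P, of "d ?x u"]) (use h g' v f u c in simp_all)
qed

text \<open>An identity comparison says directly that the successive lifts are the lift of the
  composite, codomains included. The condition on pushforwards of arrows then follows from their
  uniqueness.\<close>

lemma split_cleavageI:
  assumes n: "normal_cleavage P d"
    and i: "\<And>x u v. [|x \<in> Obj E; u \<in> Arr B; cdom B u = fobj P x; v \<in> Arr B; cdom B v = ccod B u|] ==> is_ide E (chi x u v)"
  shows "split_cleavage P d"
proof -
  have s: "ccod E (d x (v \<cdot>[B] u)) = ccod E (d (ccod E (d x u)) v)" "d x (v \<cdot>[B] u) = d (ccod E (d x u)) v \<cdot>[E] d x u"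
    if h: "x \<in> Obj E" "u \<in> Arr B" "cdom B u = fobj P x" "v \<in> Arr B" "cdom B v = ccod B u" for x u v
  proof -
    obtain z where z: "z \<in> Obj E" "chi x u v = ide E z" using i[OF h] by (auto simp: is_ide_def)
    note c = chi[OF h, unfolded z(2)]
    show "ccod E (d x (v \<cdot>[B] u)) = ccod E (d (ccod E (d x u)) v)"
      using c(2,3) z by simp
    show "d x (v \<cdot>[B] u) = d (ccod E (d x u)) v \<cdot>[E] d x u"
      using c(2,5) z h by simp
  qed
  have p: "push_arr P d (v \<cdot>[B] u) f = push_arr P d v (push_arr P d u f)"
    if uv: "u \<in> Arr B" "v \<in> Arr B" "ccod B u = cdom B v" and f: "f \<in> Arr E" "farr P f = ide B (cdom B u)" for u v f
  proof -
    have "fobj P (cdom E f) = cdom B (farr P f)" using f(1) by simp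
    then have c: "fobj P (cdom E f) = cdom B u" unfolding f(2) using uv by simp
    have "fobj P (ccod E f) = ccod B (farr P f)" using f(1) by simp
    then have d: "fobj P (ccod E f) = cdom B u" unfolding f(2) using uv by simp
    let ?p = "push_arr P d u f"
    note p = push_arr(1-5)[OF f uv(1) c]
    have fv: "farr P ?p = ide B (cdom B v)" "fobj P (cdom E ?p) = cdom B v"
      using p uv f c d by simp_all
    let ?q = "push_arr P d v ?p"
    note q = push_arr(1-5)[OF p(1) fv(1) uv(2) fv(2), unfolded p(2,3)]
    have fw: "farr P f = ide B (cdom B (v \<cdot>[B] u))" "v \<cdot>[B] u \<in> Arr B" "fobj P (cdom E f) = cdom B (v \<cdot>[B] u)"
      using f uv c by simp_all
    have sx: "ccod E (d (cdom E f) (v \<cdot>[B] u)) = ccod E (d (ccod E (d (cdom E f) u)) v)"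
        "d (cdom E f) (v \<cdot>[B] u) = d (ccod E (d (cdom E f) u)) v \<cdot>[E] d (cdom E f) u"
      and sy: "ccod E (d (ccod E f) (v \<cdot>[B] u)) = ccod E (d (ccod E (d (ccod E f) u)) v)"
        "d (ccod E f) (v \<cdot>[B] u) = d (ccod E (d (ccod E f) u)) v \<cdot>[E] d (ccod E f) u"
      using s[of "cdom E f" u v] s[of "ccod E f" u v] f uv c d by simp_all
    have y: "cdom B u = fobj P (ccod E f)" "cdom B u = fobj P (cdom E f)" using c d by simp_all
    show ?thesis
    proof (rule push_arr(6)[OF f(1) fw])
      \<comment> \<open>The square characterizing the pushforward along the composite, pasted from
        the squares of \<open>?p\<close> and \<open>?q\<close>; \<open>sx\<close> and
        \<open>sy\<close> rewrite its sides as lifts of the composite.\<close>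
      have "?q \<cdot>[E] d (ccod E (d (cdom E f) u)) v \<cdot>[E] d (cdom E f) u = d (ccod E (d (ccod E f) u)) v \<cdot>[E] (?p \<cdot>[E] d (cdom E f) u)"
        unfolding q(5) using p(1-3) f(1) uv y by simp
      also have "\<dots> = d (ccod E (d (ccod E f) u)) v \<cdot>[E] d (ccod E f) u \<cdot>[E] f"
        unfolding p(5) using f(1) uv y by simp
      finally show "?q \<cdot>[E] d (cdom E f) (v \<cdot>[B] u) = d (ccod E f) (v \<cdot>[B] u) \<cdot>[E] f"
        unfolding sx(2) sy(2) using q(1,2) f(1) uv y by simp
    qed (use q(1-4) sx(1) sy(1) uv in simp_all)
  qed
  show ?thesis
    unfolding split_cleavage_def Let_def push_obj_def using n s p by simp
qed

text \<open>All components of the comparison are identities, so by \<open>ntrans_identity\<close>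
  its two ends coincide. This equality of functors is the associativity law of a strict
  algebra.\<close>

lemma split_lift_mult:
  assumes "split_cleavage P d"
  shows "comp_functor L Lb = comp_functor L (comma_M P)" "lift_mult k P d = id2 (CAT2 k) (lift_act P d \<odot>\<^bsub>CAT2 k\<^esub> comma_mult P)"
proof -
  have i: "is_ide E (body chi_nt X)" if X: "X \<in> Obj (comma2 P)" for X
  proof -
    obtain x u v where X': "X = Pair (Pair x u) v" and h: "x \<in> Obj E" "u \<in> Arr B" "cdom B u = fobj P x" "v \<in> Arr B" "cdom B v = ccod B u"
      by (rule comma2_ObjE[OF X])
    show ?thesis
      using X h split_chi[OF assms h] unfolding X' by (auto simp: is_ide_def)
  qed
  show e: "comp_functor L Lb = comp_functor L (comma_M P)"
    using ntrans_identity(1)[OF chi_ntrans] i by simp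
  have "chi_nt = id_ntrans (comp_functor L (comma_M P))"
    using ntrans_identity(2)[OF chi_ntrans] i e by simp
  then show "lift_mult k P d = id2 (CAT2 k) (lift_act P d \<odot>\<^bsub>CAT2 k\<^esub> comma_mult P)"
    by (simp add: lift_mult_eq lift_act_eq CAT2_ops comma_mult_eq e)
qed

end

context cleavage_square
begin

text \<open>Preservation of the designated arrows makes the comparison an identity, which equates
  its ends. An identity is invertible, so such a square also preserves all cocartesian arrows; hence
  split cofibrations include into normally cloven ones.\<close>

lemma strict_square:
  assumes "\<forall>x u. liftable P x u \<longrightarrow> farr T (d x u) = d' (fobj T x) (farr S u)"
  shows "comp_functor Q.L Tb = comp_functor T L" "\<And>e. e \<in> CoCart P ==> farr T e \<in> CoCart Q"
proof -
  have c: "cmp x u = ide Q.E (fobj T (ccod E (d x u)))" if h: "x \<in> Obj E" "u \<in> Arr B" "cdom B u = fobj P x" for x u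
  proof (rule cmp_eqI[OF h])
    have e: "farr T (d x u) = d' (fobj T x) (farr S u)" using assms h by (simp add: liftable_def)
    show "cdom Q.E (ide Q.E (fobj T (ccod E (d x u)))) = ccod Q.E (d' (fobj T x) (farr S u))"
      using arg_cong[OF e, of "ccod Q.E"] h by simp
    then show "ide Q.E (fobj T (ccod E (d x u))) \<cdot>[Q.E] d' (fobj T x) (farr S u) = farr T (d x u)"
      using h by (simp add: e)
  qed (use h in simp_all)
  have "is_ide Q.E (body cmp_nt X)" if "X \<in> Obj (comma P)" for X
    using that by (rule comma_ObjE) (auto simp: comma_Obj c is_ide_def)
  then show "comp_functor Q.L Tb = comp_functor T L"
    using ntrans_identity(1)[OF cmp_ntrans] by simp
  show "farr T e \<in> CoCart Q" if "e \<in> CoCart P" for e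
    by (rule cocart_preserved[OF _ that]) (simp add: c invertible_ide)
qed

text \<open>Both composite functors are evaluated at the arrow (1, u) from (x, 1) to (x, u), on
  which lift functors of normal cleavages return the designated lifts.\<close>

lemma strict_square_converse:
  assumes n: "normal_cleavage P d" "normal_cleavage Q d'" and e: "comp_functor Q.L Tb = comp_functor T L"
    and l: "liftable P x u"
  shows "farr T (d x u) = d' (fobj T x) (farr S u)"
proof -
  have h: "x \<in> Obj E" "u \<in> Arr B" "cdom B u = fobj P x" using l by (simp_all add: liftable_def)
  have a: "Sq (Pair x (ide B (fobj P x))) (Pair x u) (ide E x) u \<in> Arr (comma P)" (is "?a \<in> _")
    using h by (simp add: comma_simps)
  have "farr Q.L (Sq (Pair (fobj T x) (ide Q.B (fobj Q (fobj T x)))) (Pair (fobj T x) (farr S u)) (ide Q.E (fobj T x)) (farr S u)) =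
      d' (fobj T x) (farr S u)"
    by (rule Q.normal_lift[OF n(2)]) (use h in simp_all)
  then show ?thesis
    using arg_cong[OF e, of "\<lambda>F. farr F ?a"] a h normal_lift[OF n(1) h] by simp
qed

end

lemma Gamma_simps:
  "F0 Gamma (P, d) = (P, lift_act P d)"
  "F1 Gamma M = Cell (F0 Gamma (src M)) (F0 Gamma (trg M)) (body M)"
  "F2 Gamma \<alpha> = Cell (F1 Gamma (src \<alpha>)) (F1 Gamma (trg \<alpha>)) (body \<alpha>)"
  "fst (F0 Gamma X) = fst X"
  by (simp_all add: Gamma_def Let_def split: prod.splits)

lemma SCoFib_Ob: "(P, d) \<in> Ob (SCoFib k) \<longleftrightarrow> P \<in> Ob (CAT2 k) \<and> split_cleavage P d"
  by (simp add: SCoFib_def)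

lemma SCoFib_Cell1:
  "M \<in> Cell1 (SCoFib k) \<longleftrightarrow> src M \<in> Ob (SCoFib k) \<and> trg M \<in> Ob (SCoFib k) \<and> body M \<in> Cell1 (CAT2 k) \<and>
     src (body M) = fst (src M) \<and> trg (body M) = fst (trg M) \<and>
     (\<forall>x u. liftable (fst (src M)) x u \<longrightarrow>
       farr (fst (body (body M))) (snd (src M) x u) = snd (trg M) (fobj (fst (body (body M))) x) (farr (snd (body (body M))) u))"
  unfolding SCoFib_def over_2cat_simps mem_hom1 Let_def by (auto split: prod.splits)

lemma SCoFib_Cell2:
  "\<alpha> \<in> Cell2 (SCoFib k) \<longleftrightarrow> src \<alpha> \<in> Cell1 (SCoFib k) \<and> trg \<alpha> \<in> Cell1 (SCoFib k) \<and> src (src \<alpha>) = src (trg \<alpha>) \<and>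
     trg (src \<alpha>) = trg (trg \<alpha>) \<and> body \<alpha> \<in> Cell2 (CAT2 k) \<and> src (body \<alpha>) = body (src \<alpha>) \<and> trg (body \<alpha>) = body (trg \<alpha>)"
  unfolding SCoFib_def over_2cat_simps(3) mem_hom2 parallel_def by auto

lemma SCoFib_cases:
  assumes "M \<in> Cell1 (SCoFib k)"
  obtains P d Q d' T S where "M = Cell (P, d) (Q, d') (Cell P Q (T, S))" "(P, d) \<in> Ob (SCoFib k)" "(Q, d') \<in> Ob (SCoFib k)"
    "Cell P Q (T, S) \<in> Cell1 (CAT2 k)" "\<forall>x u. liftable P x u \<longrightarrow> farr T (d x u) = d' (fobj T x) (farr S u)"
proof -
  obtain P d Q d' P' Q' T S where M: "M = Cell (P, d) (Q, d') (Cell P' Q' (T, S))" by (metis cell.exhaust surj_pair)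
  have h: "(P, d) \<in> Ob (SCoFib k)" "(Q, d') \<in> Ob (SCoFib k)" "Cell P' Q' (T, S) \<in> Cell1 (CAT2 k)" "P' = P" "Q' = Q"
    "\<forall>x u. liftable P x u \<longrightarrow> farr T (d x u) = d' (fobj T x) (farr S u)"
    using assms unfolding M SCoFib_Cell1 cell.sel fst_conv snd_conv by blast+
  show thesis
    by (rule that[OF M[unfolded h(4,5)] h(1,2) h(3)[unfolded h(4,5)]]) (rule h(6))
qed

lemma SCoFib_2category: "strict_2category (SCoFib k :: 'a univ cofib_2cat)"
  unfolding SCoFib_def
proof (rule over_2cat_category, goal_cases)
  case 1
  show ?case by (rule two_category.Arrow_2category[OF CAT_two_category])
next
  case (2 X)
  obtain P d where X: "X = (P, d)" by (cases X)
  then interpret cleavage P d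
    using 2 by unfold_locales (auto simp: split_cleavage_def normal_cleavage_def CAT2_Ob)
  show ?case
    using 2 unfolding X by (simp add: CAT2_ops liftable_def)
next
  case (3 F G)
  then have "F \<in> Cell1 (SCoFib k)" "G \<in> Cell1 (SCoFib k)" by (simp_all add: SCoFib_def)
  obtain P d Q d' T S where F: "F = Cell (P, d) (Q, d') (Cell P Q (T, S))" and oP: "(P, d) \<in> Ob (SCoFib k)"
      and cF: "Cell P Q (T, S) \<in> Cell1 (CAT2 k)" and eF: "\<forall>x u. liftable P x u \<longrightarrow> farr T (d x u) = d' (fobj T x) (farr S u)"
    using \<open>F \<in> Cell1 (SCoFib k)\<close> by (rule SCoFib_cases)
  obtain R d'' U W where G: "G = Cell (Q, d') (R, d'') (Cell Q R (U, W))"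
      and eG: "\<forall>x u. liftable Q x u \<longrightarrow> farr U (d' x u) = d'' (fobj U x) (farr W u)"
    using \<open>G \<in> Cell1 (SCoFib k)\<close> 3(3) unfolding F by (cases rule: SCoFib_cases) auto
  interpret cleavage P d
    using oP by unfold_locales (auto simp: SCoFib_Ob split_cleavage_def normal_cleavage_def CAT2_Ob)
  have s: "is_square P Q T S" using cF unfolding CAT2_Cell1 by blast
  have "farr U (farr T (d x u)) = d'' (fobj U (fobj T x)) (farr W (farr S u))" if l: "liftable P x u" for x u
  proof -
    have "liftable Q (fobj T x) (farr S u)" using l squareD[OF s] by (simp add: liftable_def)
    then show ?thesis using eF eG l by simp
  qed
  then show ?case
    using squareD[OF s] unfolding F G by (simp add: CAT2_ops liftable_def)
qed simp_all

lemma SCoFib_forget: "strict_2functor (SCoFib k :: 'a univ cofib_2cat) (CAT2 k) forget"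
  unfolding SCoFib_def
  by (rule forget_2functor[OF two_category.Arrow_2category[OF CAT_two_category] SCoFib_2category[unfolded SCoFib_def]]) auto

lemma SCoFib_NClCoFib_Ob: "X \<in> Ob (SCoFib k) ==> X \<in> Ob (NClCoFib k)"
  by (cases X) (simp add: SCoFib_Ob NClCoFib_Ob split_cleavage_def)

lemma SCoFib_NClCoFib_Cell1:
  fixes M :: "('a univ func \<times> 'a univ clv, 'a univ square) cell"
  assumes "M \<in> Cell1 (SCoFib k)"
  shows "M \<in> Cell1 (NClCoFib k)"
proof -
  obtain P d Q d' T S where M: "M = Cell (P, d) (Q, d') (Cell P Q (T, S))"
      and o: "(P, d) \<in> Ob (SCoFib k)" "(Q, d') \<in> Ob (SCoFib k)"
      and c: "Cell P Q (T, S) \<in> Cell1 (CAT2 k)" and e: "\<forall>x u. liftable P x u \<longrightarrow> farr T (d x u) = d' (fobj T x) (farr S u)"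
    using assms by (rule SCoFib_cases)
  note o' = o[THEN SCoFib_NClCoFib_Ob]
  interpret cleavage_square P d Q d' T S by (rule cleavage_square_intro[OF o' c])
  show ?thesis
    using o' c strict_square(2)[OF e] unfolding M NClCoFib_Cell1 by simp
qed

lemma SCoFib_inclusion: "strict_2functor (SCoFib k :: 'a univ cofib_2cat) (NClCoFib k) id_2fun"
proof (intro strict_2functor.intro strict_2functor_axioms.intro SCoFib_2category NClCoFib_2category, goal_cases)
  case (1 X)
  then show ?case by (simp add: id_2fun_def SCoFib_NClCoFib_Ob)
next
  case (2 f X Y)
  then show ?case by (simp add: id_2fun_def mem_hom1 SCoFib_NClCoFib_Cell1)
next
  case (3 \<alpha> f g)
  then show ?case by (auto simp: id_2fun_def mem_hom2 SCoFib_Cell2 NClCoFib_Cell2 SCoFib_NClCoFib_Cell1)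
qed (simp_all add: id_2fun_def SCoFib_def NClCoFib_def)

context
  fixes k :: "'k rel"
  assumes k: "Card_order k" "infinite (Field k)"
begin

interpretation T: strict_2monad "CAT2 k" "Comma :: ('a univ func, _, _) monad"
  by (rule comma_2monad[OF k])

text \<open>Derived from the pseudo case: for a split cleavage the structure cells are identities,
  and the equalities of their ends are the laws of a strict algebra.\<close>

lemma Gamma_Ob:
  fixes X :: "'a univ func \<times> 'a univ clv"
  assumes X: "X \<in> Ob (SCoFib k)"
  shows "F0 Gamma X \<in> Ob (Alg_s (CAT2 k) Comma)"
    "F0 (Gamma_n k) X = F0 (strict_as_ps (CAT2 k) Comma) (F0 Gamma X)"
proof -
  obtain P d where X': "X = (P, d)" by (cases X)
  have o: "P \<in> Ob (CAT2 k)" "split_cleavage P d" "normal_cleavage P d"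
    using X unfolding X' SCoFib_Ob by (simp_all add: split_cleavage_def)
  interpret cleavage P d by (rule normal_cleavage_locale[OF _ o(3)]) (use o in \<open>simp add: CAT2_Ob\<close>)
  note m = split_lift_mult[OF o(2)]
  show e: "F0 (Gamma_n k) X = F0 (strict_as_ps (CAT2 k) Comma) (F0 Gamma X)"
    by (simp add: X' Gamma_simps Gamma_n_simps T.strict_as_ps_simps m(2))
  have p: "pseudoalgebra (CAT2 k) Comma (PsAlg P (lift_act P d) (id2 (CAT2 k) (id1 (CAT2 k) P)) (lift_mult k P d))"
    using Gamma_n_Ob(2)[OF k o(1,3)] unfolding T.Ps_Alg_n_Ob Gamma_n_simps by blast
  have a: "lift_act P d \<in> Cell1 (CAT2 k)" "src (lift_act P d) = comma_cod P" "trg (lift_act P d) = P"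
    and u: "trg (id2 (CAT2 k) (id1 (CAT2 k) P)) = lift_act P d \<odot>\<^bsub>CAT2 k\<^esub> comma_unit P"
    using p unfolding T.pseudoalgebra_iff Comma_simps by blast+
  have u': "lift_act P d \<odot>\<^bsub>CAT2 k\<^esub> comma_unit P = id1 (CAT2 k) P"
    using u by (simp only: Arrow_simps(6) cell.sel)
  have "lift_act P d \<odot>\<^bsub>CAT2 k\<^esub> comma_mult P = lift_act P d \<odot>\<^bsub>CAT2 k\<^esub> comma_sq (lift_act P d)"
    by (simp add: lift_act_eq CAT2_ops comma_mult_eq comma_sq_simps m(1))
  then show "F0 Gamma X \<in> Ob (Alg_s (CAT2 k) Comma)"
    unfolding X' Gamma_simps T.Alg_s_Ob T.strict_algebra_iff Comma_simps using o(1) a u' by blast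
qed

text \<open>A strict algebra is a normal pseudoalgebra with identity multiplication, so it comes
  from a normal cleavage whose comparison cells are identities; such a cleavage is split.\<close>

lemma strict_algebra_cleavage:
  fixes P :: "'a univ func"
  assumes a: "strict_algebra (CAT2 k) Comma P a"
  obtains d where "(P, d) \<in> Ob (SCoFib k)" "a = lift_act P d"
proof -
  obtain d where d: "normal_cleavage P d" "a = lift_act P d" "id2 (CAT2 k) (a \<odot>\<^bsub>CAT2 k\<^esub> mu Comma P) = lift_mult k P d"
    by (rule normal_pseudoalgebra_cleavage[OF k T.strict_pseudoalgebra[OF a]])
  have o: "P \<in> Ob (CAT2 k)" using a unfolding T.strict_algebra_iff by blast
  interpret cleavage P d by (rule normal_cleavage_locale[OF _ d(1)]) (use o in \<open>simp add: CAT2_Ob\<close>)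
  \<comment> \<open>The equation of multiplication cells, read on total parts; at ((x, u), v) it
    says that the comparison is an identity.\<close>
  have x: "id_ntrans (comp_functor L (comma_M P)) = chi_nt"
    using d(3) unfolding d(2) by (auto simp: lift_act_eq lift_mult_eq CAT2_ops comma_mult_eq)
  have "split_cleavage P d"
  proof (rule split_cleavageI[OF d(1)])
    fix x u v assume h: "x \<in> Obj E" "u \<in> Arr B" "cdom B u = fobj P x" "v \<in> Arr B" "cdom B v = ccod B u"
    then have o: "Pair (Pair x u) v \<in> Obj (comma2 P)" "Pair x (v \<cdot>[B] u) \<in> Obj (comma P)" by (simp_all add: comma2_Obj comma_Obj)
    have "chi x u v = ide E (ccod E (d x (v \<cdot>[B] u)))"
      using arg_cong[OF x, of "\<lambda>t. body t (Pair (Pair x u) v)"] o by simp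
    then show "is_ide E (chi x u v)" using h by (auto simp: is_ide_def)
  qed
  with o d(2) show thesis by (intro that) (simp_all add: SCoFib_Ob)
qed

text \<open>\<open>strict_square\<close> and its converse match preservation of designated arrows
  with the equation of a strict morphism. Both implications are used: one for \<open>Gamma\<close>
  on 1-cells, the other for its fullness.\<close>

lemma Gamma_Cell1:
  fixes M :: "('a univ func \<times> 'a univ clv, 'a univ square) cell"
  assumes o: "src M \<in> Ob (SCoFib k)" "trg M \<in> Ob (SCoFib k)"
  shows "M \<in> Cell1 (SCoFib k) \<longleftrightarrow> F1 Gamma M \<in> Cell1 (Alg_s (CAT2 k) Comma)"
proof -
  obtain P d Q d' P' Q' T S where M: "M = Cell (P, d) (Q, d') (Cell P' Q' (T, S))" by (metis cell.exhaust surj_pair)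
  have o': "(P, d) \<in> Ob (SCoFib k)" "(Q, d') \<in> Ob (SCoFib k)" using o unfolding M by simp_all
  have a: "strict_algebra (CAT2 k) Comma P (lift_act P d)" "strict_algebra (CAT2 k) Comma Q (lift_act Q d')"
    using Gamma_Ob(1)[OF o'(1)] Gamma_Ob(1)[OF o'(2)] unfolding Gamma_simps T.Alg_s_Ob .
  have "(\<forall>x u. liftable P x u \<longrightarrow> farr T (d x u) = d' (fobj T x) (farr S u)) \<longleftrightarrow>
      Cell P Q (T, S) \<odot>\<^bsub>CAT2 k\<^esub> lift_act P d = lift_act Q d' \<odot>\<^bsub>CAT2 k\<^esub> comma_sq (Cell P Q (T, S))"
    if c: "Cell P Q (T, S) \<in> Cell1 (CAT2 k)"
  proof -
    interpret cleavage_square P d Q d' T S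
      by (rule cleavage_square_intro[OF o'[THEN SCoFib_NClCoFib_Ob] c])
    have n: "normal_cleavage P d" "normal_cleavage Q d'" using o' by (simp_all add: SCoFib_Ob split_cleavage_def)
    have "(\<forall>x u. liftable P x u \<longrightarrow> farr T (d x u) = d' (fobj T x) (farr S u)) \<longleftrightarrow> comp_functor Q.L Tb = comp_functor T L"
      using strict_square(1) strict_square_converse[OF n] by blast
    then show ?thesis
      by (auto simp: lift_act_eq Q.lift_act_eq CAT2_ops comma_sq_simps)
  qed
  then show ?thesis
    using o' a unfolding M SCoFib_Cell1 Gamma_simps cell.sel T.Alg_s_Cell1 Comma_simps fst_conv snd_conv by blast
qed

text \<open>The identity cell on a strict morphism is a pseudomorphism structure, so by uniqueness
  it is the comparison cell of the square.\<close>

lemma Gamma_square1: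
  fixes M :: "('a univ func \<times> 'a univ clv, 'a univ square) cell"
  assumes M: "M \<in> Cell1 (SCoFib k)"
  shows "F1 (Gamma_n k) M = F1 (strict_as_ps (CAT2 k) Comma) (F1 Gamma M)"
proof -
  have o: "src M \<in> Ob (SCoFib k)" "trg M \<in> Ob (SCoFib k)" using M by (simp_all add: SCoFib_Cell1)
  obtain P d Q d' F where M': "M = Cell (P, d) (Q, d') F" by (metis cell.exhaust surj_pair)
  have "F1 Gamma M \<in> Cell1 (Alg_s (CAT2 k) Comma)" using M Gamma_Cell1[OF o] by blast
  then have a: "strict_algebra (CAT2 k) Comma P (lift_act P d)" "strict_algebra (CAT2 k) Comma Q (lift_act Q d')"
    "F \<in> Cell1 (CAT2 k)" "src F = P" "trg F = Q"
    "F \<odot>\<^bsub>CAT2 k\<^esub> lift_act P d = lift_act Q d' \<odot>\<^bsub>CAT2 k\<^esub> T1 Comma F"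
    unfolding M' Gamma_simps cell.sel T.Alg_s_Cell1 by blast+
  note p = T.strict_pseudomorphism[OF a]
  have e: "F0 (Gamma_n k) (src M) = F0 (strict_as_ps (CAT2 k) Comma) (F0 Gamma (src M))"
    "F0 (Gamma_n k) (trg M) = F0 (strict_as_ps (CAT2 k) Comma) (F0 Gamma (trg M))"
    using Gamma_Ob(2)[OF o(1)] Gamma_Ob(2)[OF o(2)] .
  have "pseudomorphism (CAT2 k) Comma (Cell (F0 (Gamma_n k) (src M)) (F0 (Gamma_n k) (trg M))
      (body M, id2 (CAT2 k) (F \<odot>\<^bsub>CAT2 k\<^esub> lift_act P d)))"
    unfolding e unfolding M' cell.sel Gamma_simps T.strict_as_ps_simps by (rule p)
  from Gamma_n_Cell1_unique(1)[OF k o[THEN SCoFib_NClCoFib_Ob] this] show ?thesis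
    unfolding e T.strict_as_ps_simps(2) by (simp add: M' Gamma_simps)
qed

lemma Gamma_square:
  "eq_2fun (SCoFib k :: 'a univ cofib_2cat) (Gamma_n k \<circ>\<circ> id_2fun) (strict_as_ps (CAT2 k) Comma \<circ>\<circ> Gamma)"
  unfolding eq_2fun_def comp_2fun_def id_2fun_def
  by (simp add: Gamma_Ob(2) Gamma_square1 Gamma_n_simps(3) Gamma_simps(3) T.strict_as_ps_simps(3) SCoFib_Cell2)

text \<open>The axiom of an algebra 2-cell is the transformation axiom of the pseudo case with its
  two identity structure cells cancelled.\<close>

lemma Gamma_Cell2:
  fixes \<alpha> :: "(('a univ func \<times> 'a univ clv, 'a univ square) cell, 'a univ square2) cell"
  assumes \<alpha>: "\<alpha> \<in> Cell2 (SCoFib k)"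
  shows "F2 Gamma \<alpha> \<in> Cell2 (Alg_s (CAT2 k) Comma)"
proof -
  have c: "src \<alpha> \<in> Cell1 (SCoFib k)" "trg \<alpha> \<in> Cell1 (SCoFib k)" and e: "src (src \<alpha>) = src (trg \<alpha>)"
     "trg (src \<alpha>) = trg (trg \<alpha>)" and b: "body \<alpha> \<in> Cell2 (CAT2 k)" "src (body \<alpha>) = body (src \<alpha>)" "trg (body \<alpha>) = body (trg \<alpha>)"
    using \<alpha> unfolding SCoFib_Cell2 by blast+
  have m: "F1 Gamma (src \<alpha>) \<in> Cell1 (Alg_s (CAT2 k) Comma)" "F1 Gamma (trg \<alpha>) \<in> Cell1 (Alg_s (CAT2 k) Comma)"
    using c Gamma_Cell1[of "src \<alpha>"] Gamma_Cell1[of "trg \<alpha>"] unfolding SCoFib_Cell1 by blast+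
  have t: "alg_transformation (CAT2 k) Comma (Cell (F1 (Gamma_n k) (src \<alpha>)) (F1 (Gamma_n k) (trg \<alpha>)) (body \<alpha>))"
    by (rule Gamma_n_Cell2[OF k c[THEN SCoFib_NClCoFib_Cell1] e b])
  obtain P d Q d' F where s: "src \<alpha> = Cell (P, d) (Q, d') F" by (metis cell.exhaust surj_pair)
  obtain G where s': "trg \<alpha> = Cell (P, d) (Q, d') G" using e unfolding s by (metis cell.collapse cell.sel(1,2))
  have A: "strict_algebra (CAT2 k) Comma P (lift_act P d)" "strict_algebra (CAT2 k) Comma Q (lift_act Q d')"
    and F: "F \<in> Cell1 (CAT2 k)" "src F = P" "trg F = Q"
      "F \<odot>\<^bsub>CAT2 k\<^esub> lift_act P d = lift_act Q d' \<odot>\<^bsub>CAT2 k\<^esub> T1 Comma F"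
    and G: "G \<in> Cell1 (CAT2 k)" "src G = P" "trg G = Q"
      "G \<odot>\<^bsub>CAT2 k\<^esub> lift_act P d = lift_act Q d' \<odot>\<^bsub>CAT2 k\<^esub> T1 Comma G"
    using m unfolding s s' Gamma_simps cell.sel T.Alg_s_Cell1 by blast+
  have l: "lift_act P d \<in> Cell1 (CAT2 k)" "src (lift_act P d) = T0 Comma P" "trg (lift_act P d) = P"
      "lift_act Q d' \<in> Cell1 (CAT2 k)" "src (lift_act Q d') = T0 Comma Q" "trg (lift_act Q d') = Q"
    using A unfolding T.strict_algebra_iff by blast+
  have "(body \<alpha> \<lhd>\<^bsub>CAT2 k\<^esub> lift_act P d) \<bullet>\<^bsub>CAT2 k\<^esub> id2 (CAT2 k) (F \<odot>\<^bsub>CAT2 k\<^esub> lift_act P d) =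
      id2 (CAT2 k) (G \<odot>\<^bsub>CAT2 k\<^esub> lift_act P d) \<bullet>\<^bsub>CAT2 k\<^esub> (lift_act Q d' \<rhd>\<^bsub>CAT2 k\<^esub> T2 Comma (body \<alpha>))"
    using t[unfolded Gamma_square1[OF c(1)] Gamma_square1[OF c(2)]] 
    unfolding s s' Gamma_simps T.strict_as_ps_simps cell.sel snd_conv T.transformation_iff by blast
  \<comment> \<open>Both whiskered cells run between the same 1-cells, those carrying the
    identities; with this the identities can be cancelled.\<close>
  moreover have "body \<alpha> \<lhd>\<^bsub>CAT2 k\<^esub> lift_act P d \<in> hom2 (CAT2 k) (F \<odot>\<^bsub>CAT2 k\<^esub> lift_act P d) (G \<odot>\<^bsub>CAT2 k\<^esub> lift_act P d)"
    by (rule T.fn.dom.hcomp_in[OF T.fn.dom.id2_in]) (use b F G l in \<open>simp_all add: mem_hom2 s s'\<close>)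
  moreover have "lift_act Q d' \<rhd>\<^bsub>CAT2 k\<^esub> T2 Comma (body \<alpha>) \<in> hom2 (CAT2 k) (F \<odot>\<^bsub>CAT2 k\<^esub> lift_act P d) (G \<odot>\<^bsub>CAT2 k\<^esub> lift_act P d)"
    unfolding F(4) G(4)
    by (rule T.fn.dom.hcomp_in[OF T.fn.F2_in T.fn.dom.id2_in]) (use b F(1-3) G(1-3) l in \<open>simp_all add: mem_hom2 s s' del: Comma_simps\<close>)
  ultimately have "body \<alpha> \<lhd>\<^bsub>CAT2 k\<^esub> lift_act P d = lift_act Q d' \<rhd>\<^bsub>CAT2 k\<^esub> T2 Comma (body \<alpha>)"
    using T.fn.dom.vcomp_id2 T.fn.dom.id2_vcomp by metis
  then show ?thesis
    using m b unfolding Gamma_simps s s' cell.sel T.Alg_s_Cell2 by blast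
qed

lemma Gamma_2functor: "strict_2functor (SCoFib k) (Alg_s (CAT2 k) (Comma :: ('a univ func, _, _) monad)) Gamma"
proof (intro strict_2functor.intro strict_2functor_axioms.intro SCoFib_2category T.Alg_s_2category, goal_cases)
  case (1 X)
  then show ?case by (rule Gamma_Ob)
next
  case (2 f X Y)
  then show ?case using Gamma_Cell1[of f] by (auto simp: mem_hom1 SCoFib_Cell1 Gamma_simps(2))
next
  case (3 \<alpha> f g)
  then show ?case using Gamma_Cell2[of \<alpha>] by (auto simp: mem_hom2 Gamma_simps(3))
qed (simp_all add: SCoFib_def T.Alg_s_ops Gamma_simps(2-4))

lemma Gamma_iso:
  "iso_2cat_over (SCoFib k) (Alg_s (CAT2 k) Comma) (CAT2 k) forget forget
     (Gamma :: ('a univ func \<times> 'a univ clv, _, _, _, _, _) two_fun)"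
proof -
  have "iso_2cat (SCoFib k) (Alg_s (CAT2 k) Comma) (Gamma :: ('a univ func \<times> 'a univ clv, _, _, _, _, _) two_fun)"
  proof (rule iso_2cat_fullI[OF Gamma_2functor])
    show "inj_on (F0 Gamma) (Ob (SCoFib k) :: ('a univ func \<times> 'a univ clv) set)"
    proof (rule inj_onI)
      fix X Y :: "'a univ func \<times> 'a univ clv"
      assume h: "X \<in> Ob (SCoFib k)" "Y \<in> Ob (SCoFib k)" "F0 Gamma X = F0 Gamma Y"
      obtain P d P' d' where e: "X = (P, d)" "Y = (P', d')" by (metis surj_pair)
      have "P' = P" "lift_act P d = lift_act P d'" using h(3) unfolding e Gamma_simps(1) by auto
      then show "X = Y"
        using h(1,2) normal_cleavage_unique[of P d d'] unfolding e SCoFib_Ob CAT2_Ob split_cleavage_def by simp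
    qed
  next
    fix A assume A: "A \<in> Ob (Alg_s (CAT2 k) (Comma :: ('a univ func, _, _) monad))"
    obtain P a where A': "A = (P, a)" by (cases A)
    obtain d where "(P, d) \<in> Ob (SCoFib k)" "a = lift_act P d"
      using A unfolding A' T.Alg_s_Ob by (rule strict_algebra_cleavage)
    then show "\<exists>X \<in> Ob (SCoFib k). F0 Gamma X = A"
      by (intro bexI[of _ "(P, d)"]) (simp_all add: Gamma_simps A')
  next
    fix f g :: "('a univ func \<times> 'a univ clv, 'a univ square) cell"
    assume "src f = src g" "trg f = trg g" "F1 Gamma f = F1 Gamma g"
    then show "f = g" by (intro cell.expand) (simp add: Gamma_simps(2))
  next
    fix X Y :: "'a univ func \<times> 'a univ clv" and g
    assume h: "X \<in> Ob (SCoFib k)" "Y \<in> Ob (SCoFib k)" "g \<in> Cell1 (Alg_s (CAT2 k) Comma)"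
      "src g = F0 Gamma X" "trg g = F0 Gamma Y"
    have g: "g = F1 Gamma (Cell X Y (body g))" using h(4,5) by (simp add: Gamma_simps(2) cell.expand)
    then show "\<exists>f \<in> Cell1 (SCoFib k). F1 Gamma f = g"
      using h(1-3) Gamma_Cell1[of "Cell X Y (body g)"] by (intro bexI[of _ "Cell X Y (body g)"]) simp_all
  next
    fix \<alpha> \<beta> :: "(('a univ func \<times> 'a univ clv, 'a univ square) cell, 'a univ square2) cell"
    assume "src \<alpha> = src \<beta>" "trg \<alpha> = trg \<beta>" "F2 Gamma \<alpha> = F2 Gamma \<beta>"
    then show "\<alpha> = \<beta>" by (intro cell.expand) (simp add: Gamma_simps(3))
  next
    fix f g :: "('a univ func \<times> 'a univ clv, 'a univ square) cell" and \<beta>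
    assume h: "f \<in> Cell1 (SCoFib k)" "g \<in> Cell1 (SCoFib k)" "src f = src g" "trg f = trg g"
      "\<beta> \<in> Cell2 (Alg_s (CAT2 k) Comma)" "src \<beta> = F1 Gamma f" "trg \<beta> = F1 Gamma g"
    have "body \<beta> \<in> hom2 (CAT2 k) (body (src \<beta>)) (body (trg \<beta>))"
      using h(5) unfolding Alg_s_def over_2cat_simps(3) by blast
    then have "Cell f g (body \<beta>) \<in> Cell2 (SCoFib k)"
      using h by (simp add: SCoFib_Cell2 Gamma_simps(2) mem_hom2)
    then show "\<exists>\<alpha> \<in> Cell2 (SCoFib k). F2 Gamma \<alpha> = \<beta>"
      using h(6,7) by (intro bexI[of _ "Cell f g (body \<beta>)"]) (simp_all add: Gamma_simps(3) cell.expand)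
  qed
  moreover have "strict_2functor (Alg_s (CAT2 k) Comma) (CAT2 k) (forget :: ('a univ func \<times> 'a univ square, _, _, _, _, _) two_fun)"
    unfolding Alg_s_def
    by (rule forget_2functor[OF T.fn.dom.strict_2category_axioms T.Alg_s_2category[unfolded Alg_s_def]])
      (auto simp: T.strict_algebra_iff)
  moreover have "eq_2fun (SCoFib k) (forget \<circ>\<circ> Gamma) (forget :: ('a univ func \<times> 'a univ clv, _, _, _, _, _) two_fun)"
    by (simp add: eq_2fun_def comp_2fun_def Gamma_simps(2-4))
  ultimately show ?thesis
    unfolding iso_2cat_over_def using SCoFib_forget by blast
qed

end

section \<open>Factorizations\<close>

context cleavage
begin

text \<open>The components of the restricted algebra from which the selected factorization is
  computed; the unit cell is the transformation of lifts of identities.\<close>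

lemma kap_cloven:
  "und (F0 (kap_ps k) (cloven_algebra k P d)) = E"
  "act (F0 (kap_ps k) (cloven_algebra k P d)) = comp_functor L (kap P)"
  "ps_unit (F0 (kap_ps k) (cloven_algebra k P d)) = iota_nt"
  by (simp_all add: restrict_ps_def Let_def cloven_algebra_def lift_act_eq lift_unit_eq CAT_simps)

lemma iota_invertible:
  assumes "x \<in> Obj E"
  shows "invertible E (d x (ide B (fobj P x)))"
  using assms by (intro CoCart_invertible[OF P]) (simp_all add: invertible_ide)

text \<open>If \<open>h\<close> is invertible, \<open>f\<close> is a cocartesian arrow followed by
  an isomorphism. Conversely, if \<open>f\<close> is cocartesian, then \<open>h\<close> compares two
  cocartesian arrows and lies over an identity.\<close>

lemma invertible_cocart:
  assumes f: "f \<in> Arr E" and h: "h \<in> Arr E" "cdom E h = ccod E (d (cdom E f) (farr P f))"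
    "farr P h = ide B (fobj P (ccod E f))" "h \<cdot>[E] d (cdom E f) (farr P f) = f"
  shows "invertible E h \<longleftrightarrow> f \<in> CoCart P"
proof
  assume "invertible E h"
  then have "h \<cdot>[E] d (cdom E f) (farr P f) \<in> CoCart P"
    using f h by (intro CoCart_iso_comp[OF P]) simp_all
  then show "f \<in> CoCart P" by (simp only: h(4))
next
  assume c: "f \<in> CoCart P"
  have i: "inverse_arrows B (farr P h) (ide B (fobj P (ccod E f)))"
    unfolding h(3) using f by (intro inverse_arrows_ide) simp_all
  have e: "d (cdom E f) (farr P f) \<in> CoCart P" using f by simp
  show "invertible E h"
    by (rule CoCart_comparison_inverse[OF P e c h(1,2,4) i]) (auto simp: invertible_def)
qed

lemma vert_part_eqI:
  assumes f: "f \<in> Arr E" and h: "h \<in> Arr E" "cdom E h = ccod E (d (cdom E f) (farr P f))" "ccod E h = ccod E f"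
    "farr P h = ide B (fobj P (ccod E f))" "h \<cdot>[E] d (cdom E f) (farr P f) = f"
  shows "vert_part P d f = h"
proof -
  have e: "d (cdom E f) (farr P f) \<in> CoCart P" using f by simp
  have "\<exists>!g. g \<in> hom E (ccod E (d (cdom E f) (farr P f))) (ccod E f) \<and> g \<in> vert P \<and> g \<cdot>[E] d (cdom E f) (farr P f) = f"
    by (rule CoCart_vertical_lift[OF P e]) (use f in simp_all)
  then have "\<exists>!g. g \<in> hom E (push_obj P d (farr P f) (cdom E f)) (ccod E f) \<and> g \<in> vert P \<and> f = g \<cdot>[E] d (cdom E f) (farr P f)"
    by (simp add: push_obj_def eq_commute[of f])
  then show ?thesis
    unfolding vert_part_def Let_def
    by (rule the1_equality) (use f h in \<open>simp add: mem_hom push_obj_def vert_iff\<close>)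
qed

text \<open>A diagonal of a square must lie over the unique filler of its image in the base, which
  exists because the image of the right-hand arrow is invertible; the diagonal is then the
  cocartesian lift over this filler.\<close>

lemma orthogonal: "orthogonal_fs E (CoCart P) (inv_image_Iso P)"
  unfolding orthogonal_fs_def
proof (intro conjI ballI impI)
  show "CoCart P \<subseteq> Arr E" by (rule subsetI) (rule CoCart_arr)
  show "inv_image_Iso P \<subseteq> Arr E" by (auto simp: inv_image_Iso_def)
  show "iso_closed E (CoCart P)"
    unfolding iso_closed_def
    using CoCart_iso_comp[OF P] CoCart_comp[OF P] CoCart_iso[OF P] unfolding invertible_def by metis
  show "iso_closed E (inv_image_Iso P)"
    unfolding iso_closed_def inv_image_Iso_def
  proof (intro ballI allI impI conjI CollectI)
    fix f i assume f: "f \<in> {f \<in> Arr E. invertible B (farr P f)}" and i: "invertible E i"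
    have i': "i \<in> Arr E" "invertible B (farr P i)" using i invertible_arr[OF i] functor_invertible[OF P i] by simp_all
    show "i \<cdot>[E] f \<in> Arr E" "invertible B (farr P (i \<cdot>[E] f))" if c: "cdom E i = ccod E f"
      using f i' c invertible_comp[of B "farr P f" "farr P i"] by simp_all
    show "f \<cdot>[E] i \<in> Arr E" "invertible B (farr P (f \<cdot>[E] i))" if c: "ccod E i = cdom E f"
      using f i' c invertible_comp[of B "farr P i" "farr P f"] by simp_all
  qed
next
  fix f assume f: "f \<in> Arr E"
  let ?e = "d (cdom E f) (farr P f)"
  have e: "?e \<in> CoCart P" using f by simp
  have "\<exists>!g. g \<in> hom E (ccod E ?e) (ccod E f) \<and> g \<in> vert P \<and> g \<cdot>[E] ?e = f"
    by (rule CoCart_vertical_lift[OF P e]) (use f in simp_all)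
  then obtain g where g: "g \<in> Arr E" "cdom E g = ccod E ?e" "g \<in> vert P" "g \<cdot>[E] ?e = f" by (auto simp: mem_hom)
  then have "g \<in> inv_image_Iso P" by (auto simp: inv_image_Iso_def vert_def is_ide_def invertible_ide)
  then show "\<exists>e\<in>CoCart P. \<exists>m\<in>inv_image_Iso P. ccod E e = cdom E m \<and> f = m \<cdot>[E] e"
    using e g by (intro bexI[of _ ?e] bexI[of _ g]) simp_all
next
  fix e m r s
  assume e: "e \<in> CoCart P" and m: "m \<in> inv_image_Iso P" and r: "r \<in> hom E (cdom E e) (cdom E m)"
    and s: "s \<in> hom E (ccod E e) (ccod E m)" and q: "s \<cdot>[E] e = m \<cdot>[E] r"
  have a: "e \<in> Arr E" by (rule CoCart_arr[OF e])
  have h: "m \<in> Arr E" "r \<in> Arr E" "cdom E r = cdom E e" "ccod E r = cdom E m" "s \<in> Arr E" "cdom E s = ccod E e" "ccod E s = ccod E m"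
    using m r s by (simp_all add: inv_image_Iso_def mem_hom)
  obtain w where w: "inverse_arrows B (farr P m) w" using m by (auto simp: inv_image_Iso_def invertible_def)
  have w': "w \<in> Arr B" "cdom B w = fobj P (ccod E m)" "ccod B w = fobj P (cdom E m)"
    "w \<cdot>[B] farr P m = ide B (fobj P (cdom E m))" "farr P m \<cdot>[B] w = ide B (fobj P (ccod E m))"
    using w h by (simp_all add: inverse_arrows_iff)
  \<comment> \<open>The base filler: the inverse of the image of \<open>m\<close> after the image of
    \<open>s\<close>.\<close>
  let ?v = "w \<cdot>[B] farr P s"
  have "farr P s \<cdot>[B] farr P e = farr P m \<cdot>[B] farr P r"
    using arg_cong[OF q, of "farr P"] h a by simp
  from cat_extend[OF this, of w] have "?v \<cdot>[B] farr P e = w \<cdot>[B] farr P m \<cdot>[B] farr P r"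
    using h a w'(1-3) by simp
  then have v: "farr P r = ?v \<cdot>[B] farr P e"
    unfolding w'(4) using h by simp
  have "\<exists>!t. t \<in> Arr E \<and> cdom E t = ccod E e \<and> ccod E t = ccod E r \<and> t \<cdot>[E] e = r \<and> farr P t = ?v"
    by (rule CoCart_lift[OF e]) (use h a w' v in simp_all)
  then obtain t where t: "t \<in> Arr E" "cdom E t = ccod E e" "ccod E t = cdom E m" "t \<cdot>[E] e = r" "farr P t = ?v"
    using h by auto
  have "m \<cdot>[E] t \<cdot>[E] e = m \<cdot>[E] (t \<cdot>[E] e)" using t(1-3) h a by simp
  then have 1: "m \<cdot>[E] t \<cdot>[E] e = s \<cdot>[E] e" by (simp only: t(4) q)
  have "farr P m \<cdot>[B] ?v = farr P s" using h w' by simp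
  \<comment> \<open>Both arrows agree after \<open>e\<close> and have the same image in the base, so
    the second triangle commutes as well.\<close>
  then have 2: "m \<cdot>[E] t = s"
    by (intro CoCart_unique[OF P e, of "m \<cdot>[E] t" s]) (use 1 t(1-3,5) h a in simp_all)
  show "\<exists>!t. t \<in> hom E (ccod E e) (cdom E m) \<and> t \<cdot>[E] e = r \<and> m \<cdot>[E] t = s"
  proof (rule ex1I[of _ t])
    show "t \<in> hom E (ccod E e) (cdom E m) \<and> t \<cdot>[E] e = r \<and> m \<cdot>[E] t = s"
      using t 2 by (simp add: mem_hom)
  next
    fix t' assume "t' \<in> hom E (ccod E e) (cdom E m) \<and> t' \<cdot>[E] e = r \<and> m \<cdot>[E] t' = s"
    then have t': "t' \<in> Arr E" "cdom E t' = ccod E e" "ccod E t' = cdom E m" "t' \<cdot>[E] e = r" "m \<cdot>[E] t' = s"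
      by (simp_all add: mem_hom)
    \<comment> \<open>Any other diagonal has the same image \<open>?v\<close>, since the image of
      \<open>m\<close> can be cancelled; uniqueness then comes from \<open>e\<close>.\<close>
    have "farr P m \<cdot>[B] farr P t' = farr P s" using arg_cong[OF t'(5), of "farr P"] t'(1-3) h by simp
    from cat_extend1[OF this, of w] have "w \<cdot>[B] farr P m \<cdot>[B] farr P t' = ?v"
      using t'(1-3) h w'(1-3) by simp
    then have "farr P t' = ?v" unfolding w'(4) using t'(1-3) h by simp
    then show "t' = t"
      by (intro CoCart_unique[OF P e, of t' t]) (use t t' in simp_all)
  qed
qed

section \<open>The factorization selected by the restricted algebra, for an arbitrary
  cleavage\<close>

context
  fixes A :: "'a univ sq_alg"
  assumes A: "und A = E" "act A = comp_functor L (kap P)" "ps_unit A = iota_nt"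
begin

text \<open>The square from the identity of x to \<open>f\<close> goes to the arrow (1, P f) from
  (x, 1) to (x, P f). Its value under \<open>L\<close>, composed with the unit component, is the
  lift of P f by the equation defining \<open>L\<close>; so the possible failure of normality
  cancels out.\<close>

lemma e_part_eq:
  assumes f: "f \<in> Arr E"
  shows "e_part A f = d (cdom E f) (farr P f)"
proof -
  let ?x = "cdom E f"
  have a: "Sq (ide E ?x) f (ide E ?x) f \<in> Arr (arrow_cat E)" using f by (simp add: arrow_Arr)
  have k: "farr (kap P) (Sq (ide E ?x) f (ide E ?x) f) = Sq (Pair ?x (ide B (fobj P ?x))) (Pair ?x (farr P f)) (ide E ?x) (farr P f)"
    using a f by simp
  have m: "Sq (Pair ?x (ide B (fobj P ?x))) (Pair ?x (farr P f)) (ide E ?x) (farr P f) \<in> Arr (comma P)"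
    using kap_arr[OF P a] f by simp
  show ?thesis
    using a f lift_arr[OF m] by (simp add: e_part_def Let_def A k del: kap_simps(4))
qed

text \<open>The square from \<open>f\<close> to the identity of y goes to an arrow whose value under
  \<open>L\<close> ends at the pushforward of y along an identity. The inverse of the unit component
  brings it back to y.\<close>

lemma m_part:
  assumes f: "f \<in> Arr E"
  shows "m_part A f \<in> Arr E" "cdom E (m_part A f) = ccod E (d (cdom E f) (farr P f))" "ccod E (m_part A f) = ccod E f"
    "farr P (m_part A f) = ide B (fobj P (ccod E f))" "m_part A f \<cdot>[E] d (cdom E f) (farr P f) = f"
proof -
  let ?x = "cdom E f" and ?y = "ccod E f"
  let ?j = "d ?y (ide B (fobj P ?y))"
  have a: "Sq f (ide E ?y) f (ide E ?y) \<in> Arr (arrow_cat E)" using f by (simp add: arrow_Arr)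
  have k: "farr (kap P) (Sq f (ide E ?y) f (ide E ?y)) = Sq (Pair ?x (farr P f)) (Pair ?y (ide B (fobj P ?y))) f (ide B (fobj P ?y))"
    using a f by simp
  have m: "Sq (Pair ?x (farr P f)) (Pair ?y (ide B (fobj P ?y))) f (ide B (fobj P ?y)) \<in> Arr (comma P)"
    using kap_arr[OF P a] f by simp
  let ?l = "farr L (Sq (Pair ?x (farr P f)) (Pair ?y (ide B (fobj P ?y))) f (ide B (fobj P ?y)))"
  note l = lift_arr[OF m]
  have y: "?y \<in> Obj E" using f by simp
  have inv: "inverse_arrows E ?j (inv_arrow E ?j)" by (rule inv_arrow_inverse[OF _ iota_invertible[OF y]]) simp
  have j: "inv_arrow E ?j \<in> Arr E" "cdom E (inv_arrow E ?j) = ccod E ?j" "ccod E (inv_arrow E ?j) = ?y"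
      "inv_arrow E ?j \<cdot>[E] ?j = ide E ?y"
    using inv y by (simp_all add: inverse_arrows_iff)
  \<comment> \<open>The unit component lies over an identity, hence so does its inverse; this makes
    the second factor vertical.\<close>
  have "inverse_arrows B (ide B (fobj P ?y)) (farr P (inv_arrow E ?j))"
    using functor_inverse[OF P inv] y by simp
  then have Pj: "farr P (inv_arrow E ?j) = ide B (fobj P ?y)"
    using inverse_arrows_unique[of B _ _ "ide B (fobj P ?y)"] inverse_arrows_ide[of B "fobj P ?y"] y by simp
  have mp: "m_part A f = inv_arrow E ?j \<cdot>[E] ?l"
    using a f y by (simp add: m_part_def Let_def A k del: kap_simps(4))
  show "m_part A f \<in> Arr E" "cdom E (m_part A f) = ccod E (d ?x (farr P f))" "ccod E (m_part A f) = ?y"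
    "farr P (m_part A f) = ide B (fobj P ?y)"
    unfolding mp using j(1-3) Pj l y by simp_all
  have "inv_arrow E ?j \<cdot>[E] ?l \<cdot>[E] d ?x (farr P f) = inv_arrow E ?j \<cdot>[E] ?j \<cdot>[E] f"
    by (rule cat_extend[OF l(4)]) (use l(1-3) j(1-3) f y in simp_all)
  then show "m_part A f \<cdot>[E] d ?x (farr P f) = f"
    unfolding mp j(4) using f by simp
qed

lemma m_part_vert: "f \<in> Arr E ==> m_part A f = vert_part P d f"
  by (rule vert_part_eqI[symmetric]) (simp_all add: m_part)

text \<open>The left class is settled by \<open>invertible_cocart\<close>. For the right class, a
  cocartesian arrow is invertible exactly if its image in the base is, applied to the lift of P
  f.\<close>

lemma classes: "left_class A = CoCart P" "right_class A = inv_image_Iso P"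
proof -
  show "left_class A = CoCart P"
  proof (intro set_eqI iffI)
    fix f assume "f \<in> left_class A"
    then have f: "f \<in> Arr E" and i: "invertible E (m_part A f)" by (simp_all add: left_class_def A)
    show "f \<in> CoCart P" using i invertible_cocart[OF f m_part(1,2,4,5)[OF f]] by simp
  next
    fix f assume c: "f \<in> CoCart P"
    then have f: "f \<in> Arr E" by (rule CoCart_arr)
    show "f \<in> left_class A" using c f invertible_cocart[OF f m_part(1,2,4,5)[OF f]] by (simp add: left_class_def A)
  qed
  have "invertible E (d (cdom E f) (farr P f)) \<longleftrightarrow> invertible B (farr P f)" if f: "f \<in> Arr E" for f
    using functor_invertible[OF P, of "d (cdom E f) (farr P f)"] CoCart_invertible[OF P, of "d (cdom E f) (farr P f)"] f by auto
  then show "right_class A = inv_image_Iso P"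
    unfolding right_class_def inv_image_Iso_def A by (auto simp: e_part_eq)
qed

text \<open>An identity as second factor means that \<open>f\<close> is its own designated lift. An
  identity as first factor means that P f is an identity; normality is used to return from a
  vertical arrow to an identity lift.\<close>

lemma strict_classes:
  assumes n: "normal_cleavage P d"
  shows "strict_left_class A = designated P d" "strict_right_class A = vert P"
proof -
  show "strict_left_class A = designated P d"
  proof (intro set_eqI iffI)
    fix f assume "f \<in> strict_left_class A"
    then obtain z where f: "f \<in> Arr E" and z: "z \<in> Obj E" "m_part A f = ide E z"
      by (auto simp: strict_left_class_def A is_ide_def)
    have "d (cdom E f) (farr P f) = f"
      using m_part(2,5)[OF f] f z by simp
    then show "f \<in> designated P d" 
      unfolding designated_def using f by (intro CollectI exI[of _ "cdom E f"] exI[of _ "farr P f"]) (simp add: liftable_def)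
  next
    fix f assume "f \<in> designated P d"
    then obtain x u where f: "f = d x u" and h: "x \<in> Obj E" "u \<in> Arr B" "cdom B u = fobj P x"
      by (auto simp: designated_def liftable_def)
    have "vert_part P d f = ide E (ccod E f)"
      unfolding f by (rule vert_part_eqI) (use h in simp_all)
    then show "f \<in> strict_left_class A"
      using h m_part_vert[of f] by (auto simp: strict_left_class_def A f is_ide_def)
  qed
  show "strict_right_class A = vert P"
  proof (intro set_eqI iffI)
    fix f assume "f \<in> strict_right_class A"
    then obtain z where f: "f \<in> Arr E" and z: "z \<in> Obj E" "d (cdom E f) (farr P f) = ide E z"
      by (auto simp: strict_right_class_def A is_ide_def e_part_eq)
    have "farr P (d (cdom E f) (farr P f)) = farr P f" using f by simp
    then have "farr P f = ide B (fobj P z)" unfolding z(2) using z by simp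
    then show "f \<in> vert P" using f z by (auto simp: vert_def is_ide_def)
  next
    fix f assume "f \<in> vert P"
    then have f: "f \<in> Arr E" "farr P f = ide B (fobj P (cdom E f))" by (simp_all add: vert_iff)
    then have "e_part A f = ide E (cdom E f)" using n by (simp add: e_part_eq normal_cleavage_def)
    then show "f \<in> strict_right_class A" using f by (auto simp: strict_right_class_def A is_ide_def)
  qed
qed

text \<open>The second factor is a left inverse of the unit component, and that component is
  invertible; so the factor is the inverse.\<close>

lemma identity_parts:
  assumes x: "x \<in> Obj E"
  shows "body (ps_unit A) x = d x (ide B (fobj P x))" "e_part A (ide E x) = d x (ide B (fobj P x))"
    "m_part A (ide E x) = inv_arrow E (d x (ide B (fobj P x)))"
    "ide E x = inv_arrow E (d x (ide B (fobj P x))) \<cdot>[E] d x (ide B (fobj P x))"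
proof -
  let ?j = "d x (ide B (fobj P x))"
  have "inverse_arrows E ?j (inv_arrow E ?j)" by (rule inv_arrow_inverse[OF _ iota_invertible[OF x]]) simp
  then have j: "inv_arrow E ?j \<in> Arr E" "cdom E (inv_arrow E ?j) = ccod E ?j" "ccod E (inv_arrow E ?j) = x"
      "inv_arrow E ?j \<cdot>[E] ?j = ide E x" "?j \<cdot>[E] inv_arrow E ?j = ide E (ccod E ?j)"
    using x by (simp_all add: inverse_arrows_iff)
  show "body (ps_unit A) x = ?j" using x by (simp add: A)
  show "e_part A (ide E x) = ?j" using x by (simp add: e_part_eq)
  have m: "m_part A (ide E x) \<in> Arr E" "cdom E (m_part A (ide E x)) = ccod E ?j" "ccod E (m_part A (ide E x)) = x"
      "m_part A (ide E x) \<cdot>[E] ?j = ide E x"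
    using m_part[of "ide E x"] x by simp_all
  have "m_part A (ide E x) \<cdot>[E] (?j \<cdot>[E] inv_arrow E ?j) = m_part A (ide E x) \<cdot>[E] ?j \<cdot>[E] inv_arrow E ?j"
    using m(1-3) j(1-3) x by simp
  then show "m_part A (ide E x) = inv_arrow E ?j"
    unfolding j(5) m(4) using m(1-3) j(1-3) x by simp
  show "ide E x = inv_arrow E ?j \<cdot>[E] ?j" by (simp only: j(4))
qed

end

text \<open>Uniqueness is strict because a vertical second factor does not change the image in the
  base, so the designated factor can be read off from the domain and the image of
  \<open>f\<close>.\<close>

lemma strict_fs_split:
  assumes s: "split_cleavage P d"
  shows "strict_fs E (designated P d) (vert P)"
  unfolding strict_fs_def
proof (intro conjI ballI)
  have n: "normal_cleavage P d" using s by (simp add: split_cleavage_def)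
  have d: "d x u \<in> designated P d" if "x \<in> Obj E" "u \<in> Arr B" "cdom B u = fobj P x" for x u
    using that by (auto simp: designated_def liftable_def)
  show "wide_subcategory E (designated P d)"
    unfolding wide_subcategory_def
  proof (intro conjI ballI impI subsetI)
    fix f assume "f \<in> designated P d"
    then show "f \<in> Arr E" by (auto simp: designated_def liftable_def)
  next
    fix x assume x: "x \<in> Obj E"
    then have "d x (ide B (fobj P x)) = ide E x" using n by (simp add: normal_cleavage_def)
    then show "ide E x \<in> designated P d" using d[of x "ide B (fobj P x)"] x by simp
  next
    \<comment> \<open>Closure of the designated arrows under composition is the splitting condition
      on lifts.\<close>
    fix f g assume "f \<in> designated P d" "g \<in> designated P d" and c: "ccod E f = cdom E g"
    then obtain x u y v where h: "f = d x u" "x \<in> Obj E" "u \<in> Arr B" "cdom B u = fobj P x"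
        "g = d y v" "y \<in> Obj E" "v \<in> Arr B" "cdom B v = fobj P y"
      by (auto simp: designated_def liftable_def)
    have y: "y = ccod E (d x u)" using c h by simp
    have "d x (v \<cdot>[B] u) = d y v \<cdot>[E] d x u"
      using s h(2-4,7,8) unfolding y by (simp add: split_cleavage_def Let_def push_obj_def)
    then show "g \<cdot>[E] f \<in> designated P d"
      using d[of x "v \<cdot>[B] u"] h y by simp
  qed
  show "wide_subcategory E (vert P)"
    unfolding wide_subcategory_def
  proof (intro conjI ballI impI subsetI)
    fix f g assume "f \<in> vert P" "g \<in> vert P" and c: "ccod E f = cdom E g"
    then have h: "f \<in> Arr E" "farr P f = ide B (fobj P (cdom E f))" "g \<in> Arr E" "farr P g = ide B (fobj P (cdom E g))"
      by (simp_all add: vert_iff)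
    have "fobj P (cdom E g) = ccod B (farr P f)" using h(1) c by simp
    then have "fobj P (cdom E g) = fobj P (cdom E f)" unfolding h(2) using h(1) by simp
    then show "g \<cdot>[E] f \<in> vert P" using h c by (simp add: vert_iff)
  qed (simp_all add: vert_iff)
next
  fix f assume f: "f \<in> Arr E"
  let ?e = "d (cdom E f) (farr P f)"
  have e: "?e \<in> CoCart P" using f by simp
  have u: "\<exists>!g. g \<in> hom E (ccod E ?e) (ccod E f) \<and> g \<in> vert P \<and> g \<cdot>[E] ?e = f"
    by (rule CoCart_vertical_lift[OF P e]) (use f in simp_all)
  then obtain g where g: "g \<in> Arr E" "cdom E g = ccod E ?e" "ccod E g = ccod E f" "g \<in> vert P" "g \<cdot>[E] ?e = f" by (auto simp: mem_hom)
  show "\<exists>!p. fst p \<in> designated P d \<and> snd p \<in> vert P \<and> ccod E (fst p) = cdom E (snd p) \<and> f = snd p \<cdot>[E] fst p"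
  proof (rule ex1I[of _ "(?e, g)"])
    have "?e \<in> designated P d"
      unfolding designated_def using f by (intro CollectI exI[of _ "cdom E f"] exI[of _ "farr P f"]) (simp add: liftable_def)
    then show "fst (?e, g) \<in> designated P d \<and> snd (?e, g) \<in> vert P \<and> ccod E (fst (?e, g)) = cdom E (snd (?e, g)) \<and>
        f = snd (?e, g) \<cdot>[E] fst (?e, g)"
      using g by simp
  next
    fix p assume p: "fst p \<in> designated P d \<and> snd p \<in> vert P \<and> ccod E (fst p) = cdom E (snd p) \<and> f = snd p \<cdot>[E] fst p"
    then obtain x u where h: "fst p = d x u" "x \<in> Obj E" "u \<in> Arr B" "cdom B u = fobj P x"
      by (auto simp: designated_def liftable_def)
    have v: "snd p \<in> Arr E" "farr P (snd p) = ide B (fobj P (cdom E (snd p)))" "cdom E (snd p) = ccod E (d x u)"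
      and fp: "f = snd p \<cdot>[E] d x u" using p h by (simp_all add: vert_iff)
    \<comment> \<open>The pair (x, u) is recovered from \<open>f\<close>, which fixes the first
      factor; the second is then the unique vertical lift.\<close>
    have "cdom E f = x" "farr P f = u" "ccod E (snd p) = ccod E f" unfolding fp using v h by simp_all
    then have 1: "fst p = ?e" and "snd p \<in> hom E (ccod E ?e) (ccod E f)" "snd p \<in> vert P" "snd p \<cdot>[E] ?e = f"
      using h v fp p by (simp_all add: mem_hom)
    then have "snd p = g"
      using u g by (auto simp: mem_hom)
    with 1 show "p = (?e, g)" by (simp add: prod_eq_iff)
  qed
qed

end

theorem mainTheorem1:
  fixes \<kappa> :: "'k rel"
  assumes "Card_order \<kappa>" and "infinite (Field \<kappa>)"
  shows
    "iso_2cat_over (SCoFib \<kappa>) (Alg_s (CAT2 \<kappa>) Comma) (CAT2 \<kappa>) forget forget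
       (Gamma :: ('a univ func \<times> 'a univ clv, _, _, _, _, _) two_fun) \<and>
     iso_2cat_over (NClCoFib \<kappa>) (Ps_Alg_n (CAT2 \<kappa>) Comma) (CAT2 \<kappa>) forget ps_forget
       (Gamma_n \<kappa> :: ('a univ func \<times> 'a univ clv, _, _, _, _, _) two_fun) \<and>

     colax_monad_morphism (CAT2 \<kappa>) Comma (CAT \<kappa>) Squaring Dom (kap :: 'a univ func \<Rightarrow> _) \<and>
     strict_2functor (Alg_s (CAT2 \<kappa>) (Comma :: ('a univ func, _, _) monad))
       (Alg_s (CAT \<kappa>) Squaring) (kap_s \<kappa>) \<and>
     strict_2functor (Ps_Alg_n (CAT2 \<kappa>) (Comma :: ('a univ func, _, _) monad))
       (Ps_Alg_n (CAT \<kappa>) Squaring) (kap_ps \<kappa>) \<and>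

     strict_2functor (SCoFib \<kappa> :: 'a univ cofib_2cat) (NClCoFib \<kappa>) id_2fun \<and>
     strict_2functor (Alg_s (CAT2 \<kappa>) (Comma :: ('a univ func, _, _) monad))
       (Ps_Alg_n (CAT2 \<kappa>) Comma) (strict_as_ps (CAT2 \<kappa>) Comma) \<and>
     strict_2functor (Alg_s (CAT \<kappa>) (Squaring :: ('a univ cat, _, _) monad))
       (Ps_Alg_n (CAT \<kappa>) Squaring) (strict_as_ps (CAT \<kappa>) Squaring) \<and>
     eq_2fun (SCoFib \<kappa> :: 'a univ cofib_2cat)
       (Gamma_n \<kappa> \<circ>\<circ> id_2fun) (strict_as_ps (CAT2 \<kappa>) Comma \<circ>\<circ> Gamma) \<and>
     eq_2fun (Alg_s (CAT2 \<kappa>) (Comma :: ('a univ func, _, _) monad))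
       (kap_ps \<kappa> \<circ>\<circ> strict_as_ps (CAT2 \<kappa>) Comma) (strict_as_ps (CAT \<kappa>) Squaring \<circ>\<circ> kap_s \<kappa>) \<and>

     (\<forall>(P :: 'a univ func) \<delta> A.
        (P, \<delta>) \<in> Ob (NClCoFib \<kappa>) \<and> A = F0 (kap_ps \<kappa>) (F0 (Gamma_n \<kappa>) (P, \<delta>)) \<longrightarrow>
        A \<in> Ob (Ps_Alg_n (CAT \<kappa>) Squaring) \<and>
        (\<forall>f \<in> Arr (src P).
           e_part A f = \<delta> (cdom (src P) f) (farr P f) \<and> m_part A f = vert_part P \<delta> f \<and>
           f = vert_part P \<delta> f \<cdot>\<^bsub>src P\<^esub> \<delta> (cdom (src P) f) (farr P f)) \<and>
        left_class A = CoCart P \<and> right_class A = inv_image_Iso P \<and>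
        orthogonal_fs (src P) (CoCart P) (inv_image_Iso P)) \<and>

     (\<forall>(P :: 'a univ func) \<delta> A A'.
        (P, \<delta>) \<in> Ob (SCoFib \<kappa>) \<and> A = F0 (kap_s \<kappa>) (F0 Gamma (P, \<delta>)) \<and>
        A' = F0 (strict_as_ps (CAT \<kappa>) Squaring) A \<longrightarrow>
        A \<in> Ob (Alg_s (CAT \<kappa>) Squaring) \<and> F0 (kap_ps \<kappa>) (F0 (Gamma_n \<kappa>) (P, \<delta>)) = A' \<and>
        strict_left_class A' = designated P \<delta> \<and> strict_right_class A' = vert P \<and>
        strict_fs (src P) (designated P \<delta>) (vert P)) \<and>

     (\<forall>B :: 'a univ cat. B \<in> Ob (CAT \<kappa>) \<longrightarrow>
        colax_monad_morphism (Slice (CAT \<kappa>) B) Comma (CAT \<kappa>) Squaring Dom kap \<and>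
        strict_2functor (Ps_Alg (Slice (CAT \<kappa>) B) Comma) (Ps_Alg (CAT \<kappa>) Squaring) (kap_ps \<kappa>) \<and>
        (\<forall>P \<delta> A. P \<in> Ob (Slice (CAT \<kappa>) B) \<and> is_cleavage P \<delta> \<and>
           A = F0 (kap_ps \<kappa>) (cloven_algebra \<kappa> P \<delta>) \<longrightarrow>
           cloven_algebra \<kappa> P \<delta> \<in> Ob (Ps_Alg (Slice (CAT \<kappa>) B) Comma) \<and>
           A \<in> Ob (Ps_Alg (CAT \<kappa>) Squaring) \<and>
           left_class A = CoCart P \<and> right_class A = inv_image_Iso P \<and>
           orthogonal_fs (src P) (CoCart P) (inv_image_Iso P) \<and>
           (\<forall>x \<in> Obj (src P). \<forall>j. j = body (ps_unit A) x \<longrightarrow>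
              j = \<delta> x (ide B (fobj P x)) \<and> invertible (src P) j \<and>
              e_part A (ide (src P) x) = j \<and> m_part A (ide (src P) x) = inv_arrow (src P) j \<and>
              ide (src P) x = inv_arrow (src P) j \<cdot>\<^bsub>src P\<^esub> j)))"
proof -
  note k = assms
  interpret c: colax_monad_morphism "CAT2 \<kappa>" Comma "CAT \<kappa>" Squaring Dom "kap :: 'a univ func \<Rightarrow> _"
    by (rule kap_colax[OF k])
  have normal: "A \<in> Ob (Ps_Alg_n (CAT \<kappa>) Squaring) \<and>
        (\<forall>f \<in> Arr (src P).
           e_part A f = \<delta> (cdom (src P) f) (farr P f) \<and> m_part A f = vert_part P \<delta> f \<and>
           f = vert_part P \<delta> f \<cdot>\<^bsub>src P\<^esub> \<delta> (cdom (src P) f) (farr P f)) \<and>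
        left_class A = CoCart P \<and> right_class A = inv_image_Iso P \<and>
        orthogonal_fs (src P) (CoCart P) (inv_image_Iso P)"
    if o: "(P, \<delta>) \<in> Ob (NClCoFib \<kappa>)" and A: "A = F0 (kap_ps \<kappa>) (F0 (Gamma_n \<kappa>) (P, \<delta>))"
    for P :: "'a univ func" and \<delta> A
  proof -
    have n: "P \<in> Ob (CAT2 \<kappa>)" "normal_cleavage P \<delta>" using o by (simp_all add: NClCoFib_Ob)
    note G = Gamma_n_Ob[OF k n]
    interpret cleavage P \<delta> by (rule normal_cleavage_locale[OF _ n(2)]) (use n in \<open>simp add: CAT2_Ob\<close>)
    \<comment> \<open>By \<open>Gamma_n_Ob\<close> the object assigned to a normal cleavage is its
      \<open>cloven_algebra\<close>, so the facts proved for arbitrary cleavages apply.\<close>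
    note A' = kap_cloven[of \<kappa>, folded G(1), folded A]
    have "A \<in> Ob (Ps_Alg_n (CAT \<kappa>) Squaring)"
      unfolding A by (rule strict_2functor.F0_in[OF c.restrict_ps_n_2functor G(2)])
    then show ?thesis
      using e_part_eq[OF A'] m_part_vert[OF A'] m_part(5)[OF A'] classes[OF A'] orthogonal by simp
  qed
  have split: "A \<in> Ob (Alg_s (CAT \<kappa>) Squaring) \<and> F0 (kap_ps \<kappa>) (F0 (Gamma_n \<kappa>) (P, \<delta>)) = A' \<and>
        strict_left_class A' = designated P \<delta> \<and> strict_right_class A' = vert P \<and>
        strict_fs (src P) (designated P \<delta>) (vert P)"
    if o: "(P, \<delta>) \<in> Ob (SCoFib \<kappa>)" and A: "A = F0 (kap_s \<kappa>) (F0 Gamma (P, \<delta>))"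
      and A': "A' = F0 (strict_as_ps (CAT \<kappa>) Squaring) A"
    for P :: "'a univ func" and \<delta> A A'
  proof -
    have n: "P \<in> Ob (CAT2 \<kappa>)" "normal_cleavage P \<delta>" "split_cleavage P \<delta>" using o by (simp_all add: SCoFib_Ob split_cleavage_def)
    note G = Gamma_Ob[OF k o]
    interpret cleavage P \<delta> by (rule normal_cleavage_locale[OF _ n(2)]) (use n in \<open>simp add: CAT2_Ob\<close>)
    \<comment> \<open>Both squares of the diagram, evaluated at the object in question, identify the
      strict restriction with the pseudo one.\<close>
    have e: "F0 (kap_ps \<kappa>) (F0 (Gamma_n \<kappa>) (P, \<delta>)) = A'"
      using c.restrict_strict_as_ps G unfolding eq_2fun_def comp_2fun_def A A' by simp
    note K = kap_cloven[of \<kappa>, folded Gamma_n_Ob(1)[OF k n(1,2)], unfolded e]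
    have "A \<in> Ob (Alg_s (CAT \<kappa>) Squaring)"
      unfolding A by (rule strict_2functor.F0_in[OF c.restrict_s_2functor G(1)])
    then show ?thesis
      using e strict_classes[OF K n(2)] strict_fs_split[OF n(3)] by blast
  qed
  have fixed: "cloven_algebra \<kappa> P \<delta> \<in> Ob (Ps_Alg (Slice (CAT \<kappa>) B) Comma) \<and>
           A \<in> Ob (Ps_Alg (CAT \<kappa>) Squaring) \<and>
           left_class A = CoCart P \<and> right_class A = inv_image_Iso P \<and>
           orthogonal_fs (src P) (CoCart P) (inv_image_Iso P) \<and>
           (\<forall>x \<in> Obj (src P). \<forall>j. j = body (ps_unit A) x \<longrightarrow>
              j = \<delta> x (ide B (fobj P x)) \<and> invertible (src P) j \<and>
              e_part A (ide (src P) x) = j \<and> m_part A (ide (src P) x) = inv_arrow (src P) j \<and>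
              ide (src P) x = inv_arrow (src P) j \<cdot>\<^bsub>src P\<^esub> j)"
    if B: "B \<in> Ob (CAT \<kappa>)" and Pd: "P \<in> Ob (Slice (CAT \<kappa>) B)" "is_cleavage P \<delta>"
      and A: "A = F0 (kap_ps \<kappa>) (cloven_algebra \<kappa> P \<delta>)"
    for B :: "'a univ cat" and P \<delta> A
  proof -
    have o: "P \<in> Ob (CAT2 \<kappa>)" and tB: "trg P = B" using Pd(1) by (simp_all add: Slice_simps Arrow_simps(1))
    interpret d: cleavage P \<delta> using o Pd(2) by unfold_locales (simp_all add: CAT2_Ob)
    interpret S: colax_monad_morphism "Slice (CAT \<kappa>) B" Comma "CAT \<kappa>" Squaring Dom "kap :: 'a univ func \<Rightarrow> _"
      by (rule comma_Slice_2monad(2)[OF k B])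
    have p: "cloven_algebra \<kappa> P \<delta> \<in> Ob (Ps_Alg (Slice (CAT \<kappa>) B) Comma)"
      using d.cloven_pseudoalgebra[OF k o] by (simp add: S.T.Ps_Alg_simps(1) tB)
    have a: "A \<in> Ob (Ps_Alg (CAT \<kappa>) Squaring)"
      unfolding A by (rule strict_2functor.F0_in[OF S.restrict_ps_2functor p])
    note K = d.kap_cloven[of \<kappa>, folded A]
    show ?thesis
      using p a d.classes[OF K] d.orthogonal d.identity_parts[OF K] d.iota_invertible by (simp add: tB)
  qed
  show ?thesis
  proof (intro conjI, goal_cases)
    case 1 show ?case by (rule Gamma_iso[OF k])
  next
    case 2 show ?case by (rule Gamma_n_iso[OF k])
  next
    case 3 show ?case by (rule kap_colax[OF k])
  next
    case 4 show ?case by (rule c.restrict_s_2functor)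
  next
    case 5 show ?case by (rule c.restrict_ps_n_2functor)
  next
    case 6 show ?case by (rule SCoFib_inclusion)
  next
    case 7 show ?case by (rule c.T.strict_as_ps_n_2functor)
  next
    case 8 show ?case by (rule c.R.strict_as_ps_n_2functor)
  next
    case 9 show ?case by (rule Gamma_square[OF k])
  next
    case 10 show ?case by (rule c.restrict_strict_as_ps)
  next
    case 11 show ?case by (intro allI impI, elim conjE) (rule normal)
  next
    case 12 show ?case by (intro allI impI, elim conjE) (rule split)
  next
    case 13
    show ?case
    proof (intro allI impI conjI)
      fix B :: "'a univ cat" assume B: "B \<in> Ob (CAT \<kappa>)"
      show "colax_monad_morphism (Slice (CAT \<kappa>) B) Comma (CAT \<kappa>) Squaring Dom kap"
        by (rule comma_Slice_2monad(2)[OF k B])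
      then show "strict_2functor (Ps_Alg (Slice (CAT \<kappa>) B) Comma) (Ps_Alg (CAT \<kappa>) Squaring) (kap_ps \<kappa>)"
        by (rule colax_morphism.restrict_ps_2functor[OF colax_morphism.intro])
    qed (use fixed in blast)+
  qed
qed

end
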